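(* Let $r_0,\ldots,r_n\ge 0$, $d=\sum_j r_j$, and let $\mathbf r$ be the rank array of a Zelevinsky permutation $v(\mathbf r)$ for these block sizes. For $m\ge 0$ let ${\mathit K}\!{\mathcal Q}_{m+\mathbf r}(\mathbf x_{\mathbf r}/\bar{\mathbf y}_{\mathbf r})$ denote the double quiver $K$-polynomial ${\mathit K}\!{\mathcal Q}_{m+\mathbf r}$ (alphabets $\mathbf x^j,\mathbf y^j$ of sizes $m+r_j$) with $x^j_p=y^j_p=1$ for all $r_j<p\le m+r_j$. Then the limit as $m\to\infty$ of ${\mathit K}\!{\mathcal Q}_{m+\mathbf r}(\mathbf x_{\mathbf r}/\bar{\mathbf y}_{\mathbf r})$ exists, and $$G_{\mathbf r}(\mathbf x/\bar{\mathbf y}):=\lim_{m\to\infty}{\mathit K}\!{\mathcal Q}_{m+\mathbf r}(\mathbf x_{\mathbf r}/\bar{\mathbf y}_{\mathbf r})=\sum_{\mathbf w\in L(\mathbf r)}(-1)^{l(\mathbf w)-d(\mathbf r)}\hat{\mathcal G}_{\mathbf w}(\mathbf x/\bar{\mathbf y}),$$ where $L(\mathbf r)$ is the set of lacing diagrams with Demazure product $\mathbf r$, $l(\mathbf w)=\sum_{i=1}^n l(\tilde w_i)$ and $d(\mathbf r)=l(v(\mathbf r))-l(v(\mathrm{Hom}))$. Moreover $G_{\mathbf r}(\mathbf x/\bar{\mathbf y})$ is symmetric separately in each of the $2n+2$ finite alphabets $\mathbf x^0,\ldots,\mathbf x^n,\mathbf y^n,\ldots,\mathbf y^0$ (of sizes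 $r_0,\ldots,r_n,r_n,\ldots,r_0$).
   Context: Grothendieck polynomials: for alphabets $\mathbf z=z_1,z_2,\ldots$ and $\dot{\mathbf z}=\dot z_1,\dot z_2,\ldots$, the Demazure operator is $\pi_i f=\frac{z_{i+1}f(\ldots,z_i,z_{i+1},\ldots)-z_if(\ldots,z_{i+1},z_i,\ldots)}{z_{i+1}-z_i}$. For $v\in S_k$, the double Grothendieck polynomial $\mathcal G_v(\mathbf z/\dot{\mathbf z})$ is defined by $\mathcal G_{w_0^k}=\prod_{i+j\le k}(1-z_i/\dot z_j)$ ($w_0^k$ the longest element of $S_k$) and $\mathcal G_{vs_i}=\pi_i\mathcal G_v$ whenever $l(vs_i)<l(v)$; this is independent of $k$. A $k\times\ell$ partial permutation is a $0/1$ matrix with at most one $1$ in each row and column; it has a unique minimal-length completion $\tilde w\in S_\infty$ (a permutation matrix with $w$ as upper-left $k\times\ell$ corner); put $\mathcal G_w=\mathcal G_{\tilde w}$. Convention: if a polynomial in alphabets of given sizes is evaluated on shorter alphabets, the missing (later) letters are set to $1$. For $m\ge0$, $m+w$ is the $(m+k)\times(m+\ell)$ partial permutation with $1$'s at $(p,p)$ for $p\le m$ and at $(m+p,m+q)$ for each $1$ of $w$ at $(p,q)$. The stable double Grothendieck polynomial is $\hat{\mathcal G}_w(\mathbf z/\dot{\mathbf z})=\lim_{m\to\infty}\mathcal G_{m+w}(z_1,\ldots,z_k/\dot z_1,\ldots,\dot z_\ell)$ (the sequence stabilizes). Zelevinsky permutations: fix $r_0,\ldots,r_n$, $d=\sum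 r_j$. Divide $d\times d$ matrices into blocks: block row $j$ ($j=0,\ldots,n$, from the top) has height $r_j$, block column $i$ (counted from the right) has width $r_i$; $B_{ji}$ is the block in block row $j$, block column $i$. A Zelevinsky permutation is a $d\times d$ permutation matrix $v$ with $B_{ji}=0$ whenever $i\ge j+2$, and whose $1$'s proceed from northwest to southeast within every block row and every block column. Its rank array $\mathbf r=(r_{ij})_{i\ge j}$ has $r_{ij}$ = number of $1$'s of $v$ in blocks $B_{qp}$ with $q\ge j$, $p\le i$; it determines $v=v(\mathbf r)$. There is a unique Zelevinsky permutation $v(\mathrm{Hom})$ whose rank array is entrywise maximal. $m+\mathbf r$ is obtained by adding $m$ to every entry (and block size); it is the rank array of a Zelevinsky permutation with block sizes $m+r_j$. Variables: $\mathbf x=\mathbf x^0,\ldots,\mathbf x^n$ and $\bar{\mathbf y}=\mathbf y^n,\ldots,\mathbf y^0$, $\mathbf x^j=x^j_1,\ldots,x^j_{r_j}$, $\mathbf y^j=y^j_1,\ldots,y^j_{r_j}$, concatenated into $d$-letter alphabets. The double quiver $K$-polynomial is ${\mathit K}\!{\mathcal Q}_{\mathbf r}(\mathbf x/\bar{\mathbf y})=\mathcal G_{v(\mathbf r)}(\mathbf x/\bar{\mathbf y})/\mathcal G_{v(\mathrm{Hom})}(\mathbf x/\bar{\mathbf y})$. Pipe dreams: a $k\times\ell$ pipe dream is a set of boxes (crosses) in the $k\times\ell$ grid. Its word lists $s_{i+j-1}$ for each cross in row $i$, column $j$, reading each row right to left, rows top to bottom. Its Demazure product $\delta(P)\in S_\infty$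 is the product of the word using $s_i^2=s_i$ and the braid relations (equivalently, start at the identity and multiply on the right by each successive $s_i$ only if this increases length). For a partial permutation $w$, $\mathcal P(w)$ is the set of pipe dreams $P$ with $\delta(P)=\tilde w$. $\check P$ denotes $P$ rotated by $180^\circ$. Lacing diagrams: a lacing diagram is a list $\mathbf w=(w_1,\ldots,w_n)$ with $w_j$ an $r_{j-1}\times r_j$ partial permutation. For pipe dreams $P_j$ of sizes $r_{j-1}\times r_j$, $P(P_1,\ldots,P_n)$ is the $d\times d$ pipe dream whose crosses are all boxes in blocks $B_{ji}$ with $i\ge j+2$, together with $P_j$ placed in block $B_{j-1,j}$ for each $j$. If for some (equivalently every) choice of $P_j$ with $\check P_j\in\mathcal P(w_j)$ for all $j$ the Demazure product of $P(P_1,\ldots,P_n)$ is a Zelevinsky permutation $v(\mathbf r)$, write $\delta(\mathbf w)=\mathbf r$. $L(\mathbf r)=\{\mathbf w:\delta(\mathbf w)=\mathbf r\}$. Finally $\hat{\mathcal G}_{\mathbf w}(\mathbf x/\bar{\mathbf y})=\prod_{j=1}^n\hat{\mathcal G}_{w_j}(\mathbf x^{j-1}/\mathbf y^j)$. *)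

theory Defs
  imports
    "HOL-Library.Poly_Mapping"
    "HOL-Library.Countable"
    "HOL-Combinatorics.Permutations"
begin

section \<open>Laurent polynomials\<close>

text \<open>Integer Laurent polynomials in commuting letters of type \<open>'v\<close>: a monomial is a finitely
  supported exponent vector with integer entries, multiplied by adding exponents.\<close>

type_synonym 'v laurent = "('v \<Rightarrow>\<^sub>0 int) \<Rightarrow>\<^sub>0 int"

definition letter :: "'v \<Rightarrow> 'v laurent" where
  "letter v = Poly_Mapping.single (Poly_Mapping.single v 1) 1"

definition inv_letter :: "'v \<Rightarrow> 'v laurent" where
  "inv_letter v = Poly_Mapping.single (Poly_Mapping.single v (- 1)) 1"

text \<open>Ring homomorphism that replaces each letter \<open>v\<close> by the letter \<open>w\<close> if \<open>\<sigma> v = Some w\<close> and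
  by the number 1 if \<open>\<sigma> v = None\<close>.\<close>

definition subst_monom :: "('v \<Rightarrow> 'w option) \<Rightarrow> ('v \<Rightarrow>\<^sub>0 int) \<Rightarrow> ('w \<Rightarrow>\<^sub>0 int)" where
  "subst_monom \<sigma> t =
    (\<Sum>v\<in>Poly_Mapping.keys t. case \<sigma> v of
        None \<Rightarrow> 0
      | Some w \<Rightarrow> Poly_Mapping.single w (Poly_Mapping.lookup t v))"

definition subst_laurent :: "('v \<Rightarrow> 'w option) \<Rightarrow> 'v laurent \<Rightarrow> 'w laurent" where
  "subst_laurent \<sigma> f =
    (\<Sum>t\<in>Poly_Mapping.keys f.
      Poly_Mapping.single (subst_monom \<sigma> t) (Poly_Mapping.lookup f t))"

definition symmetric_in :: "'v set \<Rightarrow> 'v laurent \<Rightarrow> bool" where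
  "symmetric_in A f \<longleftrightarrow> (\<forall>\<pi>. \<pi> permutes A \<longrightarrow> subst_laurent (Some \<circ> \<pi>) f = f)"

text \<open>The quotient \<open>a / b\<close> inside an integral domain, meaningful when \<open>b \<noteq> 0\<close> divides \<open>a\<close>.\<close>

definition exact_quot :: "'a::times \<Rightarrow> 'a \<Rightarrow> 'a" where
  "exact_quot a b = (THE c. c * b = a)"

lemma exact_quot_eqI:
  fixes a b c :: "'a::idom"
  assumes "b \<noteq> 0" "c * b = a"
  shows "exact_quot a b = c"
  unfolding exact_quot_def using assms by (intro the_equality) auto

text \<open>Limits of sequences of polynomials are understood discretely: the sequence is eventually
  constant.\<close>

definition stabilizes_to :: "(nat \<Rightarrow> 'a) \<Rightarrow> 'a \<Rightarrow> bool" where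
  "stabilizes_to f L \<longleftrightarrow> (\<forall>\<^sub>F m in sequentially. f m = L)"

definition stable_limit :: "(nat \<Rightarrow> 'a) \<Rightarrow> 'a" where
  "stable_limit f = (THE L. stabilizes_to f L)"

lemma stable_limit_eqI:
  assumes "stabilizes_to f L"
  shows "stable_limit f = L"
  unfolding stable_limit_def
proof (rule the_equality)
  show "stabilizes_to f L" by (rule assms)
  fix L' assume "stabilizes_to f L'"
  with assms have "\<forall>\<^sub>F m in sequentially. f m = L \<and> f m = L'"
    by (simp add: stabilizes_to_def eventually_conj)
  then show "L' = L"
    by (auto simp: eventually_sequentially)
qed


section \<open>Permutations\<close>

text \<open>Elements of \<open>S\<^sub>\<infinity>\<close> are functions on \<open>nat\<close> that permute some \<open>{1..N}\<close>. The permutation matrix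
  of \<open>v\<close> has its 1's at row \<open>p\<close>, column \<open>v p\<close>; products are compositions of functions, so that
  \<open>v s\<^sub>i\<close> is the matrix of \<open>v\<close> with rows \<open>i\<close> and \<open>i + 1\<close> exchanged.\<close>

definition S_inf :: "(nat \<Rightarrow> nat) set" where
  "S_inf = {v. \<exists>N. v permutes {1..N}}"

definition adj :: "nat \<Rightarrow> nat \<Rightarrow> nat" where
  "adj i = Transposition.transpose i (Suc i)"

definition perm_length :: "(nat \<Rightarrow> nat) \<Rightarrow> nat" where
  "perm_length v = card {(p, q). p < q \<and> v q < v p}"

definition longest :: "nat \<Rightarrow> nat \<Rightarrow> nat" where
  "longest k p = (if p \<in> {1..k} then Suc k - p else p)"


section \<open>Double Grothendieck polynomials\<close>

text \<open>\<open>Z i\<close> is the letter \<open>z\<^sub>i\<close>, and \<open>Zd j\<close> is the dotted letter with index \<open>j\<close> (indices start at 1).\<close>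

datatype zletter = Z nat | Zd nat

instance zletter :: countable
  by countable_datatype

text \<open>The linear order is arbitrary. It only serves to satisfy the sort constraint under which
  the library proves that \<^typ>\<open>zletter laurent\<close> is an integral domain.\<close>

instantiation zletter :: linorder
begin

definition less_eq_zletter :: "zletter \<Rightarrow> zletter \<Rightarrow> bool" where
  "(a::zletter) \<le> b \<longleftrightarrow> to_nat a \<le> to_nat b"

definition less_zletter :: "zletter \<Rightarrow> zletter \<Rightarrow> bool" where
  "(a::zletter) < b \<longleftrightarrow> to_nat a < to_nat b"

instance
  by standard (auto simp: less_eq_zletter_def less_zletter_def)

end

fun swap_z :: "nat \<Rightarrow> zletter \<Rightarrow> zletter" where
  "swap_z i (Z p) = Z (adj i p)"
| "swap_z i (Zd q) = Zd q"

definition demazure_op :: "nat \<Rightarrow> zletter laurent \<Rightarrow> zletter laurent" where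
  "demazure_op i f =
    exact_quot
      (letter (Z (Suc i)) * f - letter (Z i) * subst_laurent (Some \<circ> swap_z i) f)
      (letter (Z (Suc i)) - letter (Z i))"

text \<open>All \<open>k\<close> are treated at once. If \<open>v\<close> permutes \<open>{1..k}\<close> then a descent at \<open>i\<close> forces \<open>i < k\<close>,
  so the second rule never leaves \<open>S\<^sub>k\<close>.\<close>

inductive is_grothendieck :: "(nat \<Rightarrow> nat) \<Rightarrow> zletter laurent \<Rightarrow> bool" where
  top: "is_grothendieck (longest k)
    (\<Prod>(i, j)\<in>{(i, j). 1 \<le> i \<and> 1 \<le> j \<and> i + j \<le> k}. 1 - letter (Z i) * inv_letter (Zd j))"
| step: "is_grothendieck v f \<Longrightarrow> 1 \<le> i \<Longrightarrow> perm_length (v \<circ> adj i) < perm_length v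
    \<Longrightarrow> is_grothendieck (v \<circ> adj i) (demazure_op i f)"

definition grothendieck :: "(nat \<Rightarrow> nat) \<Rightarrow> zletter laurent" where
  "grothendieck v = (THE f. is_grothendieck v f)"

text \<open>Evaluation at two finite alphabets, given as lists; letters beyond their ends become 1.\<close>

definition nth_letter :: "'w list \<Rightarrow> nat \<Rightarrow> 'w option" where
  "nth_letter xs p = (if p \<in> {1..length xs} then Some (xs ! (p - 1)) else None)"

definition at_alphabets :: "zletter laurent \<Rightarrow> 'w list \<Rightarrow> 'w list \<Rightarrow> 'w laurent" where
  "at_alphabets f xs ys =
    subst_laurent (\<lambda>a. case a of Z p \<Rightarrow> nth_letter xs p | Zd q \<Rightarrow> nth_letter ys q) f"


section \<open>Partial permutations and stable double Grothendieck polynomials\<close>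

text \<open>A 0/1 matrix is represented by the set of positions (row, column) of its 1's.\<close>

definition partial_perms :: "nat \<Rightarrow> nat \<Rightarrow> (nat \<times> nat) set set" where
  "partial_perms k l = {w. w \<subseteq> {1..k} \<times> {1..l} \<and>
     (\<forall>p q q'. (p, q) \<in> w \<and> (p, q') \<in> w \<longrightarrow> q = q') \<and>
     (\<forall>p p' q. (p, q) \<in> w \<and> (p', q) \<in> w \<longrightarrow> p = p')}"

definition completions :: "nat \<Rightarrow> nat \<Rightarrow> (nat \<times> nat) set \<Rightarrow> (nat \<Rightarrow> nat) set" where
  "completions k l w =
    {v \<in> S_inf. \<forall>p\<in>{1..k}. \<forall>q\<in>{1..l}. v p = q \<longleftrightarrow> (p, q) \<in> w}"

definition completion :: "nat \<Rightarrow> nat \<Rightarrow> (nat \<times> nat) set \<Rightarrow> (nat \<Rightarrow> nat)" where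
  "completion k l w =
    (THE v. v \<in> completions k l w \<and> (\<forall>u\<in>completions k l w. perm_length v \<le> perm_length u))"

definition shift_pp :: "nat \<Rightarrow> (nat \<times> nat) set \<Rightarrow> (nat \<times> nat) set" where
  "shift_pp m w = {(p, p) | p. p \<in> {1..m}} \<union> {(m + p, m + q) | p q. (p, q) \<in> w}"

definition stable_grothendieck :: "nat \<Rightarrow> nat \<Rightarrow> (nat \<times> nat) set \<Rightarrow> zletter laurent" where
  "stable_grothendieck k l w =
    stable_limit (\<lambda>m.
      at_alphabets (grothendieck (completion (m + k) (m + l) (shift_pp m w)))
        (map Z [1..<Suc k]) (map Zd [1..<Suc l]))"


section \<open>Pipe dreams\<close>

text \<open>A \<open>k \<times> l\<close> pipe dream is a set of boxes in \<open>{1..k} \<times> {1..l}\<close>. The letter \<open>s\<^sub>i\<close> of a word is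
  represented by its index \<open>i\<close>.\<close>

definition pipe_word :: "nat \<Rightarrow> nat \<Rightarrow> (nat \<times> nat) set \<Rightarrow> nat list" where
  "pipe_word k l P =
    concat (map (\<lambda>i. map (\<lambda>j. i + j - 1) (filter (\<lambda>j. (i, j) \<in> P) (rev [1..<Suc l])))
      [1..<Suc k])"

definition word_demazure :: "nat list \<Rightarrow> (nat \<Rightarrow> nat)" where
  "word_demazure =
    foldl (\<lambda>v i. if perm_length v < perm_length (v \<circ> adj i) then v \<circ> adj i else v) id"

definition pipe_demazure :: "nat \<Rightarrow> nat \<Rightarrow> (nat \<times> nat) set \<Rightarrow> (nat \<Rightarrow> nat)" where
  "pipe_demazure k l P = word_demazure (pipe_word k l P)"

definition pipe_dreams :: "nat \<Rightarrow> nat \<Rightarrow> (nat \<times> nat) set \<Rightarrow> (nat \<times> nat) set set" where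
  "pipe_dreams k l w = {P. P \<subseteq> {1..k} \<times> {1..l} \<and> pipe_demazure k l P = completion k l w}"

definition rotate_pd :: "nat \<Rightarrow> nat \<Rightarrow> (nat \<times> nat) set \<Rightarrow> (nat \<times> nat) set" where
  "rotate_pd k l P = {(Suc k - i, Suc l - j) | i j. (i, j) \<in> P}"


section \<open>Zelevinsky permutations\<close>

text \<open>Throughout, \<open>r\<close> gives the block sizes \<open>r 0, \<dots>, r n\<close>; its values beyond \<open>n\<close> are irrelevant.
  Block rows are numbered from the top, block columns from the right.\<close>

definition total_size :: "nat \<Rightarrow> (nat \<Rightarrow> nat) \<Rightarrow> nat" where
  "total_size n r = (\<Sum>j\<le>n. r j)"

definition row_offset :: "(nat \<Rightarrow> nat) \<Rightarrow> nat \<Rightarrow> nat" where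
  "row_offset r j = (\<Sum>q<j. r q)"

definition col_offset :: "nat \<Rightarrow> (nat \<Rightarrow> nat) \<Rightarrow> nat \<Rightarrow> nat" where
  "col_offset n r i = (\<Sum>p\<in>{i<..n}. r p)"

definition block_row :: "(nat \<Rightarrow> nat) \<Rightarrow> nat \<Rightarrow> nat set" where
  "block_row r j = {row_offset r j <.. row_offset r j + r j}"

definition block_col :: "nat \<Rightarrow> (nat \<Rightarrow> nat) \<Rightarrow> nat \<Rightarrow> nat set" where
  "block_col n r i = {col_offset n r i <.. col_offset n r i + r i}"

text \<open>The block in block row \<open>j\<close> and block column \<open>i\<close>:\<close>

definition block :: "nat \<Rightarrow> (nat \<Rightarrow> nat) \<Rightarrow> nat \<Rightarrow> nat \<Rightarrow> (nat \<times> nat) set" where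
  "block n r j i = block_row r j \<times> block_col n r i"

definition zelevinsky :: "nat \<Rightarrow> (nat \<Rightarrow> nat) \<Rightarrow> (nat \<Rightarrow> nat) \<Rightarrow> bool" where
  "zelevinsky n r v \<longleftrightarrow>
     v permutes {1..total_size n r} \<and>
     (\<forall>j i a. j \<le> n \<and> i \<le> n \<and> j + 2 \<le> i \<longrightarrow> (a, v a) \<notin> block n r j i) \<and>
     (\<forall>j a b. j \<le> n \<and> a \<in> block_row r j \<and> b \<in> block_row r j \<and> a < b \<longrightarrow> v a < v b) \<and>
     (\<forall>i a b. i \<le> n \<and> v a \<in> block_col n r i \<and> v b \<in> block_col n r i \<and> a < b \<longrightarrow> v a < v b)"

text \<open>Only the entries with \<open>i \<le> j \<le> n\<close> belong to the rank array. For \<open>i > j\<close> the same count depends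
  on the block sizes alone. The diagonal entries are the block sizes.\<close>

definition zel_rank :: "nat \<Rightarrow> (nat \<Rightarrow> nat) \<Rightarrow> (nat \<Rightarrow> nat) \<Rightarrow> nat \<Rightarrow> nat \<Rightarrow> nat" where
  "zel_rank n r v i j =
    card {a. \<exists>q p. j \<le> q \<and> q \<le> n \<and> p \<le> i \<and> (a, v a) \<in> block n r q p}"

definition has_rank_array ::
    "nat \<Rightarrow> (nat \<Rightarrow> nat) \<Rightarrow> (nat \<Rightarrow> nat) \<Rightarrow> (nat \<Rightarrow> nat \<Rightarrow> nat) \<Rightarrow> bool" where
  "has_rank_array n r v R \<longleftrightarrow> (\<forall>i j. i \<le> j \<and> j \<le> n \<longrightarrow> zel_rank n r v i j = R i j)"

definition is_zel_rank_array :: "nat \<Rightarrow> (nat \<Rightarrow> nat) \<Rightarrow> (nat \<Rightarrow> nat \<Rightarrow> nat) \<Rightarrow> bool" where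
  "is_zel_rank_array n r R \<longleftrightarrow> (\<exists>v. zelevinsky n r v \<and> has_rank_array n r v R)"

definition zel_perm :: "nat \<Rightarrow> (nat \<Rightarrow> nat) \<Rightarrow> (nat \<Rightarrow> nat \<Rightarrow> nat) \<Rightarrow> (nat \<Rightarrow> nat)" where
  "zel_perm n r R = (THE v. zelevinsky n r v \<and> has_rank_array n r v R)"

definition zel_hom :: "nat \<Rightarrow> (nat \<Rightarrow> nat) \<Rightarrow> (nat \<Rightarrow> nat)" where
  "zel_hom n r = (THE v. zelevinsky n r v \<and>
     (\<forall>u i j. zelevinsky n r u \<and> i \<le> j \<and> j \<le> n \<longrightarrow> zel_rank n r u i j \<le> zel_rank n r v i j))"

definition quiver_codim :: "nat \<Rightarrow> (nat \<Rightarrow> nat) \<Rightarrow> (nat \<Rightarrow> nat \<Rightarrow> nat) \<Rightarrow> int" where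
  "quiver_codim n r R =
    int (perm_length (zel_perm n r R)) - int (perm_length (zel_hom n r))"


section \<open>Quiver K-polynomials\<close>

text \<open>\<open>X j p\<close> and \<open>Y j p\<close> are the \<open>p\<close>-th letters (starting at 1) of the \<open>j\<close>-th alphabets.\<close>

datatype qletter = X nat nat | Y nat nat

instance qletter :: countable
  by countable_datatype

text \<open>Again an arbitrary order, making \<^typ>\<open>qletter laurent\<close> an integral domain in the library.\<close>

instantiation qletter :: linorder
begin

definition less_eq_qletter :: "qletter \<Rightarrow> qletter \<Rightarrow> bool" where
  "(a::qletter) \<le> b \<longleftrightarrow> to_nat a \<le> to_nat b"

definition less_qletter :: "qletter \<Rightarrow> qletter \<Rightarrow> bool" where
  "(a::qletter) < b \<longleftrightarrow> to_nat a < to_nat b"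

instance
  by standard (auto simp: less_eq_qletter_def less_qletter_def)

end

definition xalph :: "(nat \<Rightarrow> nat) \<Rightarrow> nat \<Rightarrow> qletter list" where
  "xalph r j = map (X j) [1..<Suc (r j)]"

definition yalph :: "(nat \<Rightarrow> nat) \<Rightarrow> nat \<Rightarrow> qletter list" where
  "yalph r j = map (Y j) [1..<Suc (r j)]"

definition xs_all :: "nat \<Rightarrow> (nat \<Rightarrow> nat) \<Rightarrow> qletter list" where
  "xs_all n r = concat (map (xalph r) [0..<Suc n])"

definition ys_all :: "nat \<Rightarrow> (nat \<Rightarrow> nat) \<Rightarrow> qletter list" where
  "ys_all n r = concat (map (yalph r) (rev [0..<Suc n]))"

text \<open>The quotient has to be formed in the Laurent polynomial ring before letters are set to 1:
  the denominator can vanish under such a specialization.\<close>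

definition double_quiver_K ::
    "nat \<Rightarrow> (nat \<Rightarrow> nat) \<Rightarrow> (nat \<Rightarrow> nat \<Rightarrow> nat) \<Rightarrow> qletter laurent" where
  "double_quiver_K n r R =
    exact_quot
      (at_alphabets (grothendieck (zel_perm n r R)) (xs_all n r) (ys_all n r))
      (at_alphabets (grothendieck (zel_hom n r)) (xs_all n r) (ys_all n r))"

fun truncate_letter :: "(nat \<Rightarrow> nat) \<Rightarrow> qletter \<Rightarrow> qletter option" where
  "truncate_letter r (X j p) = (if p \<le> r j then Some (X j p) else None)"
| "truncate_letter r (Y j p) = (if p \<le> r j then Some (Y j p) else None)"

definition shifted_quiver_K ::
    "nat \<Rightarrow> (nat \<Rightarrow> nat) \<Rightarrow> (nat \<Rightarrow> nat \<Rightarrow> nat) \<Rightarrow> nat \<Rightarrow> qletter laurent" where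
  "shifted_quiver_K n r R m =
    subst_laurent (truncate_letter r)
      (double_quiver_K n (\<lambda>j. m + r j) (\<lambda>i j. m + R i j))"

definition stable_quiver_K ::
    "nat \<Rightarrow> (nat \<Rightarrow> nat) \<Rightarrow> (nat \<Rightarrow> nat \<Rightarrow> nat) \<Rightarrow> qletter laurent" where
  "stable_quiver_K n r R = stable_limit (shifted_quiver_K n r R)"


section \<open>Lacing diagrams\<close>

text \<open>A lacing diagram is a list of length \<open>n\<close>; its \<open>j\<close>-th entry for \<open>j \<in> {1..n}\<close> is \<open>ws ! (j - 1)\<close>.\<close>

definition lacing_diagrams :: "nat \<Rightarrow> (nat \<Rightarrow> nat) \<Rightarrow> (nat \<times> nat) set list set" where
  "lacing_diagrams n r =
    {ws. length ws = n \<and> (\<forall>j\<in>{1..n}. ws ! (j - 1) \<in> partial_perms (r (j - 1)) (r j))}"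

definition assembled_pd ::
    "nat \<Rightarrow> (nat \<Rightarrow> nat) \<Rightarrow> (nat \<Rightarrow> (nat \<times> nat) set) \<Rightarrow> (nat \<times> nat) set" where
  "assembled_pd n r P =
     (\<Union>{block n r j i | j i. j \<le> n \<and> i \<le> n \<and> j + 2 \<le> i}) \<union>
     (\<Union>j\<in>{1..n}. (\<lambda>(p, q). (row_offset r (j - 1) + p, col_offset n r j + q)) ` P j)"

definition lacing_demazure_eq ::
    "nat \<Rightarrow> (nat \<Rightarrow> nat) \<Rightarrow> (nat \<times> nat) set list \<Rightarrow> (nat \<Rightarrow> nat \<Rightarrow> nat) \<Rightarrow> bool" where
  "lacing_demazure_eq n r ws R \<longleftrightarrow>
    (\<exists>P. (\<forall>j\<in>{1..n}. P j \<subseteq> {1..r (j - 1)} \<times> {1..r j} \<and>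
             rotate_pd (r (j - 1)) (r j) (P j) \<in> pipe_dreams (r (j - 1)) (r j) (ws ! (j - 1))) \<and>
         pipe_demazure (total_size n r) (total_size n r) (assembled_pd n r P) = zel_perm n r R)"

definition lacings :: "nat \<Rightarrow> (nat \<Rightarrow> nat) \<Rightarrow> (nat \<Rightarrow> nat \<Rightarrow> nat) \<Rightarrow> (nat \<times> nat) set list set" where
  "lacings n r R = {ws \<in> lacing_diagrams n r. lacing_demazure_eq n r ws R}"

definition lacing_length :: "nat \<Rightarrow> (nat \<Rightarrow> nat) \<Rightarrow> (nat \<times> nat) set list \<Rightarrow> nat" where
  "lacing_length n r ws =
    (\<Sum>j=1..n. perm_length (completion (r (j - 1)) (r j) (ws ! (j - 1))))"

definition lacing_grothendieck ::
    "nat \<Rightarrow> (nat \<Rightarrow> nat) \<Rightarrow> (nat \<times> nat) set list \<Rightarrow> qletter laurent" where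
  "lacing_grothendieck n r ws =
    (\<Prod>j=1..n. at_alphabets (stable_grothendieck (r (j - 1)) (r j) (ws ! (j - 1)))
       (xalph r (j - 1)) (yalph r j))"

text \<open>The sign \<open>(-1)\<^sup>e\<close> for an integer exponent \<open>e\<close>:\<close>

definition sign_pow :: "int \<Rightarrow> 'a::ring_1" where
  "sign_pow e = (- 1) ^ nat \<bar>e\<bar>"

end

theory Submission
  imports Defs
begin

text \<open>The weighted count of the pipe dreams with Demazure product \<open>v\<close> is a coefficient of a product over
  the boxes of a grid in the monoid ring of the 0-Hecke monoid. The Yang-Baxter equation moves a
  parameter through two adjacent rows or columns; this gives the action of the Demazure operators,
  hence the double Grothendieck polynomials, and symmetry wherever \<open>v\<close> has no descent.

  The pipe dreams of a Zelevinsky permutation contain all boxes of the blocks in which it vanishes, and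
  \<open>v(Hom)\<close> has no pipe dream besides this set. Dividing by its polynomial therefore drops the weights of
  these compulsory crosses.

  For block sizes \<open>m + r j\<close>, first reverse the order of the letters of every block. If \<open>m \<ge> d\<close>, then setting
  letters to 1 kills every pipe dream with a cross southeast of the superantidiagonal blocks, because
  \<open>v(m + r)\<close> fixes the last \<open>m\<close> points. The remaining pipe dreams are assembled from one pipe dream for
  each superantidiagonal block. Their words act on the one-line notation one block row at a time, and
  the Demazure product depends only on those of the factors. It is the extension \<open>v(m + r)\<close> precisely if
  the factors are the completions of the entries of a lacing diagram in \<open>L(r)\<close>, shifted by \<open>m\<close>. The sum
  thus factors for each lacing diagram into stable Grothendieck polynomials.\<close>

section \<open>Demazure products of words\<close>

text \<open>A cross in row p and column q weighs s - 1, where s is the quotient of the two letters.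
  With this choice, factors for the same generator multiply by multiplying s, the sign of the number
  of crosses is absorbed into the sign of the length, and a cross both of whose letters are 1 weighs
  0. In the given order the surviving letters are the first of each block, so crosses near the
  northwest corner of a block would keep their weight. Southeast of the superantidiagonal these are
  the only crosses possible: as v(m + r) fixes the last m points, all letters of its words are below
  d + m n. Reversing the letters of each block, which is allowed since v(m + r) has no descents
  inside of blocks, brings the letters equal to 1 to that corner. It also rotates the
  superantidiagonal blocks by 180 degrees, in accordance with the rotation in the definition of
  L(r). The length of v(m + r) is never computed: the extension multiplies the sign of every
  permutation by the same factor, so the parity of the difference to v(Hom) is that of d(r), and
  only this parity enters.\<close>

lemma adj_simps [simp]: "adj i i = Suc i" "adj i (Suc i) = i"
  by (auto simp: adj_def)

lemma adj_other: "p \<noteq> i \<Longrightarrow> p \<noteq> Suc i \<Longrightarrow> adj i p = p"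
  by (simp add: adj_def)

lemma adj_apply: "adj i p = (if p = i then Suc i else if p = Suc i then i else p)"
  by (auto simp: adj_other)

lemma adj_involutive [simp]: "adj i (adj i p) = p" "adj i \<circ> adj i = id" "f \<circ> adj i \<circ> adj i = f"
  by (auto simp: adj_def fun_eq_iff)

lemma permutation_adj [simp]: "permutation (adj i)"
  by (simp add: adj_def permutation_swap_id)

lemma bij_adj [simp]: "bij (adj i)"
  by (simp add: adj_def)

lemma inv_adj [simp]: "inv (adj i) = adj i"
  by (simp add: adj_def)

lemma adj_permutes: "a \<le> i \<Longrightarrow> i < b \<Longrightarrow> adj i permutes {a..b}"
  unfolding adj_def by (rule permutes_swap_id) auto

lemma adj_less_iff:
  "a \<noteq> b \<Longrightarrow> \<not> (a = i \<and> b = Suc i) \<Longrightarrow> \<not> (a = Suc i \<and> b = i) \<Longrightarrow> adj i a < adj i b \<longleftrightarrow> a < b"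
  by (auto simp: adj_apply)

lemma permutation_permutes_lessThan:
  fixes v :: "nat \<Rightarrow> nat"
  assumes "permutation v"
  obtains N where "v permutes {..<N}"
proof -
  have fin: "finite {x. v x \<noteq> x}" and b: "bij v" using assms by (simp_all add: permutation)
  obtain N where N: "\<And>x. v x \<noteq> x \<Longrightarrow> x < N"
    using finite_nat_set_iff_bounded[THEN iffD1, OF fin] by blast
  have "v permutes {..<N}" using N b by (auto simp: permutes_def bij_iff)
  then show thesis by (rule that)
qed

lemma finite_inversions:
  assumes "permutation v"
  shows "finite {(p, q :: nat). p < q \<and> v q < (v p :: nat)}"
proof -
  obtain N where N: "v permutes {..<N}" using permutation_permutes_lessThan[OF assms] .
  have "q < N" if "p < q" "v q < v p" for p q
  proof (rule ccontr)
    assume "\<not> q < N"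
    then have "v q = q" using N by (auto simp: permutes_def)
    moreover have "v p < N \<or> v p = p"
      using permutes_in_image[OF N, of p] permutes_not_in[OF N, of p] by auto
    ultimately show False using that \<open>\<not> q < N\<close> by auto
  qed
  then have "{(p, q :: nat). p < q \<and> v q < v p} \<subseteq> {..<N} \<times> {..<N}" by fastforce
  then show ?thesis by (rule finite_subset) auto
qed

text \<open>Applying \<open>adj i\<close> to both positions keeps the order of every pair of
  positions except (i, i + 1). So it carries old inversions to new ones, and this pair is the only
  additional inversion.\<close>

lemma perm_length_ascent:
  assumes v: "permutation v" and asc: "v i < v (Suc i)"
  shows "perm_length (v \<circ> adj i) = Suc (perm_length v)"
proof -
  let ?I = "\<lambda>v. {(p, q :: nat). p < q \<and> v q < (v p :: nat)}"
  have "?I (v \<circ> adj i) = insert (i, Suc i) (map_prod (adj i) (adj i) ` ?I v)"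
  proof (intro set_eqI iffI)
    fix x assume "x \<in> ?I (v \<circ> adj i)"
    then obtain p q where x: "x = (p, q)" and pq: "p < q" "v (adj i q) < v (adj i p)" by auto
    show "x \<in> insert (i, Suc i) (map_prod (adj i) (adj i) ` ?I v)"
    proof (cases "p = i \<and> q = Suc i")
      case False
      then have "adj i p < adj i q" using pq adj_less_iff[of p q i] by auto
      then have "(adj i p, adj i q) \<in> ?I v" using pq by auto
      then have "map_prod (adj i) (adj i) (adj i p, adj i q) \<in> map_prod (adj i) (adj i) ` ?I v"
        by (rule imageI)
      then show ?thesis by (simp add: x)
    qed (simp add: x)
  next
    fix x assume x: "x \<in> insert (i, Suc i) (map_prod (adj i) (adj i) ` ?I v)"
    show "x \<in> ?I (v \<circ> adj i)"
    proof (cases "x = (i, Suc i)")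
      case False
      then obtain p q where x: "x = (adj i p, adj i q)" and pq: "p < q" "v q < v p" using x by auto
      have "\<not> (p = i \<and> q = Suc i)" using pq asc by auto
      then have "adj i p < adj i q" using pq adj_less_iff[of p q i] by auto
      then show ?thesis using pq x by auto
    qed (use asc in auto)
  qed
  moreover have "(i, Suc i) \<notin> map_prod (adj i) (adj i) ` ?I v"
  proof
    assume "(i, Suc i) \<in> map_prod (adj i) (adj i) ` ?I v"
    then obtain p q where pq: "adj i p = i" "adj i q = Suc i" "p < q" by (auto dest: sym)
    then have "p = Suc i" "q = i" by (metis adj_simps(1) adj_involutive(1), metis adj_simps(2) adj_involutive(1))
    then show False using pq by auto
  qed
  moreover have "inj_on (map_prod (adj i) (adj i)) (?I v)"
    by (rule inj_onI) (auto, (metis adj_involutive(1))+)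
  ultimately show ?thesis
    using finite_inversions[OF v] by (simp add: perm_length_def card_image)
qed

lemma perm_length_descent:
  assumes v: "permutation v" and "v (Suc i) < v i"
  shows "perm_length v = Suc (perm_length (v \<circ> adj i))"
  using perm_length_ascent[of "v \<circ> adj i" i] assms by (simp add: permutation_compose)

lemma perm_length_less_iff:
  assumes v: "permutation v"
  shows "perm_length v < perm_length (v \<circ> adj i) \<longleftrightarrow> v i < v (Suc i)"
    and "perm_length (v \<circ> adj i) < perm_length v \<longleftrightarrow> v (Suc i) < v i"
proof -
  have "v i \<noteq> v (Suc i)" using v by (metis permutation bij_pointE n_not_Suc_n)
  then show "perm_length v < perm_length (v \<circ> adj i) \<longleftrightarrow> v i < v (Suc i)"
    "perm_length (v \<circ> adj i) < perm_length v \<longleftrightarrow> v (Suc i) < v i"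
    using perm_length_ascent[OF v, of i] perm_length_descent[OF v, of i]
    by (metis less_SucI less_irrefl lessI nat_neq_iff not_less_iff_gr_or_eq)+
qed

section \<open>The right and left actions of a letter\<close>

text \<open>The test of two adjacent values replaces the comparison of lengths in
  \<open>word_demazure\<close>; it is local and makes sense for arbitrary maps.\<close>

definition rop :: "(nat \<Rightarrow> nat) \<Rightarrow> nat \<Rightarrow> (nat \<Rightarrow> nat)" where
  "rop u i = (if u i < u (Suc i) then u \<circ> adj i else u)"

abbreviation rops :: "(nat \<Rightarrow> nat) \<Rightarrow> nat list \<Rightarrow> (nat \<Rightarrow> nat)" where
  "rops \<equiv> foldl rop"

lemma permutation_rop: "permutation u \<Longrightarrow> permutation (rop u i)"
  by (simp add: rop_def permutation_compose)

lemma permutation_rops: "permutation u \<Longrightarrow> permutation (rops u w)"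
  by (induction w arbitrary: u) (auto simp: permutation_rop)

lemma permutation_inj_on: "permutation u \<Longrightarrow> inj u"
  by (simp add: permutation bij_is_inj)

lemma word_demazure_rops: "word_demazure w = rops id w"
proof -
  have "foldl (\<lambda>v i. if perm_length v < perm_length (v \<circ> adj i) then v \<circ> adj i else v) u w = rops u w"
    if "permutation u" for u
    using that
    by (induction w arbitrary: u)
      (auto simp: rop_def perm_length_less_iff permutation_compose comp_assoc)
  then show ?thesis by (simp add: word_demazure_def)
qed

lemma permutation_demazure [simp]: "permutation (word_demazure w)"
  by (simp add: word_demazure_rops permutation_rops)

lemma rops_permutes:
  assumes "u permutes {a..b}" "\<And>i. i \<in> set w \<Longrightarrow> a \<le> i \<and> i < b"
  shows "rops u w permutes {a..b}"
  using assms
  by (induction w arbitrary: u) (auto simp: rop_def intro!: permutes_compose adj_permutes)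

lemma demazure_permutes:
  "(\<And>i. i \<in> set w \<Longrightarrow> a \<le> i \<and> i < b) \<Longrightarrow> word_demazure w permutes {a..b}"
  unfolding word_demazure_rops by (rule rops_permutes) (auto simp: permutes_id)

definition left_op :: "(nat \<Rightarrow> nat) \<Rightarrow> nat \<Rightarrow> (nat \<Rightarrow> nat)" where
  "left_op u i = (if inv u i < inv u (Suc i) then adj i \<circ> u else u)"

lemma inv_rop: "bij u \<Longrightarrow> inv (rop u i) = left_op (inv u) i"
  by (auto simp: rop_def left_op_def o_inv_distrib inv_inv_eq)

text \<open>The two operators interfere only if the values i, i + 1 occupy the positions j, j + 1.
  In increasing order they then satisfy \<open>adj i \<circ> u = u \<circ> adj j\<close>, and either
  order of the operators makes this exchange once; in decreasing order nothing happens. Otherwise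
  neither exchange affects the comparison made by the other.\<close>

lemma left_op_rop:
  assumes u: "bij u"
  shows "left_op (rop u j) i = rop (left_op u i) j"
proof -
  define a where "a = inv u i"
  define b where "b = inv u (Suc i)"
  have ua: "u a = i" "u b = Suc i" using u by (simp_all add: a_def b_def bij_is_surj surj_f_inv_f)
  have inj: "\<And>x y. u x = u y \<longleftrightarrow> x = y" using u by (auto dest: bij_is_inj injD)
  have ab: "a \<noteq> b" using ua by auto
  have inv1: "inv (u \<circ> adj j) = adj j \<circ> inv u" using u by (simp add: o_inv_distrib)
  consider "a = j" "b = Suc j" | "a = Suc j" "b = j"
    | "\<not> (a = j \<and> b = Suc j)" "\<not> (a = Suc j \<and> b = j)" by blast
  then show ?thesis
  proof cases
    case 1
    have "adj i \<circ> u = u \<circ> adj j"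
    proof
      fix x show "(adj i \<circ> u) x = (u \<circ> adj j) x"
        using ua 1 inj[of x a] inj[of x b] by (auto simp: adj_apply)
    qed
    then show ?thesis using 1 ua
      by (simp add: rop_def left_op_def inv1 a_def[symmetric] b_def[symmetric])
  next
    case 2
    then show ?thesis using ua
      by (simp add: rop_def left_op_def inv1 a_def[symmetric] b_def[symmetric])
  next
    case 3
    have 1: "adj j a < adj j b \<longleftrightarrow> a < b" by (rule adj_less_iff) (use 3 ab in auto)
    have 2: "adj i (u j) < adj i (u (Suc j)) \<longleftrightarrow> u j < u (Suc j)"
    proof (rule adj_less_iff)
      show "u j \<noteq> u (Suc j)" by (simp add: inj)
      show "\<not> (u j = i \<and> u (Suc j) = Suc i)" "\<not> (u j = Suc i \<and> u (Suc j) = i)"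
        using 3 ua inj by metis+
    qed
    show ?thesis
      using 1 2 by (auto simp: rop_def left_op_def inv1 a_def[symmetric] b_def[symmetric] comp_assoc)
  qed
qed

lemma rops_left_op:
  assumes "permutation u"
  shows "rops (left_op u i) w = left_op (rops u w) i"
  using assms
proof (induction w arbitrary: u)
  case (Cons j w)
  have "rops (left_op u i) (j # w) = rops (left_op (rop u j) i) w"
    using Cons.prems by (simp add: left_op_rop permutation)
  also have "\<dots> = left_op (rops (rop u j) w) i"
    by (rule Cons.IH) (simp add: Cons.prems permutation_rop)
  finally show ?case by simp
qed simp

lemma demazure_Cons: "word_demazure (i # w) = left_op (word_demazure w) i"
proof -
  have "rop id i = left_op id i" by (simp add: rop_def left_op_def)
  then show ?thesis
    using rops_left_op[of id i w] by (simp add: word_demazure_rops)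
qed

lemma demazure_append: "word_demazure (a @ b) = rops (word_demazure a) b"
  by (simp add: word_demazure_rops)

lemma demazure_snoc: "word_demazure (a @ [i]) = rop (word_demazure a) i"
  by (simp add: demazure_append)

text \<open>A prefix acts by the left operators of its letters and therefore sees only the Demazure
  product of the suffix. Together with \<open>demazure_append\<close> this makes equality of
  products a congruence.\<close>

lemma demazure_cong_right:
  "word_demazure b = word_demazure b' \<Longrightarrow> word_demazure (a @ b) = word_demazure (a @ b')"
  by (induction a) (simp_all add: demazure_Cons)

lemma demazure_cong:
  "word_demazure a = word_demazure a' \<Longrightarrow> word_demazure b = word_demazure b' \<Longrightarrow>
    word_demazure (a @ b) = word_demazure (a' @ b')"
  by (metis demazure_append demazure_cong_right)

lemma demazure_concat_cong:
  assumes "length as = length bs" "\<And>i. i < length as \<Longrightarrow> word_demazure (as ! i) = word_demazure (bs ! i)"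
  shows "word_demazure (concat as) = word_demazure (concat bs)"
  using assms
proof (induction as bs rule: list_induct2)
  case (Cons x xs y ys)
  show ?case
    using Cons.IH Cons.prems[of 0] Cons.prems[of "Suc _"] by (auto intro!: demazure_cong)
qed simp

lemma demazure_rev: "word_demazure (rev w) = inv (word_demazure w)"
proof (induction w)
  case Nil
  then show ?case by (simp add: word_demazure_rops)
next
  case (Cons i w)
  have b: "bij (word_demazure w)" by (metis permutation permutation_demazure)
  have "word_demazure (rev (i # w)) = rop (inv (word_demazure w)) i"
    by (simp add: demazure_snoc Cons.IH)
  also have "\<dots> = inv (inv (rop (inv (word_demazure w)) i))"
    using Cons.IH by (metis inv_inv_eq permutation permutation_demazure permutation_rop)
  also have "\<dots> = inv (left_op (word_demazure w) i)"
    using b by (simp add: inv_rop bij_imp_bij_inv inv_inv_eq)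
  finally show ?case by (simp add: demazure_Cons)
qed

lemma demazure_right_descent:
  assumes "word_demazure w (Suc i) < word_demazure w i"
  shows "word_demazure (w @ [i]) = word_demazure w"
  using assms by (simp add: demazure_snoc rop_def)

lemma demazure_left_descent:
  assumes "inv (word_demazure w) (Suc i) < inv (word_demazure w) i"
  shows "word_demazure (i # w) = word_demazure w"
  using assms by (simp add: demazure_Cons left_op_def)

lemma rop_descent: "inj u \<Longrightarrow> rop u i (Suc i) < rop u i i"
  using inj_eq[of u i "Suc i"] by (auto simp: rop_def)

lemma demazure_snoc_descent: "word_demazure (w @ [i]) (Suc i) < word_demazure (w @ [i]) i"
  by (simp add: demazure_snoc rop_descent permutation_inj_on)

lemma demazure_Cons_left_descent:
  "inv (word_demazure (i # w)) (Suc i) < inv (word_demazure (i # w)) i"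
  using demazure_snoc_descent[of "rev w" i] by (simp add: demazure_rev[of "i # w", symmetric])

text \<open>Induction on the length: a descent of a permutation of \<open>{a..b}\<close> lies inside
  of the interval, and removing it is undone by appending its letter. Without descents only the
  identity is left.\<close>

lemma every_permutation_demazure:
  assumes "u permutes {a..b :: nat}"
  obtains w where "word_demazure w = u" "\<And>i. i \<in> set w \<Longrightarrow> a \<le> i \<and> i < b"
proof -
  have "\<exists>w. word_demazure w = u \<and> (\<forall>i\<in>set w. a \<le> i \<and> i < b)"
    using assms
  proof (induction "perm_length u" arbitrary: u rule: less_induct)
    case less
    have p: "permutation u" using less.prems by (auto intro: permutation_permutes[THEN iffD2])
    show ?case
    proof (cases "\<exists>i. u (Suc i) < u i")
      case True
      then obtain i where i: "u (Suc i) < u i" by blast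
      have ib: "a \<le> i \<and> i < b"
        using i permutes_in_image[OF less.prems, of i] permutes_in_image[OF less.prems, of "Suc i"]
          permutes_not_in[OF less.prems, of i] permutes_not_in[OF less.prems, of "Suc i"]
        by (cases "i \<in> {a..b}"; cases "Suc i \<in> {a..b}") auto
      have "perm_length (u \<circ> adj i) < perm_length u" using i p by (simp add: perm_length_less_iff)
      moreover have "u \<circ> adj i permutes {a..b}"
        using ib less.prems by (intro permutes_compose adj_permutes) auto
      ultimately obtain w where "word_demazure w = u \<circ> adj i" "\<forall>i\<in>set w. a \<le> i \<and> i < b"
        using less.hyps by blast
      then have "word_demazure (w @ [i]) = u" using i by (simp add: demazure_snoc rop_def)
      then show ?thesis using ib \<open>\<forall>i\<in>set w. a \<le> i \<and> i < b\<close> by (intro exI[of _ "w @ [i]"]) auto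
    next
      case False
      have "strict_mono u"
        using False permutation_inj_on[OF p] by (intro strict_mono_Suc_iff[THEN iffD2]) (metis injD linorder_neqE_nat n_not_Suc_n)
      moreover have "surj u" using p by (simp add: permutation bij_is_surj)
      ultimately have "u = id"
      proof -
        have ge: "x \<le> u x" for x using \<open>strict_mono u\<close> by (rule strict_mono_imp_increasing)
        have "u x = x" for x
        proof (induction x rule: less_induct)
          case (less x)
          obtain y where y: "u y = x" using \<open>surj u\<close> by (metis surjD)
          have "y \<le> x" using ge[of y] y by simp
          then show ?case using y less.IH[of y] by (cases "y = x") auto
        qed
        then show ?thesis by (simp add: fun_eq_iff)
      qed
      then show ?thesis by (intro exI[of _ "[]"]) (simp add: word_demazure_rops)
    qed
  qed
  then show thesis using that by blast
qed

text \<open>The number of 1's in the northwest corner, with row and column 0 included so that the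
  effect of a letter is uniform; for permutations fixing 0 the count is off by 1.\<close>

definition rk :: "(nat \<Rightarrow> nat) \<Rightarrow> nat \<Rightarrow> nat \<Rightarrow> nat" where
  "rk u a b = card {p \<in> {..a}. u p \<le> b}"

lemma rk_0: "rk u 0 b = (if u 0 \<le> b then 1 else 0)"
proof -
  have "{p \<in> {..0::nat}. u p \<le> b} = (if u 0 \<le> b then {0} else {})" by auto
  then show ?thesis by (simp add: rk_def)
qed

lemma rk_Suc: "rk u (Suc a) b = rk u a b + (if u (Suc a) \<le> b then 1 else 0)"
proof -
  have "{p \<in> {..Suc a}. u p \<le> b} =
      (if u (Suc a) \<le> b then insert (Suc a) {p \<in> {..a}. u p \<le> b} else {p \<in> {..a}. u p \<le> b})"
    by (auto simp: le_Suc_eq)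
  then show ?thesis by (simp add: rk_def)
qed

lemma rk_id: "rk id a b = Suc (min a b)"
  by (induction a) (auto simp: rk_Suc rk_0)

lemma rop_apply:
  "rop u i a = (if a = i then max (u i) (u (Suc i)) else if a = Suc i then min (u i) (u (Suc i)) else u a)"
  by (auto simp: rop_def adj_apply)

text \<open>Only row i of the rank table changes. As the larger of the two values comes first
  afterwards, the entry becomes the least one compatible with rows i - 1 and i + 1. The closed form
  is monotone in the old ranks, which is what comparisons of words rely on.\<close>

lemma rk_rop:
  "rk (rop u i) a b =
    (if a = i then max (if i = 0 then 0 else rk u (i - 1) b) (rk u (Suc i) b - 1) else rk u a b)"
proof -
  have low: "rk (rop u i) a b = rk u a b" if "a < i" for a
    using that by (induction a) (auto simp: rk_Suc rk_0 rop_apply)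
  define c where "c = (if i = 0 then 0 else rk u (i - 1) b)"
  have c: "rk u i b = c + (if u i \<le> b then 1 else 0)"
    by (cases i) (auto simp: c_def rk_Suc rk_0)
  have at: "rk (rop u i) i b = c + (if max (u i) (u (Suc i)) \<le> b then 1 else 0)"
    using low[of "i - 1"] by (cases i) (auto simp: c_def rk_Suc rk_0 rop_apply)
  have two: "rk (rop u i) (Suc i) b = rk u (Suc i) b"
    unfolding rk_Suc[of _ i] at c
    by (cases "u i \<le> b"; cases "u (Suc i) \<le> b") (simp_all add: rop_apply min_le_iff_disj)
  have high: "rk (rop u i) a b = rk u a b" if "Suc i \<le> a" for a
    using that
  proof (induction a rule: dec_induct)
    case (step n)
    then show ?case by (simp add: rk_Suc[of _ n] rop_apply)
  qed (rule two)
  have "rk (rop u i) i b = max c (rk u (Suc i) b - 1)"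
    unfolding at rk_Suc c by (auto simp: max_def)
  then show ?thesis using low[of a] high[of a] unfolding c_def
    by (cases a i rule: linorder_cases) auto
qed

lemma rk_rop_le: "rk (rop u i) a b \<le> rk u a b"
  by (cases i) (auto simp: rk_rop rk_Suc rk_0)

lemma rk_rops_le: "rk (rops u w) a b \<le> rk u a b"
proof (induction w arbitrary: u)
  case (Cons i w)
  have "rk (rops (rop u i) w) a b \<le> rk (rop u i) a b" by (rule Cons)
  also have "\<dots> \<le> rk u a b" by (rule rk_rop_le)
  finally show ?case by simp
qed simp

text \<open>At the moment when the letter i acts, ranks are bounded by those of \<open>id\<close>,
  so the rank at (i, i) drops to at most i; later letters can only lower it. A letter that occurs is
  never undone.\<close>

lemma rk_demazure_letter:
  assumes "i \<in> set w"
  shows "rk (word_demazure w) i i \<le> i"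
proof -
  obtain a b where w: "w = a @ i # b" using assms(1) by (auto dest: split_list)
  let ?u = "word_demazure a"
  have le: "rk ?u x y \<le> Suc (min x y)" for x y
    using rk_rops_le[of id a x y] by (auto simp: word_demazure_rops rk_id)
  have "rk (rop ?u i) i i \<le> i" using le[of "i - 1" i] le[of "Suc i" i] by (auto simp: rk_rop)
  moreover have "word_demazure w = rops (rop ?u i) b" by (simp add: w demazure_append)
  ultimately show ?thesis using rk_rops_le[of "rop ?u i" b i i] by auto
qed

lemma rk_full:
  assumes "\<And>p. p \<le> a \<Longrightarrow> u p \<le> b"
  shows "rk u a b = Suc a"
proof -
  have "{p \<in> {..a}. u p \<le> b} = {..a}" using assms by auto
  then show ?thesis by (simp add: rk_def)
qed

text \<open>For i out of range the product maps {0..i} into itself and has rank i + 1 at (i, i),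
  against \<open>rk_demazure_letter\<close>.\<close>

lemma demazure_letter_range:
  assumes "word_demazure w permutes {m..d}" "i \<in> set w"
  shows "m \<le> i \<and> i < d"
proof (rule ccontr)
  assume *: "\<not> (m \<le> i \<and> i < d)"
  have "word_demazure w p \<le> i" if "p \<le> i" for p
    using permutes_in_image[OF assms(1), of p] permutes_not_in[OF assms(1), of p] that *
    by (cases "p \<in> {m..d}") auto
  then have "rk (word_demazure w) i i = Suc i" by (rule rk_full)
  then show False using rk_demazure_letter[OF assms(2)] by simp
qed

section \<open>The 0-Hecke monoid and its monoid ring\<close>

text \<open>Words modulo equal products: associativity of the 0-Hecke monoid is inherited from
  concatenation, and \<open>demazure_cong\<close> makes it well defined.\<close>

definition demazure_eq :: "nat list \<Rightarrow> nat list \<Rightarrow> bool" where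
  "demazure_eq a b \<longleftrightarrow> word_demazure a = word_demazure b"

quotient_type hecke = "nat list" / demazure_eq
  by (intro equivpI reflpI sympI transpI) (auto simp: demazure_eq_def)

lift_definition hperm :: "hecke \<Rightarrow> (nat \<Rightarrow> nat)" is word_demazure
  by (simp add: demazure_eq_def)

lift_definition hword :: "nat list \<Rightarrow> hecke" is "\<lambda>w. w" .

text \<open>The monoid is written additively for use as the exponents of a monoid ring and
  multiplicatively for use with products over lists.\<close>

instantiation hecke :: "{monoid_add, monoid_mult}"
begin
lift_definition zero_hecke :: hecke is "[]" .
lift_definition one_hecke :: hecke is "[]" .
lift_definition plus_hecke :: "hecke \<Rightarrow> hecke \<Rightarrow> hecke" is append
  by (simp only: demazure_eq_def) (rule demazure_cong)
lift_definition times_hecke :: "hecke \<Rightarrow> hecke \<Rightarrow> hecke" is append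
  by (simp only: demazure_eq_def) (rule demazure_cong)
instance
  by standard (transfer; simp add: demazure_eq_def)+
end

lemma hword_Nil: "hword [] = 0" "hword [] = 1"
  by (transfer, simp add: demazure_eq_def)+

lemma hword_append: "hword (a @ b) = hword a + hword b" "hword (a @ b) = hword a * hword b"
  by (transfer, simp add: demazure_eq_def)+

lemma hperm_hword [simp]: "hperm (hword w) = word_demazure w"
  by transfer simp

lemma hperm_inject: "hperm a = hperm b \<longleftrightarrow> a = b"
  by transfer (simp add: demazure_eq_def)

lemma hword_eq_iff: "hword a = hword b \<longleftrightarrow> word_demazure a = word_demazure b"
  by transfer (simp add: demazure_eq_def)

lemma hword_cases: obtains w where "k = hword w"
  by transfer (auto simp: demazure_eq_def)

abbreviation hgen :: "nat \<Rightarrow> hecke" where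
  "hgen i \<equiv> hword [i]"

lemma hword_prod_list: "prod_list (map hgen w) = hword w"
proof (induction w)
  case (Cons i w)
  then show ?case using hword_append(2)[of "[i]" w] by simp
qed (simp add: hword_Nil(2))

lemma hgen_commute:
  assumes "Suc i < j"
  shows "hgen i + hgen j = hgen j + hgen i" "hgen i * hgen j = hgen j * hgen i"
proof -
  have "word_demazure [i, j] = word_demazure [j, i]"
    using assms by (auto simp: word_demazure_rops fun_eq_iff rop_apply)
  then show "hgen i + hgen j = hgen j + hgen i" "hgen i * hgen j = hgen j * hgen i"
    by (simp_all add: hword_append[symmetric] hword_eq_iff)
qed

lemma hgen_idem: "hgen i + hgen i = hgen i"
proof -
  have "word_demazure [i, i] = word_demazure [i]"
    by (auto simp: word_demazure_rops fun_eq_iff rop_apply)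
  then show ?thesis by (simp add: hword_append(1)[symmetric] hword_eq_iff)
qed

lemma hgen_braid:
  "hgen i + hgen (Suc i) + hgen i = hgen (Suc i) + hgen i + hgen (Suc i)"
  "hgen i * hgen (Suc i) * hgen i = hgen (Suc i) * hgen i * hgen (Suc i)"
proof -
  have "word_demazure [i, Suc i, i] = word_demazure [Suc i, i, Suc i]"
    by (auto simp: word_demazure_rops fun_eq_iff rop_apply)
  then show "hgen i + hgen (Suc i) + hgen i = hgen (Suc i) + hgen i + hgen (Suc i)"
    "hgen i * hgen (Suc i) * hgen i = hgen (Suc i) * hgen i * hgen (Suc i)"
    by (simp_all add: hword_append[symmetric] hword_eq_iff)
qed

text \<open>The inverse of \<open>hperm\<close> on Demazure products. For other maps the choice is
  arbitrary, hence the guard \<open>demazure_perm\<close> in the lemmas.\<close>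

definition helem :: "(nat \<Rightarrow> nat) \<Rightarrow> hecke" where
  "helem v = hword (SOME w. word_demazure w = v)"

definition demazure_perm :: "(nat \<Rightarrow> nat) \<Rightarrow> bool" where
  "demazure_perm v \<longleftrightarrow> (\<exists>w. word_demazure w = v)"

lemma hperm_helem: "demazure_perm v \<Longrightarrow> hperm (helem v) = v"
  unfolding helem_def demazure_perm_def by (auto intro: someI)

lemma eq_helem_iff: "demazure_perm v \<Longrightarrow> k = helem v \<longleftrightarrow> hperm k = v"
  using hperm_helem hperm_inject by metis

lemma demazure_perm_permutes: "v permutes {a..b} \<Longrightarrow> demazure_perm v"
  unfolding demazure_perm_def by (metis every_permutation_demazure)

section \<open>Boxes as elements of the monoid ring\<close>

type_synonym 'a hecke_ring = "hecke \<Rightarrow>\<^sub>0 'a"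

text \<open>A box of a grid: \<open>\<alpha>\<close> is the weight of leaving it empty,
  \<open>\<beta>\<close> that of a cross.\<close>

definition hbox :: "'a \<Rightarrow> 'a \<Rightarrow> nat \<Rightarrow> 'a::comm_ring_1 hecke_ring" where
  "hbox \<alpha> \<beta> i = Poly_Mapping.single 0 \<alpha> + Poly_Mapping.single (hgen i) \<beta>"

text \<open>The shift by 1 makes the parameter multiplicative: since \<open>hgen i\<close> is
  idempotent, the factors with parameters s and t multiply to the one with parameter s * t.\<close>

abbreviation hh :: "nat \<Rightarrow> 'a \<Rightarrow> 'a::comm_ring_1 hecke_ring" where
  "hh i s \<equiv> hbox 1 (s - 1) i"

lemma hbox_commute: "Suc i < j \<Longrightarrow> hbox \<alpha> \<beta> i * hbox \<gamma> \<delta> j = hbox \<gamma> \<delta> j * hbox \<alpha> \<beta> i"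
  by (simp add: hbox_def distrib_left distrib_right mult_single mult.commute, subst hgen_commute(1))
    (simp_all add: add_ac)

text \<open>Idempotence collects the terms of one generator on each side into A + c + A * c = s * t
  - 1 = B, which is the coefficient of the other generator already; the longest terms agree by the
  braid relation.\<close>

lemma yang_baxter:
  "hh i s * hh (Suc i) (s * t) * hh i t = hh (Suc i) t * hh i (s * t) * hh (Suc i) s"
proof -
  define A B c where "A = s - 1" and "B = s * t - 1" and "c = t - 1"
  have B: "B = A + c + A * c" by (simp add: A_def B_def c_def algebra_simps)
  let ?S = "Poly_Mapping.single :: hecke \<Rightarrow> 'a \<Rightarrow> _"
  let ?x = "hgen i" and ?y = "hgen (Suc i)"
  have "hh i s * hh (Suc i) (s * t) * hh i t =
      ?S 0 1 + (?S ?x c + ?S ?x A + ?S ?x (A * c)) + ?S ?y B + ?S (?x + ?y) (A * B) +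
      ?S (?y + ?x) (B * c) + ?S (?x + ?y + ?x) (A * B * c)"
    by (simp add: hbox_def distrib_left distrib_right mult_single hgen_idem A_def[symmetric]
        B_def[symmetric] c_def[symmetric] add_ac)
  also have "?S ?x c + ?S ?x A + ?S ?x (A * c) = ?S ?x B"
    by (simp add: B single_add[symmetric] add_ac)
  also have "?S 0 1 + ?S ?x B + ?S ?y B + ?S (?x + ?y) (A * B) +
      ?S (?y + ?x) (B * c) + ?S (?x + ?y + ?x) (A * B * c) =
      ?S 0 1 + ?S ?x B + (?S ?y c + ?S ?y A + ?S ?y (c * A)) + ?S (?x + ?y) (A * B) +
      ?S (?y + ?x) (B * c) + ?S (?y + ?x + ?y) (A * B * c)"
    by (simp add: B single_add[symmetric] add_ac mult_ac hgen_braid(1)[unfolded add.assoc])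
  also have "\<dots> = hh (Suc i) t * hh i (s * t) * hh (Suc i) s"
    by (simp add: hbox_def distrib_left distrib_right mult_single hgen_idem A_def[symmetric]
        B_def[symmetric] c_def[symmetric] add_ac mult_ac)
  finally show ?thesis .
qed

text \<open>Through crosses alone, in which no letters occur, the parameter travels unchanged.\<close>

lemma cross_swap:
  "hbox 0 \<beta> i * hbox 0 \<gamma> (Suc i) * hh i c = hh (Suc i) c * hbox 0 \<beta> i * hbox 0 \<gamma> (Suc i)"
  "hh i c * hbox 0 \<beta> (Suc i) * hbox 0 \<gamma> i = hbox 0 \<beta> (Suc i) * hbox 0 \<gamma> i * hh (Suc i) c"
  by (simp_all add: hbox_def distrib_left distrib_right mult_single hgen_braid mult_ac
      flip: add.assoc)

section \<open>Products over grids\<close>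

definition boxes :: "nat \<Rightarrow> nat \<Rightarrow> (nat \<times> nat) list" where
  "boxes N M = concat (map (\<lambda>p. map (\<lambda>q. (p, q)) (rev [1..<Suc M])) [1..<Suc N])"

definition grid :: "nat \<Rightarrow> nat \<Rightarrow> (nat \<Rightarrow> nat \<Rightarrow> 'm) \<Rightarrow> 'm::monoid_mult" where
  "grid N M E = prod_list (map (\<lambda>(p, q). E p q) (boxes N M))"

lemma pipe_word_boxes: "pipe_word N M P = map (\<lambda>(p, q). p + q - 1) (filter (\<lambda>x. x \<in> P) (boxes N M))"
  by (simp add: pipe_word_def boxes_def filter_concat map_concat filter_map comp_def)

lemma boxes_Suc: "boxes (Suc N) M = boxes N M @ map (\<lambda>q. (Suc N, q)) (rev [1..<Suc M])"
  by (simp add: boxes_def)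

lemma set_boxes: "set (boxes N M) = {1..N} \<times> {1..M}"
  by (induction N) (auto simp: boxes_Suc simp del: upt_Suc, auto simp: boxes_def)

lemma distinct_boxes: "distinct (boxes N M)"
proof (induction N)
  case (Suc N)
  then show ?case
    by (auto simp: boxes_Suc distinct_map inj_on_def set_boxes simp del: upt_Suc)
qed (simp add: boxes_def)

lemma grid_cong:
  "(\<And>p q. 1 \<le> p \<Longrightarrow> p \<le> N \<Longrightarrow> 1 \<le> q \<Longrightarrow> q \<le> M \<Longrightarrow> E p q = E' p q) \<Longrightarrow> grid N M E = grid N M E'"
  unfolding grid_def by (rule arg_cong[where f = prod_list]) (auto simp: set_boxes)

lemma grid_Suc: "grid (Suc N) M E = grid N M E * prod_list (map (E (Suc N)) (rev [1..<Suc M]))"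
  by (simp add: grid_def boxes_Suc comp_def)

lemma grid_0 [simp]: "grid 0 M E = 1" "grid N 0 E = 1"
  by (simp add: grid_def boxes_def) (induction N, simp_all add: grid_Suc, simp add: grid_def boxes_def)

lemma grid_add_rows: "grid (N1 + N2) M E = grid N1 M E * grid N2 M (\<lambda>p q. E (N1 + p) q)"
  by (induction N2) (simp_all add: grid_Suc mult.assoc)

lemma prod_list_one: "(\<And>x. x \<in> set xs \<Longrightarrow> f x = 1) \<Longrightarrow> prod_list (map f xs) = (1 :: 'm::monoid_mult)"
  by (induction xs) auto

lemma grid_one: "(\<And>p q. 1 \<le> p \<Longrightarrow> p \<le> N \<Longrightarrow> 1 \<le> q \<Longrightarrow> q \<le> M \<Longrightarrow> E p q = 1) \<Longrightarrow> grid N M E = 1"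
  unfolding grid_def by (rule prod_list_one) (auto simp: set_boxes)

lemma commute_prod_list:
  fixes x :: "'m::monoid_mult"
  assumes "\<And>y. y \<in> set ys \<Longrightarrow> x * y = y * x"
  shows "x * prod_list ys = prod_list ys * x"
  using assms
proof (induction ys)
  case (Cons y ys)
  have "x * prod_list (y # ys) = y * (x * prod_list ys)"
    using Cons.prems[of y] by (simp add: mult.assoc[symmetric])
  also have "\<dots> = prod_list (y # ys) * x" using Cons by (simp add: mult.assoc)
  finally show ?case .
qed simp

lemma prod_list_commute:
  fixes xs ys :: "'m::monoid_mult list"
  assumes "\<And>x y. x \<in> set xs \<Longrightarrow> y \<in> set ys \<Longrightarrow> x * y = y * x"
  shows "prod_list xs * prod_list ys = prod_list ys * prod_list xs"
  using commute_prod_list[of xs "prod_list ys"] commute_prod_list[of ys] assms by metis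

lemma upt_shift: "[1..<Suc (a + b)] = [1..<Suc a] @ map ((+) a) [1..<Suc b]"
  by (induction b) auto

text \<open>Rows are read from the right, so to read the right columns first, only left boxes of
  upper rows have to pass right boxes of lower rows. Such boxes lie at least two diagonals apart,
  which is why they commute in the applications.\<close>

lemma grid_add_cols:
  fixes E :: "nat \<Rightarrow> nat \<Rightarrow> 'm::monoid_mult"
  assumes "\<And>p q p' q'. 1 \<le> p \<Longrightarrow> 1 \<le> q \<Longrightarrow> p < p' \<Longrightarrow> q < q' \<Longrightarrow> E p q * E p' q' = E p' q' * E p q"
  shows "grid N (M1 + M2) E = grid N M2 (\<lambda>p q. E p (M1 + q)) * grid N M1 E"
proof (induction N)
  case (Suc N)
  let ?L = "grid N M1 E" and ?R = "prod_list (map (\<lambda>q. E (Suc N) (M1 + q)) (rev [1..<Suc M2]))"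
  have comm: "?L * ?R = ?R * ?L"
    unfolding grid_def
    by (rule prod_list_commute) (auto simp: set_boxes intro!: assms)
  have split: "map (E (Suc N)) (rev [1..<Suc (M1 + M2)]) =
      map (\<lambda>q. E (Suc N) (M1 + q)) (rev [1..<Suc M2]) @ map (E (Suc N)) (rev [1..<Suc M1])"
    unfolding upt_shift by (simp add: rev_map comp_def)
  define l where "l = prod_list (map (E (Suc N)) (rev [1..<Suc M1]))"
  have "grid (Suc N) (M1 + M2) E = grid N M2 (\<lambda>p q. E p (M1 + q)) * (?L * ?R) * l"
    by (simp only: grid_Suc Suc.IH split prod_list.append l_def mult.assoc)
  also have "\<dots> = grid N M2 (\<lambda>p q. E p (M1 + q)) * (?R * ?L) * l"
    by (simp only: comm)
  finally show ?case by (simp only: grid_Suc l_def mult.assoc)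
qed simp

lemma grid_columns:
  fixes E :: "nat \<Rightarrow> nat \<Rightarrow> 'm::monoid_mult"
  assumes "\<And>p q p' q'. 1 \<le> p \<Longrightarrow> 1 \<le> q \<Longrightarrow> p < p' \<Longrightarrow> q < q' \<Longrightarrow> E p q * E p' q' = E p' q' * E p q"
  shows "grid N M E = prod_list (map (\<lambda>q. prod_list (map (\<lambda>p. E p q) [1..<Suc N])) (rev [1..<Suc M]))"
proof (induction M)
  case (Suc M)
  have "boxes N 1 = map (\<lambda>p. (p, 1)) [1..<Suc N]"
  proof (induction N)
    case (Suc N)
    then show ?case unfolding boxes_Suc by simp
  qed (simp add: boxes_def)
  then have "grid N 1 (\<lambda>p q. E p (M + q)) = prod_list (map (\<lambda>p. E p (Suc M)) [1..<Suc N])"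
    by (simp add: grid_def comp_def del: upt_Suc)
  then show ?case using grid_add_cols[of E N M 1, OF assms] Suc
    by (simp del: upt_Suc add: upt_Suc_append)
qed simp

lemma hword_Cons: "hword (i # w) = hgen i * hword w"
  using hword_append(2)[of "[i]" w] by simp

lemma hword_filter:
  "hword (map g (filter (\<lambda>x. x \<in> S) xs)) = prod_list (map (\<lambda>x. if x \<in> S then hgen (g x) else 1) xs)"
proof (induction xs)
  case (Cons x xs)
  show ?case
  proof (cases "x \<in> S")
    case True
    then have "map g (filter (\<lambda>x. x \<in> S) (x # xs)) = g x # map g (filter (\<lambda>x. x \<in> S) xs)" by simp
    then show ?thesis by (simp only: list.map, subst hword_Cons) (simp add: True Cons)
  qed (simp add: Cons)
qed (simp add: hword_Nil(2))

lemma hword_pipe_word: "hword (pipe_word N M P) = grid N M (\<lambda>p q. if (p, q) \<in> P then hgen (p + q - 1) else 1)"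
  unfolding pipe_word_boxes hword_filter grid_def
  by (rule arg_cong[where f = prod_list], rule map_cong) (auto split: prod.splits)

text \<open>The factor \<open>h\<close> enters at one end of two adjacent rows and leaves them at the other.\<close>

lemma exchange_lines:
  fixes e1 e2 f1 f2 h :: "nat \<Rightarrow> 'm::monoid_mult"
  assumes step: "\<And>q. 1 \<le> q \<Longrightarrow> q \<le> M \<Longrightarrow> e1 q * e2 q * h q = h (Suc q) * f1 q * f2 q"
    and comm: "\<And>q q'. q < q' \<Longrightarrow> e1 q * e2 q' = e2 q' * e1 q"
      "\<And>q q'. q < q' \<Longrightarrow> f1 q * f2 q' = f2 q' * f1 q"
  shows "prod_list (map e1 (rev [1..<Suc M])) * prod_list (map e2 (rev [1..<Suc M])) * h 1 =
    h (Suc M) * prod_list (map f1 (rev [1..<Suc M])) * prod_list (map f2 (rev [1..<Suc M]))"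
  using step
proof (induction M)
  case (Suc M)
  define a1 a2 b1 b2 where "a1 = prod_list (map e1 (rev [1..<Suc M]))"
    and "a2 = prod_list (map e2 (rev [1..<Suc M]))" and "b1 = prod_list (map f1 (rev [1..<Suc M]))"
    and "b2 = prod_list (map f2 (rev [1..<Suc M]))"
  have IH: "a1 * a2 * h 1 = h (Suc M) * b1 * b2" using Suc by (simp add: a1_def a2_def b1_def b2_def)
  have c1: "a1 * e2 (Suc M) = e2 (Suc M) * a1" unfolding a1_def
    by (rule commute_prod_list[symmetric]) (auto simp: comm)
  have c2: "b1 * f2 (Suc M) = f2 (Suc M) * b1" unfolding b1_def
    by (rule commute_prod_list[symmetric]) (auto simp: comm)
  have "e1 (Suc M) * a1 * (e2 (Suc M) * a2) * h 1 = e1 (Suc M) * e2 (Suc M) * (a1 * a2 * h 1)"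
    using c1 by (metis mult.assoc)
  also have "\<dots> = e1 (Suc M) * e2 (Suc M) * (h (Suc M) * b1 * b2)" by (simp only: IH)
  also have "\<dots> = e1 (Suc M) * e2 (Suc M) * h (Suc M) * b1 * b2" by (simp only: mult.assoc)
  also have "\<dots> = h (Suc (Suc M)) * f1 (Suc M) * f2 (Suc M) * b1 * b2" using Suc.prems[of "Suc M"] by simp
  also have "\<dots> = h (Suc (Suc M)) * (f1 (Suc M) * b1) * (f2 (Suc M) * b2)" using c2 by (metis mult.assoc)
  finally show ?case by (simp add: a1_def a2_def b1_def b2_def mult.assoc)
qed simp

text \<open>The version for two columns, which are read downwards: here the factor enters on the
  left of the product.\<close>

lemma exchange_lines':
  fixes e1 e2 f1 f2 h :: "nat \<Rightarrow> 'm::monoid_mult"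
  assumes step: "\<And>p. 1 \<le> p \<Longrightarrow> p \<le> N \<Longrightarrow> h p * e1 p * e2 p = f1 p * f2 p * h (Suc p)"
    and comm: "\<And>p p'. p < p' \<Longrightarrow> e1 p' * e2 p = e2 p * e1 p'"
      "\<And>p p'. p < p' \<Longrightarrow> f1 p' * f2 p = f2 p * f1 p'"
  shows "h 1 * prod_list (map e1 [1..<Suc N]) * prod_list (map e2 [1..<Suc N]) =
    prod_list (map f1 [1..<Suc N]) * prod_list (map f2 [1..<Suc N]) * h (Suc N)"
  using step
proof (induction N)
  case (Suc N)
  define a1 a2 b1 b2 where "a1 = prod_list (map e1 [1..<Suc N])"
    and "a2 = prod_list (map e2 [1..<Suc N])" and "b1 = prod_list (map f1 [1..<Suc N])"
    and "b2 = prod_list (map f2 [1..<Suc N])"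
  have IH: "h 1 * a1 * a2 = b1 * b2 * h (Suc N)" using Suc by (simp add: a1_def a2_def b1_def b2_def)
  have c1: "e1 (Suc N) * a2 = a2 * e1 (Suc N)" unfolding a2_def
    by (rule commute_prod_list) (auto simp: comm)
  have c2: "f1 (Suc N) * b2 = b2 * f1 (Suc N)" unfolding b2_def
    by (rule commute_prod_list) (auto simp: comm)
  have "h 1 * (a1 * e1 (Suc N)) * (a2 * e2 (Suc N)) = (h 1 * a1 * a2) * (e1 (Suc N) * e2 (Suc N))"
    using c1 by (metis mult.assoc)
  also have "\<dots> = b1 * b2 * h (Suc N) * (e1 (Suc N) * e2 (Suc N))" by (simp only: IH)
  also have "\<dots> = b1 * b2 * (h (Suc N) * e1 (Suc N) * e2 (Suc N))" by (simp only: mult.assoc)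
  also have "\<dots> = b1 * b2 * (f1 (Suc N) * f2 (Suc N) * h (Suc (Suc N)))" using Suc.prems[of "Suc N"] by simp
  also have "\<dots> = b1 * f1 (Suc N) * (b2 * f2 (Suc N)) * h (Suc (Suc N))" using c2 by (metis mult.assoc)
  finally show ?case by (simp add: a1_def a2_def b1_def b2_def mult.assoc)
qed simp

section \<open>Sums over pipe dreams\<close>

text \<open>Expanding the product selects the empty term or the cross term of each factor; the
  subset \<open>S\<close> records where the cross was chosen.\<close>

lemma prod_list_hbox:
  assumes "distinct xs"
  shows "prod_list (map (\<lambda>x. hbox (\<alpha> x) (\<beta> x) (g x)) xs) =
    (\<Sum>S\<in>Pow (set xs). Poly_Mapping.single (hword (map g (filter (\<lambda>x. x \<in> S) xs)))
      (\<Prod>x\<in>set xs. if x \<in> S then \<beta> x else \<alpha> x))"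
  using assms
proof (induction xs)
  case Nil
  then show ?case by (simp add: hword_Nil(1))
next
  case (Cons y ys)
  let ?w = "\<lambda>xs S. hword (map g (filter (\<lambda>x. x \<in> S) xs))"
  let ?c = "\<lambda>xs S. \<Prod>x\<in>set xs. if x \<in> S then \<beta> x else \<alpha> x"
  have y: "y \<notin> set ys" using Cons.prems by simp
  have "(\<Sum>S\<in>Pow (set (y # ys)). Poly_Mapping.single (?w (y # ys) S) (?c (y # ys) S)) =
      (\<Sum>S\<in>Pow (set ys). Poly_Mapping.single (?w (y # ys) S) (?c (y # ys) S)) +
      (\<Sum>S\<in>insert y ` Pow (set ys). Poly_Mapping.single (?w (y # ys) S) (?c (y # ys) S))"
    unfolding list.set(2) Pow_insert by (rule sum.union_disjoint) (use y in auto)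
  also have "(\<Sum>S\<in>insert y ` Pow (set ys). Poly_Mapping.single (?w (y # ys) S) (?c (y # ys) S)) =
      (\<Sum>S\<in>Pow (set ys). Poly_Mapping.single (?w (y # ys) (insert y S)) (?c (y # ys) (insert y S)))"
    by (rule sum.reindex_cong[of "insert y"]) (use y in \<open>auto simp: inj_on_def\<close>)
  also have "(\<Sum>S\<in>Pow (set ys). Poly_Mapping.single (?w (y # ys) (insert y S)) (?c (y # ys) (insert y S))) =
      (\<Sum>S\<in>Pow (set ys). Poly_Mapping.single (hgen (g y)) (\<beta> y) * Poly_Mapping.single (?w ys S) (?c ys S))"
  proof (rule sum.cong[OF refl])
    fix S assume "S \<in> Pow (set ys)"
    have "filter (\<lambda>x. x \<in> insert y S) ys = filter (\<lambda>x. x \<in> S) ys"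
      using y by (intro filter_cong) auto
    moreover have "?c ys (insert y S) = ?c ys S" using y by (intro prod.cong) auto
    ultimately show "Poly_Mapping.single (?w (y # ys) (insert y S)) (?c (y # ys) (insert y S)) =
        Poly_Mapping.single (hgen (g y)) (\<beta> y) * Poly_Mapping.single (?w ys S) (?c ys S)"
      using y by (simp add: mult_single hword_append(1)[symmetric])
  qed
  also have "(\<Sum>S\<in>Pow (set ys). Poly_Mapping.single (?w (y # ys) S) (?c (y # ys) S)) =
      (\<Sum>S\<in>Pow (set ys). Poly_Mapping.single 0 (\<alpha> y) * Poly_Mapping.single (?w ys S) (?c ys S))"
  proof (rule sum.cong[OF refl])
    fix S assume "S \<in> Pow (set ys)"
    then have "y \<notin> S" using y by auto
    then show "Poly_Mapping.single (?w (y # ys) S) (?c (y # ys) S) =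
        Poly_Mapping.single 0 (\<alpha> y) * Poly_Mapping.single (?w ys S) (?c ys S)"
      using y by (simp add: mult_single)
  qed
  finally show ?case
    using Cons by (simp add: hbox_def distrib_right sum_distrib_left sum.distrib del: Pow_insert)
qed

definition pd_sum :: "nat \<Rightarrow> nat \<Rightarrow> (nat \<times> nat \<Rightarrow> 'a) \<Rightarrow> (nat \<times> nat \<Rightarrow> 'a) \<Rightarrow> (nat \<Rightarrow> nat) \<Rightarrow> 'a::comm_ring_1" where
  "pd_sum N M \<alpha> \<beta> v = (\<Sum>P | P \<subseteq> {1..N} \<times> {1..M} \<and> pipe_demazure N M P = v.
     \<Prod>x\<in>{1..N} \<times> {1..M}. if x \<in> P then \<beta> x else \<alpha> x)"

lemma lookup_grid:
  assumes "demazure_perm v"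
  shows "Poly_Mapping.lookup (grid N M (\<lambda>p q. hbox (\<alpha> (p, q)) (\<beta> (p, q)) (p + q - 1))) (helem v) =
    pd_sum N M \<alpha> \<beta> v"
proof -
  have "grid N M (\<lambda>p q. hbox (\<alpha> (p, q)) (\<beta> (p, q)) (p + q - 1)) =
      prod_list (map (\<lambda>x. hbox (\<alpha> x) (\<beta> x) ((\<lambda>(p, q). p + q - 1) x)) (boxes N M))"
    unfolding grid_def by (rule arg_cong[where f = prod_list], rule map_cong) auto
  also have "\<dots> = (\<Sum>S\<in>Pow ({1..N} \<times> {1..M}). Poly_Mapping.single (hword (pipe_word N M S))
      (\<Prod>x\<in>{1..N} \<times> {1..M}. if x \<in> S then \<beta> x else \<alpha> x))"
    unfolding prod_list_hbox[OF distinct_boxes] set_boxes pipe_word_boxes ..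
  finally have "Poly_Mapping.lookup (grid N M (\<lambda>p q. hbox (\<alpha> (p, q)) (\<beta> (p, q)) (p + q - 1))) (helem v) =
      (\<Sum>S\<in>Pow ({1..N} \<times> {1..M}). if pipe_demazure N M S = v
        then \<Prod>x\<in>{1..N} \<times> {1..M}. if x \<in> S then \<beta> x else \<alpha> x else 0)"
    using assms
    by (simp add: lookup_sum lookup_single when_def eq_helem_iff pipe_demazure_def cong: if_cong)
  also have "\<dots> = pd_sum N M \<alpha> \<beta> v"
    unfolding pd_sum_def by (subst sum.inter_filter[symmetric]) (auto intro!: sum.cong)
  finally show ?thesis .
qed

section \<open>Coefficients after multiplication by one more factor\<close>

text \<open>The monoid is not cancellative, so several l may solve k = l + g and a sum remains; for
  a generator, \<open>lookup_hh_descent\<close> finds two of them.\<close>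

lemma lookup_times_single:
  "Poly_Mapping.lookup (F * Poly_Mapping.single g c) k =
    (\<Sum>l. Poly_Mapping.lookup F l * (c when k = l + g))"
proof -
  have "(\<Sum>q. Poly_Mapping.lookup (Poly_Mapping.single g c) q when k = l + q) = (c when k = l + g)" for l
  proof -
    have "(\<Sum>q. Poly_Mapping.lookup (Poly_Mapping.single g c) q when k = l + q) =
        (\<Sum>q. (c when k = l + q) when q = g)"
      by (rule Sum_any.cong) (auto simp: lookup_single when_def)
    then show ?thesis by simp
  qed
  then show ?thesis by (simp add: lookup_mult)
qed

lemma lookup_not_sum:
  assumes "\<And>a b. k \<noteq> a + g + b"
  shows "Poly_Mapping.lookup (F * Poly_Mapping.single g c * G) k = 0"
proof -
  have "Poly_Mapping.keys (F * Poly_Mapping.single g c * G) \<subseteq> {a + g + b | a b. True}"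
    using keys_mult[of "F * Poly_Mapping.single g c" G] keys_mult[of F "Poly_Mapping.single g c"]
    by (fastforce split: if_splits)
  then have "k \<notin> Poly_Mapping.keys (F * Poly_Mapping.single g c * G)" using assms by blast
  then show ?thesis by (simp add: in_keys_iff)
qed

text \<open>By \<open>demazure_letter_range\<close> no word with a letter out of range has the
  product \<open>v\<close>. This is how a travelling factor disappears at the far end of the
  grid.\<close>

lemma lookup_hh_cut:
  assumes "v permutes {m..d}" "\<not> (m \<le> i \<and> i < d)"
  shows "Poly_Mapping.lookup (F * hh i c * G) (helem v) = Poly_Mapping.lookup (F * G) (helem v)"
proof -
  have "helem v \<noteq> a + hgen i + b" for a b
  proof
    assume *: "helem v = a + hgen i + b"
    obtain s t where "a = hword s" "b = hword t" by (metis hword_cases)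
    with * have "helem v = hword (s @ [i] @ t)" by (simp add: hword_append(1)[symmetric])
    then have "v = word_demazure (s @ [i] @ t)"
      using hperm_helem demazure_perm_permutes[OF assms(1)] by (metis hperm_hword)
    then show False using demazure_letter_range[of "s @ [i] @ t" m d i] assms by auto
  qed
  then have "Poly_Mapping.lookup (F * Poly_Mapping.single (hgen i) (c - 1) * G) (helem v) = 0"
    by (rule lookup_not_sum)
  then show ?thesis by (simp add: hbox_def distrib_left distrib_right lookup_add single_one)
qed

text \<open>Every word that ends in i has a descent at i, so the generator term contributes nothing
  at an ascent of \<open>v\<close>.\<close>

lemma lookup_hh_right:
  assumes "demazure_perm v" "v i < v (Suc i)"
  shows "Poly_Mapping.lookup (F * hh i c) (helem v) = Poly_Mapping.lookup F (helem v)"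
proof -
  have "(\<Sum>l. Poly_Mapping.lookup F l * (c' when helem v = l + hgen i)) = 0" for c'
  proof -
    have "helem v \<noteq> l + hgen i" for l
    proof
      assume *: "helem v = l + hgen i"
      obtain s where "l = hword s" by (metis hword_cases)
      with * have "v = word_demazure (s @ [i])"
        using hperm_helem[OF assms(1)] by (simp add: hword_append(1)[symmetric])
      then show False using demazure_snoc_descent[of s i] assms by auto
    qed
    then show ?thesis by simp
  qed
  then show ?thesis
    by (simp add: hbox_def distrib_left lookup_add single_one lookup_times_single)
qed

lemma lookup_hh_left:
  assumes "demazure_perm v" "inv v i < inv v (Suc i)"
  shows "Poly_Mapping.lookup (hh i c * F) (helem v) = Poly_Mapping.lookup F (helem v)"
proof -
  have "helem v \<notin> Poly_Mapping.keys (Poly_Mapping.single (hgen i) (c - 1) * F)"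
  proof
    assume "helem v \<in> Poly_Mapping.keys (Poly_Mapping.single (hgen i) (c - 1) * F)"
    then obtain l where *: "helem v = hgen i + l"
      using keys_mult[of "Poly_Mapping.single (hgen i) (c - 1)" F] by (auto split: if_splits)
    obtain s where "l = hword s" by (metis hword_cases)
    with * have "v = word_demazure (i # s)"
      using hperm_helem[OF assms(1)] by (simp add: hword_append(1)[symmetric])
    then show False using demazure_Cons_left_descent[of i s] assms by auto
  qed
  then show ?thesis
    by (simp add: hbox_def distrib_right lookup_add single_one in_keys_iff)
qed

text \<open>The left factors of \<open>v\<close> with respect to \<open>hgen i\<close> are
  \<open>v\<close> itself, by absorption, and \<open>v \<circ> adj i\<close>.\<close>

lemma lookup_hh_descent:
  assumes v: "demazure_perm v" "v (Suc i) < v i"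
  shows "Poly_Mapping.lookup (F * hh i c) (helem v) = Poly_Mapping.lookup F (helem v) +
    (c - 1) * (Poly_Mapping.lookup F (helem v) + Poly_Mapping.lookup F (helem (v \<circ> adj i)))"
proof -
  have pv: "permutation v" using v unfolding demazure_perm_def by auto
  obtain N where "v permutes {..<N}" using permutation_permutes_lessThan[OF pv] .
  then have "v \<circ> adj i permutes {0..max N (Suc i)}"
    by (intro permutes_compose adj_permutes) (auto elim!: permutes_subset)
  then have v': "demazure_perm (v \<circ> adj i)" by (rule demazure_perm_permutes)
  have iff: "helem v = l + hgen i \<longleftrightarrow> l = helem v \<or> l = helem (v \<circ> adj i)" for l
  proof -
    obtain s where l: "l = hword s" by (metis hword_cases)
    have "helem v = l + hgen i \<longleftrightarrow> rop (word_demazure s) i = v"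
      using eq_helem_iff[OF v(1), of "l + hgen i"]
      by (auto simp: l hword_append(1)[symmetric] demazure_snoc)
    also have "\<dots> \<longleftrightarrow> word_demazure s = v \<or> word_demazure s = v \<circ> adj i"
    proof
      assume "rop (word_demazure s) i = v"
      then show "word_demazure s = v \<or> word_demazure s = v \<circ> adj i"
        by (auto simp: rop_def split: if_splits)
    next
      assume "word_demazure s = v \<or> word_demazure s = v \<circ> adj i"
      then show "rop (word_demazure s) i = v" using v(2) by (auto simp: rop_def)
    qed
    finally show ?thesis by (simp add: eq_helem_iff[OF v(1)] eq_helem_iff[OF v'] l)
  qed
  have ne: "helem v \<noteq> helem (v \<circ> adj i)"
  proof
    assume "helem v = helem (v \<circ> adj i)"
    then have "v = v \<circ> adj i" using hperm_helem v' v(1) by metis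
    then have "v i = v (Suc i)" by (metis adj_simps(1) comp_apply)
    then show False using v(2) by simp
  qed
  have "(\<Sum>l. Poly_Mapping.lookup F l * (c' when helem v = l + hgen i)) =
      (\<Sum>l\<in>{helem v, helem (v \<circ> adj i)}. Poly_Mapping.lookup F l * (c' when helem v = l + hgen i))" for c'
    by (rule Sum_any.expand_superset) (auto simp: iff when_def)
  then show ?thesis
    using ne by (simp add: hbox_def distrib_left lookup_add single_one lookup_times_single iff algebra_simps)
qed

text \<open>In the boxes of \<open>U\<close> a cross is compulsory.\<close>

definition zbox :: "(nat \<times> nat) set \<Rightarrow> (nat \<Rightarrow> 'a) \<Rightarrow> (nat \<Rightarrow> 'a) \<Rightarrow> nat \<Rightarrow> nat \<Rightarrow> 'a::comm_ring_1 hecke_ring" where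
  "zbox U a b p q = (if (p, q) \<in> U then hbox 0 1 (p + q - 1) else hh (p + q - 1) (a p * b q))"

definition kp :: "(nat \<times> nat) set \<Rightarrow> (nat \<Rightarrow> 'a) \<Rightarrow> (nat \<Rightarrow> 'a) \<Rightarrow> nat \<Rightarrow> (nat \<Rightarrow> nat) \<Rightarrow> 'a::comm_ring_1" where
  "kp U a b d v = pd_sum d d (\<lambda>x. if x \<in> U then 0 else 1)
     (\<lambda>x. if x \<in> U then 1 else a (fst x) * b (snd x) - 1) v"

lemma kp_lookup:
  assumes "demazure_perm v"
  shows "kp U a b d v = Poly_Mapping.lookup (grid d d (zbox U a b)) (helem v)"
proof -
  have "zbox U a b = (\<lambda>p q. hbox (if (p, q) \<in> U then 0 else 1)
      (if (p, q) \<in> U then 1 else a p * b q - 1) (p + q - 1))"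
    by (auto simp: zbox_def fun_eq_iff)
  then show ?thesis
    using lookup_grid[OF assms, of d d "\<lambda>x. if x \<in> U then 0 else 1"
        "\<lambda>x. if x \<in> U then 1 else a (fst x) * b (snd x) - 1"]
    by (simp add: kp_def cong: if_cong)
qed

lemma zbox_hbox: obtains \<alpha> \<beta> where "zbox U a b p q = hbox \<alpha> \<beta> (p + q - 1)"
  by (cases "(p, q) \<in> U") (auto simp: zbox_def)

lemma zbox_commute:
  assumes "p + q + 1 < p' + q'" "1 \<le> p + q"
  shows "zbox U a b p q * zbox U' a' b' p' q' = zbox U' a' b' p' q' * zbox U a b p q"
proof -
  obtain \<alpha> \<beta> where 1: "zbox U a b p q = hbox \<alpha> \<beta> (p + q - 1)" by (rule zbox_hbox)
  obtain \<gamma> \<delta> where 2: "zbox U' a' b' p' q' = hbox \<gamma> \<delta> (p' + q' - 1)" by (rule zbox_hbox)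
  show ?thesis unfolding 1 2 by (rule hbox_commute) (use assms in auto)
qed

lemma zbox_hh_commute:
  assumes "i + 2 < p + q"
  shows "zbox U a b p q * hh i c = hh i c * zbox U a b p q"
proof -
  obtain \<alpha> \<beta> where 1: "zbox U a b p q = hbox \<alpha> \<beta> (p + q - 1)" by (rule zbox_hbox)
  show ?thesis unfolding 1 by (rule hbox_commute[symmetric]) (use assms in auto)
qed

text \<open>The factor behind the grid commutes with the rows below i + 1 and then runs through rows
  i and i + 1, where it exchanges their letters. In each column either both boxes are compulsory
  (\<open>cross_swap\<close>) or both carry parameters (\<open>yang_baxter\<close>). Its letter
  grows to i + d, and there it is cut off.\<close>

lemma grid_row_exchange:
  assumes v: "v permutes {1..d}" and i: "1 \<le> i" "i < d"
    and U: "\<And>q. (i, q) \<in> U \<longleftrightarrow> (Suc i, q) \<in> U" and c: "a i * c = a (Suc i)"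
  shows "Poly_Mapping.lookup (grid d d (zbox U a b) * hh i c) (helem v) = kp U (a \<circ> adj i) b d v"
proof -
  define k where "k = d - Suc i"
  have d: "d = (i - 1) + 1 + 1 + k" using i by (simp add: k_def)
  let ?a = "a \<circ> adj i"
  define row where "row = (\<lambda>a p. prod_list (map (zbox U a b p) (rev [1..<Suc d])))"
  define R where "R = grid k d (\<lambda>p q. zbox U a b (Suc i + p) q)"
  have dec: "grid d d (zbox U a b) =
      grid (i - 1) d (zbox U a b) * row a i * row a (Suc i) * grid k d (\<lambda>p q. zbox U a b (Suc i + p) q)" for a
  proof -
    have "grid d d (zbox U a b) = grid ((i - 1) + 1 + 1 + k) d (zbox U a b)" using d by simp
    also have "\<dots> = grid (Suc (Suc (i - 1))) d (zbox U a b) * grid k d (\<lambda>p q. zbox U a b (Suc i + p) q)"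
      using i grid_add_rows[of "Suc i" k d "zbox U a b"] by simp
    also have "grid (Suc (Suc (i - 1))) d (zbox U a b) = grid (i - 1) d (zbox U a b) * row a i * row a (Suc i)"
      using i by (simp only: grid_Suc row_def) simp
    finally show ?thesis .
  qed
  have top: "grid (i - 1) d (zbox U ?a b) = grid (i - 1) d (zbox U a b)"
    by (rule grid_cong) (auto simp: zbox_def adj_other)
  have bot: "grid k d (\<lambda>p q. zbox U ?a b (Suc i + p) q) = R"
    unfolding R_def by (rule grid_cong) (auto simp: zbox_def adj_other)
  have RH: "R * hh i c = hh i c * R"
    unfolding R_def grid_def
    by (rule commute_prod_list[symmetric]) (auto simp: set_boxes intro!: zbox_hh_commute[symmetric])
  have ex: "row a i * row a (Suc i) * hh (i + 1 - 1) c = hh (i + Suc d - 1) c * row ?a i * row ?a (Suc i)"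
    unfolding row_def
  proof (rule exchange_lines)
    fix q assume q: "1 \<le> q" "q \<le> d"
    obtain m where Suc: "i + q = Suc m" using i by (metis Suc_le_D add_Suc One_nat_def)
    show "zbox U a b i q * zbox U a b (Suc i) q * hh (i + q - 1) c =
        hh (i + Suc q - 1) c * zbox U ?a b i q * zbox U ?a b (Suc i) q"
    proof (cases "(i, q) \<in> U")
      case True
      then show ?thesis using U cross_swap(1)[where i = m and c = c and \<beta> = 1 and \<gamma> = 1] by (simp add: zbox_def Suc)
    next
      case False
      have "a i * b q * c = a (Suc i) * b q" using c by (metis mult.assoc mult.commute)
      then show ?thesis using False U yang_baxter[where i = m and s = "a i * b q" and t = c]
        by (simp add: zbox_def Suc)
    qed
  qed (use i in \<open>auto intro!: zbox_commute\<close>)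
  have "grid d d (zbox U a b) * hh i c =
      grid (i - 1) d (zbox U a b) * (row a i * row a (Suc i) * hh i c) * R"
    by (simp only: dec[of a] R_def[symmetric] mult.assoc RH)
  also have "\<dots> = grid (i - 1) d (zbox U a b) * hh (i + d) c * (row ?a i * row ?a (Suc i) * R)"
    using ex i by (simp add: mult.assoc)
  finally have "Poly_Mapping.lookup (grid d d (zbox U a b) * hh i c) (helem v) =
      Poly_Mapping.lookup (grid (i - 1) d (zbox U a b) * (row ?a i * row ?a (Suc i) * R)) (helem v)"
    using lookup_hh_cut[OF v, of "i + d"] by simp
  then show ?thesis
    unfolding kp_lookup[OF demazure_perm_permutes[OF v]] dec[of ?a] top bot by (simp only: mult.assoc)
qed

text \<open>The travelling parameter is the ratio of the two letters, which exists because
  \<open>a i\<close> is a unit.\<close>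

lemma kp_row_symmetric:
  assumes "v permutes {1..d}" "1 \<le> i" "i < d" "\<And>q. (i, q) \<in> U \<longleftrightarrow> (Suc i, q) \<in> U"
    and "a i dvd 1" "v i < v (Suc i)"
  shows "kp U (a \<circ> adj i) b d v = kp U a b d v"
proof -
  obtain c where "a i * c = a (Suc i)" using assms(5) by (metis dvdE dvd_trans one_dvd)
  then show ?thesis
    using grid_row_exchange[where v = v and d = d and i = i and U = U and a = a and b = b and c = c]
      lookup_hh_right[of v i "grid d d (zbox U a b)" c] assms
    by (simp add: kp_lookup demazure_perm_permutes)
qed

text \<open>At a descent the same exchange is the Demazure recursion: solved for the term of
  \<open>v \<circ> adj i\<close> it becomes a divided difference.\<close>

lemma kp_descent:
  assumes "v permutes {1..d}" "1 \<le> i" "i < d" "\<And>q. (i, q) \<in> U \<longleftrightarrow> (Suc i, q) \<in> U"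
    and "a i * c = a (Suc i)" "v (Suc i) < v i"
  shows "kp U (a \<circ> adj i) b d v = kp U a b d v + (c - 1) * (kp U a b d v + kp U a b d (v \<circ> adj i))"
proof -
  have "v \<circ> adj i permutes {1..d}" using assms by (intro permutes_compose adj_permutes) auto
  then show ?thesis
    using grid_row_exchange[where v = v and d = d and i = i and U = U and a = a and b = b and c = c]
      lookup_hh_descent[of v i "grid d d (zbox U a b)" c] assms
    by (simp add: kp_lookup demazure_perm_permutes)
qed

text \<open>The mirror image of the row exchange: the grid is read by columns from the right, the
  factor starts in front of it, and left descents take the place of right ones.\<close>

lemma grid_col_exchange:
  assumes v: "v permutes {1..d}" and i: "1 \<le> i" "i < d"
    and U: "\<And>p. (p, i) \<in> U \<longleftrightarrow> (p, Suc i) \<in> U" and c: "b i * c = b (Suc i)"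
  shows "Poly_Mapping.lookup (hh i c * grid d d (zbox U a b)) (helem v) = kp U a (b \<circ> adj i) d v"
proof -
  define k where "k = d - Suc i"
  have d: "Suc d = Suc (Suc i + k)" using i by (simp add: k_def)
  let ?b = "b \<circ> adj i"
  define col where "col = (\<lambda>b q. prod_list (map (\<lambda>p. zbox U a b p q) [1..<Suc d]))"
  define R where "R = (\<lambda>b. prod_list (map (\<lambda>q. col b (Suc i + q)) (rev [1..<Suc k])))"
  define L where "L = (\<lambda>b. prod_list (map (col b) (rev [1..<i])))"
  have dec: "grid d d (zbox U a b) = R b * (col b (Suc i) * col b i) * L b" for b
  proof -
    have "grid d d (zbox U a b) = prod_list (map (col b) (rev [1..<Suc d]))"
      unfolding col_def by (rule grid_columns) (auto intro!: zbox_commute)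
    also have "[1..<Suc d] = [1..<i] @ [i, Suc i] @ map ((+) (Suc i)) [1..<Suc k]"
      unfolding d upt_shift using i by (simp add: upt_Suc_append)
    finally show ?thesis by (simp add: R_def L_def rev_map comp_def mult.assoc del: upt_Suc)
  qed
  have L: "L ?b = L b"
    unfolding L_def col_def by (rule arg_cong[where f = prod_list] map_cong refl)+ (auto simp: zbox_def adj_other)
  have R: "R ?b = R b"
    unfolding R_def col_def by (rule arg_cong[where f = prod_list] map_cong refl)+ (auto simp: zbox_def adj_other)
  have RH: "hh i c * R b = R b * hh i c"
    unfolding R_def col_def
    by (rule commute_prod_list, clarsimp simp del: upt_Suc, rule commute_prod_list, clarsimp simp del: upt_Suc)
      (rule zbox_hh_commute[symmetric], auto)
  have ex: "hh (i + 1 - 1) c * col b (Suc i) * col b i = col ?b (Suc i) * col ?b i * hh (i + Suc d - 1) c"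
    unfolding col_def
  proof (rule exchange_lines')
    fix p assume p: "1 \<le> p" "p \<le> d"
    obtain m where Suc: "p + i = Suc m" "i + p = Suc m" using i by (metis Suc_le_D add_Suc One_nat_def add.commute)
    show "hh (i + p - 1) c * zbox U a b p (Suc i) * zbox U a b p i =
        zbox U a ?b p (Suc i) * zbox U a ?b p i * hh (i + Suc p - 1) c"
    proof (cases "(p, i) \<in> U")
      case True
      then show ?thesis using U[of p] cross_swap(2)[where i = m and c = c and \<beta> = 1 and \<gamma> = 1] by (simp add: zbox_def Suc)
    next
      case False
      have "c * (a p * b i) = a p * b (Suc i)" using c by (metis mult.left_commute mult.commute)
      then show ?thesis using False U[of p] yang_baxter[where i = m and s = c and t = "a p * b i"]
        by (simp add: zbox_def Suc)
    qed
  qed (use i in \<open>auto intro!: zbox_commute[symmetric]\<close>)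
  have "hh i c * grid d d (zbox U a b) = R b * (hh i c * col b (Suc i) * col b i) * L b"
    using RH by (simp only: dec mult.assoc[symmetric])
  also have "\<dots> = R b * (col ?b (Suc i) * col ?b i) * hh (i + d) c * L b"
    using ex i by (simp add: mult.assoc del: upt_Suc)
  finally have "Poly_Mapping.lookup (hh i c * grid d d (zbox U a b)) (helem v) =
      Poly_Mapping.lookup (R b * (col ?b (Suc i) * col ?b i) * L b) (helem v)"
    using lookup_hh_cut[OF v, of "i + d"] by simp
  then show ?thesis
    unfolding kp_lookup[OF demazure_perm_permutes[OF v]] dec[of ?b] L R by (simp only: mult.assoc)
qed

lemma kp_col_symmetric:
  assumes "v permutes {1..d}" "1 \<le> i" "i < d" "\<And>p. (p, i) \<in> U \<longleftrightarrow> (p, Suc i) \<in> U"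
    and "b i dvd 1" "inv v i < inv v (Suc i)"
  shows "kp U a (b \<circ> adj i) d v = kp U a b d v"
proof -
  obtain c where "b i * c = b (Suc i)" using assms(5) by (metis dvdE dvd_trans one_dvd)
  then show ?thesis
    using grid_col_exchange[where v = v and d = d and i = i and U = U and a = a and b = b and c = c]
      lookup_hh_left[of v i c "grid d d (zbox U a b)"] assms
    by (simp add: kp_lookup demazure_perm_permutes)
qed

section \<open>Substitution in Laurent polynomials\<close>

lemma poly_mapping_sum_single:
  "f = (\<Sum>t\<in>Poly_Mapping.keys f. Poly_Mapping.single t (Poly_Mapping.lookup f t))"
proof (rule poly_mapping_eqI)
  fix k
  have "(\<Sum>t\<in>Poly_Mapping.keys f. Poly_Mapping.lookup f t when t = k) =
      (\<Sum>t\<in>Poly_Mapping.keys f. if k = t then Poly_Mapping.lookup f t else 0)"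
    by (rule sum.cong) (auto simp: when_def)
  also have "\<dots> = Poly_Mapping.lookup f k"
    by (simp add: in_keys_iff)
  finally show "Poly_Mapping.lookup f k =
      Poly_Mapping.lookup (\<Sum>t\<in>Poly_Mapping.keys f. Poly_Mapping.single t (Poly_Mapping.lookup f t)) k"
    by (simp add: lookup_sum lookup_single)
qed

lemma subst_monom_superset:
  assumes "finite S" "Poly_Mapping.keys t \<subseteq> S"
  shows "subst_monom \<sigma> t =
    (\<Sum>v\<in>S. case \<sigma> v of None \<Rightarrow> 0 | Some w \<Rightarrow> Poly_Mapping.single w (Poly_Mapping.lookup t v))"
  unfolding subst_monom_def
  by (rule sum.mono_neutral_left) (use assms in \<open>auto simp: in_keys_iff split: option.splits\<close>)

lemma subst_monom_add: "subst_monom \<sigma> (s + t) = subst_monom \<sigma> s + subst_monom \<sigma> t"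
proof -
  let ?S = "Poly_Mapping.keys s \<union> Poly_Mapping.keys t"
  show ?thesis
    using keys_add[of s t]
    by (subst (1 2 3) subst_monom_superset[of ?S])
      (auto simp: sum.distrib[symmetric] lookup_add single_add intro!: sum.cong split: option.splits)
qed

lemma subst_laurent_superset:
  assumes "finite S" "Poly_Mapping.keys f \<subseteq> S"
  shows "subst_laurent \<sigma> f = (\<Sum>t\<in>S. Poly_Mapping.single (subst_monom \<sigma> t) (Poly_Mapping.lookup f t))"
  unfolding subst_laurent_def
  by (rule sum.mono_neutral_left) (use assms in \<open>auto simp: in_keys_iff\<close>)

lemma subst_laurent_add: "subst_laurent \<sigma> (f + g) = subst_laurent \<sigma> f + subst_laurent \<sigma> g"
proof -
  let ?S = "Poly_Mapping.keys f \<union> Poly_Mapping.keys g"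
  show ?thesis
    using keys_add[of f g]
    by (subst (1 2 3) subst_laurent_superset[of ?S])
      (auto simp: sum.distrib[symmetric] lookup_add single_add intro!: sum.cong)
qed

lemma subst_laurent_0 [simp]: "subst_laurent \<sigma> 0 = 0"
  by (simp add: subst_laurent_def)

lemma subst_laurent_sum: "subst_laurent \<sigma> (sum h A) = (\<Sum>x\<in>A. subst_laurent \<sigma> (h x))"
  by (induction A rule: infinite_finite_induct) (auto simp: subst_laurent_add)

lemma subst_laurent_uminus: "subst_laurent \<sigma> (- f) = - subst_laurent \<sigma> f"
  using subst_laurent_add[of \<sigma> f "- f"] by (simp add: eq_neg_iff_add_eq_0 add.commute)

lemma subst_laurent_diff: "subst_laurent \<sigma> (f - g) = subst_laurent \<sigma> f - subst_laurent \<sigma> g"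
  using subst_laurent_add[of \<sigma> f "- g"] by (simp add: subst_laurent_uminus)

lemma subst_laurent_single:
  "subst_laurent \<sigma> (Poly_Mapping.single t c) = Poly_Mapping.single (subst_monom \<sigma> t) c"
  by (subst subst_laurent_superset[of "{t}"]) (auto split: if_splits)

lemma subst_laurent_mult: "subst_laurent \<sigma> (f * g) = subst_laurent \<sigma> f * subst_laurent \<sigma> g"
proof -
  have "f * g = (\<Sum>s\<in>Poly_Mapping.keys f. \<Sum>t\<in>Poly_Mapping.keys g.
      Poly_Mapping.single s (Poly_Mapping.lookup f s) * Poly_Mapping.single t (Poly_Mapping.lookup g t))"
    by (subst poly_mapping_sum_single[of f], subst poly_mapping_sum_single[of g], simp only: sum_product)
  then show ?thesis
    by (simp add: mult_single subst_laurent_sum subst_laurent_single subst_monom_add)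
      (simp add: subst_laurent_def sum_product mult_single)
qed

lemma subst_laurent_1 [simp]: "subst_laurent \<sigma> 1 = 1"
  unfolding single_one[symmetric] subst_laurent_single by (simp add: subst_monom_def)

lemma subst_laurent_prod: "subst_laurent \<sigma> (prod h A) = (\<Prod>x\<in>A. subst_laurent \<sigma> (h x))"
  by (induction A rule: infinite_finite_induct) (auto simp: subst_laurent_mult)

lemma subst_laurent_power: "subst_laurent \<sigma> (f ^ k) = subst_laurent \<sigma> f ^ k"
  by (induction k) (auto simp: subst_laurent_mult)

text \<open>The value of a letter after a substitution, where \<open>None\<close> stands for a
  letter that was set to 1.\<close>

definition lval :: "'w option \<Rightarrow> 'w laurent" where
  "lval x = (case x of None \<Rightarrow> 1 | Some w \<Rightarrow> letter w)"

definition ilval :: "'w option \<Rightarrow> 'w laurent" where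
  "ilval x = (case x of None \<Rightarrow> 1 | Some w \<Rightarrow> inv_letter w)"

lemma subst_monom_single:
  "subst_monom \<sigma> (Poly_Mapping.single v c) = (case \<sigma> v of None \<Rightarrow> 0 | Some w \<Rightarrow> Poly_Mapping.single w c)"
  by (subst subst_monom_superset[of "{v}"]) (auto split: if_splits option.splits)

lemma subst_letter: "subst_laurent \<sigma> (letter v) = lval (\<sigma> v)"
  "subst_laurent \<sigma> (inv_letter v) = ilval (\<sigma> v)"
  by (auto simp: letter_def inv_letter_def lval_def ilval_def subst_laurent_single subst_monom_single
      single_one split: option.splits)

lemma letter_inv_letter: "letter v * inv_letter v = 1"
  by (simp add: letter_def inv_letter_def mult_single single_add[symmetric] single_one)

lemma lval_dvd_1: "lval x dvd 1" "ilval x dvd 1"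
  by (auto simp: lval_def ilval_def dvd_def split: option.splits)
    (metis letter_inv_letter, metis letter_inv_letter mult.commute)

lemma letter_eq_iff: "letter v = letter w \<longleftrightarrow> v = w"
proof
  assume "letter v = letter w"
  then have "Poly_Mapping.keys (letter v) = Poly_Mapping.keys (letter w)" by simp
  then have "Poly_Mapping.single v (1::int) = Poly_Mapping.single w 1" by (simp add: letter_def)
  then have "Poly_Mapping.keys (Poly_Mapping.single v (1::int)) = Poly_Mapping.keys (Poly_Mapping.single w (1::int))" by simp
  then show "v = w" by simp
qed simp

lemma subst_pd_sum:
  "subst_laurent \<sigma> (pd_sum N M \<alpha> \<beta> v) = pd_sum N M (\<lambda>x. subst_laurent \<sigma> (\<alpha> x)) (\<lambda>x. subst_laurent \<sigma> (\<beta> x)) v"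
  unfolding pd_sum_def subst_laurent_sum subst_laurent_prod
  by (intro sum.cong prod.cong) auto

lemma pd_sum_cong:
  assumes "\<And>p q. 1 \<le> p \<Longrightarrow> p \<le> N \<Longrightarrow> 1 \<le> q \<Longrightarrow> q \<le> M \<Longrightarrow> \<alpha> (p, q) = \<alpha>' (p, q) \<and> \<beta> (p, q) = \<beta>' (p, q)"
  shows "pd_sum N M \<alpha> \<beta> v = pd_sum N M \<alpha>' \<beta>' v"
  unfolding pd_sum_def by (intro sum.cong prod.cong) (use assms in auto)

lemma subst_kp:
  "subst_laurent \<sigma> (kp U a b d v) = kp U (\<lambda>p. subst_laurent \<sigma> (a p)) (\<lambda>q. subst_laurent \<sigma> (b q)) d v"
  unfolding kp_def subst_pd_sum
  by (rule pd_sum_cong) (auto simp: subst_laurent_diff subst_laurent_mult)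

lemma kp_cong:
  "(\<And>p. 1 \<le> p \<Longrightarrow> p \<le> d \<Longrightarrow> a p = a' p) \<Longrightarrow> (\<And>q. 1 \<le> q \<Longrightarrow> q \<le> d \<Longrightarrow> b q = b' q) \<Longrightarrow>
    kp U a b d v = kp U a' b' d v"
  unfolding kp_def by (rule pd_sum_cong) auto

lemma pipe_word_restrict:
  assumes "P \<subseteq> {1..N'} \<times> {1..M'}" "N' \<le> N" "M' \<le> M"
  shows "pipe_word N M P = pipe_word N' M' P"
proof -
  have row: "filter (\<lambda>j. (i, j) \<in> P) (rev [1..<Suc M]) = filter (\<lambda>j. (i, j) \<in> P) (rev [1..<Suc M'])" for i
  proof -
    have "[1..<Suc M] = [1..<Suc M'] @ [Suc M'..<Suc M]"
      using assms(3) upt_add_eq_append[of 1 "Suc M'" "M - M'"] by simp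
    moreover have "filter (\<lambda>j. (i, j) \<in> P) (rev [Suc M'..<Suc M]) = []"
      using assms(1) by (auto simp: filter_empty_conv)
    ultimately show ?thesis by simp
  qed
  have "[1..<Suc N] = [1..<Suc N'] @ [Suc N'..<Suc N]"
    using assms(2) upt_add_eq_append[of 1 "Suc N'" "N - N'"] by simp
  moreover have "map (\<lambda>i. map (\<lambda>j. i + j - 1) (filter (\<lambda>j. (i, j) \<in> P) (rev [1..<Suc M']))) [Suc N'..<Suc N] =
      map (\<lambda>i. []) [Suc N'..<Suc N]"
    using assms(1) by (intro map_cong refl) (auto simp: filter_empty_conv)
  moreover have "concat (map (\<lambda>i. []) xs) = []" for xs :: "nat list" by simp
  ultimately show ?thesis unfolding pipe_word_def row by (simp del: upt_Suc)
qed

lemma pd_sum_restrict: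
  assumes "N' \<le> N" "M' \<le> M"
    and "\<And>P. P \<subseteq> {1..N} \<times> {1..M} \<Longrightarrow> pipe_demazure N M P = v \<Longrightarrow> P \<subseteq> {1..N'} \<times> {1..M'}"
    and "\<And>x. x \<notin> {1..N'} \<times> {1..M'} \<Longrightarrow> \<alpha> x = 1"
  shows "pd_sum N M \<alpha> \<beta> v = pd_sum N' M' \<alpha> \<beta> v"
proof -
  have sub: "{1..N'} \<times> {1..M'} \<subseteq> {1..N} \<times> {1..M}" using assms by auto
  have "pipe_demazure N M P = pipe_demazure N' M' P" if "P \<subseteq> {1..N'} \<times> {1..M'}" for P
    unfolding pipe_demazure_def using pipe_word_restrict[OF that assms(1,2)] by simp
  then have "{P. P \<subseteq> {1..N} \<times> {1..M} \<and> pipe_demazure N M P = v} =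
      {P. P \<subseteq> {1..N'} \<times> {1..M'} \<and> pipe_demazure N' M' P = v}"
    using assms(3) sub by (metis (lifting) order_trans)
  moreover have "(\<Prod>x\<in>{1..N} \<times> {1..M}. if x \<in> P then \<beta> x else \<alpha> x) =
      (\<Prod>x\<in>{1..N'} \<times> {1..M'}. if x \<in> P then \<beta> x else \<alpha> x)" if "P \<subseteq> {1..N'} \<times> {1..M'}" for P
    by (rule prod.mono_neutral_right) (use sub that assms(4) in auto)
  ultimately show ?thesis unfolding pd_sum_def by (intro sum.cong) auto
qed

lemma set_pipe_word: "set (pipe_word N M P) = {p + q - 1 | p q. (p, q) \<in> P \<and> p \<in> {1..N} \<and> q \<in> {1..M}}"
  by (auto simp: pipe_word_boxes set_boxes image_iff split: prod.splits) force

lemma pipe_demazure_letter: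
  assumes "pipe_demazure N M P permutes {m..d}" "(p, q) \<in> P" "P \<subseteq> {1..N} \<times> {1..M}"
  shows "m \<le> p + q - 1 \<and> p + q - 1 < d"
proof -
  have "p + q - 1 \<in> set (pipe_word N M P)"
    unfolding set_pipe_word using assms(2,3) by blast
  then show ?thesis using demazure_letter_range assms(1) unfolding pipe_demazure_def by blast
qed

text \<open>The letter p + q - 1 of a cross is below d, so no cross lies outside of the smaller
  grid. This gives the independence of the polynomial from k.\<close>

lemma kp_enlarge:
  assumes "v permutes {1..d}" "d \<le> D"
  shows "kp {} a b D v = kp {} a b d v"
  unfolding kp_def
proof (rule pd_sum_restrict)
  fix P assume P: "P \<subseteq> {1..D} \<times> {1..D}" "pipe_demazure D D P = v"
  show "P \<subseteq> {1..d} \<times> {1..d}"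
  proof
    fix x assume x: "x \<in> P"
    obtain p q where pq: "x = (p, q)" by (cases x)
    have "1 \<le> p" "1 \<le> q" using P x pq by auto
    moreover have "p + q - 1 < d" using pipe_demazure_letter[of D D P 1 d p q] P x pq assms by auto
    ultimately show "x \<in> {1..d} \<times> {1..d}" by (auto simp: pq)
  qed
qed (use assms in auto)

section \<open>Double Grothendieck polynomials as sums over pipe dreams\<close>

text \<open>Crosses weigh s - 1 in \<open>kp\<close> but 1 - s in the usual formula, whose terms
  have the sign of the excess of crosses over the length. The two differ by the sign of the
  length.\<close>

definition groth_sum :: "nat \<Rightarrow> (nat \<Rightarrow> nat) \<Rightarrow> zletter laurent" where
  "groth_sum d v = (- 1) ^ perm_length v * kp {} (\<lambda>p. letter (Z p)) (\<lambda>q. inv_letter (Zd q)) d v"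

text \<open>Insert \<open>kp_descent\<close> with c = z_(i+1) / z_i into the numerator: everything
  cancels except for the term of v s_i times the denominator. The lost unit of length accounts for
  the sign.\<close>

lemma demazure_op_groth_sum:
  assumes v: "v permutes {1..d}" and i: "1 \<le> i" "i < d" and desc: "v (Suc i) < v i"
  shows "demazure_op i (groth_sum d v) = groth_sum d (v \<circ> adj i)"
proof -
  define K where "K = (\<lambda>v. kp {} (\<lambda>p. letter (Z p)) (\<lambda>q. inv_letter (Zd q)) d v)"
  define s where "s = ((- 1) ^ perm_length v :: zletter laurent)"
  define c where "c = inv_letter (Z i) * letter (Z (Suc i))"
  have pv: "permutation v" using v by (auto intro: permutation_permutes[THEN iffD2])
  have zc: "letter (Z i) * c = letter (Z (Suc i))"
    by (simp add: c_def mult.assoc[symmetric] letter_inv_letter)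
  have "subst_laurent (Some \<circ> swap_z i) (K v) = kp {} ((\<lambda>p. letter (Z p)) \<circ> adj i) (\<lambda>q. inv_letter (Zd q)) d v"
    unfolding K_def subst_kp by (rule kp_cong) (auto simp: subst_letter lval_def ilval_def)
  also have "\<dots> = K v + (c - 1) * (K v + K (v \<circ> adj i))"
    unfolding K_def by (rule kp_descent) (use assms zc in auto)
  finally have sub: "subst_laurent (Some \<circ> swap_z i) (K v) = K v + (c - 1) * (K v + K (v \<circ> adj i))" .
  have g: "groth_sum d v = s * K v" by (simp add: groth_sum_def K_def s_def)
  have sub': "subst_laurent (Some \<circ> swap_z i) (groth_sum d v) = s * subst_laurent (Some \<circ> swap_z i) (K v)"
    by (simp add: g subst_laurent_mult s_def subst_laurent_power subst_laurent_uminus)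
  have "perm_length v = Suc (perm_length (v \<circ> adj i))" using perm_length_descent[OF pv desc] .
  then have g': "groth_sum d (v \<circ> adj i) = - s * K (v \<circ> adj i)"
    by (simp add: groth_sum_def K_def s_def)
  show ?thesis
    unfolding demazure_op_def
  proof (rule exact_quot_eqI)
    show "letter (Z (Suc i)) - letter (Z i) \<noteq> 0" by (simp add: letter_eq_iff)
    have "letter (Z (Suc i)) * (s * K v) - letter (Z i) * (s * (K v + (c - 1) * (K v + K (v \<circ> adj i)))) =
        s * (letter (Z (Suc i)) * K v - letter (Z i) * K v - (letter (Z i) * c) * (K v + K (v \<circ> adj i))
          + letter (Z i) * (K v + K (v \<circ> adj i)))"
      by (simp add: algebra_simps)
    also have "\<dots> = - s * K (v \<circ> adj i) * (letter (Z (Suc i)) - letter (Z i))"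
      unfolding zc by (simp add: algebra_simps)
    finally show "groth_sum d (v \<circ> adj i) * (letter (Z (Suc i)) - letter (Z i)) =
        letter (Z (Suc i)) * groth_sum d v - letter (Z i) * subst_laurent (Some \<circ> swap_z i) (groth_sum d v)"
      by (simp only: g g' sub'[unfolded g] sub)
  qed
qed

lemma groth_sum_enlarge: "v permutes {1..d} \<Longrightarrow> d \<le> D \<Longrightarrow> groth_sum D v = groth_sum d v"
  unfolding groth_sum_def by (subst kp_enlarge[of v d D]) auto

lemma longest_permutes: "longest k permutes {1..k}"
proof (rule bij_imp_permutes)
  show "bij_betw (longest k) {1..k} {1..k}"
    by (rule bij_betw_byWitness[where f' = "longest k"]) (auto simp: longest_def)
qed (auto simp: longest_def)

text \<open>Without ascents v p >= k + 1 - p for every p, and both sides have the same sum over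
  \<open>{1..k}\<close>.\<close>

lemma ascent_or_longest:
  assumes v: "v permutes {1..k}" and noasc: "\<And>i. 1 \<le> i \<Longrightarrow> i < k \<Longrightarrow> v (Suc i) \<le> v i"
  shows "v = longest k"
proof -
  have dec: "v p \<ge> Suc k - p" if "p \<in> {1..k}" for p
  proof -
    have "1 \<le> p" "p \<le> k" using that by auto
    from \<open>p \<le> k\<close> \<open>1 \<le> p\<close> show ?thesis
    proof (induction p rule: inc_induct)
      case base
      then show ?case using permutes_in_image[OF v, of k] by auto
    next
      case (step p)
      have "v p \<noteq> v (Suc p)" using permutes_inj[OF v] by (metis injD n_not_Suc_n)
      then show ?case using step noasc[of p] by auto
    qed
  qed
  have "(\<Sum>p\<in>{1..k}. v p) = (\<Sum>p\<in>{1..k}. p)"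
    using sum.permute[OF v, of "\<lambda>x. x"] by (simp add: comp_def)
  also have "\<dots> = (\<Sum>p\<in>{1..k}. longest k p)"
    using sum.permute[OF longest_permutes, of "\<lambda>x. x" k] by (simp add: comp_def)
  finally have eq: "(\<Sum>p\<in>{1..k}. longest k p) = (\<Sum>p\<in>{1..k}. v p)" ..
  have "v p = longest k p" if "p \<in> {1..k}" for p
  proof (rule ccontr)
    assume "v p \<noteq> longest k p"
    then have "longest k p < v p" using dec[OF that] that by (auto simp: longest_def)
    then have "(\<Sum>p\<in>{1..k}. longest k p) < (\<Sum>p\<in>{1..k}. v p)"
      by (intro sum_strict_mono_ex1) (use dec that in \<open>auto simp: longest_def\<close>)
    then show False using eq by simp
  qed
  then show ?thesis
    using permutes_not_in[OF v] by (auto simp: fun_eq_iff longest_def)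
qed

text \<open>Induction upwards in length, bounded by the crude k * k: a polynomial of the longer
  \<open>v \<circ> adj i\<close> at an ascent yields one of \<open>v\<close>, and without ascents
  \<open>v\<close> is \<open>longest k\<close>.\<close>

lemma is_grothendieck_exists:
  assumes "v permutes {1..k}"
  shows "\<exists>f. is_grothendieck v f"
proof -
  have bound: "perm_length v \<le> k * k" if "v permutes {1..k}" for v
  proof -
    have "q \<in> {1..k}" "p \<in> {1..k}" if "p < q" "v q < v p" for p q
      using that permutes_in_image[OF \<open>v permutes {1..k}\<close>, of p] permutes_in_image[OF \<open>v permutes {1..k}\<close>, of q]
        permutes_not_in[OF \<open>v permutes {1..k}\<close>, of p] permutes_not_in[OF \<open>v permutes {1..k}\<close>, of q]
      by (cases "q \<in> {1..k}"; cases "p \<in> {1..k}"; auto)+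
    then have "{(p, q). p < q \<and> v q < v p} \<subseteq> {1..k} \<times> {1..k}" by blast
    then have "perm_length v \<le> card ({1..k} \<times> {1..k})"
      unfolding perm_length_def by (intro card_mono) auto
    then show ?thesis by simp
  qed
  show ?thesis
    using assms
  proof (induction "k * k - perm_length v" arbitrary: v rule: less_induct)
    case less
    have pv: "permutation v" using less.prems by (auto intro: permutation_permutes[THEN iffD2])
    show ?case
    proof (cases "\<exists>i. 1 \<le> i \<and> i < k \<and> v i < v (Suc i)")
      case True
      then obtain i where i: "1 \<le> i" "i < k" "v i < v (Suc i)" by blast
      have p': "v \<circ> adj i permutes {1..k}" using i less.prems by (intro permutes_compose adj_permutes) auto
      have l: "perm_length (v \<circ> adj i) = Suc (perm_length v)" by (rule perm_length_ascent[OF pv i(3)])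
      then have "\<exists>f. is_grothendieck (v \<circ> adj i) f"
        by (intro less.hyps p') (use bound[OF p'] in auto)
      then obtain f where "is_grothendieck (v \<circ> adj i) f" ..
      from is_grothendieck.step[OF this i(1)] l show ?thesis by auto
    next
      case False
      then have "v = longest k" using ascent_or_longest[OF less.prems] by (metis not_le_imp_less)
      then show ?thesis using is_grothendieck.top by blast
    qed
  qed
qed

section \<open>Compulsory crosses and dominant permutations\<close>

lemma pipe_word_split_row:
  assumes "1 \<le> p" "p \<le> N"
  shows "pipe_word N M P = pipe_word (p - 1) M P @
    map (\<lambda>q. p + q - 1) (filter (\<lambda>q. (p, q) \<in> P) (rev [1..<Suc M])) @
    concat (map (\<lambda>i. map (\<lambda>j. i + j - 1) (filter (\<lambda>j. (i, j) \<in> P) (rev [1..<Suc M]))) [Suc p..<Suc N])"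
proof -
  have "[1..<Suc N] = [1..<Suc (p - 1)] @ [p] @ [Suc p..<Suc N]"
    using assms upt_add_eq_append[of 1 p "Suc N - p"] by (simp add: upt_conv_Cons del: upt_Suc)
  then show ?thesis unfolding pipe_word_def by (simp del: upt_Suc)
qed

lemma pipe_word_Suc:
  "pipe_word (Suc N) M P = pipe_word N M P @
    map (\<lambda>q. Suc N + q - 1) (filter (\<lambda>q. (Suc N, q) \<in> P) (rev [1..<Suc M]))"
  unfolding pipe_word_def by simp

lemma rk_mono: "a \<le> a' \<Longrightarrow> rk u a b \<le> rk u a' b"
  unfolding rk_def by (rule card_mono) auto

lemma rk_rops_other: "a \<notin> set w \<Longrightarrow> rk (rops u w) a b = rk u a b"
  by (induction w arbitrary: u) (auto simp: rk_rop)

text \<open>When a decreasing word reaches the letter a, row a - 1 is still untouched and bounds the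
  new row a from below; the later, smaller letters leave row a alone.\<close>

lemma rk_rops_decreasing:
  assumes "sorted_wrt (>) w" "1 \<le> a"
  shows "rk u (a - 1) b \<le> rk (rops u w) a b"
  using assms
proof (induction w arbitrary: u)
  case (Cons i w)
  show ?case
  proof (cases "a \<in> set w")
    case True
    then have "a < i" using Cons.prems by auto
    then have "a - 1 \<noteq> i" by simp
    then have "rk (rop u i) (a - 1) b = rk u (a - 1) b" by (simp add: rk_rop)
    then show ?thesis using Cons.IH[of "rop u i"] Cons.prems by simp
  next
    case False
    have "rk u (a - 1) b \<le> rk (rop u i) a b"
      using Cons.prems rk_mono[of "a - 1" a u b] by (auto simp: rk_rop)
    then show ?thesis using False by (simp add: rk_rops_other)
  qed
qed (simp add: rk_mono)

lemma sorted_row_letters: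
  "1 \<le> p \<Longrightarrow> sorted_wrt (>) (map (\<lambda>q. p + q - 1) (filter f (rev [1..<Suc M])))"
  unfolding sorted_wrt_map
  by (rule sorted_wrt_filter, unfold sorted_wrt_rev)
    (rule sorted_wrt_mono_rel[OF _ sorted_wrt_upt], auto)

text \<open>Each row is a decreasing word, so N rows can push the rank table of the identity down by
  at most N.\<close>

lemma rk_rows_ge: "Suc (min (a - N) b) \<le> rk (word_demazure (pipe_word N M P)) a b"
proof (induction N arbitrary: a)
  case 0
  then show ?case using rk_id[of a b] by (simp add: pipe_word_def word_demazure_rops del: id_apply)
next
  case (Suc N)
  let ?u = "word_demazure (pipe_word N M P)"
  let ?w = "map (\<lambda>q. Suc N + q - 1) (filter (\<lambda>q. (Suc N, q) \<in> P) (rev [1..<Suc M]))"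
  have e: "word_demazure (pipe_word (Suc N) M P) = rops ?u ?w"
    by (simp only: pipe_word_Suc demazure_append)
  show ?case
  proof (cases "a = 0")
    case True
    have "0 \<notin> set ?w" by auto
    then have "rk (rops ?u ?w) 0 b = rk ?u 0 b" by (rule rk_rops_other)
    then show ?thesis using True Suc.IH[of 0] e by simp
  next
    case False
    have "Suc (min (a - Suc N) b) \<le> rk ?u (a - 1) b" using Suc.IH[of "a - 1"] False by simp
    also have "\<dots> \<le> rk (rops ?u ?w) a b"
      by (rule rk_rops_decreasing, rule sorted_row_letters) (use False in auto)
    finally show ?thesis by (simp only: e)
  qed
qed

text \<open>A gap at (p, q) forces a 1 into the northwest p by q corner; the other unit of the count
  is row 0. The rows above p guarantee rank s + 1 at (p - 1 + s, q) for all s <= q. Row p preserves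
  these bounds because it lacks the letter p + q - 1, and all later letters exceed p. The claim is
  the bound for s = 1.\<close>

lemma rk_missing_box:
  assumes "(p, q) \<notin> P" "1 \<le> p" "p \<le> N" "1 \<le> q"
  shows "2 \<le> rk (pipe_demazure N M P) p q"
proof -
  let ?u = "word_demazure (pipe_word (p - 1) M P)"
  let ?w = "map (\<lambda>q. p + q - 1) (filter (\<lambda>q. (p, q) \<in> P) (rev [1..<Suc M]))"
  let ?r = "concat (map (\<lambda>i. map (\<lambda>j. i + j - 1) (filter (\<lambda>j. (i, j) \<in> P) (rev [1..<Suc M]))) [Suc p..<Suc N])"
  have e: "pipe_demazure N M P = rops (rops ?u ?w) ?r"
    unfolding pipe_demazure_def by (subst pipe_word_split_row[of p]) (use assms in \<open>simp_all add: demazure_append\<close>)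
  \<comment> \<open>The letter p - 1 + s affects only the bound for s, which the bound for s + 1
    protects. For s = q no further bound exists, and exactly this letter is excluded.\<close>
  have inv: "\<forall>s\<le>q. Suc s \<le> rk (rops u w) (p - 1 + s) q"
    if "\<forall>s\<le>q. Suc s \<le> rk u (p - 1 + s) q" "\<forall>i\<in>set w. p \<le> i \<and> i \<noteq> p + q - 1" for u w
    using that
  proof (induction w arbitrary: u)
    case (Cons i w)
    have "\<forall>s\<le>q. Suc s \<le> rk (rop u i) (p - 1 + s) q"
    proof (intro allI impI)
      fix s assume s: "s \<le> q"
      show "Suc s \<le> rk (rop u i) (p - 1 + s) q"
      proof (cases "p - 1 + s = i")
        case True
        then have "Suc s \<le> q" using Cons.prems(2) s assms by auto
        then have "Suc (Suc s) \<le> rk u (Suc i) q" using Cons.prems(1) True by (metis add_Suc_right)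
        then show ?thesis using True by (auto simp: rk_rop)
      qed (use Cons.prems(1) s in \<open>auto simp: rk_rop\<close>)
    qed
    then show ?case using Cons.IH Cons.prems by auto
  qed simp
  have "\<forall>s\<le>q. Suc s \<le> rk ?u (p - 1 + s) q"
  proof (intro allI impI)
    fix s assume "s \<le> q"
    then show "Suc s \<le> rk ?u (p - 1 + s) q" using rk_rows_ge[of "p - 1 + s" "p - 1" q M P] by simp
  qed
  then have "\<forall>s\<le>q. Suc s \<le> rk (rops ?u ?w) (p - 1 + s) q"
  proof (rule inv)
    show "\<forall>i\<in>set ?w. p \<le> i \<and> i \<noteq> p + q - 1"
    proof
      fix i assume "i \<in> set ?w"
      then obtain q' where q': "i = p + q' - 1" "(p, q') \<in> P" "1 \<le> q'" by (auto simp del: upt_Suc)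
      then have "q' \<noteq> q" using assms by auto
      then show "p \<le> i \<and> i \<noteq> p + q - 1" using q' assms by auto
    qed
  qed
  then have "2 \<le> rk (rops ?u ?w) p q" using assms by (auto dest!: spec[of _ 1])
  moreover have "p \<notin> set ?r" by auto
  ultimately show ?thesis by (simp add: e rk_rops_other)
qed

text \<open>A gap at (p, q) would give a 1 in the corner up to (p, q), but all values in rows 1 to p
  exceed \<open>lam p\<close>, hence q.\<close>

lemma compulsory_crosses:
  assumes v: "v permutes {1..d}" and P: "pipe_demazure N M P = v"
    and lam: "\<And>p p'. 1 \<le> p \<Longrightarrow> p \<le> p' \<Longrightarrow> p' \<le> N \<Longrightarrow> lam p' \<le> lam p"
    and big: "\<And>p. 1 \<le> p \<Longrightarrow> p \<le> N \<Longrightarrow> lam p < v p"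
    and pq: "1 \<le> p" "p \<le> N" "1 \<le> q" "q \<le> lam p"
  shows "(p, q) \<in> P"
proof (rule ccontr)
  assume "(p, q) \<notin> P"
  then have *: "2 \<le> rk v p q" using rk_missing_box[of p q P N M] pq P by auto
  have "{p' \<in> {..p}. v p' \<le> q} \<subseteq> {0}"
  proof
    fix p' assume p': "p' \<in> {p' \<in> {..p}. v p' \<le> q}"
    show "p' \<in> {0}"
    proof (rule ccontr)
      assume "p' \<notin> {0}"
      then have "q < v p'" using big[of p'] lam[of p' p] p' pq by auto
      then show False using p' by auto
    qed
  qed
  then have "rk v p q \<le> card {0::nat}" unfolding rk_def by (intro card_mono) simp_all
  then show False using * by simp
qed

section \<open>Left-justified diagrams and dominant permutations\<close>

text \<open>A decreasing run of letters is a cycle: the entry at p + c travels to p past c smaller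
  entries.\<close>

lemma rops_cycle:
  assumes "\<And>x. p \<le> x \<Longrightarrow> x < p + c \<Longrightarrow> u x < u (p + c)"
  shows "rops u (rev [p..<p + c]) x = (if x = p then u (p + c) else if p < x \<and> x \<le> p + c then u (x - 1) else u x)"
  using assms
proof (induction c arbitrary: u)
  case (Suc c)
  let ?u = "rop u (p + c)"
  have lt: "u (p + c) < u (Suc (p + c))" using Suc.prems[of "p + c"] by simp
  have u: "?u y = (if y = p + c then u (Suc (p + c)) else if y = Suc (p + c) then u (p + c) else u y)" for y
    using lt by (simp add: rop_apply)
  have "rops ?u (rev [p..<p + c]) x =
      (if x = p then ?u (p + c) else if p < x \<and> x \<le> p + c then ?u (x - 1) else ?u x)"
    by (rule Suc.IH) (use Suc.prems in \<open>auto simp: u\<close>)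
  moreover have "rops u (rev [p..<p + Suc c]) = rops ?u (rev [p..<p + c])" by simp
  ultimately show ?case by (auto simp: u)
qed simp

lemma perm_length_cycle:
  assumes "permutation u" "\<And>x. p \<le> x \<Longrightarrow> x < p + c \<Longrightarrow> u x < u (p + c)"
  shows "perm_length (rops u (rev [p..<p + c])) = perm_length u + c"
  using assms
proof (induction c arbitrary: u)
  case (Suc c)
  let ?u = "rop u (p + c)"
  have lt: "u (p + c) < u (Suc (p + c))" using Suc.prems(2)[of "p + c"] by simp
  have u: "?u y = (if y = p + c then u (Suc (p + c)) else if y = Suc (p + c) then u (p + c) else u y)" for y
    using lt by (simp add: rop_apply)
  have "perm_length (rops ?u (rev [p..<p + c])) = perm_length ?u + c"
  proof (rule Suc.IH)
    show "permutation ?u" by (rule permutation_rop[OF Suc.prems(1)])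
  qed (use Suc.prems(2) in \<open>auto simp: u\<close>)
  moreover have "perm_length ?u = Suc (perm_length u)"
    using perm_length_ascent[OF Suc.prems(1) lt] lt by (simp add: rop_def)
  ultimately show ?case by simp
qed simp

text \<open>Left-justified rows of arbitrary lengths: a partition in the case of dominant
  permutations, the Lehmer code in \<open>every_permutation_pipe_dream\<close>.\<close>

definition young :: "nat \<Rightarrow> (nat \<Rightarrow> nat) \<Rightarrow> (nat \<times> nat) set" where
  "young N c = {(p, q). 1 \<le> p \<and> p \<le> N \<and> 1 \<le> q \<and> q \<le> c p}"

lemma pipe_word_young_Suc:
  assumes "c (Suc N) \<le> M"
  shows "pipe_word (Suc N) M (young K c) = pipe_word N M (young K c) @ (if Suc N \<le> K then rev [Suc N..<Suc N + c (Suc N)] else [])"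
proof -
  have "filter (\<lambda>q. (Suc N, q) \<in> young K c) (rev [1..<Suc M]) = (if Suc N \<le> K then rev [1..<Suc (c (Suc N))] else [])"
  proof (cases "Suc N \<le> K")
    case True
    have "filter (\<lambda>q. (Suc N, q) \<in> young K c) [1..<Suc M] = [1..<Suc (c (Suc N))]"
    proof -
      have "[1..<Suc M] = [1..<Suc (c (Suc N))] @ [Suc (c (Suc N))..<Suc M]"
        using assms upt_add_eq_append[of 1 "Suc (c (Suc N))" "M - c (Suc N)"] by simp
      moreover have "filter (\<lambda>q. (Suc N, q) \<in> young K c) [1..<Suc (c (Suc N))] = [1..<Suc (c (Suc N))]"
        by (rule filter_True) (use True in \<open>auto simp: young_def\<close>)
      moreover have "filter (\<lambda>q. (Suc N, q) \<in> young K c) [Suc (c (Suc N))..<Suc M] = []"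
        by (rule filter_False) (auto simp: young_def)
      ultimately show ?thesis by (simp del: upt_Suc)
    qed
    then show ?thesis using True by (simp add: rev_filter[symmetric] del: upt_Suc)
  next
    case False
    then show ?thesis by (auto simp: young_def filter_empty_conv simp del: upt_Suc)
  qed
  moreover have "map (\<lambda>q. Suc N + q - 1) (rev [1..<Suc m]) = rev [Suc N..<Suc N + m]" for m
    by (induction m) auto
  ultimately show ?thesis unfolding pipe_word_Suc by (simp del: upt_Suc)
qed

text \<open>Processing the rows of \<open>young N c\<close> sends to position \<open>p\<close>, in turn, the entry preceded by
  exactly \<open>c p\<close> entries in the increasing list of the remaining ones.\<close>

lemma young_rows:
  assumes "n \<le> K" "\<And>p. 1 \<le> p \<Longrightarrow> p \<le> K \<Longrightarrow> c p \<le> M"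
  defines "A \<equiv> \<lambda>n. word_demazure (pipe_word n M (young K c))"
  shows "(\<forall>x y. n < x \<longrightarrow> x < y \<longrightarrow> A n x < A n y) \<and> perm_length (A n) = (\<Sum>p=1..n. c p) \<and>
    (n < K \<longrightarrow> (\<forall>x. A (Suc n) x = (if x = Suc n then A n (Suc n + c (Suc n))
      else if Suc n < x \<and> x \<le> Suc n + c (Suc n) then A n (x - 1) else A n x)))"
  using assms(1)
proof (induction n)
  have step: "\<forall>x. A (Suc n) x = (if x = Suc n then A n (Suc n + c (Suc n))
      else if Suc n < x \<and> x \<le> Suc n + c (Suc n) then A n (x - 1) else A n x)"
    "perm_length (A (Suc n)) = perm_length (A n) + c (Suc n)"
    if inc: "\<forall>x y. n < x \<longrightarrow> x < y \<longrightarrow> A n x < A n y" and n: "n < K" for n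
  proof -
    have e: "A (Suc n) = rops (A n) (rev [Suc n..<Suc n + c (Suc n)])"
      unfolding A_def using n assms(2)[of "Suc n"] by (simp add: pipe_word_young_Suc demazure_append del: upt_Suc)
    show "\<forall>x. A (Suc n) x = (if x = Suc n then A n (Suc n + c (Suc n))
        else if Suc n < x \<and> x \<le> Suc n + c (Suc n) then A n (x - 1) else A n x)"
      unfolding e by (subst rops_cycle) (use inc in auto)
    show "perm_length (A (Suc n)) = perm_length (A n) + c (Suc n)"
      unfolding e by (rule perm_length_cycle) (use inc in \<open>auto simp: A_def\<close>)
  qed
  {
    case 0
    have A0: "A 0 x = x" for x by (simp add: A_def pipe_word_def word_demazure_rops)
    then have "\<forall>x y. 0 < x \<longrightarrow> x < y \<longrightarrow> A 0 x < A 0 y" by simp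
    moreover have "perm_length (A 0) = 0"
    proof -
      have "{(p, q). p < q \<and> A 0 q < A 0 p} = {}" by (auto simp: A0)
      then show ?thesis by (simp only: perm_length_def card.empty)
    qed
    ultimately show ?case using step[of 0] by auto
  next
    case (Suc n)
    then have IH: "\<forall>x y. n < x \<longrightarrow> x < y \<longrightarrow> A n x < A n y" "perm_length (A n) = (\<Sum>p=1..n. c p)" by auto
    have inc: "\<forall>x y. Suc n < x \<longrightarrow> x < y \<longrightarrow> A (Suc n) x < A (Suc n) y"
      using step(1)[OF IH(1)] Suc.prems IH(1) by auto
    moreover have "perm_length (A (Suc n)) = (\<Sum>p=1..Suc n. c p)"
      using step(2)[OF IH(1)] Suc.prems IH(2) by simp
    ultimately show ?case using step(1)[OF inc] by auto
  }
qed

text \<open>A partition inside of the staircase; \<open>dom_perm\<close> is the dominant permutation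
  with this code.\<close>

locale dominant =
  fixes d :: nat and lam :: "nat \<Rightarrow> nat"
  assumes lam_antimono: "\<And>p p'. 1 \<le> p \<Longrightarrow> p \<le> p' \<Longrightarrow> p' \<le> d \<Longrightarrow> lam p' \<le> lam p"
    and lam_le: "\<And>p. 1 \<le> p \<Longrightarrow> p \<le> d \<Longrightarrow> p + lam p \<le> d"
begin

definition "dom_state n = word_demazure (pipe_word n d (young d lam))"

definition "dom_perm = pipe_demazure d d (young d lam)"

lemma dom_perm_state: "dom_perm = dom_state d"
  by (simp add: dom_perm_def dom_state_def pipe_demazure_def)

lemma lam_le_d: "1 \<le> p \<Longrightarrow> p \<le> d \<Longrightarrow> lam p \<le> d"
  using lam_le[of p] by simp

lemma dom_state_permutes: "n \<le> d \<Longrightarrow> dom_state n permutes {1..d}"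
  unfolding dom_state_def
  by (rule demazure_permutes) (use lam_le in \<open>fastforce simp: set_pipe_word young_def\<close>)

lemma dom_state_Suc:
  "n < d \<Longrightarrow> dom_state (Suc n) x = (if x = Suc n then dom_state n (Suc n + lam (Suc n))
      else if Suc n < x \<and> x \<le> Suc n + lam (Suc n) then dom_state n (x - 1) else dom_state n x)"
  using young_rows[of n d lam d] lam_le_d unfolding dom_state_def by auto

lemma dom_state_less: "n \<le> d \<Longrightarrow> n < x \<Longrightarrow> x < y \<Longrightarrow> dom_state n x < dom_state n y"
  using young_rows[of n d lam d] lam_le_d unfolding dom_state_def by auto

text \<open>As \<open>lam\<close> decreases, every earlier row passed over at least as many entries,
  so the smallest values have merely been shifted to the right.\<close>

lemma dom_state_low: "n < d \<Longrightarrow> 1 \<le> s \<Longrightarrow> s \<le> lam (Suc n) \<Longrightarrow> dom_state n (n + s) = s"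
proof (induction n arbitrary: s)
  case 0
  then show ?case by (simp add: dom_state_def pipe_word_def word_demazure_rops)
next
  case (Suc n)
  have "lam (Suc (Suc n)) \<le> lam (Suc n)" using lam_antimono Suc.prems by auto
  then show ?case using Suc.IH[of s] Suc.prems dom_state_Suc[of n "Suc n + s"] by auto
qed

lemma dom_state_above:
  assumes "n < d" "lam (Suc n) < s"
  shows "lam (Suc n) < dom_state n (n + s)"
proof (cases "lam (Suc n) = 0")
  case True
  have "n + s \<noteq> 0" using assms by auto
  moreover have "dom_state n 0 = 0" using permutes_not_in[OF dom_state_permutes[of n], of 0] assms by auto
  ultimately have "dom_state n (n + s) \<noteq> 0"
    using permutes_inj[OF dom_state_permutes[of n]] assms by (metis injD less_imp_le)
  then show ?thesis using True by simp
next
  case False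
  then show ?thesis
    using dom_state_low[of n "lam (Suc n)"] dom_state_less[of n "n + lam (Suc n)" "n + s"] assms by auto
qed

lemma dom_state_stable: "p \<le> n \<Longrightarrow> n \<le> d \<Longrightarrow> dom_state n p = dom_state p p"
proof (induction n)
  case (Suc n)
  then show ?case using dom_state_Suc[of n p] by (cases "p = Suc n") auto
qed simp

lemma dom_perm_permutes: "dom_perm permutes {1..d}"
  unfolding dom_perm_state by (rule dom_state_permutes) simp

lemma dom_perm_above: "1 \<le> p \<Longrightarrow> p \<le> d \<Longrightarrow> lam p < dom_perm p"
proof -
  assume p: "1 \<le> p" "p \<le> d"
  then obtain n where n: "p = Suc n" by (cases p) auto
  have "dom_perm p = dom_state n (n + Suc (lam p))"
    using dom_state_stable[of p d] dom_state_Suc[of n p] p n by (simp add: dom_perm_state)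
  then show ?thesis using dom_state_above[of n "Suc (lam p)"] n p by simp
qed

lemma dom_perm_greedy:
  assumes p: "1 \<le> p" "p \<le> d" and x: "lam p < x" "x < dom_perm p"
  shows "\<exists>p'. 1 \<le> p' \<and> p' < p \<and> dom_perm p' = x"
proof -
  obtain n where n: "p = Suc n" using p by (cases p) auto
  have vp: "dom_perm p = dom_state n (p + lam p)"
    using dom_state_stable[of p d] dom_state_Suc[of n p] p n by (simp add: dom_perm_state)
  have perm: "dom_state n permutes {1..d}" using dom_state_permutes p n by simp
  have xd: "x \<in> {1..d}" using x permutes_in_image[OF dom_perm_permutes, of p] p by auto
  then obtain y where y: "dom_state n y = x" "y \<in> {1..d}"
    using permutes_image[OF perm] by (metis imageE)
  have "y \<le> n"
  proof (rule ccontr)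
    assume "\<not> y \<le> n"
    then have "y < p + lam p"
      using dom_state_less[of n "p + lam p" y] x y vp p n by (cases y "p + lam p" rule: linorder_cases) auto
    then have "dom_state n y = y - n"
      using dom_state_low[of n "y - n"] \<open>\<not> y \<le> n\<close> p n by auto
    then show False using y x \<open>y < p + lam p\<close> n by auto
  qed
  then have "dom_perm y = x"
    using dom_state_stable[of y n] dom_state_stable[of y d] y p n by (simp add: dom_perm_state)
  then show ?thesis using \<open>y \<le> n\<close> y n by auto
qed

lemma card_young: "card (young d lam) = (\<Sum>p=1..d. lam p)"
proof -
  have "young d lam = (SIGMA p:{1..d}. {1..lam p})" by (auto simp: young_def)
  then show ?thesis by simp
qed

lemma perm_length_dom_perm: "perm_length dom_perm = card (young d lam)"
  using young_rows[of d d lam d] lam_le_d unfolding card_young dom_perm_state dom_state_def by auto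

lemma young_subset: "young d lam \<subseteq> {1..d} \<times> {1..d}"
  using lam_le_d by (fastforce simp: young_def)

end

section \<open>Uniqueness of the pipe dream of a dominant permutation\<close>

text \<open>An exchange takes place only at an ascent, so a pair of values that is inverted once
  stays inverted.\<close>

lemma rops_inverted:
  assumes "s < t" "u t < u s"
  shows "\<exists>s' t'. s' < t' \<and> rops u w s' = u s \<and> rops u w t' = u t"
  using assms
proof (induction w arbitrary: u s t)
  case (Cons i w)
  have "\<exists>s' t'. s' < t' \<and> rop u i s' = u s \<and> rop u i t' = u t"
  proof (cases "u i < u (Suc i)")
    case True
    then have r: "rop u i = u \<circ> adj i" by (simp add: rop_def)
    have "adj i s < adj i t"
      by (subst adj_less_iff) (use Cons.prems True in auto)
    moreover have "rop u i (adj i s) = u s" "rop u i (adj i t) = u t" by (simp_all add: r)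
    ultimately show ?thesis by blast
  next
    case False
    then show ?thesis using Cons.prems by (auto simp: rop_def)
  qed
  then obtain s' t' where st: "s' < t'" "rop u i s' = u s" "rop u i t' = u t" by blast
  show ?case using Cons.IH[of s' t' "rop u i"] st Cons.prems by auto
qed auto

lemma rk_rop_mono:
  assumes "\<And>a b. rk u a b \<le> rk v a b"
  shows "rk (rop u i) a b \<le> rk (rop v i) a b"
  using assms[of "i - 1" b] assms[of "Suc i" b] assms[of a b] by (auto simp: rk_rop)

lemma rk_subset_mono:
  assumes "P \<subseteq> P'" "\<And>a b. rk u a b \<le> rk v a b"
  shows "rk (rops u (map g (filter (\<lambda>x. x \<in> P') xs))) a b \<le> rk (rops v (map g (filter (\<lambda>x. x \<in> P) xs))) a b"
  using assms(2)
proof (induction xs arbitrary: u v)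
  case (Cons x xs)
  consider "x \<in> P" | "x \<in> P' - P" | "x \<notin> P'" by blast
  then show ?case
  proof cases
    case 1
    then show ?thesis using Cons assms(1) rk_rop_mono[of u v] by auto
  next
    case 2
    have "rk (rop u (g x)) a b \<le> rk v a b" for a b
      using rk_rop_le[of u "g x" a b] Cons.prems[of a b] by simp
    then show ?thesis using 2 Cons.IH[of "rop u (g x)" v] by simp
  next
    case 3
    then show ?thesis using Cons assms(1) by auto
  qed
qed simp

text \<open>More crosses mean lower ranks, that is, a larger product in Bruhat order; each skipped
  letter is compared by \<open>rk_rop_le\<close> and each common one by
  \<open>rk_rop_mono\<close>.\<close>

lemma rk_pipe_mono: "P \<subseteq> P' \<Longrightarrow> rk (pipe_demazure N M P') a b \<le> rk (pipe_demazure N M P) a b"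
  unfolding pipe_demazure_def pipe_word_boxes word_demazure_rops by (rule rk_subset_mono) auto

lemma rk_eq_imp_eq:
  assumes "\<And>a b. rk u a b = rk v a b"
  shows "u = v"
proof
  fix p
  have "u p \<le> b \<longleftrightarrow> v p \<le> b" for b
    using assms[of p b] assms[of "p - 1" b] by (cases p) (auto simp: rk_0 rk_Suc split: if_splits)
  then show "u p = v p" by (metis le_antisym order_refl)
qed

context dominant
begin

text \<open>Given a further cross, the diagram with this one box added lies between the diagram and
  P and has, by monotonicity, the product \<open>dom_perm\<close> as well. The added letter inverts
  for good two values x < y above \<open>lam p\<close>, so y precedes x in \<open>dom_perm\<close>.
  But the greedy rule would have chosen x first.\<close>

lemma dom_perm_unique_pipe_dream:
  assumes P: "P \<subseteq> {1..d} \<times> {1..d}" "pipe_demazure d d P = dom_perm"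
  shows "P = young d lam"
proof
  show Y: "young d lam \<subseteq> P"
  proof
    fix x assume "x \<in> young d lam"
    then obtain p q where "x = (p, q)" "1 \<le> p" "p \<le> d" "1 \<le> q" "q \<le> lam p" by (auto simp: young_def)
    then show "x \<in> P"
      using compulsory_crosses[OF dom_perm_permutes P(2) lam_antimono dom_perm_above] by auto
  qed
  show "P \<subseteq> young d lam"
  proof (rule ccontr)
    assume "\<not> P \<subseteq> young d lam"
    then obtain p q where pq: "(p, q) \<in> P" "(p, q) \<notin> young d lam" by auto
    have pq1: "1 \<le> p" "p \<le> d" "1 \<le> q" "q \<le> d" using pq P by auto
    have pqd: "p + q - 1 < d" using pipe_demazure_letter[of d d P 1 d p q] P pq dom_perm_permutes by auto
    have q: "lam p < q" using pq pq1 by (auto simp: young_def)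
    let ?Q = "insert (p, q) (young d lam)"
    have "rk (pipe_demazure d d ?Q) a b = rk dom_perm a b" for a b
    proof (rule antisym)
      show "rk (pipe_demazure d d ?Q) a b \<le> rk dom_perm a b"
        unfolding dom_perm_def by (rule rk_pipe_mono) auto
      show "rk dom_perm a b \<le> rk (pipe_demazure d d ?Q) a b"
        unfolding P(2)[symmetric] by (rule rk_pipe_mono) (use Y pq in auto)
    qed
    then have Q: "pipe_demazure d d ?Q = dom_perm" by (rule rk_eq_imp_eq)
    obtain n where n: "p = Suc n" using pq1 by (cases p) auto
    define i where "i = p + q - 1"
    let ?row = "map (\<lambda>q. p + q - 1) (filter (\<lambda>q'. (p, q') \<in> ?Q) (rev [1..<Suc d]))"
    have "pipe_word n d ?Q = pipe_word n d (young d lam)"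
      unfolding pipe_word_def using n by (intro arg_cong[where f = concat] map_cong refl filter_cong) auto
    then obtain w where w: "pipe_word d d ?Q = pipe_word n d (young d lam) @ ?row @ w"
      using pipe_word_split_row[of p d d ?Q] pq1 n by simp
    \<comment> \<open>The added box is the rightmost cross of row p, hence its letter is the first
      one read in this row.\<close>
    have "[1..<Suc d] = [1..<q] @ [q] @ [Suc q..<Suc d]"
      using pq1 upt_add_eq_append[of 1 q "Suc d - q"] by (simp add: upt_conv_Cons del: upt_Suc)
    moreover have "filter (\<lambda>q'. (p, q') \<in> ?Q) [Suc q..<Suc d] = []"
      by (rule filter_False) (use q in \<open>auto simp: young_def\<close>)
    ultimately obtain w' where "?row = i # w'"
      by (simp add: rev_filter[symmetric] i_def del: upt_Suc)
    then have e: "dom_perm = rops (rop (dom_state n) i) (w' @ w)"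
      using Q w by (simp add: pipe_demazure_def dom_state_def demazure_append)
    define x y where "x = dom_state n i" and "y = dom_state n (Suc i)"
    have xy: "x < y" unfolding x_def y_def by (rule dom_state_less) (use pq1 n i_def in auto)
    then have "rop (dom_state n) i i = y" "rop (dom_state n) i (Suc i) = x"
      by (simp_all add: rop_apply x_def y_def)
    then obtain s t where st: "s < t" "dom_perm s = y" "dom_perm t = x"
      using rops_inverted[of i "Suc i" "rop (dom_state n) i" "w' @ w"] xy e by auto
    have lamx: "lam p < x"
      using dom_state_above[of n q] pq1 q n by (simp add: x_def i_def)
    have yd: "y \<in> {1..d}"
      using permutes_in_image[OF dom_state_permutes[of n], of "Suc i"] pqd pq1 n by (simp add: y_def i_def)
    then have sd: "s \<in> {1..d}" using permutes_in_image[OF dom_perm_permutes, of s] st by simp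
    \<comment> \<open>The first n = p - 1 positions are final before row p is read, and y stands
      behind them at that time.\<close>
    have "p \<le> s"
    proof (rule ccontr)
      assume "\<not> p \<le> s"
      then have "dom_state n s = y"
        using dom_state_stable[of s n] dom_state_stable[of s d] st pq1 n by (simp add: dom_perm_state)
      then have "s = Suc i"
        using injD[OF permutes_inj[OF dom_state_permutes[of n]], of s "Suc i"] pq1 n unfolding y_def by simp
      then show False using \<open>\<not> p \<le> s\<close> pq1 by (simp add: i_def)
    qed
    then have "lam s < x" using lam_antimono[of p s] lamx pq1 sd by auto
    then obtain p' where p': "p' < s" "dom_perm p' = x"
      using dom_perm_greedy[of s x] sd st xy by auto
    then have "p' = t" using st(3) injD[OF permutes_inj[OF dom_perm_permutes], of p' t] by simp
    then show False using p' st by simp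
  qed
qed

lemma kp_dom_perm: "kp (young d lam) a b d dom_perm = 1"
proof -
  have "{P. P \<subseteq> {1..d} \<times> {1..d} \<and> pipe_demazure d d P = dom_perm} = {young d lam}"
    using dom_perm_unique_pipe_dream young_subset by (auto simp: dom_perm_def)
  then show ?thesis by (simp add: kp_def pd_sum_def) (rule prod.neutral, simp)
qed

lemma kp_factor:
  fixes a b :: "nat \<Rightarrow> 'a::comm_ring_1"
  assumes v: "v permutes {1..d}" and big: "\<And>p. 1 \<le> p \<Longrightarrow> p \<le> d \<Longrightarrow> lam p < v p"
  shows "kp {} a b d v = (\<Prod>(p, q)\<in>young d lam. a p * b q - 1) * kp (young d lam) a b d v"
proof -
  have main: "(\<Prod>x\<in>{1..d} \<times> {1..d}. if x \<in> P then a (fst x) * b (snd x) - 1 else 1) =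
      (\<Prod>(p, q)\<in>young d lam. a p * b q - 1) *
      (\<Prod>x\<in>{1..d} \<times> {1..d}. if x \<in> P then if x \<in> young d lam then 1 else a (fst x) * b (snd x) - 1
        else if x \<in> young d lam then 0 else 1)"
    if P: "P \<subseteq> {1..d} \<times> {1..d}" "pipe_demazure d d P = v" for P
  proof -
    have Y: "young d lam \<subseteq> P"
    proof
      fix x assume "x \<in> young d lam"
      then obtain p q where "x = (p, q)" "1 \<le> p" "p \<le> d" "1 \<le> q" "q \<le> lam p" by (auto simp: young_def)
      then show "x \<in> P"
        using compulsory_crosses[OF v P(2) lam_antimono big] by auto
    qed
    have "(\<Prod>(p, q)\<in>young d lam. a p * b q - 1) =
        (\<Prod>x\<in>{1..d} \<times> {1..d}. if x \<in> young d lam then a (fst x) * b (snd x) - 1 else 1)"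
      using young_subset
      by (subst prod.inter_filter[symmetric]) (auto intro!: prod.cong simp: Collect_conj_eq Int_absorb2)
    then show ?thesis
      using Y by (auto simp: prod.distrib[symmetric] intro!: prod.cong)
  qed
  show ?thesis
    unfolding kp_def pd_sum_def sum_distrib_left
    by (rule sum.cong[OF refl]) (use main in \<open>simp cong: if_cong\<close>)
qed

end

section \<open>Identification with double Grothendieck polynomials\<close>

lemma groth_sum_longest:
  "groth_sum k (longest k) =
    (\<Prod>(i, j)\<in>{(i, j). 1 \<le> i \<and> 1 \<le> j \<and> i + j \<le> k}. 1 - letter (Z i) * inv_letter (Zd j))"
proof -
  interpret dominant k "\<lambda>p. k - p" by standard auto
  have "dom_perm = longest k"
  proof (rule ascent_or_longest[OF dom_perm_permutes])
    fix i assume i: "1 \<le> i" "i < k"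
    have *: "k - p < dom_perm p" if "1 \<le> p" "p \<le> k" for p using dom_perm_above that by auto
    show "dom_perm (Suc i) \<le> dom_perm i"
    proof (rule ccontr)
      assume "\<not> dom_perm (Suc i) \<le> dom_perm i"
      then have "k - i < dom_perm i" "k - i < dom_perm (Suc i)" "dom_perm i < dom_perm (Suc i)"
        using *[of i] i by auto
      \<comment> \<open>Earlier rows have taken larger values, so the smallest value above
        \<open>lam p\<close> = k - p is still free in row p.\<close>
      have "dom_perm p = Suc k - p" if "1 \<le> p" "p \<le> k" for p
        using that
      proof (induction p rule: less_induct)
        case (less p)
        show ?case
        proof (rule ccontr)
          assume ne: "dom_perm p \<noteq> Suc k - p"
          then have gt: "Suc k - p < dom_perm p" using *[of p] less.prems by auto
          then obtain p' where p': "1 \<le> p'" "p' < p" "dom_perm p' = Suc k - p"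
            using dom_perm_greedy[of p "Suc k - p"] less.prems by (auto simp: Suc_diff_le)
          then show False using less.IH[of p'] less.prems by auto
        qed
      qed
      from this[of i] this[of "Suc i"] i \<open>dom_perm i < dom_perm (Suc i)\<close> show False by auto
    qed
  qed
  moreover have Y: "young k (\<lambda>p. k - p) = {(i, j). 1 \<le> i \<and> 1 \<le> j \<and> i + j \<le> k}"
    by (auto simp: young_def)
  ultimately have 1: "perm_length (longest k) = card {(i, j). 1 \<le> i \<and> 1 \<le> j \<and> i + j \<le> k}"
    and 2: "kp {} a b k (longest k) = (\<Prod>(p, q)\<in>{(i, j). 1 \<le> i \<and> 1 \<le> j \<and> i + j \<le> k}. a p * b q - 1)"
    for a b :: "nat \<Rightarrow> zletter laurent"
    using perm_length_dom_perm kp_dom_perm[of a b] kp_factor[OF dom_perm_permutes dom_perm_above, of a b] by auto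
  have neg: "(- 1) ^ card A * (\<Prod>x\<in>A. f x) = (\<Prod>x\<in>A. - f x)" for f :: "nat \<times> nat \<Rightarrow> zletter laurent" and A
    by (simp add: prod_uminus)
  show ?thesis
    unfolding groth_sum_def 1 2 neg by (intro prod.cong) auto
qed

text \<open>Both rules lead to the pipe dream sum in a grid that is large enough, and sums for
  different sizes agree by \<open>groth_sum_enlarge\<close>.\<close>

lemma is_grothendieck_unique:
  assumes "is_grothendieck v f" "v permutes {1..d}"
  shows "f = groth_sum d v"
proof -
  have "\<exists>k. v permutes {1..k} \<and> f = groth_sum k v"
    using assms(1)
  proof (induction rule: is_grothendieck.induct)
    case (top k)
    then show ?case using groth_sum_longest longest_permutes by metis
  next
    case (step v f i)
    then obtain k where k: "v permutes {1..k}" "f = groth_sum k v" by blast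
    let ?k = "max k (Suc i)"
    have k': "v permutes {1..?k}" by (rule permutes_subset[OF k(1)]) auto
    have f: "f = groth_sum ?k v" using groth_sum_enlarge[OF k(1), of ?k] k(2) by simp
    have "v (Suc i) < v i"
      using step.hyps perm_length_less_iff(2) k(1) by (metis permutation_permutes finite_atLeastAtMost)
    then have "demazure_op i f = groth_sum ?k (v \<circ> adj i)"
      unfolding f by (intro demazure_op_groth_sum[OF k']) (use step.hyps in auto)
    moreover have "v \<circ> adj i permutes {1..?k}"
      by (intro permutes_compose adj_permutes k') (use step.hyps in auto)
    ultimately show ?case by blast
  qed
  then obtain k where k: "v permutes {1..k}" "f = groth_sum k v" by blast
  then show ?thesis
    using groth_sum_enlarge[OF k(1), of "max k d"] groth_sum_enlarge[OF assms(2), of "max k d"] by simp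
qed

lemma grothendieck_eq:
  assumes "v permutes {1..d}"
  shows "grothendieck v = groth_sum d v"
  unfolding grothendieck_def
  using is_grothendieck_exists[OF assms] is_grothendieck_unique[OF _ assms]
  by (metis the_equality)

lemma at_alphabets_grothendieck:
  assumes "v permutes {1..d}"
  shows "at_alphabets (grothendieck v) xs ys =
    (- 1) ^ perm_length v * kp {} (\<lambda>p. lval (nth_letter xs p)) (\<lambda>q. ilval (nth_letter ys q)) d v"
  unfolding grothendieck_eq[OF assms] at_alphabets_def groth_sum_def
  by (simp add: subst_laurent_mult subst_laurent_power subst_laurent_uminus subst_kp subst_letter)

section \<open>Minimal completions of partial permutations\<close>

text \<open>This describes the minimal completions of k by l partial permutations intrinsically, see
  \<open>completion_props\<close> and \<open>nice_completion\<close>.\<close>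

definition nice :: "nat \<Rightarrow> nat \<Rightarrow> (nat \<Rightarrow> nat) \<Rightarrow> bool" where
  "nice k l v \<longleftrightarrow> v \<in> S_inf \<and> (\<forall>i>k. v i < v (Suc i)) \<and> (\<forall>j>l. inv v j < inv v (Suc j))"

lemma S_inf_permutation: "v \<in> S_inf \<Longrightarrow> permutation v"
  unfolding S_inf_def by (auto intro: permutation_permutes[THEN iffD2])

lemma S_inf_0: "v \<in> S_inf \<Longrightarrow> v 0 = 0"
  unfolding S_inf_def by (auto intro: permutes_not_in)

lemma S_inf_inv: "v \<in> S_inf \<Longrightarrow> inv v \<in> S_inf"
  unfolding S_inf_def using permutes_inv by blast

lemma S_inf_inv_apply: "v \<in> S_inf \<Longrightarrow> v (inv v x) = x" "v \<in> S_inf \<Longrightarrow> inv v (v x) = x"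
  unfolding S_inf_def by (auto simp: permutes_inverses)

lemma nice_inv: "nice k l v \<Longrightarrow> nice l k (inv v)"
proof -
  assume v: "nice k l v"
  then have "inv (inv v) = v"
    unfolding nice_def by (metis S_inf_permutation permutation inv_inv_eq)
  then show ?thesis using v S_inf_inv unfolding nice_def by auto
qed

lemma nice_less: "nice k l v \<Longrightarrow> k < i \<Longrightarrow> i < i' \<Longrightarrow> v i < v i'"
proof (induction i' rule: nat_induct)
  case (Suc i')
  then show ?case unfolding nice_def by (metis less_SucE less_trans)
qed simp

text \<open>An excess v p > p would persist along the increasing tail, but far out \<open>v\<close>
  is the identity.\<close>

lemma nice_le: "nice k l v \<Longrightarrow> k < p \<Longrightarrow> v p \<le> p"
proof (rule ccontr)
  assume v: "nice k l v" and p: "k < p" and *: "\<not> v p \<le> p"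
  obtain N where N: "v permutes {1..N}" using v unfolding nice_def S_inf_def by auto
  have less: "p + t < v (p + t)" for t
  proof (induction t)
    case (Suc t)
    then show ?case using nice_less[OF v, of "p + t" "p + Suc t"] p by auto
  qed (use * in simp)
  have "v (p + N) = p + N" by (rule permutes_not_in[OF N]) (use p in auto)
  then show False using less[of N] by simp
qed

text \<open>The p - k positions after k up to p have distinct positive values of size at most v p.
  Hence l < v p, and \<open>nice_le\<close> applies to the inverse at v p.\<close>

lemma nice_ge: 
  assumes v: "nice k l v" and p: "k + l < p"
  shows "p \<le> v p"
proof -
  have S: "v \<in> S_inf" using v by (simp add: nice_def)
  have inj: "inj v" using permutation_inj_on[OF S_inf_permutation[OF S]] .
  have "v ` {k<..p} \<subseteq> {1..v p}"
  proof
    fix y assume "y \<in> v ` {k<..p}"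
    then obtain x where x: "y = v x" "k < x" "x \<le> p" by auto
    have "v x \<noteq> 0" using inj S_inf_0[OF S] x by (metis injD less_nat_zero_code)
    moreover have "v x \<le> v p" using nice_less[OF v, of x p] x by (cases "x = p") auto
    ultimately show "y \<in> {1..v p}" using x by auto
  qed
  then have "card (v ` {k<..p}) \<le> card {1..v p}" by (intro card_mono) auto
  also have "card (v ` {k<..p}) = p - k" using inj by (simp add: card_image inj_on_subset)
  finally have "l < v p" using p by simp
  then have "inv v (v p) \<le> v p" using nice_le[OF nice_inv[OF v]] by blast
  then show ?thesis by (simp add: S_inf_inv_apply[OF S])
qed

lemma nice_permutes:
  assumes "nice k l v"
  shows "v permutes {1..k + l}"
proof -
  have S: "v \<in> S_inf" using assms by (simp add: nice_def)
  have "v x = x" if "x \<notin> {1..k + l}" for x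
  proof (cases "x = 0")
    case False
    then have "k + l < x" using that by auto
    then show ?thesis using nice_ge[OF assms] nice_le[OF assms] by (simp add: antisym)
  qed (simp add: S_inf_0[OF S])
  moreover obtain N where "v permutes {1..N}" using S unfolding S_inf_def by auto
  ultimately show ?thesis by (auto simp: permutes_def)
qed

text \<open>At the first difference a, say v a < u a, the value v a occurs in \<open>u\<close> only
  at some later position b. Since \<open>u\<close> increases beyond k, a <= k, and as the corners
  agree, v a > l. But then the inverse of \<open>u\<close> increases from v a to u a, which gives b
  < a.\<close>

lemma nice_unique:
  assumes u: "nice k l u" and v: "nice k l v"
    and eq: "\<And>p q. p \<in> {1..k} \<Longrightarrow> q \<in> {1..l} \<Longrightarrow> u p = q \<longleftrightarrow> v p = q"
  shows "u = v"
proof -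
  have main: False if u: "nice k l u" and v: "nice k l v"
    and eq: "\<And>p q. p \<in> {1..k} \<Longrightarrow> q \<in> {1..l} \<Longrightarrow> u p = q \<longleftrightarrow> v p = q"
    and before: "\<And>b. b < a \<Longrightarrow> u b = v b" and less: "v a < u a" for u v a
  proof -
    have Su: "u \<in> S_inf" and Sv: "v \<in> S_inf" using u v by (simp_all add: nice_def)
    define b where "b = inv u (v a)"
    have ub: "u b = v a" by (simp add: b_def S_inf_inv_apply[OF Su])
    have "\<not> b < a"
    proof
      assume "b < a"
      then have "v b = v a" using before ub by simp
      then have "b = a" using permutation_inj_on[OF S_inf_permutation[OF Sv]] by (auto dest: injD)
      then show False using \<open>b < a\<close> by simp
    qed
    moreover have "b \<noteq> a" using ub less by auto
    ultimately have ab: "a < b" by simp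
    show False
    proof (cases "k < a")
      case True
      then show False using nice_less[OF u True ab] ub less by simp
    next
      case False
      have a0: "a \<noteq> 0"
      proof
        assume "a = 0"
        then show False using less S_inf_0[OF Su] S_inf_0[OF Sv] by simp
      qed
      have "v a \<noteq> 0" using a0 S_inf_0[OF Sv] permutation_inj_on[OF S_inf_permutation[OF Sv]] by (metis injD)
      then have l: "l < v a" using eq[of a "v a"] False a0 less by (cases "v a \<le> l") auto
      then have "inv u (v a) < inv u (u a)" using nice_less[OF nice_inv[OF u]] less by blast
      then show False using ab by (simp add: S_inf_inv_apply[OF Su] b_def)
    qed
  qed
  show ?thesis
  proof
    fix a show "u a = v a"
    proof (induction a rule: less_induct)
      case (less a)
      show ?case
      proof (rule ccontr)
        assume "u a \<noteq> v a"
        then consider "v a < u a" | "u a < v a" by linarith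
        then show False
        proof cases
          case 1
          show False by (rule main[OF u v eq less 1])
        next
          case 2
          show False by (rule main[OF v u eq[symmetric] less[symmetric] 2])
        qed
      qed
    qed
  qed
qed

lemma perm_length_inv:
  assumes "permutation v"
  shows "perm_length (inv v) = perm_length v"
proof -
  have b: "bij v" using assms by (simp add: permutation)
  have i1: "v (inv v x) = x" "inv v (v x) = x" for x
    using b by (simp_all add: bij_is_surj surj_f_inv_f bij_is_inj)
  have "bij_betw (\<lambda>(p, q). (v q, v p)) {(p, q). p < q \<and> v q < v p} {(p, q). p < q \<and> inv v q < inv v p}"
    by (rule bij_betw_byWitness[where f' = "\<lambda>(p, q). (inv v q, inv v p)"]) (auto simp: i1)
  then show ?thesis unfolding perm_length_def by (simp add: bij_betw_same_card)
qed

lemma completions_nonempty: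
  assumes w: "w \<in> partial_perms k l"
  shows "\<exists>v. v \<in> completions k l w"
proof -
  have sub: "w \<subseteq> {1..k} \<times> {1..l}"
    and fn: "\<And>p q q'. (p, q) \<in> w \<Longrightarrow> (p, q') \<in> w \<Longrightarrow> q = q'"
    and inj: "\<And>p p' q. (p, q) \<in> w \<Longrightarrow> (p', q) \<in> w \<Longrightarrow> p = p'"
    using w unfolding partial_perms_def by blast+
  \<comment> \<open>The block matrix with \<open>w\<close> and its transpose on the diagonal; the
    blocks off the diagonal contain unit entries for the empty rows and the empty columns of
    \<open>w\<close>.\<close>
  define v where "v x = (if x \<in> {1..k} then (if \<exists>q. (x, q) \<in> w then THE q. (x, q) \<in> w else l + x)
      else if x \<in> {k<..k + l} then (if \<exists>p. (p, x - k) \<in> w then l + (THE p. (p, x - k) \<in> w) else x - k)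
      else x)" for x
  have v1: "v p = q" if "(p, q) \<in> w" for p q
    using that sub fn by (auto simp: v_def)
  have v2: "v p = l + p" if "p \<in> {1..k}" "\<nexists>q. (p, q) \<in> w" for p
    using that by (auto simp: v_def)
  have v3: "v (k + q) = l + p" if "(p, q) \<in> w" for p q
  proof -
    have "(THE p. (p, q) \<in> w) = p" using that inj by blast
    moreover have "q \<in> {1..l}" using that sub by auto
    ultimately show ?thesis using that by (auto simp: v_def)
  qed
  have v4: "v (k + q) = q" if "q \<in> {1..l}" "\<nexists>p. (p, q) \<in> w" for q
    using that by (auto simp: v_def)
  have cases: "P x" if "x \<in> {1..k + l}" "\<And>p q. (p, q) \<in> w \<Longrightarrow> P p" "\<And>p. p \<in> {1..k} \<Longrightarrow> \<nexists>q. (p, q) \<in> w \<Longrightarrow> P p"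
    "\<And>p q. (p, q) \<in> w \<Longrightarrow> P (k + q)" "\<And>q. q \<in> {1..l} \<Longrightarrow> \<nexists>p. (p, q) \<in> w \<Longrightarrow> P (k + q)" for P x
  proof (cases "x \<le> k")
    case True
    then show ?thesis using that(1) that(2)[of x] that(3)[of x] by auto
  next
    case False
    then have "x = k + (x - k)" "x - k \<in> {1..l}" using that(1) by auto
    then show ?thesis using that(4)[of _ "x - k"] that(5)[of "x - k"] by metis
  qed
  have "v ` {1..k + l} = {1..k + l}"
  proof (rule card_subset_eq)
    show fin: "finite {1..k + l}" by simp
    show "v ` {1..k + l} \<subseteq> {1..k + l}"
    proof
      fix y assume "y \<in> v ` {1..k + l}"
      then obtain x where x: "x \<in> {1..k + l}" "y = v x" by auto
      have "v x \<in> {1..k + l}"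
        by (rule cases[OF x(1)]) (use sub in \<open>auto simp: v1 v2 v3 v4\<close>)
      then show "y \<in> {1..k + l}" using x by simp
    qed
    have "{1..k + l} \<subseteq> v ` {1..k + l}"
    proof
      fix y assume y: "y \<in> {1..k + l}"
      show "y \<in> v ` {1..k + l}"
      proof (cases "y \<le> l")
        case True
        show ?thesis
        proof (cases "\<exists>p. (p, y) \<in> w")
          case True
          then obtain p where "(p, y) \<in> w" by blast
          then show ?thesis using v1[of p y] sub by (intro image_eqI[of _ _ p]) auto
        next
          case False
          then show ?thesis using v4[of y] y True by (intro image_eqI[of _ _ "k + y"]) auto
        qed
      next
        case False
        define p where "p = y - l"
        have p: "y = l + p" "p \<in> {1..k}" using y False by (auto simp: p_def)
        show ?thesis
        proof (cases "\<exists>q. (p, q) \<in> w")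
          case True
          then obtain q where "(p, q) \<in> w" by blast
          then show ?thesis using v3[of p q] sub p by (intro image_eqI[of _ _ "k + q"]) auto
        next
          case False
          then show ?thesis using v2[of p] p by (intro image_eqI[of _ _ p]) auto
        qed
      qed
    qed
    then have "card {1..k + l} \<le> card (v ` {1..k + l})" by (intro card_mono) auto
    then show "card (v ` {1..k + l}) = card {1..k + l}"
      using card_image_le[OF fin, of v] by simp
  qed
  then have "v permutes {1..k + l}"
    by (intro bij_imp_permutes) (auto simp: bij_betw_def v_def intro!: eq_card_imp_inj_on)
  moreover have "v p = q \<longleftrightarrow> (p, q) \<in> w" if "p \<in> {1..k}" "q \<in> {1..l}" for p q
    using v1[of p] v2[of p] that by (cases "\<exists>q. (p, q) \<in> w") fastforce+
  ultimately have "v \<in> completions k l w" unfolding completions_def S_inf_def by blast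
  then show ?thesis by blast
qed

text \<open>A descent beyond row k, or one of the inverse beyond column l, could be removed without
  changing the k by l corner.\<close>

lemma minimal_completion_nice:
  assumes v: "v \<in> completions k l w" and min: "\<And>u. u \<in> completions k l w \<Longrightarrow> perm_length v \<le> perm_length u"
  shows "nice k l v"
proof -
  have S: "v \<in> S_inf" and pat: "\<forall>p\<in>{1..k}. \<forall>q\<in>{1..l}. v p = q \<longleftrightarrow> (p, q) \<in> w"
    using v by (auto simp: completions_def)
  have pv: "permutation v" by (rule S_inf_permutation[OF S])
  obtain N where N: "v permutes {1..N}" using S unfolding S_inf_def by auto
  have adjS: "adj i permutes {1..max N (Suc i)}" if "1 \<le> i" for i using that by (intro adj_permutes) auto
  have NS: "v permutes {1..max N (Suc i)}" for i by (rule permutes_subset[OF N]) auto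
  have inj: "inj v" by (rule permutation_inj_on[OF pv])
  have 1: "v i < v (Suc i)" if i: "i > k" for i
  proof (rule ccontr)
    assume "\<not> v i < v (Suc i)"
    then have "v (Suc i) < v i" using injD[OF inj, of i "Suc i"] by (metis n_not_Suc_n nat_neq_iff)
    then have "perm_length (v \<circ> adj i) < perm_length v" using perm_length_less_iff[OF pv] by blast
    moreover have "v \<circ> adj i \<in> completions k l w"
    proof -
      have "v \<circ> adj i permutes {1..max N (Suc i)}" using permutes_compose[OF adjS NS] i by auto
      then show ?thesis unfolding completions_def S_inf_def using i pat by (auto simp: adj_other)
    qed
    ultimately show False using min by fastforce
  qed
  have 2: "inv v j < inv v (Suc j)" if j: "j > l" for j
  proof (rule ccontr)
    assume *: "\<not> inv v j < inv v (Suc j)"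
    have pi: "permutation (inv v)" using S_inf_permutation[OF S_inf_inv[OF S]] .
    have "inv v j \<noteq> inv v (Suc j)" using permutation_inj_on[OF pi] by (metis injD n_not_Suc_n)
    then have "perm_length (inv v \<circ> adj j) < perm_length (inv v)"
      using * perm_length_less_iff(2)[OF pi] by auto
    also have "inv v \<circ> adj j = inv (adj j \<circ> v)"
      using pv by (simp add: o_inv_distrib permutation)
    finally have "perm_length (adj j \<circ> v) < perm_length v"
      using pv by (simp add: perm_length_inv permutation_compose)
    moreover have "adj j \<circ> v \<in> completions k l w"
    proof -
      have "adj j \<circ> v permutes {1..max N (Suc j)}" using permutes_compose[OF NS adjS] j by auto
      moreover have "adj j x = q \<longleftrightarrow> x = q" if "q \<in> {1..l}" for x q
        using that j by (auto simp: adj_apply)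
      ultimately show ?thesis unfolding completions_def S_inf_def using pat by auto
    qed
    ultimately show False using min by fastforce
  qed
  show ?thesis unfolding nice_def using S 1 2 by blast
qed

lemma completion_unique:
  assumes "w \<in> partial_perms k l"
  obtains v where "completion k l w = v" "v \<in> completions k l w" "nice k l v"
    "\<And>u. u \<in> completions k l w \<Longrightarrow> nice k l u \<Longrightarrow> u = v"
proof -
  obtain v0 where "v0 \<in> completions k l w" using completions_nonempty[OF assms] by blast
  then obtain v where v: "v \<in> completions k l w" "\<forall>u. u \<in> completions k l w \<longrightarrow> perm_length v \<le> perm_length u"
    using ex_has_least_nat[of "\<lambda>v. v \<in> completions k l w" v0 perm_length] by blast
  have nv: "nice k l v" using minimal_completion_nice v by blast
  have eq: "u = v" if "u \<in> completions k l w" "nice k l u" for u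
    by (rule nice_unique[OF that(2) nv]) (use that(1) v(1) in \<open>auto simp: completions_def\<close>)
  have "completion k l w = v"
    unfolding completion_def
    by (rule the_equality) (use v eq minimal_completion_nice in blast)+
  then show thesis using that v nv eq by blast
qed

lemma completion_eqI:
  "w \<in> partial_perms k l \<Longrightarrow> v \<in> completions k l w \<Longrightarrow> nice k l v \<Longrightarrow> completion k l w = v"
  by (metis completion_unique)

lemma completion_props:
  assumes "w \<in> partial_perms k l"
  shows "completion k l w \<in> completions k l w" "nice k l (completion k l w)"
  using completion_unique[OF assms] by metis+

lemma nice_completion:
  assumes "nice k l v"
  shows "{(p, v p) | p. p \<in> {1..k} \<and> v p \<in> {1..l}} \<in> partial_perms k l"
    "completion k l {(p, v p) | p. p \<in> {1..k} \<and> v p \<in> {1..l}} = v"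
proof -
  have S: "v \<in> S_inf" using assms by (simp add: nice_def)
  have inj: "inj v" using permutation_inj_on[OF S_inf_permutation[OF S]] .
  show w: "{(p, v p) | p. p \<in> {1..k} \<and> v p \<in> {1..l}} \<in> partial_perms k l"
    unfolding partial_perms_def using injD[OF inj] by auto
  show "completion k l {(p, v p) | p. p \<in> {1..k} \<and> v p \<in> {1..l}} = v"
    by (rule completion_eqI[OF w _ assms]) (use S in \<open>auto simp: completions_def\<close>)
qed

lemma completion_inject:
  assumes "w \<in> partial_perms k l" "w' \<in> partial_perms k l" "completion k l w = completion k l w'"
  shows "w = w'"
proof -
  have "w = {(p, q). p \<in> {1..k} \<and> q \<in> {1..l} \<and> completion k l w p = q}" if "w \<in> partial_perms k l" for w
  proof -
    have "\<forall>p\<in>{1..k}. \<forall>q\<in>{1..l}. completion k l w p = q \<longleftrightarrow> (p, q) \<in> w" "w \<subseteq> {1..k} \<times> {1..l}"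
      using completion_props(1)[OF that] that unfolding completions_def partial_perms_def by auto
    then have "\<And>p q. p \<in> {1..k} \<Longrightarrow> q \<in> {1..l} \<Longrightarrow> completion k l w p = q \<longleftrightarrow> (p, q) \<in> w" by blast
    then show ?thesis using \<open>w \<subseteq> {1..k} \<times> {1..l}\<close> by fastforce
  qed
  from this[OF assms(1)] this[OF assms(2)] assms(3) show ?thesis by simp
qed

definition shift_perm :: "nat \<Rightarrow> (nat \<Rightarrow> nat) \<Rightarrow> (nat \<Rightarrow> nat)" where
  "shift_perm m v x = (if x \<le> m then x else m + v (x - m))"

lemma shift_perm_inv:
  assumes "v \<in> S_inf"
  shows "shift_perm m v \<in> S_inf" "inv (shift_perm m v) = shift_perm m (inv v)"
proof -
  note i = S_inf_inv_apply[OF assms]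
  have v0: "x \<noteq> 0 \<Longrightarrow> v x \<noteq> 0" "x \<noteq> 0 \<Longrightarrow> inv v x \<noteq> 0" for x
    using i S_inf_0[OF assms] S_inf_0[OF S_inf_inv[OF assms]] by metis+
  have 1: "shift_perm m v (shift_perm m (inv v) x) = x" "shift_perm m (inv v) (shift_perm m v x) = x" for x
    using v0[of "x - m"] by (auto simp: shift_perm_def i)
  then show "inv (shift_perm m v) = shift_perm m (inv v)"
    by (intro inv_equality) auto
  have b: "bij (shift_perm m v)"
    by (rule o_bij[of "shift_perm m (inv v)"]) (simp_all add: fun_eq_iff 1)
  obtain N where N: "v permutes {1..N}" using assms unfolding S_inf_def by auto
  have "shift_perm m v x = x" if "x \<notin> {1..m + N}" for x
  proof (cases "x \<le> m")
    case False
    then have "x - m \<notin> {1..N}" using that by auto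
    then have "v (x - m) = x - m" by (rule permutes_not_in[OF N])
    then show ?thesis using False by (simp add: shift_perm_def)
  qed (simp add: shift_perm_def)
  then have "shift_perm m v permutes {1..m + N}"
    using b unfolding permutes_def by (metis bij_pointE)
  then show "shift_perm m v \<in> S_inf" unfolding S_inf_def by blast
qed

lemma nice_shift:
  assumes "nice k l v"
  shows "nice (m + k) (m + l) (shift_perm m v)"
proof -
  have S: "v \<in> S_inf" using assms by (simp add: nice_def)
  have "shift_perm m u i < shift_perm m u (Suc i)" if "\<forall>i>k. u i < u (Suc i)" "m + k < i" for u k i
    using that(1)[rule_format, of "i - m"] that(2) by (auto simp: shift_perm_def Suc_diff_le)
  then show ?thesis
    unfolding nice_def shift_perm_inv(2)[OF S] using assms shift_perm_inv(1)[OF S] unfolding nice_def by blast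
qed

lemma completion_shift:
  assumes w: "w \<in> partial_perms k l"
  shows "shift_pp m w \<in> partial_perms (m + k) (m + l)"
    "completion (m + k) (m + l) (shift_pp m w) = shift_perm m (completion k l w)"
proof -
  let ?v = "completion k l w"
  have v: "?v \<in> S_inf" "\<forall>p\<in>{1..k}. \<forall>q\<in>{1..l}. ?v p = q \<longleftrightarrow> (p, q) \<in> w" "nice k l ?v"
    using completion_props[OF w] by (auto simp: completions_def)
  have sub: "w \<subseteq> {1..k} \<times> {1..l}" using w by (auto simp: partial_perms_def)
  show s: "shift_pp m w \<in> partial_perms (m + k) (m + l)"
    using w unfolding partial_perms_def shift_pp_def by (auto 0 4)
  have v0: "x \<noteq> 0 \<Longrightarrow> ?v x \<noteq> 0" for x
    using S_inf_0[OF v(1)] S_inf_inv_apply[OF v(1)] by metis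
  have "shift_perm m ?v p = q \<longleftrightarrow> (p, q) \<in> shift_pp m w" if "p \<in> {1..m + k}" "q \<in> {1..m + l}" for p q
  proof (cases "p \<le> m")
    case True
    then show ?thesis using that sub by (auto simp: shift_perm_def shift_pp_def)
  next
    case False
    define p' where "p' = p - m"
    have p: "p = m + p'" "p' \<in> {1..k}" using False that by (auto simp: p'_def)
    show ?thesis
    proof (cases "q \<le> m")
      case True
      then show ?thesis using p v0[of p'] sub by (auto simp: shift_perm_def shift_pp_def)
    next
      case False
      define q' where "q' = q - m"
      have q: "q = m + q'" "q' \<in> {1..l}" using False that by (auto simp: q'_def)
      show ?thesis using p q v(2) by (auto simp: shift_perm_def shift_pp_def)
    qed
  qed
  then have "shift_perm m ?v \<in> completions (m + k) (m + l) (shift_pp m w)"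
    using shift_perm_inv(1)[OF v(1)] by (simp add: completions_def)
  then show "completion (m + k) (m + l) (shift_pp m w) = shift_perm m ?v"
    by (rule completion_eqI[OF s _ nice_shift[OF v(3)]])
qed

lemma perm_length_shift:
  assumes "v \<in> S_inf"
  shows "perm_length (shift_perm m v) = perm_length v"
proof -
  have v0: "v 0 = 0" "x \<noteq> 0 \<Longrightarrow> v x \<noteq> 0" for x
    using S_inf_0[OF assms] S_inf_inv_apply[OF assms] by metis+
  have "bij_betw (map_prod ((+) m) ((+) m)) {(p, q). p < q \<and> v q < v p}
      {(p, q). p < q \<and> shift_perm m v q < shift_perm m v p}"
  proof (rule bij_betw_byWitness[where f' = "map_prod (\<lambda>x. x - m) (\<lambda>x. x - m)"])
    show "map_prod ((+) m) ((+) m) ` {(p, q). p < q \<and> v q < v p} \<subseteq>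
        {(p, q). p < q \<and> shift_perm m v q < shift_perm m v p}"
      using v0 by (auto simp: shift_perm_def)
    show "map_prod (\<lambda>x. x - m) (\<lambda>x. x - m) ` {(p, q). p < q \<and> shift_perm m v q < shift_perm m v p} \<subseteq>
        {(p, q). p < q \<and> v q < v p}"
      by (auto simp: shift_perm_def split: if_splits)
  qed (auto simp: shift_perm_def split: if_splits)
  then show ?thesis unfolding perm_length_def by (simp add: bij_betw_same_card)
qed

text \<open>The letter 0 is excluded because its shift would act across the border between the m
  fixed points and \<open>v\<close>.\<close>

lemma demazure_shift:
  assumes "0 \<notin> set w"
  shows "word_demazure (map ((+) m) w) = shift_perm m (word_demazure w)"
  using assms
proof (induction w rule: rev_induct)
  case Nil
  then show ?case by (auto simp: word_demazure_rops shift_perm_def)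
next
  case (snoc i w)
  let ?u = "word_demazure w"
  have i: "i \<noteq> 0" using snoc.prems by auto
  have "rop (shift_perm m ?u) (m + i) = shift_perm m (rop ?u i)"
    using i by (auto simp: rop_apply shift_perm_def min_def max_def fun_eq_iff)
  then show ?case using snoc by (simp add: demazure_snoc)
qed

section \<open>Stable double Grothendieck polynomials\<close>

text \<open>If there were crosses below row k, the last letter of the word would exceed k and cause
  a descent there. For the columns the grid is read with the columns beyond l first, so that the
  first letter exceeds l and causes a left descent.\<close>

lemma nice_pipe_dream_subset:
  assumes v: "nice k l v" and P: "P \<subseteq> {1..N} \<times> {1..M}" "pipe_demazure N M P = v"
  shows "P \<subseteq> {1..k} \<times> {1..l}"
proof
  fix x assume x: "x \<in> P"
  obtain p q where pq: "x = (p, q)" by (cases x)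
  have b: "1 \<le> p" "p \<le> N" "1 \<le> q" "q \<le> M" using P x pq by auto
  have "p \<le> k"
  proof (rule ccontr)
    assume p: "\<not> p \<le> k"
    let ?rest = "concat (map (\<lambda>i. map (\<lambda>j. i + j - 1) (filter (\<lambda>j. (i, j) \<in> P) (rev [1..<Suc M]))) [Suc k..<Suc N])"
    have "[1..<Suc N] = [1..<Suc k] @ [Suc k..<Suc N]"
      using p b upt_add_eq_append[of 1 "Suc k" "N - k"] by simp
    then have e: "pipe_word N M P = pipe_word k M P @ ?rest" unfolding pipe_word_def by (simp del: upt_Suc)
    define rest where "rest = ?rest"
    have "p + q - 1 \<in> set rest"
      unfolding rest_def set_concat set_map image_image
      by (rule UN_I[of p]) (use p b x pq in \<open>auto simp del: upt_Suc intro: image_eqI[of _ _ q]\<close>)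
    then have "rest \<noteq> []" by auto
    then obtain w i where w: "rest = w @ [i]" by (metis append_butlast_last_id)
    then have "i \<in> set rest" by simp
    then have "k < i" unfolding rest_def by (auto simp del: upt_Suc)
    moreover have "v (Suc i) < v i"
      using demazure_snoc_descent[of "pipe_word k M P @ w" i] P e[folded rest_def] w by (simp add: pipe_demazure_def)
    ultimately show False using v unfolding nice_def by (meson less_asym)
  qed
  moreover have "q \<le> l"
  proof (rule ccontr)
    assume q: "\<not> q \<le> l"
    let ?E = "\<lambda>p q. if (p, q) \<in> P then hgen (p + q - 1) else 1"
    let ?S = "{(p, q). (p, l + q) \<in> P}"
    let ?w = "map (\<lambda>(p, q). p + (l + q) - 1) (filter (\<lambda>x. x \<in> ?S) (boxes N (M - l)))"
    have "hword (pipe_word N M P) = grid N (l + (M - l)) ?E"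
      using q b by (simp add: hword_pipe_word)
    also have "\<dots> = grid N (M - l) (\<lambda>p q. ?E p (l + q)) * grid N l ?E"
      by (rule grid_add_cols) (auto intro: hgen_commute)
    also have "grid N (M - l) (\<lambda>p q. ?E p (l + q)) = hword ?w"
    proof -
      show ?thesis unfolding grid_def hword_filter
        by (rule arg_cong[where f = prod_list], rule map_cong) auto
    qed
    also have "grid N l ?E = hword (pipe_word N l P)" by (rule hword_pipe_word[symmetric])
    finally have e: "word_demazure (pipe_word N M P) = word_demazure (?w @ pipe_word N l P)"
      by (simp only: hword_append(2)[symmetric] hword_eq_iff)
    have "(p, q - l) \<in> set (filter (\<lambda>x. x \<in> ?S) (boxes N (M - l)))" using q b x pq by (auto simp: set_boxes)
    then have "?w \<noteq> []" by (metis empty_iff list.set(1) map_is_Nil_conv)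
    then obtain i w where w: "?w = i # w" by (metis list.exhaust)
    then have "i \<in> set ?w" by simp
    then have "l < i" by (auto simp: set_boxes)
    moreover have "inv v (Suc i) < inv v i"
      using demazure_Cons_left_descent[of i "w @ pipe_word N l P"] P e w by (simp add: pipe_demazure_def)
    ultimately show False using v unfolding nice_def by (meson less_asym)
  qed
  ultimately show "x \<in> {1..k} \<times> {1..l}" using b pq by simp
qed

definition rect_sum :: "nat \<Rightarrow> nat \<Rightarrow> (nat \<Rightarrow> 'a) \<Rightarrow> (nat \<Rightarrow> 'a) \<Rightarrow> (nat \<Rightarrow> nat) \<Rightarrow> 'a::comm_ring_1" where
  "rect_sum k l a b v = (\<Sum>P | P \<subseteq> {1..k} \<times> {1..l} \<and> pipe_demazure k l P = v. \<Prod>(p, q)\<in>P. a p * b q - 1)"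

lemma rect_sum_pd_sum: "rect_sum k l a b v = pd_sum k l (\<lambda>_. 1) (\<lambda>x. a (fst x) * b (snd x) - 1) v"
  unfolding rect_sum_def pd_sum_def
proof (rule sum.cong[OF refl])
  fix P assume "P \<in> {P. P \<subseteq> {1..k} \<times> {1..l} \<and> pipe_demazure k l P = v}"
  then have P: "P \<subseteq> {1..k} \<times> {1..l}" by simp
  show "(\<Prod>(p, q)\<in>P. a p * b q - 1) = (\<Prod>x\<in>{1..k} \<times> {1..l}. if x \<in> P then a (fst x) * b (snd x) - 1 else 1)"
    using P by (subst prod.inter_filter[symmetric]) (auto intro!: prod.cong)
qed

lemma kp_rect_sum:
  assumes "nice k l v" "v permutes {1..d}" "k \<le> d" "l \<le> d"
  shows "kp {} a b d v = rect_sum k l a b v"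
  unfolding kp_def rect_sum_pd_sum
  by (subst pd_sum_restrict[of k d l d])
    (use assms nice_pipe_dream_subset in \<open>auto intro!: arg_cong2[where f = "\<lambda>x y. pd_sum k l x y v"]\<close>)

text \<open>Every cross moves one diagonal further, so each letter rises by one while the reading
  order is kept. Row k + 1 is empty before and after, which separates the two kinds of
  motion.\<close>

lemma pipe_word_step:
  assumes P: "P \<subseteq> {1..N} \<times> {1..M}" "k \<le> N" "\<And>q. (Suc k, q) \<notin> P"
  shows "pipe_word (Suc N) (Suc M) ((\<lambda>(p, q). if p \<le> k then (p, Suc q) else (Suc p, q)) ` P) =
    map Suc (pipe_word N M P)"
proof -
  let ?P = "(\<lambda>(p, q). if p \<le> k then (p, Suc q) else (Suc p, q)) ` P"
  let ?row = "\<lambda>M P i. map (\<lambda>j. i + j - 1) (filter (\<lambda>j. (i, j) \<in> P) (rev [1..<Suc M]))"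
  have mem: "(i, j) \<in> ?P \<longleftrightarrow> (i \<le> k \<and> j \<ge> 1 \<and> (i, j - 1) \<in> P) \<or> (i > Suc k \<and> (i - 1, j) \<in> P)" for i j
  proof
    assume "(i, j) \<in> ?P"
    then show "(i \<le> k \<and> j \<ge> 1 \<and> (i, j - 1) \<in> P) \<or> (i > Suc k \<and> (i - 1, j) \<in> P)"
      using P(3) by (auto split: if_splits)
  next
    assume "(i \<le> k \<and> j \<ge> 1 \<and> (i, j - 1) \<in> P) \<or> (i > Suc k \<and> (i - 1, j) \<in> P)"
    then show "(i, j) \<in> ?P"
    proof
      assume "i \<le> k \<and> j \<ge> 1 \<and> (i, j - 1) \<in> P"
      then show ?thesis by (intro image_eqI[of _ _ "(i, j - 1)"]) auto
    next
      assume "i > Suc k \<and> (i - 1, j) \<in> P"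
      then show ?thesis by (intro image_eqI[of _ _ "(i - 1, j)"]) auto
    qed
  qed
  have up: "[1..<Suc (Suc M)] = 1 # map Suc [1..<Suc M]"
    by (simp add: upt_conv_Cons map_Suc_upt del: upt_Suc)
  have row1: "?row (Suc M) ?P i = map Suc (?row M P i)" if "i \<le> k" "i \<in> {1..}" for i
  proof -
    have "filter (\<lambda>j. (i, j) \<in> ?P) (rev [1..<Suc (Suc M)]) = map Suc (filter (\<lambda>j. (i, j) \<in> P) (rev [1..<Suc M]))"
      unfolding up using that subsetD[OF P(1), of "(i, 0)"]
      by (auto simp add: mem filter_map comp_def rev_map simp del: upt_Suc)
    then show ?thesis using that by (simp add: comp_def del: upt_Suc)
  qed
  have row2: "?row (Suc M) ?P (Suc k) = []" by (auto simp: filter_empty_conv mem simp del: upt_Suc)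
  have row3: "?row (Suc M) ?P (Suc i) = map Suc (?row M P i)" if "k < i" for i
  proof -
    have "filter (\<lambda>j. (Suc i, j) \<in> ?P) (rev [1..<Suc (Suc M)]) = filter (\<lambda>j. (i, j) \<in> P) (rev [1..<Suc M])"
      using that P(1) by (auto simp: mem upt_Suc_append intro!: filter_cong simp del: upt_Suc)
    moreover have "map Suc (?row M P i) = map (\<lambda>j. Suc i + j - 1) (filter (\<lambda>j. (i, j) \<in> P) (rev [1..<Suc M]))"
      using that by (auto simp del: upt_Suc)
    ultimately show ?thesis by simp
  qed
  have u1: "[1..<Suc N] = [1..<Suc k] @ [Suc k..<Suc N]"
    using P(2) upt_add_eq_append[of 1 "Suc k" "N - k"] by simp
  have u2: "[1..<Suc (Suc N)] = [1..<Suc k] @ Suc k # map Suc [Suc k..<Suc N]"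
  proof -
    have "[1..<Suc (Suc N)] = [1..<Suc k] @ [Suc k..<Suc (Suc N)]"
      using P(2) upt_add_eq_append[of 1 "Suc k" "Suc N - k"] by (simp add: Suc_diff_le)
    also have "[Suc k..<Suc (Suc N)] = Suc k # map Suc [Suc k..<Suc N]"
      using P(2) by (simp add: upt_conv_Cons map_Suc_upt del: upt_Suc)
    finally show ?thesis .
  qed
  have m1: "map (?row (Suc M) ?P) [1..<Suc k] = map (\<lambda>i. map Suc (?row M P i)) [1..<Suc k]"
    by (rule map_cong[OF refl], rule row1) auto
  have m3: "map (\<lambda>i. ?row (Suc M) ?P (Suc i)) [Suc k..<Suc N] = map (\<lambda>i. map Suc (?row M P i)) [Suc k..<Suc N]"
    by (rule map_cong[OF refl], rule row3) auto
  have "pipe_word (Suc N) (Suc M) ?P = concat (map (?row (Suc M) ?P) [1..<Suc k]) @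
      ?row (Suc M) ?P (Suc k) @ concat (map (\<lambda>i. ?row (Suc M) ?P (Suc i)) [Suc k..<Suc N])"
    unfolding pipe_word_def u2 by (simp only: map_append concat_append list.map concat.simps map_map comp_def)
  also have "\<dots> = map Suc (pipe_word N M P)"
    unfolding m1 m3 row2 pipe_word_def u1 by (simp only: map_append concat_append map_concat map_map comp_def append_Nil)
  finally show ?thesis .
qed

lemma shift_perm_Suc: "shift_perm (Suc m) v = shift_perm 1 (shift_perm m v)"
  by (auto simp: shift_perm_def fun_eq_iff)

lemma shift_perm_1_inject:
  assumes "u 0 = v 0" "shift_perm 1 u = shift_perm 1 v"
  shows "u = v"
proof
  fix x
  have "shift_perm 1 u (Suc x) = shift_perm 1 v (Suc x)" using assms(2) by simp
  then show "u x = v x" using assms(1) by (cases x) (auto simp: shift_perm_def)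
qed

lemma pipe_demazure_permutes: "pipe_demazure N M P permutes {1..N + M}"
  unfolding pipe_demazure_def by (rule demazure_permutes) (auto simp: set_pipe_word)

text \<open>A cross outside of both the first k rows and the first l columns weighs 0. The product
  fixes 1, ..., m, so all letters exceed m >= k + l and the other crosses form two arms: far to the
  right in the first k rows and far down in the first l columns. Moving both arms outwards by one is
  a bijection, and it keeps the weights because the coordinate that moves carries the letter
  1.\<close>

lemma rect_sum_step:
  fixes a b :: "nat \<Rightarrow> 'a::comm_ring_1"
  assumes v: "nice k l v" and m: "k + l \<le> m"
    and a: "\<And>p. k < p \<Longrightarrow> a p = 1" and b: "\<And>q. l < q \<Longrightarrow> b q = 1"
  shows "rect_sum (Suc m + k) (Suc m + l) a b (shift_perm (Suc m) v) =
    rect_sum (m + k) (m + l) a b (shift_perm m v)"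
proof -
  define D where "D = (\<lambda>m. {P. P \<subseteq> {1..m + k} \<times> {1..m + l} \<and> (\<forall>(p, q)\<in>P. p \<le> k \<or> q \<le> l) \<and>
      pipe_demazure (m + k) (m + l) P = shift_perm m v})"
  let ?t = "\<lambda>(p, q). if p \<le> k then (p, Suc q) else (Suc p, q)"
  let ?t' = "\<lambda>(p, q). if p \<le> k then (p, q - 1) else (p - 1, q)"
  have S: "v \<in> S_inf" using v by (simp add: nice_def)
  have rect: "rect_sum (m + k) (m + l) a b (shift_perm m v) = (\<Sum>P\<in>D m. \<Prod>(p, q)\<in>P. a p * b q - 1)" for m
    unfolding rect_sum_def
  proof (rule sum.mono_neutral_right)
    show "finite {P. P \<subseteq> {1..m + k} \<times> {1..m + l} \<and> pipe_demazure (m + k) (m + l) P = shift_perm m v}"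
      by (rule finite_subset[of _ "Pow ({1..m + k} \<times> {1..m + l})"]) auto
    show "\<forall>P\<in>{P. P \<subseteq> {1..m + k} \<times> {1..m + l} \<and> pipe_demazure (m + k) (m + l) P = shift_perm m v} - D m.
        (\<Prod>(p, q)\<in>P. a p * b q - 1) = 0"
    proof
      fix P assume P: "P \<in> {P. P \<subseteq> {1..m + k} \<times> {1..m + l} \<and> pipe_demazure (m + k) (m + l) P = shift_perm m v} - D m"
      then have "\<exists>x\<in>P. \<not> (case x of (p, q) \<Rightarrow> p \<le> k \<or> q \<le> l)" unfolding D_def by blast
      then obtain p q where "(p, q) \<in> P" "\<not> p \<le> k" "\<not> q \<le> l" by auto
      moreover have "finite P" using P finite_subset[of P "{1..m + k} \<times> {1..m + l}"] by auto
      ultimately show "(\<Prod>(p, q)\<in>P. a p * b q - 1) = 0"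
        using a b by (intro prod_zero bexI[of _ "(p, q)"]) auto
    qed
  qed (auto simp: D_def)
  have letter: "m < p + q - 1" if P: "P \<in> D m" and pq: "(p, q) \<in> P" for m P p q
  proof -
    have "shift_perm m v permutes {Suc m..m + (k + l)}"
    proof -
      have "shift_perm m v \<in> S_inf" using shift_perm_inv[OF S] by simp
      then obtain N where N: "shift_perm m v permutes {1..N}" unfolding S_inf_def by auto
      have "shift_perm m v x = x" if "x \<notin> {Suc m..m + (k + l)}" for x
      proof (cases "x \<le> m")
        case False
        then have "x - m \<notin> {1..k + l}" using that by auto
        then have "v (x - m) = x - m" by (rule permutes_not_in[OF nice_permutes[OF v]])
        then show ?thesis using False by (simp add: shift_perm_def)
      qed (simp add: shift_perm_def)
      then show ?thesis using N by (auto simp: permutes_def)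
    qed
    then have "pipe_demazure (m + k) (m + l) P permutes {Suc m..m + (k + l)}" using P by (simp add: D_def)
    from pipe_demazure_letter[OF this pq] show ?thesis using P by (simp add: D_def)
  qed
  have word: "pipe_demazure (Suc m + k) (Suc m + l) (?t ` P) = shift_perm 1 (pipe_demazure (m + k) (m + l) P)"
    if P: "P \<subseteq> {1..m + k} \<times> {1..m + l}" "\<And>q. (Suc k, q) \<notin> P" for P m
  proof -
    have "pipe_word (Suc (m + k)) (Suc (m + l)) (?t ` P) = map ((+) 1) (pipe_word (m + k) (m + l) P)"
      using pipe_word_step[OF P(1) _ P(2)] by simp
    moreover have "0 \<notin> set (pipe_word (m + k) (m + l) P)" by (auto simp: set_pipe_word)
    ultimately show ?thesis unfolding pipe_demazure_def by (simp add: demazure_shift del: One_nat_def)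
  qed
  have no: "(Suc k, q) \<notin> P" if "P \<in> D m" for P q
    using letter[OF that, of "Suc k" q] that m by (fastforce simp: D_def)
  have bij: "bij_betw (image ?t) (D m) (D (Suc m))"
  proof (rule bij_betw_byWitness[where f' = "image ?t'"])
    show "\<forall>P\<in>D m. ?t' ` ?t ` P = P"
    proof
      fix P assume P: "P \<in> D m"
      have "?t' (?t x) = x" if "x \<in> P" for x using that by (auto split: prod.splits)
      then show "?t' ` ?t ` P = P" by (force simp: image_image)
    qed
    have t't: "?t (?t' x) = x" if Q: "Q \<in> D (Suc m)" and x: "x \<in> Q" for Q x
    proof -
      obtain p q where pq: "x = (p, q)" by (cases x)
      have "Suc m < p + q - 1" using letter[OF Q] x pq by simp
      moreover have "p \<le> k \<or> q \<le> l" using Q x pq by (auto simp: D_def)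
      ultimately show ?thesis using m by (auto simp: pq)
    qed
    show "\<forall>Q\<in>D (Suc m). ?t ` ?t' ` Q = Q"
      using t't by (force simp: image_image)
    show "image ?t ` D m \<subseteq> D (Suc m)"
    proof
      fix Q assume "Q \<in> image ?t ` D m"
      then obtain P where P: "P \<in> D m" "Q = ?t ` P" by auto
      have "pipe_demazure (Suc m + k) (Suc m + l) (?t ` P) = shift_perm (Suc m) v"
        using word[of P m] no[OF P(1)] P(1) by (auto simp: D_def shift_perm_Suc simp del: One_nat_def)
      then show "Q \<in> D (Suc m)" using P by (fastforce simp: D_def split: if_splits)
    qed
    show "image ?t' ` D (Suc m) \<subseteq> D m"
    proof
      fix P assume "P \<in> image ?t' ` D (Suc m)"
      then obtain Q where Q: "Q \<in> D (Suc m)" "P = ?t' ` Q" by auto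
      have QP: "?t ` P = Q" unfolding Q(2) using t't[OF Q(1)] by (force simp: image_image)
      have "(case ?t' x of (p, q) \<Rightarrow> p \<in> {1..m + k} \<and> q \<in> {1..m + l} \<and> (p \<le> k \<or> q \<le> l) \<and> p \<noteq> Suc k)"
        if x: "x \<in> Q" for x
      proof -
        obtain p q where pq: "x = (p, q)" by (cases x)
        have "Suc m < p + q - 1" using letter[OF Q(1)] x pq by simp
        moreover have "p \<le> k \<or> q \<le> l" "p \<in> {1..Suc m + k}" "q \<in> {1..Suc m + l}" using Q(1) x pq by (auto simp: D_def)
        ultimately show ?thesis using m by (auto simp: pq)
      qed
      then have P: "P \<subseteq> {1..m + k} \<times> {1..m + l}" "\<forall>(p, q)\<in>P. p \<le> k \<or> q \<le> l" "\<And>q. (Suc k, q) \<notin> P"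
        unfolding Q(2) by (fastforce split: prod.splits)+
      have "shift_perm 1 (pipe_demazure (m + k) (m + l) P) = shift_perm (Suc m) v"
        using word[OF P(1,3)] Q(1) unfolding QP by (simp add: D_def)
      \<comment> \<open>\<open>shift_perm 1\<close> does not depend on the value at 0, so this value
        is compared separately.\<close>
      moreover have "pipe_demazure (m + k) (m + l) P 0 = shift_perm m v 0"
        using permutes_not_in[OF pipe_demazure_permutes[of "m + k" "m + l" P], of 0]
        by (simp add: shift_perm_def)
      ultimately have "pipe_demazure (m + k) (m + l) P = shift_perm m v"
        using shift_perm_1_inject unfolding shift_perm_Suc by blast
      then show "P \<in> D m" using P by (simp add: D_def)
    qed
  qed
  have wt: "(\<Prod>(p, q)\<in>?t ` P. a p * b q - 1) = (\<Prod>(p, q)\<in>P. a p * b q - 1)" if P: "P \<in> D m" for P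
  proof (rule prod.reindex_cong[of ?t])
    show "inj_on ?t P" by (auto simp: inj_on_def split: if_splits)
    fix x assume x: "x \<in> P"
    obtain p q where pq: "x = (p, q)" by (cases x)
    have "m < p + q - 1" using letter[OF P] x pq by simp
    moreover have "p \<le> k \<or> q \<le> l" using P x pq by (auto simp: D_def)
    ultimately show "(case ?t x of (p, q) \<Rightarrow> a p * b q - 1) = (case x of (p, q) \<Rightarrow> a p * b q - 1)"
      using m a b by (auto simp: pq)
  qed simp
  have "(\<Sum>P\<in>D (Suc m). \<Prod>(p, q)\<in>P. a p * b q - 1) = (\<Sum>P\<in>D m. \<Prod>(p, q)\<in>?t ` P. a p * b q - 1)"
    by (rule sum.reindex_bij_betw[OF bij, symmetric])
  also have "\<dots> = (\<Sum>P\<in>D m. \<Prod>(p, q)\<in>P. a p * b q - 1)"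
    by (rule sum.cong[OF refl wt])
  finally show ?thesis using rect[of m] rect[of "Suc m"] by simp
qed

lemma rect_sum_stable:
  fixes a b :: "nat \<Rightarrow> 'a::comm_ring_1"
  assumes "nice k l v" "k + l \<le> m" "m \<le> m'" "\<And>p. k < p \<Longrightarrow> a p = 1" "\<And>q. l < q \<Longrightarrow> b q = 1"
  shows "rect_sum (m' + k) (m' + l) a b (shift_perm m' v) = rect_sum (m + k) (m + l) a b (shift_perm m v)"
  using assms(3)
proof (induction m' rule: dec_induct)
  case (step n)
  then show ?case using rect_sum_step[of k l v n a b] assms by simp
qed simp

lemma subst_rect_sum:
  "subst_laurent \<sigma> (rect_sum k l a b v) = rect_sum k l (\<lambda>p. subst_laurent \<sigma> (a p)) (\<lambda>q. subst_laurent \<sigma> (b q)) v"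
  unfolding rect_sum_pd_sum subst_pd_sum
  by (rule pd_sum_cong) (auto simp: subst_laurent_diff subst_laurent_mult)

lemma at_alphabets_shifted:
  assumes w: "w \<in> partial_perms k l"
  shows "at_alphabets (grothendieck (completion (m + k) (m + l) (shift_pp m w))) xs ys =
    (- 1) ^ perm_length (completion k l w) *
    rect_sum (m + k) (m + l) (\<lambda>p. lval (nth_letter xs p)) (\<lambda>q. ilval (nth_letter ys q))
      (shift_perm m (completion k l w))"
proof -
  let ?v = "completion k l w"
  have nv: "nice k l ?v" by (rule completion_props[OF w])
  have n: "nice (m + k) (m + l) (shift_perm m ?v)" by (rule nice_shift[OF nv])
  have p: "shift_perm m ?v permutes {1..(m + k) + (m + l)}" by (rule nice_permutes[OF n])
  have "?v \<in> S_inf" using nv by (simp add: nice_def)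
  then show ?thesis
    unfolding completion_shift(2)[OF w] at_alphabets_grothendieck[OF p]
    by (subst kp_rect_sum[OF n p]) (simp_all add: perm_length_shift)
qed

text \<open>The limit is attained from k + l on, in the letters \<open>Z\<close> and
  \<open>Zd\<close>; alphabets of the same lengths are then substituted into the stable
  value.\<close>

lemma stable_grothendieck_at:
  assumes w: "w \<in> partial_perms k l" and len: "length xs = k" "length ys = l" and m: "k + l \<le> m"
  shows "at_alphabets (stable_grothendieck k l w) xs ys = (- 1) ^ perm_length (completion k l w) *
    rect_sum (m + k) (m + l) (\<lambda>p. lval (nth_letter xs p)) (\<lambda>q. ilval (nth_letter ys q))
      (shift_perm m (completion k l w))"
proof -
  let ?v = "completion k l w"
  let ?X = "map Z [1..<Suc k]" and ?Y = "map Zd [1..<Suc l]"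
  have nv: "nice k l ?v" by (rule completion_props[OF w])
  define L where "L = (- 1) ^ perm_length ?v *
    rect_sum (m + k) (m + l) (\<lambda>p. lval (nth_letter ?X p)) (\<lambda>q. ilval (nth_letter ?Y q)) (shift_perm m ?v)"
  have "stabilizes_to (\<lambda>m. at_alphabets (grothendieck (completion (m + k) (m + l) (shift_pp m w))) ?X ?Y) L"
    unfolding stabilizes_to_def eventually_sequentially
  proof (intro exI[of _ m] allI impI)
    fix m' assume "m \<le> m'"
    then show "at_alphabets (grothendieck (completion (m' + k) (m' + l) (shift_pp m' w))) ?X ?Y = L"
      unfolding at_alphabets_shifted[OF w] L_def
      by (subst rect_sum_stable[OF nv m]) (auto simp: nth_letter_def lval_def ilval_def)
  qed
  then have s: "stable_grothendieck k l w = L"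
    unfolding stable_grothendieck_def by (rule stable_limit_eqI)
  have x: "subst_laurent (\<lambda>a. case a of Z p \<Rightarrow> nth_letter xs p | Zd q \<Rightarrow> nth_letter ys q) (lval (nth_letter ?X p)) =
      lval (nth_letter xs p)" for p
    by (cases "p \<in> {1..k}") (auto simp: nth_letter_def lval_def[of "Some _"] lval_def[of None] subst_letter len nth_append simp del: upt_Suc)
  have y: "subst_laurent (\<lambda>a. case a of Z p \<Rightarrow> nth_letter xs p | Zd q \<Rightarrow> nth_letter ys q) (ilval (nth_letter ?Y p)) =
      ilval (nth_letter ys p)" for p
    by (cases "p \<in> {1..l}") (auto simp: nth_letter_def ilval_def[of "Some _"] ilval_def[of None] subst_letter len nth_append simp del: upt_Suc)
  show ?thesis
    unfolding s L_def at_alphabets_def subst_laurent_mult subst_rect_sum x y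
    by (simp add: subst_laurent_power subst_laurent_uminus)
qed

section \<open>Blocks and Zelevinsky permutations\<close>

lemma row_offset_Suc: "row_offset r (Suc j) = row_offset r j + r j"
  by (simp add: row_offset_def)

lemma row_offset_mono: "i \<le> j \<Longrightarrow> row_offset r i \<le> row_offset r j"
  unfolding row_offset_def by (rule sum_mono2) auto

lemma row_offset_total: "row_offset r (Suc n) = total_size n r"
  by (simp add: row_offset_def total_size_def lessThan_Suc_atMost)

lemma row_offset_le_total: "j \<le> Suc n \<Longrightarrow> row_offset r j \<le> total_size n r"
  using row_offset_mono[of j "Suc n" r] by (simp add: row_offset_total)

lemma col_offset_row_offset: "i \<le> n \<Longrightarrow> col_offset n r i + row_offset r (Suc i) = total_size n r"
proof -
  assume "i \<le> n"
  then have "{..n} = {..<Suc i} \<union> {i<..n}" by auto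
  then have "sum r {..n} = sum r {..<Suc i} + sum r {i<..n}"
    by (simp only:) (rule sum.union_disjoint, auto)
  then show ?thesis
    unfolding col_offset_def row_offset_def total_size_def by simp
qed

lemma col_offset_eq: "i \<le> n \<Longrightarrow> col_offset n r i = total_size n r - row_offset r (Suc i)"
  using col_offset_row_offset[of i n r] by simp

lemma col_offset_add: "i \<le> n \<Longrightarrow> col_offset n r i + r i = total_size n r - row_offset r i"
  using col_offset_row_offset[of i n r] by (simp add: row_offset_Suc)

lemma col_offset_Suc: "i < n \<Longrightarrow> col_offset n r i = col_offset n r (Suc i) + r (Suc i)"
  using col_offset_add[of "Suc i" n r] col_offset_eq[of i n r] by simp

lemma col_offset_top: "n \<le> i \<Longrightarrow> col_offset n r i = 0"
  by (simp add: col_offset_def)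

lemma col_offset_antimono: "i \<le> j \<Longrightarrow> col_offset n r j \<le> col_offset n r i"
  unfolding col_offset_def by (rule sum_mono2) auto

lemma block_row_Suc: "block_row r j = {row_offset r j<..row_offset r (Suc j)}"
  by (simp add: block_row_def row_offset_Suc)

text \<open>Blocks may be empty, so offsets can coincide; the least index is that of the block which
  contains p.\<close>

definition rowblk :: "(nat \<Rightarrow> nat) \<Rightarrow> nat \<Rightarrow> nat" where
  "rowblk r p = (LEAST j. p \<le> row_offset r (Suc j))"

text \<open>Block columns are counted from the right, columns from the left. Reflecting the column
  reduces everything to \<open>rowblk\<close>.\<close>

definition colblk :: "nat \<Rightarrow> (nat \<Rightarrow> nat) \<Rightarrow> nat \<Rightarrow> nat" where
  "colblk n r q = rowblk r (Suc (total_size n r) - q)"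

lemma rowblk_eqI:
  assumes "p \<in> block_row r j"
  shows "rowblk r p = j"
  unfolding rowblk_def
proof (rule Least_equality)
  show "p \<le> row_offset r (Suc j)" using assms by (simp add: block_row_Suc)
  fix i assume "p \<le> row_offset r (Suc i)"
  then show "j \<le> i" using assms row_offset_mono[of "Suc i" j r]
    by (auto simp: block_row_Suc) (meson leD le_less_trans not_less_eq_eq)
qed

lemma rowblk_props:
  assumes "1 \<le> p" "p \<le> total_size n r"
  shows "p \<in> block_row r (rowblk r p)" "rowblk r p \<le> n"
proof -
  have n: "p \<le> row_offset r (Suc n)" using assms by (simp add: row_offset_total)
  then show "rowblk r p \<le> n" unfolding rowblk_def by (rule Least_le)
  have 1: "p \<le> row_offset r (Suc (rowblk r p))" unfolding rowblk_def by (rule LeastI) (rule n)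
  have "row_offset r (rowblk r p) < p"
  proof (cases "rowblk r p")
    case 0
    then show ?thesis using assms by (simp add: row_offset_def)
  next
    case (Suc j)
    then have "\<not> p \<le> row_offset r (Suc j)" unfolding rowblk_def using not_less_Least by (metis lessI)
    then show ?thesis using Suc by simp
  qed
  then show "p \<in> block_row r (rowblk r p)" using 1 by (simp add: block_row_Suc)
qed

lemma rowblk_mono:
  assumes "1 \<le> p" "p \<le> p'" "p' \<le> total_size n r"
  shows "rowblk r p \<le> rowblk r p'"
  unfolding rowblk_def[of r p]
proof (rule Least_le)
  show "p \<le> row_offset r (Suc (rowblk r p'))"
    using rowblk_props(1)[of p' n r] assms by (simp add: block_row_Suc)
qed

lemma block_col_iff_row:
  assumes "i \<le> n" "1 \<le> q" "q \<le> total_size n r"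
  shows "q \<in> block_col n r i \<longleftrightarrow> Suc (total_size n r) - q \<in> block_row r i"
  using assms col_offset_eq[of i n r] col_offset_add[of i n r] row_offset_le_total[of "Suc i" n r]
    row_offset_le_total[of i n r]
  unfolding block_col_def block_row_Suc by auto

lemma block_col_bounds:
  assumes "i \<le> n" "q \<in> block_col n r i"
  shows "1 \<le> q" "q \<le> total_size n r"
  using assms col_offset_add[of i n r] unfolding block_col_def by auto

lemma block_row_bounds:
  assumes "j \<le> n" "p \<in> block_row r j"
  shows "1 \<le> p" "p \<le> total_size n r"
  using assms row_offset_le_total[of "Suc j" n r] unfolding block_row_Suc by auto

lemma colblk_props:
  assumes "1 \<le> q" "q \<le> total_size n r"
  shows "q \<in> block_col n r (colblk n r q)" "colblk n r q \<le> n"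
proof -
  have b: "1 \<le> Suc (total_size n r) - q" "Suc (total_size n r) - q \<le> total_size n r" using assms by auto
  show le: "colblk n r q \<le> n" unfolding colblk_def by (rule rowblk_props(2)[OF b])
  show "q \<in> block_col n r (colblk n r q)"
    using block_col_iff_row[OF le assms] rowblk_props(1)[OF b] unfolding colblk_def by simp
qed

lemma colblk_eqI: "i \<le> n \<Longrightarrow> q \<in> block_col n r i \<Longrightarrow> colblk n r q = i"
  using block_col_iff_row[of i n q r] block_col_bounds[of i n q r] rowblk_eqI unfolding colblk_def by blast

lemma colblk_antimono:
  "1 \<le> q \<Longrightarrow> q \<le> q' \<Longrightarrow> q' \<le> total_size n r \<Longrightarrow> colblk n r q' \<le> colblk n r q"
  unfolding colblk_def by (rule rowblk_mono[where n = n]) auto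

section \<open>The diagram formed by the zero blocks\<close>

text \<open>The number of columns of the zero blocks in row p: with j the block row of p, these are
  the block columns from j + 2 on, which stand leftmost.\<close>

definition zlam :: "nat \<Rightarrow> (nat \<Rightarrow> nat) \<Rightarrow> nat \<Rightarrow> nat" where
  "zlam n r p = col_offset n r (Suc (rowblk r p))"

lemma zlam_dominant: "dominant (total_size n r) (zlam n r)"
proof
  show "zlam n r p' \<le> zlam n r p" if "1 \<le> p" "p \<le> p'" "p' \<le> total_size n r" for p p'
    unfolding zlam_def using rowblk_mono[OF that] by (intro col_offset_antimono) simp
  show "p + zlam n r p \<le> total_size n r" if p: "1 \<le> p" "p \<le> total_size n r" for p
  proof (cases "Suc (rowblk r p) \<le> n")
    case True
    have "p \<le> row_offset r (Suc (rowblk r p))" using rowblk_props(1)[OF p] by (simp add: block_row_Suc)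
    also have "\<dots> \<le> row_offset r (Suc (Suc (rowblk r p)))" by (rule row_offset_mono) simp
    finally show ?thesis using col_offset_row_offset[OF True, of r] by (simp add: zlam_def)
  next
    case False
    then show ?thesis using p by (simp add: zlam_def col_offset_top)
  qed
qed

lemma zlam_less_iff:
  assumes "1 \<le> p" "p \<le> total_size n r" "1 \<le> q" "q \<le> total_size n r"
  shows "zlam n r p < q \<longleftrightarrow> colblk n r q \<le> Suc (rowblk r p)"
proof
  assume "zlam n r p < q"
  show "colblk n r q \<le> Suc (rowblk r p)"
  proof (rule ccontr)
    assume *: "\<not> colblk n r q \<le> Suc (rowblk r p)"
    have "q \<le> col_offset n r (colblk n r q) + r (colblk n r q)"
      using colblk_props(1)[OF assms(3,4)] by (simp add: block_col_def)
    also have "\<dots> \<le> col_offset n r (Suc (rowblk r p))"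
      using col_offset_Suc[of "colblk n r q - 1" n r] * colblk_props(2)[OF assms(3,4)]
        col_offset_antimono[of "Suc (rowblk r p)" "colblk n r q - 1" n r] by simp
    finally show False using \<open>zlam n r p < q\<close> by (simp add: zlam_def)
  qed
next
  assume "colblk n r q \<le> Suc (rowblk r p)"
  then have "zlam n r p \<le> col_offset n r (colblk n r q)"
    unfolding zlam_def by (rule col_offset_antimono)
  then show "zlam n r p < q" using colblk_props(1)[OF assms(3,4)] by (simp add: block_col_def)
qed

lemma zero_blocks:
  "\<Union>{block n r j i | j i. j \<le> n \<and> i \<le> n \<and> j + 2 \<le> i} = young (total_size n r) (zlam n r)"
proof (intro set_eqI iffI)
  fix x assume "x \<in> \<Union>{block n r j i | j i. j \<le> n \<and> i \<le> n \<and> j + 2 \<le> i}"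
  then obtain j i where ji: "j \<le> n" "i \<le> n" "j + 2 \<le> i" "x \<in> block n r j i" by auto
  obtain p q where x: "x = (p, q)" by (cases x)
  have pq: "p \<in> block_row r j" "q \<in> block_col n r i" using ji x by (auto simp: block_def)
  note b = block_row_bounds[OF ji(1) pq(1)] block_col_bounds[OF ji(2) pq(2)]
  have "\<not> zlam n r p < q"
    using zlam_less_iff[OF b] rowblk_eqI[OF pq(1)] colblk_eqI[OF ji(2) pq(2)] ji by simp
  then show "x \<in> young (total_size n r) (zlam n r)" using b by (simp add: young_def x)
next
  fix x assume "x \<in> young (total_size n r) (zlam n r)"
  then obtain p q where x: "x = (p, q)" and b: "1 \<le> p" "p \<le> total_size n r" "1 \<le> q" "q \<le> zlam n r p"
    by (auto simp: young_def)
  interpret dominant "total_size n r" "zlam n r" by (rule zlam_dominant)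
  have q: "q \<le> total_size n r" using b lam_le_d[of p] by simp
  have "rowblk r p + 2 \<le> colblk n r q" using zlam_less_iff[OF b(1-3) q] b by simp
  moreover have "x \<in> block n r (rowblk r p) (colblk n r q)"
    using rowblk_props(1)[OF b(1,2)] colblk_props(1)[OF b(3) q] by (simp add: block_def x)
  ultimately show "x \<in> \<Union>{block n r j i | j i. j \<le> n \<and> i \<le> n \<and> j + 2 \<le> i}"
    using rowblk_props(2)[OF b(1,2)] colblk_props(2)[OF b(3) q] by blast
qed

lemma zelevinsky_permutes: "zelevinsky n r v \<Longrightarrow> v permutes {1..total_size n r}"
  by (simp add: zelevinsky_def)

lemma zelevinsky_range:
  assumes "zelevinsky n r v" "1 \<le> p" "p \<le> total_size n r"
  shows "1 \<le> v p" "v p \<le> total_size n r"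
  using permutes_in_image[OF zelevinsky_permutes[OF assms(1)], of p] assms by auto

lemma zelevinsky_iff:
  "zelevinsky n r v \<longleftrightarrow> v permutes {1..total_size n r} \<and>
    (\<forall>p\<in>{1..total_size n r}. zlam n r p < v p) \<and>
    (\<forall>a\<in>{1..total_size n r}. \<forall>b\<in>{1..total_size n r}. a < b \<longrightarrow> rowblk r a = rowblk r b \<longrightarrow> v a < v b) \<and>
    (\<forall>a\<in>{1..total_size n r}. \<forall>b\<in>{1..total_size n r}. a < b \<longrightarrow> colblk n r (v a) = colblk n r (v b) \<longrightarrow> v a < v b)"
  (is "_ \<longleftrightarrow> ?R")
proof (cases "v permutes {1..total_size n r}")
  case True
  let ?d = "total_size n r"
  have vb: "1 \<le> v a \<and> v a \<le> ?d" if "a \<in> {1..?d}" for a using permutes_in_image[OF True, of a] that by auto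
  have vb': "a \<in> {1..?d}" if "1 \<le> v a" "v a \<le> ?d" for a using permutes_in_image[OF True, of a] that by auto
  have A: "(\<forall>j i a. j \<le> n \<and> i \<le> n \<and> j + 2 \<le> i \<longrightarrow> (a, v a) \<notin> block n r j i) \<longleftrightarrow> (\<forall>p\<in>{1..?d}. zlam n r p < v p)"
  proof
    assume L: "\<forall>j i a. j \<le> n \<and> i \<le> n \<and> j + 2 \<le> i \<longrightarrow> (a, v a) \<notin> block n r j i"
    show "\<forall>p\<in>{1..?d}. zlam n r p < v p"
    proof
      fix p assume p: "p \<in> {1..?d}"
      have "(p, v p) \<in> block n r (rowblk r p) (colblk n r (v p))"
        using rowblk_props(1)[of p n r] colblk_props(1)[of "v p" n r] p vb[OF p] by (simp add: block_def)
      then have "\<not> rowblk r p + 2 \<le> colblk n r (v p)"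
        using L rowblk_props(2)[of p n r] colblk_props(2)[of "v p" n r] p vb[OF p] by auto
      then show "zlam n r p < v p" using zlam_less_iff[of p n r "v p"] p vb[OF p] by auto
    qed
  next
    assume R: "\<forall>p\<in>{1..?d}. zlam n r p < v p"
    show "\<forall>j i a. j \<le> n \<and> i \<le> n \<and> j + 2 \<le> i \<longrightarrow> (a, v a) \<notin> block n r j i"
    proof (intro allI impI notI)
      fix j i a assume ji: "j \<le> n \<and> i \<le> n \<and> j + 2 \<le> i" "(a, v a) \<in> block n r j i"
      then have "(a, v a) \<in> young ?d (zlam n r)" unfolding zero_blocks[symmetric] by blast
      then have "1 \<le> a \<and> a \<le> ?d \<and> v a \<le> zlam n r a" by (simp add: young_def)
      then show False using R[rule_format, of a] by simp
    qed
  qed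
  have B: "(\<forall>j a b. j \<le> n \<and> a \<in> block_row r j \<and> b \<in> block_row r j \<and> a < b \<longrightarrow> v a < v b) \<longleftrightarrow>
      (\<forall>a\<in>{1..?d}. \<forall>b\<in>{1..?d}. a < b \<longrightarrow> rowblk r a = rowblk r b \<longrightarrow> v a < v b)"
  proof
    assume L: "\<forall>j a b. j \<le> n \<and> a \<in> block_row r j \<and> b \<in> block_row r j \<and> a < b \<longrightarrow> v a < v b"
    show "\<forall>a\<in>{1..?d}. \<forall>b\<in>{1..?d}. a < b \<longrightarrow> rowblk r a = rowblk r b \<longrightarrow> v a < v b"
      using L rowblk_props[of _ n r] by (metis atLeastAtMost_iff)
  next
    assume R: "\<forall>a\<in>{1..?d}. \<forall>b\<in>{1..?d}. a < b \<longrightarrow> rowblk r a = rowblk r b \<longrightarrow> v a < v b"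
    show "\<forall>j a b. j \<le> n \<and> a \<in> block_row r j \<and> b \<in> block_row r j \<and> a < b \<longrightarrow> v a < v b"
      using R block_row_bounds[of _ n _ r] rowblk_eqI by (metis atLeastAtMost_iff)
  qed
  have C: "(\<forall>i a b. i \<le> n \<and> v a \<in> block_col n r i \<and> v b \<in> block_col n r i \<and> a < b \<longrightarrow> v a < v b) \<longleftrightarrow>
      (\<forall>a\<in>{1..?d}. \<forall>b\<in>{1..?d}. a < b \<longrightarrow> colblk n r (v a) = colblk n r (v b) \<longrightarrow> v a < v b)"
  proof
    assume L: "\<forall>i a b. i \<le> n \<and> v a \<in> block_col n r i \<and> v b \<in> block_col n r i \<and> a < b \<longrightarrow> v a < v b"
    show "\<forall>a\<in>{1..?d}. \<forall>b\<in>{1..?d}. a < b \<longrightarrow> colblk n r (v a) = colblk n r (v b) \<longrightarrow> v a < v b"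
      using L colblk_props[of _ n r] vb by metis
  next
    assume R: "\<forall>a\<in>{1..?d}. \<forall>b\<in>{1..?d}. a < b \<longrightarrow> colblk n r (v a) = colblk n r (v b) \<longrightarrow> v a < v b"
    show "\<forall>i a b. i \<le> n \<and> v a \<in> block_col n r i \<and> v b \<in> block_col n r i \<and> a < b \<longrightarrow> v a < v b"
      using R block_col_bounds[of _ n _ r] colblk_eqI vb' by metis
  qed
  show ?thesis unfolding zelevinsky_def A B C using True by simp
qed (simp add: zelevinsky_def)

lemma
  assumes "zelevinsky n r v"
  shows zelevinsky_above: "1 \<le> p \<Longrightarrow> p \<le> total_size n r \<Longrightarrow> zlam n r p < v p"
    and zelevinsky_rowD: "1 \<le> a \<Longrightarrow> a < b \<Longrightarrow> b \<le> total_size n r \<Longrightarrow> rowblk r a = rowblk r b \<Longrightarrow> v a < v b"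
    and zelevinsky_colD: "1 \<le> a \<Longrightarrow> a < b \<Longrightarrow> b \<le> total_size n r \<Longrightarrow>
      colblk n r (v a) = colblk n r (v b) \<Longrightarrow> v a < v b"
  using assms unfolding zelevinsky_iff by (fastforce, fastforce, fastforce)

section \<open>Ranks and uniqueness of Zelevinsky permutations\<close>

lemma zel_rank_card:
  assumes v: "v permutes {1..total_size n r}" and ij: "i \<le> n" "j \<le> n"
  shows "zel_rank n r v i j = card {a \<in> {row_offset r j<..total_size n r}. col_offset n r i < v a}"
  unfolding zel_rank_def
proof (rule arg_cong[where f = card], intro set_eqI iffI)
  let ?d = "total_size n r"
  fix a assume "a \<in> {a. \<exists>q p. j \<le> q \<and> q \<le> n \<and> p \<le> i \<and> (a, v a) \<in> block n r q p}"
  then obtain q p where qp: "j \<le> q" "q \<le> n" "p \<le> i" "a \<in> block_row r q" "v a \<in> block_col n r p"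
    by (auto simp: block_def)
  have "row_offset r j < a" using qp row_offset_mono[of j q r] by (auto simp: block_row_Suc)
  moreover have "col_offset n r i < v a" using qp col_offset_antimono[of p i n r] by (auto simp: block_col_def)
  ultimately show "a \<in> {a \<in> {row_offset r j<..?d}. col_offset n r i < v a}"
    using block_row_bounds[OF qp(2,4)] by auto
next
  let ?d = "total_size n r"
  fix a assume a: "a \<in> {a \<in> {row_offset r j<..?d}. col_offset n r i < v a}"
  then have b: "1 \<le> a" "a \<le> ?d" by auto
  then have vb: "1 \<le> v a" "v a \<le> ?d" using permutes_in_image[OF v, of a] by auto
  have "j \<le> rowblk r a"
  proof (rule ccontr)
    assume "\<not> j \<le> rowblk r a"
    then have "row_offset r (Suc (rowblk r a)) \<le> row_offset r j" by (intro row_offset_mono) simp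
    then show False using a rowblk_props(1)[OF b] by (auto simp: block_row_Suc)
  qed
  moreover have "colblk n r (v a) \<le> i"
  proof (rule ccontr)
    assume *: "\<not> colblk n r (v a) \<le> i"
    have "v a \<le> col_offset n r (colblk n r (v a) - 1)"
      using colblk_props[OF vb] col_offset_Suc[of "colblk n r (v a) - 1" n r] * by (auto simp: block_col_def)
    also have "\<dots> \<le> col_offset n r i" using * by (intro col_offset_antimono) simp
    finally show False using a by simp
  qed
  ultimately show "a \<in> {a. \<exists>q p. j \<le> q \<and> q \<le> n \<and> p \<le> i \<and> (a, v a) \<in> block n r q p}"
    using rowblk_props[OF b] colblk_props[OF vb] by (auto simp: block_def)
qed

text \<open>The southeast count and the northwest count determine each other through the numbers of
  rows and columns; the 1 comes from row 0, which \<open>rk\<close> includes.\<close>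

lemma zel_rank_rk:
  assumes v: "v permutes {1..total_size n r}" and ij: "i \<le> n" "j \<le> n"
  shows "zel_rank n r v i j + col_offset n r i + row_offset r j + 1 = total_size n r + rk v (row_offset r j) (col_offset n r i)"
proof -
  let ?d = "total_size n r" and ?a = "row_offset r j" and ?b = "col_offset n r i"
  have ad: "?a \<le> ?d" using row_offset_le_total[of j n r] ij by simp
  have bd: "?b \<le> ?d" using col_offset_row_offset[OF ij(1), of r] by simp
  have v0: "v 0 = 0" using permutes_not_in[OF v, of 0] by simp
  have 1: "card {a \<in> {1..?d}. ?b < v a} = ?d - ?b"
  proof -
    have "v ` {a \<in> {1..?d}. ?b < v a} = {?b<..?d}"
    proof
      show "v ` {a \<in> {1..?d}. ?b < v a} \<subseteq> {?b<..?d}"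
      proof
        fix y assume "y \<in> v ` {a \<in> {1..?d}. ?b < v a}"
        then obtain a where a: "y = v a" "a \<in> {1..?d}" "?b < v a" by auto
        have "v a \<in> {1..?d}" using permutes_in_image[OF v, of a] a(2) by simp
        then show "y \<in> {?b<..?d}" using a by simp
      qed
      show "{?b<..?d} \<subseteq> v ` {a \<in> {1..?d}. ?b < v a}"
      proof
        fix y assume y: "y \<in> {?b<..?d}"
        then have "y \<in> v ` {1..?d}" using permutes_image[OF v] by auto
        then show "y \<in> v ` {a \<in> {1..?d}. ?b < v a}" using y by auto
      qed
    qed
    moreover have "inj_on v {a \<in> {1..?d}. ?b < v a}" using permutes_inj[OF v] by (rule inj_on_subset) simp
    ultimately show ?thesis using card_image by fastforce
  qed
  have "{a \<in> {1..?d}. ?b < v a} = {a \<in> {?a<..?d}. ?b < v a} \<union> {a \<in> {1..?a}. ?b < v a}" using ad by auto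
  moreover have "card ({a \<in> {?a<..?d}. ?b < v a} \<union> {a \<in> {1..?a}. ?b < v a}) =
      card {a \<in> {?a<..?d}. ?b < v a} + card {a \<in> {1..?a}. ?b < v a}"
    by (rule card_Un_disjoint) auto
  ultimately have 2: "?d - ?b = card {a \<in> {?a<..?d}. ?b < v a} + card {a \<in> {1..?a}. ?b < v a}" using 1 by simp
  have "{..?a} = {a \<in> {1..?a}. ?b < v a} \<union> {p \<in> {..?a}. v p \<le> ?b}"
  proof (intro set_eqI iffI)
    fix p assume "p \<in> {..?a}"
    then show "p \<in> {a \<in> {1..?a}. ?b < v a} \<union> {p \<in> {..?a}. v p \<le> ?b}"
      using v0 by (cases "p = 0") auto
  qed auto
  moreover have "card ({a \<in> {1..?a}. ?b < v a} \<union> {p \<in> {..?a}. v p \<le> ?b}) =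
      card {a \<in> {1..?a}. ?b < v a} + rk v ?a ?b"
    unfolding rk_def by (rule card_Un_disjoint) auto
  ultimately have "Suc ?a = card {a \<in> {1..?a}. ?b < v a} + rk v ?a ?b" by (metis card_atMost)
  then show ?thesis using 2 bd zel_rank_card[OF assms] by simp
qed

text \<open>For j <= i the corner consists of zero blocks, so only row 0 is counted.\<close>

lemma rk_zelevinsky_one:
  assumes "zelevinsky n r v" "j \<le> i" "j \<le> Suc n"
  shows "rk v (row_offset r j) (col_offset n r i) = 1"
proof -
  have "{p \<in> {..row_offset r j}. v p \<le> col_offset n r i} = {0}"
  proof (intro set_eqI iffI)
    fix p assume p: "p \<in> {p \<in> {..row_offset r j}. v p \<le> col_offset n r i}"
    show "p \<in> {0}"
    proof (rule ccontr)
      assume "p \<notin> {0}"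
      then have b: "1 \<le> p" "p \<le> total_size n r" using p row_offset_le_total[OF assms(3), of r] by auto
      have "rowblk r p < j"
      proof (rule ccontr)
        assume "\<not> rowblk r p < j"
        then have "row_offset r j \<le> row_offset r (rowblk r p)" by (intro row_offset_mono) simp
        then show False using rowblk_props(1)[OF b] p by (auto simp: block_row_Suc)
      qed
      then have "col_offset n r i \<le> zlam n r p"
        unfolding zlam_def using assms(2) by (intro col_offset_antimono) simp
      moreover have "zlam n r p < v p" by (rule zelevinsky_above[OF assms(1) b])
      ultimately show False using p by simp
    qed
  next
    fix p assume "p \<in> {0::nat}"
    then show "p \<in> {p \<in> {..row_offset r j}. v p \<le> col_offset n r i}"
      using permutes_not_in[OF zelevinsky_permutes[OF assms(1)], of 0] by simp
  qed
  then show ?thesis by (simp add: rk_def)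
qed

lemma rk_permutes_full:
  assumes "v permutes {1..d}" "b \<le> d"
  shows "rk v d b = Suc b"
proof -
  have "v ` {p \<in> {..d}. v p \<le> b} = {..b}"
  proof
    show "{..b} \<subseteq> v ` {p \<in> {..d}. v p \<le> b}"
    proof
      fix y assume y: "y \<in> {..b}"
      have "v (inv v y) = y" using permutes_inverses[OF assms(1)] by simp
      moreover have "inv v y \<le> d"
        using permutes_in_image[OF permutes_inv[OF assms(1)], of y] permutes_not_in[OF permutes_inv[OF assms(1)], of y] y assms(2)
        by (cases "y = 0") auto
      ultimately show "y \<in> v ` {p \<in> {..d}. v p \<le> b}" using y by (intro image_eqI[of _ _ "inv v y"]) auto
    qed
  qed auto
  moreover have "inj_on v {p \<in> {..d}. v p \<le> b}" using permutes_inj[OF assms(1)] by (rule inj_on_subset) simp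
  ultimately have "card {p \<in> {..d}. v p \<le> b} = card {..b}" using card_image by fastforce
  then show ?thesis by (simp add: rk_def)
qed

text \<open>At the first difference a, say v a < u a, let T be the right end of the block column of
  v a. In \<open>u\<close> the value v a comes later, so u a cannot lie in the same block column and
  exceeds T. Up to the end e of the block row of a, the values of \<open>u\<close> increase and
  hence exceed T as well. So the rank of \<open>u\<close> at (e, T) is smaller than that of
  \<open>v\<close>, although this corner is made of whole blocks.\<close>

lemma zelevinsky_unique:
  assumes u: "zelevinsky n r u" and v: "zelevinsky n r v"
    and eq: "\<And>i j. i \<le> j \<Longrightarrow> j \<le> n \<Longrightarrow> zel_rank n r u i j = zel_rank n r v i j"
  shows "u = v"
proof -
  let ?d = "total_size n r"
  have rk_eq: "rk u (row_offset r j) (col_offset n r i) = rk v (row_offset r j) (col_offset n r i)"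
    if "j \<le> Suc n" "i \<le> n" for i j
  proof (cases "j = Suc n")
    case True
    then show ?thesis
      using rk_permutes_full[OF zelevinsky_permutes[OF u], of "col_offset n r i"]
        rk_permutes_full[OF zelevinsky_permutes[OF v], of "col_offset n r i"] col_offset_row_offset[OF that(2), of r]
      by (simp add: row_offset_total)
  next
    case False
    then have j: "j \<le> n" using that by simp
    show ?thesis
    proof (cases "i \<le> j")
      case True
      then show ?thesis
        using zel_rank_rk[OF zelevinsky_permutes[OF u] that(2) j] zel_rank_rk[OF zelevinsky_permutes[OF v] that(2) j] eq[OF True j] by simp
    next
      case False
      then show ?thesis using rk_zelevinsky_one[OF u, of j i] rk_zelevinsky_one[OF v, of j i] j by simp
    qed
  qed
  have main: False
    if u: "zelevinsky n r u" and v: "zelevinsky n r v"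
      and rk_eq: "\<And>i j. j \<le> Suc n \<Longrightarrow> i \<le> n \<Longrightarrow> rk u (row_offset r j) (col_offset n r i) = rk v (row_offset r j) (col_offset n r i)"
      and before: "\<And>b. b < a \<Longrightarrow> u b = v b" and less: "v a < u a" for u v a
  proof -
    note pu = zelevinsky_permutes[OF u] and pv = zelevinsky_permutes[OF v]
    have a: "1 \<le> a" "a \<le> ?d"
    proof -
      have "a \<in> {1..?d}"
      proof (rule ccontr)
        assume "a \<notin> {1..?d}"
        then show False using less permutes_not_in[OF pu, of a] permutes_not_in[OF pv, of a] by simp
      qed
      then show "1 \<le> a" "a \<le> ?d" by auto
    qed
    have va: "1 \<le> v a" "v a \<le> ?d" using zelevinsky_range[OF v a] .
    have ua: "1 \<le> u a" "u a \<le> ?d" using zelevinsky_range[OF u a] .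
    define i where "i = colblk n r (v a)"
    define j where "j = rowblk r a"
    define b where "b = inv u (v a)"
    have ub: "u b = v a" using permutes_inverses[OF pu] by (simp add: b_def)
    have "\<not> b < a"
    proof
      assume "b < a"
      then have "v b = v a" using before ub by simp
      then show False using \<open>b < a\<close> permutes_inj[OF pv] by (metis injD less_irrefl)
    qed
    then have ab: "a < b" using ub less by (cases "a = b") auto
    have bd: "b \<in> {1..?d}" using permutes_in_image[OF pu, of b] ub va by auto
    have ne: "colblk n r (u a) \<noteq> i"
    proof
      assume "colblk n r (u a) = i"
      then have "u a < u b" using zelevinsky_colD[OF u a(1) ab] bd ub by (simp add: i_def)
      then show False using ub less by simp
    qed
    have "colblk n r (u a) \<le> i" unfolding i_def by (rule colblk_antimono) (use va ua less in auto)
    then have ci: "colblk n r (u a) < i" using ne by simp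
    define T where "T = col_offset n r (i - 1)"
    have i: "i \<le> n" "v a \<in> block_col n r i" using colblk_props[OF va] by (auto simp: i_def)
    have vT: "v a \<le> T" using i ci col_offset_Suc[of "i - 1" n r] by (auto simp: T_def block_col_def)
    have uT: "T < u a"
    proof -
      have "T \<le> col_offset n r (colblk n r (u a))"
        unfolding T_def by (rule col_offset_antimono) (use ci in simp)
      then show ?thesis using colblk_props(1)[OF ua] by (simp add: block_col_def)
    qed
    have j: "j \<le> n" "a \<in> block_row r j" using rowblk_props[OF a] by (auto simp: j_def)
    define e where "e = row_offset r (Suc j)"
    have ae: "a \<le> e" using j by (simp add: block_row_Suc e_def)
    have e: "rk u e T = rk v e T"
      unfolding e_def T_def by (rule rk_eq) (use i j ci in auto)
    have later: "T < u p" if "a \<le> p" "p \<le> e" for p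
    proof (cases "p = a")
      case False
      have "p \<in> block_row r j" using that j by (auto simp: block_row_Suc e_def)
      then have "rowblk r p = j" by (rule rowblk_eqI)
      moreover have "p \<le> ?d" using that row_offset_le_total[of "Suc j" n r] j by (simp add: e_def)
      ultimately have "u a < u p" using zelevinsky_rowD[OF u a(1), of p] that False by (simp add: j_def)
      then show ?thesis using uT by simp
    qed (use uT in simp)
    have "{p \<in> {..e}. u p \<le> T} \<subset> {p \<in> {..e}. v p \<le> T}"
    proof
      show "{p \<in> {..e}. u p \<le> T} \<subseteq> {p \<in> {..e}. v p \<le> T}"
        using later before by (auto simp: not_le) (metis leD not_le_imp_less)
      have "a \<in> {p \<in> {..e}. v p \<le> T}" "a \<notin> {p \<in> {..e}. u p \<le> T}" using vT uT ae by auto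
      then show "{p \<in> {..e}. u p \<le> T} \<noteq> {p \<in> {..e}. v p \<le> T}" by blast
    qed
    then have "rk u e T < rk v e T" unfolding rk_def by (intro psubset_card_mono) auto
    then show False using e by simp
  qed
  show ?thesis
  proof
    fix a show "u a = v a"
    proof (induction a rule: less_induct)
      case (less a)
      show ?case
      proof (rule ccontr)
        assume "u a \<noteq> v a"
        then consider "v a < u a" | "u a < v a" by linarith
        then show False
        proof cases
          case 1
          show False by (rule main[OF u v rk_eq less 1])
        next
          case 2
          show False by (rule main[OF v u rk_eq[symmetric] less[symmetric] 2])
        qed
      qed
    qed
  qed
qed

lemma zel_perm_eqI:
  assumes "zelevinsky n r v" "has_rank_array n r v R"
  shows "zel_perm n r R = v"
  unfolding zel_perm_def
proof (rule the_equality)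
  fix u assume "zelevinsky n r u \<and> has_rank_array n r u R"
  then show "u = v" using assms by (intro zelevinsky_unique) (auto simp: has_rank_array_def)
qed (use assms in simp)

section \<open>The permutation v(Hom)\<close>

context dominant
begin

text \<open>If the value of \<open>dom_perm\<close> in row a + 1 is at most b, its rank rises by
  one, which is all that \<open>u\<close> can gain. Otherwise the greedy rule has already used all
  values above lam (a + 1) up to b, while the values of \<open>u\<close> in these rows that are at
  most b are among them.\<close>

lemma rk_le_dom_perm:
  assumes u: "u permutes {1..d}" and big: "\<And>p. 1 \<le> p \<Longrightarrow> p \<le> d \<Longrightarrow> lam p < u p" and a: "a \<le> d"
  shows "rk u a b \<le> rk dom_perm a b"
  using a
proof (induction a)
  case 0
  then show ?case
    using permutes_not_in[OF u, of 0] permutes_not_in[OF dom_perm_permutes, of 0] by (simp add: rk_0)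
next
  case (Suc a)
  show ?case
  proof (cases "dom_perm (Suc a) \<le> b")
    case True
    then show ?thesis using Suc by (simp add: rk_Suc)
  next
    case False
    let ?l = "lam (Suc a)"
    have "{p \<in> {..Suc a}. u p \<le> b} \<subseteq> insert 0 (inv u ` {?l<..b})"
    proof
      fix p assume p: "p \<in> {p \<in> {..Suc a}. u p \<le> b}"
      show "p \<in> insert 0 (inv u ` {?l<..b})"
      proof (cases "p = 0")
        case False
        then have "?l \<le> lam p" "lam p < u p" using p Suc.prems lam_antimono[of p "Suc a"] big[of p] by auto
        then have "p = inv u (u p)" "u p \<in> {?l<..b}" using p permutes_inverses[OF u] by auto
        then show ?thesis by blast
      qed simp
    qed
    then have "rk u (Suc a) b \<le> card (insert 0 (inv u ` {?l<..b}))"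
      unfolding rk_def by (rule card_mono[rotated]) auto
    also have "\<dots> \<le> Suc (card (inv u ` {?l<..b}))" by (rule card_insert_le_m1) auto
    also have "card (inv u ` {?l<..b}) \<le> b - ?l" using card_image_le[of "{?l<..b}" "inv u"] by simp
    finally have 1: "rk u (Suc a) b \<le> Suc (b - ?l)" by simp
    have "insert 0 (inv dom_perm ` {?l<..b}) \<subseteq> {p \<in> {..Suc a}. dom_perm p \<le> b}"
    proof
      fix p assume p: "p \<in> insert 0 (inv dom_perm ` {?l<..b})"
      show "p \<in> {p \<in> {..Suc a}. dom_perm p \<le> b}"
      proof (cases "p = 0")
        case True
        then show ?thesis using permutes_not_in[OF dom_perm_permutes, of 0] by simp
      next
        case p0: False
        then obtain x where x: "?l < x" "x \<le> b" "p = inv dom_perm x" using p by auto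
        then obtain p' where "p' < Suc a" "dom_perm p' = x"
          using dom_perm_greedy[of "Suc a" x] False Suc.prems by auto
        moreover have "p' = p" using x(3) \<open>dom_perm p' = x\<close> permutes_inverses(2)[OF dom_perm_permutes] by auto
        ultimately show ?thesis using x by auto
      qed
    qed
    then have "card (insert 0 (inv dom_perm ` {?l<..b})) \<le> rk dom_perm (Suc a) b"
      unfolding rk_def by (rule card_mono[rotated]) auto
    moreover have "0 \<notin> inv dom_perm ` {?l<..b}"
    proof
      assume "0 \<in> inv dom_perm ` {?l<..b}"
      then obtain x where "?l < x" "inv dom_perm x = 0" by auto
      then show False
        using permutes_inverses(1)[OF dom_perm_permutes, of x] permutes_not_in[OF dom_perm_permutes, of 0] by simp
    qed
    moreover have "card (inv dom_perm ` {?l<..b}) = b - ?l"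
      using permutes_inj[OF permutes_inv[OF dom_perm_permutes]] by (subst card_image) (auto intro: inj_on_subset)
    ultimately show ?thesis using 1 by simp
  qed
qed

end

text \<open>By the greedy rule, rows a < b can have decreasing values only if the later value is at
  most \<open>zlam\<close> of row a. Inside of a block row or a block column this is impossible,
  since \<open>zlam\<close> depends on the block row and is exceeded by all or by none of a block
  column.\<close>

lemma dom_perm_zelevinsky: "zelevinsky n r (dominant.dom_perm (total_size n r) (zlam n r))"
proof -
  let ?d = "total_size n r"
  interpret dominant ?d "zlam n r" by (rule zlam_dominant)
  have key: "dom_perm a < dom_perm b" if ab: "a \<in> {1..?d}" "b \<in> {1..?d}" "a < b" and low: "zlam n r a < dom_perm b" for a b
  proof (rule ccontr)
    assume "\<not> dom_perm a < dom_perm b"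
    moreover have "dom_perm a \<noteq> dom_perm b" using permutes_inj[OF dom_perm_permutes] ab by (auto dest: injD)
    ultimately obtain p' where "p' < a" "dom_perm p' = dom_perm b"
      using dom_perm_greedy[of a "dom_perm b"] ab low by auto
    then have "p' = b" using permutes_inj[OF dom_perm_permutes] by (metis injD)
    then show False using \<open>p' < a\<close> ab by simp
  qed
  have range: "1 \<le> dom_perm a \<and> dom_perm a \<le> ?d" if "a \<in> {1..?d}" for a
    using permutes_in_image[OF dom_perm_permutes, of a] that by auto
  show ?thesis
    unfolding zelevinsky_iff
  proof (intro conjI ballI impI)
    show "dom_perm permutes {1..?d}" by (rule dom_perm_permutes)
    show "zlam n r p < dom_perm p" if "p \<in> {1..?d}" for p using dom_perm_above that by auto
    fix a b assume ab: "a \<in> {1..?d}" "b \<in> {1..?d}" "a < b"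
    {
      assume "rowblk r a = rowblk r b"
      then have "zlam n r a = zlam n r b" by (simp add: zlam_def)
      then show "dom_perm a < dom_perm b" using key[OF ab] dom_perm_above[of b] ab by simp
    next
      assume eq: "colblk n r (dom_perm a) = colblk n r (dom_perm b)"
      have "zlam n r a < dom_perm a" using dom_perm_above[of a] ab by simp
      then have "zlam n r a < dom_perm b"
        using zlam_less_iff[of a n r "dom_perm a"] zlam_less_iff[of a n r "dom_perm b"] eq range[OF ab(1)] range[OF ab(2)] ab by simp
      then show "dom_perm a < dom_perm b" by (rule key[OF ab])
    }
  qed
qed

lemma zel_hom_eq: "zel_hom n r = dominant.dom_perm (total_size n r) (zlam n r)"
proof -
  let ?d = "total_size n r"
  interpret dominant ?d "zlam n r" by (rule zlam_dominant)
  have max: "zel_rank n r u i j \<le> zel_rank n r dom_perm i j" if u: "zelevinsky n r u" and ij: "i \<le> j" "j \<le> n" for u i j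
  proof -
    have i: "i \<le> n" using ij by simp
    have "rk u (row_offset r j) (col_offset n r i) \<le> rk dom_perm (row_offset r j) (col_offset n r i)"
      by (rule rk_le_dom_perm)
        (use u ij row_offset_le_total[of j n r] in \<open>auto simp: zelevinsky_iff\<close>)
    then show ?thesis
      using zel_rank_rk[OF zelevinsky_permutes[OF u] i ij(2)] zel_rank_rk[OF dom_perm_permutes i ij(2)] by linarith
  qed
  show ?thesis
    unfolding zel_hom_def
  proof (rule the_equality)
    show "zelevinsky n r dom_perm \<and> (\<forall>u i j. zelevinsky n r u \<and> i \<le> j \<and> j \<le> n \<longrightarrow> zel_rank n r u i j \<le> zel_rank n r dom_perm i j)"
      using dom_perm_zelevinsky max by blast
    fix v assume v: "zelevinsky n r v \<and> (\<forall>u i j. zelevinsky n r u \<and> i \<le> j \<and> j \<le> n \<longrightarrow> zel_rank n r u i j \<le> zel_rank n r v i j)"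
    show "v = dom_perm"
    proof (rule zelevinsky_unique[where n = n and r = r])
      fix i j assume "i \<le> j" "j \<le> n"
      then show "zel_rank n r v i j = zel_rank n r dom_perm i j"
        using v max dom_perm_zelevinsky by (intro antisym) auto
    qed (use v dom_perm_zelevinsky in auto)
  qed
qed

section \<open>Double quiver K-polynomials as sums over pipe dreams\<close>

lemma nth_letter_middle:
  assumes "1 \<le> t" "t \<le> length ys"
  shows "nth_letter (xs @ ys @ zs) (length xs + t) = Some (ys ! (t - 1))"
proof -
  have "length xs + t - 1 = length xs + (t - 1)" using assms by simp
  then show ?thesis using assms by (auto simp: nth_letter_def nth_append)
qed

lemma nth_letter_xs_all:
  assumes "j \<le> n" "1 \<le> t" "t \<le> r j"
  shows "nth_letter (xs_all n r) (row_offset r j + t) = Some (X j t)"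
proof -
  have "[0..<Suc n] = [0..<j] @ [j] @ [Suc j..<Suc n]"
    using assms upt_add_eq_append[of 0 j "Suc n - j"] by (simp add: upt_conv_Cons del: upt_Suc)
  then have "xs_all n r = concat (map (xalph r) [0..<j]) @ xalph r j @ concat (map (xalph r) [Suc j..<Suc n])"
    by (simp add: xs_all_def del: upt_Suc)
  moreover have "length (concat (map (xalph r) [0..<j])) = row_offset r j"
    by (induction j) (auto simp: row_offset_def xalph_def)
  moreover have "t \<le> length (xalph r j)" "xalph r j ! (t - 1) = X j t"
    using assms by (auto simp: xalph_def simp del: upt_Suc)
  ultimately show ?thesis using nth_letter_middle[OF assms(2), of "xalph r j"] by metis
qed

lemma nth_letter_ys_all:
  assumes "i \<le> n" "1 \<le> t" "t \<le> r i"
  shows "nth_letter (ys_all n r) (col_offset n r i + t) = Some (Y i t)"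
proof -
  have "[0..<Suc n] = [0..<i] @ [i] @ [Suc i..<Suc n]"
    using assms upt_add_eq_append[of 0 i "Suc n - i"] by (simp add: upt_conv_Cons del: upt_Suc)
  then have "ys_all n r = concat (map (yalph r) (rev [Suc i..<Suc n])) @ yalph r i @ concat (map (yalph r) (rev [0..<i]))"
    by (simp add: ys_all_def del: upt_Suc)
  moreover have "length (concat (map (yalph r) (rev [Suc i..<Suc n]))) = col_offset n r i"
  proof -
    have "length (concat (map (yalph r) (rev xs))) = (\<Sum>x\<leftarrow>xs. r x)" for xs
      by (induction xs) (auto simp: yalph_def)
    moreover have "(\<Sum>x\<leftarrow>[Suc i..<Suc n]. r x) = (\<Sum>x\<in>{Suc i..<Suc n}. r x)"
      by (simp add: interv_sum_list_conv_sum_set_nat)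
    moreover have "{Suc i..<Suc n} = {i<..n}" by auto
    ultimately show ?thesis by (simp add: col_offset_def)
  qed
  moreover have "t \<le> length (yalph r i)" "yalph r i ! (t - 1) = Y i t"
    using assms by (auto simp: yalph_def simp del: upt_Suc)
  ultimately show ?thesis using nth_letter_middle[OF assms(2), of "yalph r i"] by metis
qed

definition xpar :: "(nat \<Rightarrow> nat) \<Rightarrow> nat \<Rightarrow> qletter" where
  "xpar r p = X (rowblk r p) (p - row_offset r (rowblk r p))"

definition ypar :: "nat \<Rightarrow> (nat \<Rightarrow> nat) \<Rightarrow> nat \<Rightarrow> qletter" where
  "ypar n r q = Y (colblk n r q) (q - col_offset n r (colblk n r q))"

lemma nth_letter_xpar:
  assumes "1 \<le> p" "p \<le> total_size n r"
  shows "nth_letter (xs_all n r) p = Some (xpar r p)"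
proof -
  define j t where "j = rowblk r p" and "t = p - row_offset r j"
  have j: "j \<le> n" "1 \<le> t" "t \<le> r j" and p: "row_offset r j + t = p"
    using rowblk_props[OF assms] by (auto simp: j_def t_def block_row_def)
  have "nth_letter (xs_all n r) p = Some (X j t)"
    using nth_letter_xs_all[of j n t r, OF j] unfolding p .
  then show ?thesis unfolding xpar_def j_def t_def .
qed

lemma nth_letter_ypar:
  assumes "1 \<le> q" "q \<le> total_size n r"
  shows "nth_letter (ys_all n r) q = Some (ypar n r q)"
proof -
  define i t where "i = colblk n r q" and "t = q - col_offset n r i"
  have i: "i \<le> n" "1 \<le> t" "t \<le> r i" and q: "col_offset n r i + t = q"
    using colblk_props[OF assms] by (auto simp: i_def t_def block_col_def)
  have "nth_letter (ys_all n r) q = Some (Y i t)"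
    using nth_letter_ys_all[of i n t r, OF i] unfolding q .
  then show ?thesis unfolding ypar_def i_def t_def .
qed

lemma letter_prod_ne_1: "x \<noteq> y \<Longrightarrow> letter x * inv_letter y - 1 \<noteq> 0"
proof
  assume "x \<noteq> y" "letter x * inv_letter y - 1 = 0"
  then have 1: "letter y * (letter x * inv_letter y) = letter y" by simp
  have "letter y * (letter x * inv_letter y) = letter x * (letter y * inv_letter y)"
    by (rule mult.left_commute)
  then have "letter x = letter y" using 1 by (simp add: letter_inv_letter)
  then show False using \<open>x \<noteq> y\<close> by (simp add: letter_eq_iff)
qed

text \<open>Both polynomials contain the product W over the zero blocks, and for v(Hom) only a sign
  remains besides it. W is nonzero because row letters and column letters differ; after letters are
  set to 1 it may vanish.\<close>

lemma double_quiver_K_eq: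
  assumes v: "zelevinsky n r (zel_perm n r R)"
  shows "double_quiver_K n r R = (- 1) ^ (perm_length (zel_perm n r R) + perm_length (zel_hom n r)) *
    kp (young (total_size n r) (zlam n r)) (\<lambda>p. letter (xpar r p)) (\<lambda>q. inv_letter (ypar n r q))
      (total_size n r) (zel_perm n r R)"
proof -
  let ?d = "total_size n r" and ?v = "zel_perm n r R"
  interpret dominant ?d "zlam n r" by (rule zlam_dominant)
  let ?a = "\<lambda>p. letter (xpar r p)" and ?b = "\<lambda>q. inv_letter (ypar n r q)"
  define W where "W = (\<Prod>(p, q)\<in>young ?d (zlam n r). ?a p * ?b q - 1)"
  have at: "at_alphabets (grothendieck u) (xs_all n r) (ys_all n r) =
      (- 1) ^ perm_length u * (W * kp (young ?d (zlam n r)) ?a ?b ?d u)" if "zelevinsky n r u" for u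
  proof -
    have "kp {} (\<lambda>p. lval (nth_letter (xs_all n r) p)) (\<lambda>q. ilval (nth_letter (ys_all n r) q)) ?d u = kp {} ?a ?b ?d u"
      by (rule kp_cong) (auto simp: nth_letter_xpar nth_letter_ypar lval_def ilval_def)
    also have "\<dots> = W * kp (young ?d (zlam n r)) ?a ?b ?d u"
      unfolding W_def by (rule kp_factor) (use that in \<open>auto simp: zelevinsky_iff\<close>)
    finally show ?thesis unfolding at_alphabets_grothendieck[OF zelevinsky_permutes[OF that]] by (rule arg_cong)
  qed
  have "W \<noteq> 0"
    unfolding W_def using finite_subset[OF young_subset]
    by (auto simp: xpar_def ypar_def dest: letter_prod_ne_1[THEN notE, rotated])
  then have W: "(- 1) ^ perm_length (zel_hom n r) * W \<noteq> 0" by simp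
  have hom: "at_alphabets (grothendieck (zel_hom n r)) (xs_all n r) (ys_all n r) = (- 1) ^ perm_length (zel_hom n r) * W"
    using at[OF dom_perm_zelevinsky] by (simp add: zel_hom_eq kp_dom_perm)
  show ?thesis
    unfolding double_quiver_K_def hom
  proof (rule exact_quot_eqI[OF W])
    have "(- 1) ^ k * (- 1) ^ k = (1 :: qletter laurent)" for k
      by (simp add: power_mult_distrib[symmetric])
    then have "(- 1) ^ (k + l) * K * ((- 1) ^ l * W) = (- 1) ^ k * (W * K)" for k l K
      by (simp add: power_add algebra_simps)
    then show "(- 1) ^ (perm_length ?v + perm_length (zel_hom n r)) * kp (young ?d (zlam n r)) ?a ?b ?d ?v *
        ((- 1) ^ perm_length (zel_hom n r) * W) =
        at_alphabets (grothendieck ?v) (xs_all n r) (ys_all n r)"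
      unfolding at[OF v] by blast
  qed
qed

section \<open>Symmetry within blocks\<close>

text \<open>A permutation of the interval is the Demazure product of a word with letters inside of
  it, so single exchanges suffice. \<open>Q\<close> carries a condition on the letters such as
  invertibility along the word.\<close>

lemma adjacent_invariance:
  fixes F :: "(nat \<Rightarrow> 'a) \<Rightarrow> 'b"
  assumes inv: "\<And>a i. c < i \<Longrightarrow> i < e \<Longrightarrow> Q a \<Longrightarrow> F (a \<circ> adj i) = F a"
    and Q: "\<And>a s. Q a \<Longrightarrow> Q (a \<circ> s)" and s: "s permutes {c<..e}" and a: "Q a"
  shows "F (a \<circ> s) = F a"
proof -
  have "s permutes {Suc c..e}" using s by (simp add: atLeastSucAtMost_greaterThanAtMost)
  then obtain w where w: "word_demazure w = s" "\<And>i. i \<in> set w \<Longrightarrow> Suc c \<le> i \<and> i < e"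
    using every_permutation_demazure by blast
  have "F (a \<circ> word_demazure w) = F a" using w(2)
  proof (induction w rule: rev_induct)
    case (snoc i w)
    have "F ((a \<circ> word_demazure w) \<circ> adj i) = F (a \<circ> word_demazure w)"
      by (rule inv) (use snoc.prems[of i] Q[OF a] in auto)
    then have "F (a \<circ> rop (word_demazure w) i) = F (a \<circ> word_demazure w)"
      by (simp add: rop_def comp_assoc)
    moreover have "F (a \<circ> word_demazure w) = F a" by (rule snoc.IH) (use snoc.prems in auto)
    ultimately show ?case unfolding demazure_snoc by (rule trans)
  qed (simp add: word_demazure_rops)
  then show ?thesis by (simp add: w)
qed

lemma young_zlam_row:
  assumes "p \<in> block_row r j" "Suc p \<in> block_row r j" "j \<le> n"
  shows "(p, q) \<in> young (total_size n r) (zlam n r) \<longleftrightarrow> (Suc p, q) \<in> young (total_size n r) (zlam n r)"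
  using assms block_row_bounds[of j n] rowblk_eqI[OF assms(1)] rowblk_eqI[OF assms(2)]
  by (auto simp: young_def zlam_def)

lemma young_zlam_iff:
  assumes "1 \<le> p" "p \<le> total_size n r" "1 \<le> q" "q \<le> total_size n r"
  shows "(p, q) \<in> young (total_size n r) (zlam n r) \<longleftrightarrow> rowblk r p + 2 \<le> colblk n r q"
  using zlam_less_iff[OF assms] assms by (auto simp: young_def)

lemma young_zlam_col:
  assumes "q \<in> block_col n r i" "Suc q \<in> block_col n r i" "i \<le> n"
  shows "(p, q) \<in> young (total_size n r) (zlam n r) \<longleftrightarrow> (p, Suc q) \<in> young (total_size n r) (zlam n r)"
proof (cases "1 \<le> p \<and> p \<le> total_size n r")
  case True
  then show ?thesis
    using young_zlam_iff[of p n r] assms block_col_bounds[of i n _ r] colblk_eqI[of i n _ r] by auto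
qed (auto simp: young_def)

text \<open>Inside of a block row \<open>v\<close> has only ascents and neighbouring rows have the
  same compulsory crosses, so \<open>kp_row_symmetric\<close> applies to every exchange.\<close>

lemma kp_row_block_symmetric:
  assumes v: "zelevinsky n r v" and j: "j \<le> n" and s: "s permutes block_row r j" and a: "\<And>p. a p dvd 1"
  shows "kp (young (total_size n r) (zlam n r)) (a \<circ> s) b (total_size n r) v =
    kp (young (total_size n r) (zlam n r)) a b (total_size n r) v"
proof (rule adjacent_invariance[where F = "\<lambda>a. kp (young (total_size n r) (zlam n r)) a b (total_size n r) v"
      and Q = "\<lambda>a. \<forall>p. a p dvd 1" and c = "row_offset r j" and e = "row_offset r (Suc j)"])
  fix a :: "nat \<Rightarrow> 'a" and i
  assume i: "row_offset r j < i" "i < row_offset r (Suc j)" "\<forall>p. a p dvd 1"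
  have m: "i \<in> block_row r j" "Suc i \<in> block_row r j" using i by (auto simp: block_row_Suc)
  note b = block_row_bounds[OF j m(1)] block_row_bounds[OF j m(2)]
  have "v i < v (Suc i)"
    by (rule zelevinsky_rowD[OF v]) (use m b in \<open>auto simp: rowblk_eqI\<close>)
  then show "kp (young (total_size n r) (zlam n r)) (a \<circ> adj i) b (total_size n r) v =
      kp (young (total_size n r) (zlam n r)) a b (total_size n r) v"
    using i b young_zlam_row[OF m j] by (intro kp_row_symmetric[OF zelevinsky_permutes[OF v]]) auto
qed (use s a in \<open>auto simp: block_row_Suc\<close>)

lemma kp_col_block_symmetric:
  assumes v: "zelevinsky n r v" and i: "i \<le> n" and s: "s permutes block_col n r i" and b: "\<And>q. b q dvd 1"
  shows "kp (young (total_size n r) (zlam n r)) a (b \<circ> s) (total_size n r) v =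
    kp (young (total_size n r) (zlam n r)) a b (total_size n r) v"
proof (rule adjacent_invariance[where F = "\<lambda>b. kp (young (total_size n r) (zlam n r)) a b (total_size n r) v"
      and Q = "\<lambda>b. \<forall>q. b q dvd 1" and c = "col_offset n r i" and e = "col_offset n r i + r i"])
  fix b :: "nat \<Rightarrow> 'a" and q
  assume q: "col_offset n r i < q" "q < col_offset n r i + r i" "\<forall>q. b q dvd 1"
  have m: "q \<in> block_col n r i" "Suc q \<in> block_col n r i" using q by (auto simp: block_col_def)
  note bd = block_col_bounds[OF i m(1)] block_col_bounds[OF i m(2)]
  note p = zelevinsky_permutes[OF v]
  have "inv v q < inv v (Suc q)"
  proof (rule ccontr)
    assume "\<not> inv v q < inv v (Suc q)"
    moreover have "inv v q \<noteq> inv v (Suc q)" by (metis n_not_Suc_n permutes_inverses(1)[OF p])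
    ultimately have "inv v (Suc q) < inv v q" by simp
    moreover have "inv v q \<in> {1..total_size n r}" "inv v (Suc q) \<in> {1..total_size n r}"
      using permutes_in_image[OF permutes_inv[OF p]] bd by auto
    moreover have "v (inv v q) = q" "v (inv v (Suc q)) = Suc q" using permutes_inverses(1)[OF p] by auto
    ultimately have "Suc q < q"
      using zelevinsky_colD[OF v, of "inv v (Suc q)" "inv v q"] colblk_eqI[OF i m(1)] colblk_eqI[OF i m(2)] by simp
    then show False by simp
  qed
  then show "kp (young (total_size n r) (zlam n r)) a (b \<circ> adj q) (total_size n r) v =
      kp (young (total_size n r) (zlam n r)) a b (total_size n r) v"
    using q bd young_zlam_col[OF m i] by (intro kp_col_symmetric[OF p]) auto
qed (use s b in \<open>auto simp: block_col_def\<close>)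

section \<open>One-line notation\<close>

text \<open>\<open>rop\<close> on one-line notation: positions i and i + 1 are the list indices i -
  1 and i.\<close>

definition lop :: "nat list \<Rightarrow> nat \<Rightarrow> nat list" where
  "lop L i = (if L ! (i - 1) < L ! i then L[i - 1 := L ! i, i := L ! (i - 1)] else L)"

abbreviation lops :: "nat list \<Rightarrow> nat list \<Rightarrow> nat list" where
  "lops \<equiv> foldl lop"

lemma length_lop [simp]: "length (lop L i) = length L"
  by (simp add: lop_def)

lemma length_lops [simp]: "length (lops L w) = length L"
  by (induction w arbitrary: L) auto

lemma set_lop: "1 \<le> i \<Longrightarrow> i < length L \<Longrightarrow> set (lop L i) = set L"
  by (simp add: lop_def set_swap)

lemma set_lops: "(\<And>i. i \<in> set w \<Longrightarrow> 1 \<le> i \<and> i < length L) \<Longrightarrow> set (lops L w) = set L"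
proof (induction w arbitrary: L)
  case (Cons i w)
  have "set (lops (lop L i) w) = set (lop L i)" by (rule Cons.IH) (use Cons.prems in auto)
  then show ?case using set_lop[of i L] Cons.prems by simp
qed simp

lemma olist_rop:
  assumes "1 \<le> i" "i < d"
  shows "map (rop u i) [1..<Suc d] = lop (map u [1..<Suc d]) i"
  by (rule nth_equalityI) (use assms in \<open>auto simp: lop_def rop_apply nth_list_update simp del: upt_Suc\<close>)

lemma olist_rops:
  "(\<And>i. i \<in> set w \<Longrightarrow> 1 \<le> i \<and> i < d) \<Longrightarrow> map (rops u w) [1..<Suc d] = lops (map u [1..<Suc d]) w"
proof (induction w arbitrary: u)
  case (Cons i w)
  then show ?case using olist_rop[of i d u] Cons.IH[of "rop u i"] by (simp del: upt_Suc)
qed simp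

lemma olist_demazure:
  "(\<And>i. i \<in> set w \<Longrightarrow> 1 \<le> i \<and> i < d) \<Longrightarrow> map (word_demazure w) [1..<Suc d] = lops [1..<Suc d] w"
  using olist_rops[of w d id] by (simp add: word_demazure_rops del: upt_Suc)

lemma lop_window:
  assumes "1 \<le> i" "i < length M"
  shows "lop (A @ M @ B) (length A + i) = A @ lop M i @ B"
proof -
  have "(A @ M @ B) ! (length A + i) = M ! i" "(A @ M @ B) ! (length A + i - 1) = M ! (i - 1)"
    using assms by (auto simp: nth_append)
  moreover have "(A @ M @ B)[length A + i - 1 := x, length A + i := y] = A @ M[i - 1 := x, i := y] @ B" for x y
    using assms by (auto simp: list_update_append)
  ultimately show ?thesis by (simp add: lop_def)
qed

lemma lops_window:
  assumes "\<And>i. i \<in> set w \<Longrightarrow> 1 \<le> i \<and> i < length M"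
  shows "lops (A @ M @ B) (map ((+) (length A)) w) = A @ lops M w @ B"
  using assms
proof (induction w arbitrary: M)
  case (Cons i w)
  then show ?case using lop_window[of i M A B] Cons.IH[of "lop M i"] by simp
qed simp

lemma lops_map:
  assumes "strict_mono_on S \<phi>" "set L \<subseteq> S" "\<And>i. i \<in> set w \<Longrightarrow> 1 \<le> i \<and> i < length L"
  shows "lops (map \<phi> L) w = map \<phi> (lops L w)"
  using assms(2,3)
proof (induction w arbitrary: L)
  case (Cons i w)
  have i: "1 \<le> i" "i < length L" using Cons.prems(2)[of i] by auto
  then have "L ! (i - 1) \<in> S" "L ! i \<in> S" using Cons.prems(1) by auto
  then have "\<phi> (L ! (i - 1)) < \<phi> (L ! i) \<longleftrightarrow> L ! (i - 1) < L ! i"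
    using assms(1) by (simp add: strict_mono_on_less)
  then have "lop (map \<phi> L) i = map \<phi> (lop L i)"
    using i by (simp add: lop_def map_update)
  moreover have "lops (map \<phi> (lop L i)) w = map \<phi> (lops (lop L i) w)"
    by (rule Cons.IH) (use Cons.prems set_lop[OF i] in auto)
  ultimately show ?case by simp
qed simp

lemma lops_move_row:
  assumes "\<And>y. y \<in> set low \<Longrightarrow> y < x"
  shows "lops (pre @ low @ x # B) (rev [Suc (length pre)..<Suc (length pre) + length low]) = pre @ x # low @ B"
  using assms
proof (induction low arbitrary: B rule: rev_induct)
  case (snoc y low)
  let ?i = "Suc (length pre) + length low"
  have "lop ((pre @ low) @ [y, x] @ B) (length (pre @ low) + 1) = (pre @ low) @ lop [y, x] 1 @ B"
    by (rule lop_window) auto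
  also have "lop [y, x] 1 = [x, y]" using snoc.prems[of y] by (simp add: lop_def)
  finally have "lop (pre @ (low @ [y]) @ x # B) ?i = pre @ low @ x # (y # B)" by simp
  moreover have "lops (pre @ low @ x # (y # B)) (rev [Suc (length pre)..<?i]) = pre @ x # low @ (y # B)"
    by (rule snoc.IH) (use snoc.prems in auto)
  ultimately show ?case by simp
qed simp

text \<open>The word of a full rectangle of crosses with k rows and c columns whose northwest box
  has the letter a + 1.\<close>

definition rect_word :: "nat \<Rightarrow> nat \<Rightarrow> nat \<Rightarrow> nat list" where
  "rect_word a k c = concat (map (\<lambda>t. rev [a + t..<a + t + c]) [1..<Suc k])"

text \<open>Row by row, each entry of \<open>A\<close> travels past all of \<open>low\<close>, whose
  entries are smaller; so the full rectangle exchanges the two segments.\<close>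

lemma lops_rect_word:
  assumes "\<And>x y. x \<in> set low \<Longrightarrow> y \<in> set A \<Longrightarrow> x < y"
  shows "lops (pre @ low @ A @ B) (rect_word (length pre) (length A) (length low)) = pre @ A @ low @ B"
  using assms
proof (induction A arbitrary: B rule: rev_induct)
  case (snoc x A)
  have "rect_word (length pre) (length (A @ [x])) (length low) =
      rect_word (length pre) (length A) (length low) @
      rev [Suc (length (pre @ A))..<Suc (length (pre @ A)) + length low]"
    by (simp add: rect_word_def)
  moreover have "lops (pre @ low @ A @ (x # B)) (rect_word (length pre) (length A) (length low)) =
      pre @ A @ low @ (x # B)"
    by (rule snoc.IH) (use snoc.prems in auto)
  moreover have "lops ((pre @ A) @ low @ x # B) (rev [Suc (length (pre @ A))..<Suc (length (pre @ A)) + length low]) =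
      (pre @ A) @ x # low @ B"
    by (rule lops_move_row) (use snoc.prems in auto)
  ultimately show ?case by simp
qed (simp add: rect_word_def)

section \<open>Processing a lacing diagram block by block\<close>

text \<open>The words of a lacing diagram are rotated, hence they act on lists from the end.\<close>

definition fops :: "nat list \<Rightarrow> nat list \<Rightarrow> nat list" where
  "fops L w = lops L (map (\<lambda>i. length L - i) (rev w))"

text \<open>The list carried over to stage \<open>j\<close> consists of the entries of the block columns up to \<open>j\<close> that no
  finished block row has used.\<close>

fun trun :: "(nat \<Rightarrow> nat list) \<Rightarrow> (nat \<Rightarrow> nat) \<Rightarrow> (nat \<Rightarrow> nat list) \<Rightarrow> nat \<Rightarrow> nat list list \<times> nat list" where
  "trun cb s g 0 = ([], cb 0)"
| "trun cb s g (Suc j) = (let (outs, R) = trun cb s g j; M = fops (cb (Suc j) @ R) (g j)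
     in (outs @ [take (s j) M], drop (s j) M))"

definition colb :: "nat \<Rightarrow> (nat \<Rightarrow> nat) \<Rightarrow> nat \<Rightarrow> nat list" where
  "colb n r i = [Suc (col_offset n r i)..<Suc (col_offset n r i + r i)]"

text \<open>Block row j of an assembled pipe dream with its right columns read first: the rotated
  superantidiagonal block, whose reversed letters count from the end, and then the compulsory
  rectangle to the left of it.\<close>

definition stage_word :: "nat \<Rightarrow> (nat \<Rightarrow> nat) \<Rightarrow> nat list \<Rightarrow> nat \<Rightarrow> nat list" where
  "stage_word n r w j = map (\<lambda>i. total_size n r - i) (rev w) @ rect_word (row_offset r j) (r j) (col_offset n r (Suc j))"

definition total_word :: "nat \<Rightarrow> (nat \<Rightarrow> nat) \<Rightarrow> (nat \<Rightarrow> nat list) \<Rightarrow> nat \<Rightarrow> nat list" where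
  "total_word n r g j = concat (map (\<lambda>j. stage_word n r (g j) j) [0..<j])"

text \<open>The range of letters possible in pipe dreams of size r j by r (j + 1).\<close>

definition words_ok :: "nat \<Rightarrow> (nat \<Rightarrow> nat) \<Rightarrow> (nat \<Rightarrow> nat list) \<Rightarrow> bool" where
  "words_ok n r g \<longleftrightarrow> (\<forall>j<n. \<forall>i\<in>set (g j). 1 \<le> i \<and> i < r j + r (Suc j))"

lemma total_word_Suc: "total_word n r g (Suc j) = total_word n r g j @ stage_word n r (g j) j"
  by (simp add: total_word_def)

lemma offsets_total: "j < n \<Longrightarrow> row_offset r j + col_offset n r (Suc j) + (r (Suc j) + r j) = total_size n r"
  using col_offset_add[of "Suc j" n r] row_offset_le_total[of "Suc j" n r]
  by (simp add: row_offset_Suc)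

lemma stage_word_letters:
  assumes "j < n" "\<And>i. i \<in> set w \<Longrightarrow> 1 \<le> i \<and> i < r j + r (Suc j)" "i \<in> set (stage_word n r w j)"
  shows "1 \<le> i \<and> i < total_size n r"
proof -
  consider i' where "i' \<in> set w" "i = total_size n r - i'"
    | t where "1 \<le> t" "t \<le> r j" "row_offset r j + t \<le> i" "i < row_offset r j + t + col_offset n r (Suc j)"
    using assms(3) by (auto simp: stage_word_def rect_word_def simp del: upt_Suc)
  then show ?thesis
  proof cases
    case 1
    then show ?thesis using assms(2)[of i'] offsets_total[OF assms(1), of r] by auto
  next
    case 2
    then show ?thesis using offsets_total[OF assms(1), of r] by auto
  qed
qed

lemma total_word_letters:
  assumes "words_ok n r g" "j \<le> n" "i \<in> set (total_word n r g j)"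
  shows "1 \<le> i \<and> i < total_size n r"
proof -
  obtain j' where j': "j' < j" "i \<in> set (stage_word n r (g j') j')"
    using assms(3) unfolding total_word_def by auto
  show ?thesis
  proof (rule stage_word_letters[OF _ _ j'(2)])
    show jn: "j' < n" using j' assms(2) by simp
    show "1 \<le> i \<and> i < r j' + r (Suc j')" if "i \<in> set (g j')" for i
      using assms(1) \<open>j' < n\<close> that by (simp add: words_ok_def)
  qed
qed

lemma words_okD: "words_ok n r g \<Longrightarrow> j < n \<Longrightarrow> i \<in> set (g j) \<Longrightarrow> 1 \<le> i \<and> i < r j + r (Suc j)"
  by (auto simp: words_ok_def)

lemma trun_invariants:
  assumes "words_ok n r g" "j \<le> n" "\<And>i. length (cb i) = r i"
  shows "length (snd (trun cb r g j)) = r j \<and> map length (fst (trun cb r g j)) = map r [0..<j] \<and>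
    set (snd (trun cb r g j)) \<subseteq> (\<Union>i\<le>j. set (cb i))"
  using assms(2)
proof (induction j)
  case (Suc j)
  obtain outs R where t: "trun cb r g j = (outs, R)" by fastforce
  have jn: "j < n" using Suc.prems by simp
  have R: "length R = r j" "map length outs = map r [0..<j]" "set R \<subseteq> (\<Union>i\<le>j. set (cb i))"
    using Suc.IH jn t by auto
  define M where "M = fops (cb (Suc j) @ R) (g j)"
  have len: "length M = r (Suc j) + r j" by (simp add: M_def fops_def R assms(3))
  have "set M = set (cb (Suc j) @ R)"
    unfolding M_def fops_def
  proof (rule set_lops)
    fix i assume "i \<in> set (map (\<lambda>i. length (cb (Suc j) @ R) - i) (rev (g j)))"
    then obtain i' where "i' \<in> set (g j)" "i = length (cb (Suc j) @ R) - i'" by auto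
    then show "1 \<le> i \<and> i < length (cb (Suc j) @ R)"
      using words_okD[OF assms(1) jn, of i'] by (auto simp: R assms(3))
  qed
  then have "set (drop (r j) M) \<subseteq> (\<Union>i\<le>Suc j. set (cb i))"
    using set_drop_subset[of "r j" M] R(3) by (auto simp: atMost_Suc)
  then show ?case
    using len R(2) by (simp add: t M_def[symmetric] Let_def)
qed (auto simp: assms(3))

lemma length_colb [simp]: "length (colb n r i) = r i"
  by (simp add: colb_def del: upt_Suc)

lemma set_colb: "set (colb n r i) = block_col n r i"
  by (auto simp: colb_def block_col_def simp del: upt_Suc)

lemma colb_gt: "i \<le> j \<Longrightarrow> x \<in> set (colb n r i) \<Longrightarrow> col_offset n r j < x"
  using col_offset_antimono[of i j n r] by (auto simp: set_colb block_col_def)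

text \<open>The rotated block acts on the last r (j + 1) + r j entries, which are block column j + 1
  and the carried list. The rectangle then brings the first r j of the resulting entries in front of
  the untouched values, which are all smaller.\<close>

lemma total_word_state:
  assumes g: "words_ok n r g" and j: "j \<le> n"
  shows "lops [1..<Suc (total_size n r)] (total_word n r g j) =
    concat (fst (trun (colb n r) r g j)) @ [1..<Suc (col_offset n r j)] @ snd (trun (colb n r) r g j)"
  using j
proof (induction j)
  case 0
  have "col_offset n r 0 + r 0 = total_size n r" using col_offset_add[of 0 n r] by (simp add: row_offset_def)
  then show ?case by (simp add: total_word_def colb_def upt_add_eq_append[symmetric] del: upt_Suc)
    (metis One_nat_def Suc_eq_plus1_left add_Suc le_add1 upt_add_eq_append)
next
  case (Suc j)
  obtain outs R where t: "trun (colb n r) r g j = (outs, R)" by fastforce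
  define M where "M = fops (colb n r (Suc j) @ R) (g j)"
  have jn: "j \<le> n" "j < n" using Suc.prems by auto
  have R: "length R = r j" "map length outs = map r [0..<j]" "set R \<subseteq> (\<Union>i\<le>j. set (colb n r i))"
    using trun_invariants[OF g jn(1), of "colb n r"] t by auto
  have len: "length (concat outs) = row_offset r j"
    by (simp add: length_concat R(2) row_offset_def interv_sum_list_conv_sum_set_nat atLeast0LessThan)
  let ?low = "[1..<Suc (col_offset n r (Suc j))]"
  have letters: "1 \<le> i \<and> i < r j + r (Suc j)" if "i \<in> set (g j)" for i
    using g jn that by (auto simp: words_ok_def)
  have split: "[1..<Suc (col_offset n r j)] = ?low @ colb n r (Suc j)"
    unfolding col_offset_Suc[OF jn(2)] colb_def
    using upt_add_eq_append[of 1 "Suc (col_offset n r (Suc j))" "r (Suc j)"] by simp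
  have lenM: "length M = r (Suc j) + r j" by (simp add: M_def fops_def R)
  have "map (\<lambda>i. total_size n r - i) (rev (g j)) =
      map ((+) (length (concat outs @ ?low))) (map (\<lambda>i. length (colb n r (Suc j) @ R) - i) (rev (g j)))"
    unfolding map_map
  proof (rule map_cong[OF refl])
    fix i assume "i \<in> set (rev (g j))"
    then show "total_size n r - i =
        ((+) (length (concat outs @ ?low)) \<circ> (\<lambda>i. length (colb n r (Suc j) @ R) - i)) i"
      using letters[of i] offsets_total[OF jn(2), of r] len by (simp add: R del: upt_Suc)
  qed
  then have "lops (concat outs @ [1..<Suc (col_offset n r j)] @ R) (map (\<lambda>i. total_size n r - i) (rev (g j))) =
      (concat outs @ ?low) @ M @ []"
  proof -
    have "lops ((concat outs @ ?low) @ (colb n r (Suc j) @ R) @ [])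
        (map ((+) (length (concat outs @ ?low))) (map (\<lambda>i. length (colb n r (Suc j) @ R) - i) (rev (g j)))) =
        (concat outs @ ?low) @ M @ []"
      unfolding M_def fops_def
    proof (rule lops_window)
      fix i assume "i \<in> set (map (\<lambda>i. length (colb n r (Suc j) @ R) - i) (rev (g j)))"
      then obtain i' where "i' \<in> set (g j)" "i = length (colb n r (Suc j) @ R) - i'" by auto
      then show "1 \<le> i \<and> i < length (colb n r (Suc j) @ R)" using letters[of i'] by (auto simp: R)
    qed
    then show ?thesis unfolding split \<open>map (\<lambda>i. total_size n r - i) (rev (g j)) = _\<close> by (simp del: upt_Suc)
  qed
  moreover have "lops (concat outs @ ?low @ take (r j) M @ drop (r j) M)
      (rect_word (length (concat outs)) (length (take (r j) M)) (length ?low)) =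
      concat outs @ take (r j) M @ ?low @ drop (r j) M"
  proof (rule lops_rect_word)
    fix x y assume x: "x \<in> set ?low" and y: "y \<in> set (take (r j) M)"
    have "set M = set (colb n r (Suc j) @ R)"
      unfolding M_def fops_def
    proof (rule set_lops)
      fix i assume "i \<in> set (map (\<lambda>i. length (colb n r (Suc j) @ R) - i) (rev (g j)))"
      then obtain i' where "i' \<in> set (g j)" "i = length (colb n r (Suc j) @ R) - i'" by auto
      then show "1 \<le> i \<and> i < length (colb n r (Suc j) @ R)" using letters[of i'] by (auto simp: R)
    qed
    then have "y \<in> (\<Union>i\<le>Suc j. set (colb n r i))"
      using y in_set_takeD[OF y] R(3) by (auto simp: atMost_Suc)
    then have "col_offset n r (Suc j) < y" using colb_gt by blast
    then show "x < y" using x by auto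
  qed
  ultimately have "lops (concat outs @ [1..<Suc (col_offset n r j)] @ R) (stage_word n r (g j) j) =
      concat outs @ take (r j) M @ ?low @ drop (r j) M"
    by (simp add: stage_word_def len lenM del: upt_Suc)
  then show ?case
    using Suc.IH jn by (simp add: total_word_Suc t M_def Let_def del: upt_Suc)
qed

lemma total_word_final:
  assumes g: "words_ok n r g"
  shows "map (word_demazure (total_word n r g n)) [1..<Suc (total_size n r)] =
    concat (fst (trun (colb n r) r g n)) @ snd (trun (colb n r) r g n)"
  using olist_demazure[of "total_word n r g n" "total_size n r"] total_word_letters[OF g, of n]
    total_word_state[OF g, of n] by (simp add: col_offset_top del: upt_Suc)

lemma total_word_permutes:
  "words_ok n r g \<Longrightarrow> word_demazure (total_word n r g n) permutes {1..total_size n r}"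
  by (rule demazure_permutes) (use total_word_letters[of n r g n] in auto)

definition rowl :: "(nat \<Rightarrow> nat) \<Rightarrow> nat \<Rightarrow> nat list" where
  "rowl r j = [Suc (row_offset r j)..<Suc (row_offset r j + r j)]"

lemma concat_rowl: "concat (map (rowl r) [0..<j]) = [1..<Suc (row_offset r j)]"
proof (induction j)
  case (Suc j)
  then show ?case
    using upt_add_eq_append[of 1 "Suc (row_offset r j)" "r j"] by (simp add: row_offset_Suc rowl_def)
qed (simp add: row_offset_def)

lemma length_rowl [simp]: "length (rowl r j) = r j"
  by (simp add: rowl_def del: upt_Suc)

lemma set_rowl: "set (rowl r j) = block_row r j"
  by (auto simp: rowl_def block_row_def simp del: upt_Suc)

text \<open>The pieces have the lengths of the block rows, so the one-line notation can be cut into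
  them in only one way.\<close>

lemma trun_rows:
  assumes v: "word_demazure (total_word n r g n) = v" and g: "words_ok n r g"
  shows "fst (trun (colb n r) r g n) = map (\<lambda>j. map v (rowl r j)) [0..<n]"
    "snd (trun (colb n r) r g n) = map v (rowl r n)"
proof -
  let ?o = "fst (trun (colb n r) r g n)" and ?R = "snd (trun (colb n r) r g n)"
  have inv: "length ?R = r n" "map length ?o = map r [0..<n]"
    using trun_invariants[OF g, of n "colb n r"] by auto
  have len: "length ?o = n" using arg_cong[OF inv(2), of length] by simp
  have "concat (?o @ [?R]) = map v [1..<Suc (total_size n r)]"
    using total_word_final[OF g] v by simp
  also have "\<dots> = concat (map (\<lambda>j. map v (rowl r j)) [0..<Suc n])"
    unfolding row_offset_total[symmetric] concat_rowl[symmetric] by (simp only: map_concat map_map comp_def)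
  finally have e: "concat (?o @ [?R]) = concat (map (\<lambda>j. map v (rowl r j)) [0..<Suc n])" .
  have "?o @ [?R] = map (\<lambda>j. map v (rowl r j)) [0..<Suc n]"
  proof (rule concat_injective[OF e])
    show "length (?o @ [?R]) = length (map (\<lambda>j. map v (rowl r j)) [0..<Suc n])" using len by simp
    have nth: "length (?o ! i) = r i" if "i < n" for i
      using arg_cong[OF inv(2), of "\<lambda>l. l ! i"] that len by simp
    show "\<forall>(x, y)\<in>set (zip (?o @ [?R]) (map (\<lambda>j. map v (rowl r j)) [0..<Suc n])). length x = length y"
      using nth inv(1) len by (auto simp: set_zip nth_append less_Suc_eq simp del: upt_Suc)
  qed
  then show "?o = map (\<lambda>j. map v (rowl r j)) [0..<n]" "?R = map v (rowl r n)" by auto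
qed

section \<open>Rank-stable extension of permutations\<close>

locale block_shift =
  fixes n :: nat and r :: "nat \<Rightarrow> nat" and m :: nat
begin

definition r' :: "nat \<Rightarrow> nat" where "r' j = m + r j"

abbreviation "d \<equiv> total_size n r"
abbreviation "d' \<equiv> total_size n r'"

lemma row_offset': "row_offset r' j = row_offset r j + m * j"
  by (induction j) (auto simp: row_offset_Suc r'_def, simp add: row_offset_def)

lemma d'_eq: "d' = d + m * n + m"
  using row_offset'[of "Suc n"] by (simp add: row_offset_total)

lemma col_offset': "i \<le> n \<Longrightarrow> col_offset n r' i = col_offset n r i + m * (n - i)"
proof -
  assume i: "i \<le> n"
  have "m * n = m * (n - i) + m * i" using i by (simp add: add_mult_distrib2[symmetric])
  then show ?thesis
    using col_offset_row_offset[OF i, of r] col_offset_row_offset[OF i, of r'] row_offset'[of "Suc i"] d'_eq by simp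
qed

text \<open>Old rows and columns are the last ones of their blocks, except for the first ones of the last
  block row and of the last block column.\<close>

definition \<psi> :: "nat \<Rightarrow> nat" where "\<psi> p = p + m * min (Suc (rowblk r p)) n"
definition \<phi> :: "nat \<Rightarrow> nat" where "\<phi> q = q + m * min (Suc (n - colblk n r q)) n"

lemma psi_block:
  assumes "p \<in> block_row r j" "j \<le> n"
  shows "\<psi> p = row_offset r' j + (if j = n then 0 else m) + (p - row_offset r j)"
    "\<psi> p \<in> block_row r' j" "rowblk r' (\<psi> p) = j" "1 \<le> \<psi> p" "\<psi> p \<le> d' - m"
proof -
  have j: "rowblk r p = j" using assms by (simp add: rowblk_eqI)
  have p: "row_offset r j < p" "p \<le> row_offset r j + r j" using assms by (auto simp: block_row_def)
  show e: "\<psi> p = row_offset r' j + (if j = n then 0 else m) + (p - row_offset r j)"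
    using assms(2) p by (auto simp: \<psi>_def j row_offset' min_def)
  show b: "\<psi> p \<in> block_row r' j" using p unfolding block_row_def e by (auto simp: r'_def)
  show "rowblk r' (\<psi> p) = j" using b by (rule rowblk_eqI)
  show "1 \<le> \<psi> p" using p by (simp add: e)
  have "p \<le> d" using block_row_bounds(2)[OF assms(2,1)] .
  then have "p + m * min (Suc j) n \<le> d + m * n" by (intro add_mono mult_le_mono2) auto
  then show "\<psi> p \<le> d' - m" by (simp add: \<psi>_def j d'_eq)
qed

lemma phi_block:
  assumes "q \<in> block_col n r i" "i \<le> n"
  shows "\<phi> q = col_offset n r' i + (if i = 0 then 0 else m) + (q - col_offset n r i)"
    "\<phi> q \<in> block_col n r' i" "colblk n r' (\<phi> q) = i" "1 \<le> \<phi> q" "\<phi> q \<le> d' - m"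
proof -
  have i: "colblk n r q = i" using assms by (simp add: colblk_eqI)
  have q: "col_offset n r i < q" "q \<le> col_offset n r i + r i" using assms by (auto simp: block_col_def)
  have "min (Suc (n - i)) n = (if i = 0 then n else Suc (n - i))" using assms(2) by auto
  then show e: "\<phi> q = col_offset n r' i + (if i = 0 then 0 else m) + (q - col_offset n r i)"
    using assms(2) q by (auto simp: \<phi>_def i col_offset')
  show b: "\<phi> q \<in> block_col n r' i" using q unfolding block_col_def e by (auto simp: r'_def)
  show "colblk n r' (\<phi> q) = i" by (rule colblk_eqI[OF assms(2) b])
  show "1 \<le> \<phi> q" using q by (simp add: e)
  have "q \<le> d" using block_col_bounds(2)[OF assms(2,1)] .
  then have "q + m * min (Suc (n - i)) n \<le> d + m * n" by (intro add_mono mult_le_mono2) auto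
  then show "\<phi> q \<le> d' - m" by (simp add: \<phi>_def i d'_eq)
qed

lemma phi_mono: "strict_mono_on {1..d} \<phi>"
proof (rule strict_mono_onI)
  fix x y assume "x \<in> {1..d}" "y \<in> {1..d}" "x < y"
  then have "colblk n r y \<le> colblk n r x" by (intro colblk_antimono) auto
  then have "m * min (Suc (n - colblk n r x)) n \<le> m * min (Suc (n - colblk n r y)) n"
    by (intro mult_le_mono2) (auto simp: min_def)
  with \<open>x < y\<close> show "\<phi> x < \<phi> y" unfolding \<phi>_def by (rule add_less_le_mono)
qed

lemma psi_mono: "strict_mono_on {1..d} \<psi>"
proof (rule strict_mono_onI)
  fix x y assume "x \<in> {1..d}" "y \<in> {1..d}" "x < y"
  then have "rowblk r x \<le> rowblk r y" by (intro rowblk_mono[where n = n]) auto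
  then have "m * min (Suc (rowblk r x)) n \<le> m * min (Suc (rowblk r y)) n"
    by (intro mult_le_mono2) (auto simp: min_def)
  with \<open>x < y\<close> show "\<psi> x < \<psi> y" unfolding \<psi>_def by (rule add_less_le_mono)
qed

lemma psi_inj: "x \<in> {1..d} \<Longrightarrow> y \<in> {1..d} \<Longrightarrow> \<psi> x = \<psi> y \<longleftrightarrow> x = y"
  using strict_mono_on_imp_inj_on[OF psi_mono] by (auto dest: inj_onD)

lemma phi_inj: "x \<in> {1..d} \<Longrightarrow> y \<in> {1..d} \<Longrightarrow> \<phi> x = \<phi> y \<longleftrightarrow> x = y"
  using strict_mono_on_imp_inj_on[OF phi_mono] by (auto dest: inj_onD)

lemma position_cases:
  assumes "1 \<le> P" "P \<le> d'"
  obtains (old) p where "p \<in> {1..d}" "P = \<psi> p"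
    | (new) j t where "j < n" "1 \<le> t" "t \<le> m" "P = row_offset r' j + t"
    | (last) t where "1 \<le> t" "t \<le> m" "P = d' - m + t"
proof -
  define j where "j = rowblk r' P"
  have j: "P \<in> block_row r' j" "j \<le> n" using rowblk_props[OF assms] by (auto simp: j_def)
  define t where "t = P - row_offset r' j"
  have t: "1 \<le> t" "t \<le> m + r j" "P = row_offset r' j + t" using j by (auto simp: t_def block_row_def r'_def)
  show thesis
  proof (cases "j = n")
    case True
    show thesis
    proof (cases "t \<le> r n")
      case t': True
      have "row_offset r n + t \<in> block_row r n" using t t' by (auto simp: block_row_def)
      then show thesis using old[of "row_offset r n + t"] psi_block(1)[of "row_offset r n + t" n] t True
        block_row_bounds[of n n "row_offset r n + t" r] by simp
    next
      case False
      have "row_offset r' n + r n = d' - m" using row_offset_total[of r' n] by (simp add: row_offset_Suc r'_def)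
      then show thesis using last[of "t - r n"] False t True by simp
    qed
  next
    case False
    show thesis
    proof (cases "t \<le> m")
      case True
      then show thesis using new[of j t] t j False by simp
    next
      case t': False
      have "row_offset r j + (t - m) \<in> block_row r j" using t t' by (auto simp: block_row_def)
      then show thesis using old[of "row_offset r j + (t - m)"] psi_block(1)[of "row_offset r j + (t - m)" j] t t' False j
        block_row_bounds[of j n "row_offset r j + (t - m)" r] by simp
    qed
  qed
qed

lemma value_cases:
  assumes "1 \<le> Q" "Q \<le> d'"
  obtains (old) q where "q \<in> {1..d}" "Q = \<phi> q"
    | (new) j t where "j < n" "1 \<le> t" "t \<le> m" "Q = col_offset n r' (Suc j) + t"
    | (last) t where "1 \<le> t" "t \<le> m" "Q = d' - m + t"
proof -
  define i where "i = colblk n r' Q"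
  have i: "Q \<in> block_col n r' i" "i \<le> n" using colblk_props[OF assms] by (auto simp: i_def)
  define t where "t = Q - col_offset n r' i"
  have t: "1 \<le> t" "t \<le> m + r i" "Q = col_offset n r' i + t" using i by (auto simp: t_def block_col_def r'_def)
  show thesis
  proof (cases "i = 0")
    case True
    show thesis
    proof (cases "t \<le> r 0")
      case t': True
      have "col_offset n r 0 + t \<in> block_col n r 0" using t t' by (auto simp: block_col_def)
      then show thesis using old[of "col_offset n r 0 + t"] phi_block(1)[of "col_offset n r 0 + t" 0] t True
        block_col_bounds[of 0 n "col_offset n r 0 + t" r] by simp
    next
      case False
      have "col_offset n r' 0 + r 0 = d' - m" using col_offset_add[of 0 n r'] by (simp add: row_offset_def r'_def)
      then show thesis using last[of "t - r 0"] False t True by simp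
    qed
  next
    case False
    show thesis
    proof (cases "t \<le> m")
      case True
      then show thesis using new[of "i - 1" t] t i False by simp
    next
      case t': False
      have "col_offset n r i + (t - m) \<in> block_col n r i" using t t' by (auto simp: block_col_def)
      then show thesis using old[of "col_offset n r i + (t - m)"] phi_block(1)[of "col_offset n r i + (t - m)" i] t t' False i
        block_col_bounds[of i n "col_offset n r i + (t - m)" r] by simp
    qed
  qed
qed

text \<open>The fixed last m points lie in block (n, 0) and raise every rank r_ij by m. The new
  points in the blocks (j, j + 1) supply the rows and columns that are still free; no rank with i <=
  j counts them.\<close>

definition ext :: "(nat \<Rightarrow> nat) \<Rightarrow> nat \<Rightarrow> nat" where
  "ext v P = (if \<exists>p\<in>{1..d}. P = \<psi> p then \<phi> (v (THE p. p \<in> {1..d} \<and> P = \<psi> p))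
    else if P \<in> {1..d' - m} then col_offset n r' (Suc (rowblk r' P)) + (P - row_offset r' (rowblk r' P)) else P)"

lemma ext_old: "p \<in> {1..d} \<Longrightarrow> ext v (\<psi> p) = \<phi> (v p)"
proof -
  assume p: "p \<in> {1..d}"
  then have "(THE p'. p' \<in> {1..d} \<and> \<psi> p = \<psi> p') = p" using psi_inj by (intro the_equality) auto
  then show ?thesis using p by (auto simp: ext_def)
qed

lemma new_not_old: "j < n \<Longrightarrow> 1 \<le> t \<Longrightarrow> t \<le> m \<Longrightarrow> p \<in> {1..d} \<Longrightarrow> row_offset r' j + t \<noteq> \<psi> p"
proof
  assume *: "j < n" "1 \<le> t" "t \<le> m" "p \<in> {1..d}" "row_offset r' j + t = \<psi> p"
  have b: "p \<in> block_row r (rowblk r p)" "rowblk r p \<le> n" using rowblk_props[of p n r] * by auto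
  have "\<psi> p \<in> block_row r' j" using * by (auto simp: block_row_def r'_def)
  then have j: "rowblk r p = j" using psi_block(3)[OF b] rowblk_eqI by metis
  show False using psi_block(1)[OF b] * b j by (auto simp: block_row_def)
qed

lemma ext_new:
  assumes "j < n" "1 \<le> t" "t \<le> m"
  shows "ext v (row_offset r' j + t) = col_offset n r' (Suc j) + t"
proof -
  have b: "row_offset r' j + t \<in> block_row r' j" using assms by (auto simp: block_row_def r'_def)
  have "row_offset r' (Suc j) \<le> row_offset r' n" using assms by (intro row_offset_mono) simp
  then have "row_offset r' j + t \<le> d' - m"
    using assms row_offset_total[of r' n] by (simp add: row_offset_Suc r'_def)
  then show ?thesis
    using new_not_old[OF assms] assms rowblk_eqI[OF b] by (auto simp: ext_def)
qed

lemma ext_last: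
  assumes "d' - m < P"
  shows "ext v P = P"
proof -
  have "P \<noteq> \<psi> p" if "p \<in> {1..d}" for p
    using psi_block(5)[of p "rowblk r p"] rowblk_props[of p n r] that assms by auto
  then show ?thesis using assms by (auto simp: ext_def)
qed

lemma d'_ge: "m \<le> d'" by (simp add: d'_eq)

lemma ext_permutes:
  assumes v: "v permutes {1..d}"
  shows "ext v permutes {1..d'}"
proof (rule bij_imp_permutes)
  have out: "ext v P = P" if "P \<notin> {1..d'}" for P
  proof (cases "P = 0")
    case True
    have 1: "\<not> (\<exists>p\<in>{1..d}. P = \<psi> p)" using True by (auto simp: \<psi>_def)
    have 2: "P \<notin> {1..d' - m}" using True by simp
    show ?thesis unfolding ext_def if_not_P[OF 1] if_not_P[OF 2] ..
  next
    case False
    then show ?thesis using that by (intro ext_last) auto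
  qed
  then show "\<And>P. P \<notin> {1..d'} \<Longrightarrow> ext v P = P" .
  have vr: "v p \<in> {1..d}" if "p \<in> {1..d}" for p using permutes_in_image[OF v, of p] that by simp
  have sub: "{1..d'} \<subseteq> ext v ` {1..d'}"
  proof
    fix Q assume "Q \<in> {1..d'}"
    then have "1 \<le> Q" "Q \<le> d'" by auto
    then show "Q \<in> ext v ` {1..d'}"
    proof (cases Q rule: value_cases)
      case (old q)
      define p where "p = inv v q"
      have p: "p \<in> {1..d}" "v p = q"
        using permutes_in_image[OF permutes_inv[OF v], of q] old permutes_inverses(1)[OF v] by (auto simp: p_def)
      have "\<psi> p \<in> {1..d'}"
        using psi_block(4,5)[of p "rowblk r p"] rowblk_props[of p n r] p by auto
      then show ?thesis using ext_old[OF p(1), of v] p old by (metis imageI)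
    next
      case (new j t)
      have "row_offset r' (Suc j) \<le> d'" using new by (intro row_offset_le_total) simp
      then show ?thesis using ext_new[OF new(1-3), of v] new
        by (intro image_eqI[of _ _ "row_offset r' j + t"]) (auto simp: row_offset_Suc r'_def)
    next
      case (last t)
      then show ?thesis using ext_last[of Q v] d'_ge by (intro image_eqI[of _ _ Q]) auto
    qed
  qed
  have "ext v ` {1..d'} \<subseteq> {1..d'}"
  proof
    fix Q assume "Q \<in> ext v ` {1..d'}"
    then obtain P where P: "1 \<le> P" "P \<le> d'" "Q = ext v P" by auto
    from P(1,2) have "ext v P \<in> {1..d'}"
    proof (cases P rule: position_cases)
      case (old p)
      then show ?thesis
        using ext_old[of p v] vr[of p] phi_block(4,5)[of "v p" "colblk n r (v p)"] colblk_props[of "v p" n r] by auto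
    next
      case (new j t)
      have "col_offset n r' (Suc j) + r' (Suc j) \<le> d'" using col_offset_add[of "Suc j" n r'] new by simp
      then show ?thesis using ext_new[OF new(1-3), of v] new by (simp add: r'_def)
    next
      case (last t)
      then show ?thesis using ext_last[of P v] P by auto
    qed
    then show "Q \<in> {1..d'}" using P by simp
  qed
  then have "ext v ` {1..d'} = {1..d'}" using sub by auto
  then show "bij_betw (ext v) {1..d'} {1..d'}"
    by (auto simp: bij_betw_def intro!: eq_card_imp_inj_on)
qed

lemma ext_inject:
  assumes "u permutes {1..d}" "v permutes {1..d}" "ext u = ext v"
  shows "u = v"
proof
  fix p
  show "u p = v p"
  proof (cases "p \<in> {1..d}")
    case True
    then have "\<phi> (u p) = \<phi> (v p)" using ext_old[OF True] assms(3) by metis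
    then show ?thesis
      using phi_inj permutes_in_image[OF assms(1), of p] permutes_in_image[OF assms(2), of p] True by blast
  qed (use permutes_not_in assms in metis)
qed

text \<open>In a block (j, j + 1) the new points lie northwest of the old ones, the last m points
  lie southeast of everything, and each kind is increasing inside of a block row or block column.
  The cases compare the kinds of two points.\<close>

lemma ext_zelevinsky:
  assumes v: "zelevinsky n r v"
  shows "zelevinsky n r' (ext v)"
proof -
  note pv = zelevinsky_permutes[OF v]
  have vr: "1 \<le> v p \<and> v p \<le> d" if "p \<in> {1..d}" for p using permutes_in_image[OF pv, of p] that by auto
  have old_row: "rowblk r' (\<psi> p) = rowblk r p" if "p \<in> {1..d}" for p
    using psi_block(3)[of p "rowblk r p"] rowblk_props[of p n r] that by auto
  have old_row_local: "row_offset r' (rowblk r p) + m < \<psi> p" if "p \<in> {1..d}" "rowblk r p < n" for p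
    using psi_block(1)[of p "rowblk r p"] rowblk_props[of p n r] that by (auto simp: block_row_def)
  have old_col: "colblk n r' (\<phi> q) = colblk n r q" if "1 \<le> q \<and> q \<le> d" for q
    using phi_block(3)[of q "colblk n r q"] colblk_props[of q n r] that by auto
  have old_col_local: "col_offset n r' (colblk n r q) + m < \<phi> q" if "1 \<le> q \<and> q \<le> d" "0 < colblk n r q" for q
    using phi_block(1)[of q "colblk n r q"] colblk_props[of q n r] that by (auto simp: block_col_def)
  have old_le: "\<phi> q \<le> d' - m" if "1 \<le> q \<and> q \<le> d" for q
    using phi_block(5)[of q "colblk n r q"] colblk_props[of q n r] that by auto
  have old_le': "\<psi> p \<le> d' - m" if "p \<in> {1..d}" for p
    using psi_block(5)[of p "rowblk r p"] rowblk_props[of p n r] that by auto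
  have new_row: "rowblk r' (row_offset r' j + t) = j" if "1 \<le> t" "t \<le> m" for j t
    by (rule rowblk_eqI) (use that in \<open>auto simp: block_row_def r'_def\<close>)
  have new_col: "colblk n r' (col_offset n r' (Suc j) + t) = Suc j" if "j < n" "1 \<le> t" "t \<le> m" for j t
    by (rule colblk_eqI) (use that in \<open>auto simp: block_col_def r'_def\<close>)
  have last_row: "rowblk r' (d' - m + t) = n" if "1 \<le> t" "t \<le> m" for t
  proof (rule rowblk_eqI)
    have "row_offset r' n + r n = d' - m" using row_offset_total[of r' n] by (simp add: row_offset_Suc r'_def)
    then show "d' - m + t \<in> block_row r' n" using that by (auto simp: block_row_def r'_def)
  qed
  have last_col: "colblk n r' (d' - m + t) = 0" if "1 \<le> t" "t \<le> m" for t
  proof (rule colblk_eqI)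
    have "col_offset n r' 0 + r 0 = d' - m" using col_offset_add[of 0 n r'] by (simp add: row_offset_def r'_def)
    then show "d' - m + t \<in> block_col n r' 0" using that by (auto simp: block_col_def r'_def)
  qed simp
  have col_less: "x < y" if "colblk n r' y < colblk n r' x" "1 \<le> x" "x \<le> d'" "1 \<le> y" "y \<le> d'" for x y
    using colblk_antimono[of y x n r'] that by (cases "x < y") auto
  have er: "1 \<le> ext v P \<and> ext v P \<le> d'" if "1 \<le> P" "P \<le> d'" for P
    using permutes_in_image[OF ext_permutes[OF pv], of P] that by auto
  have above: "colblk n r' (ext v P) \<le> Suc (rowblk r' P)" if "1 \<le> P" "P \<le> d'" for P
    using that
  proof (cases P rule: position_cases)
    case (old p)
    have "colblk n r (v p) \<le> Suc (rowblk r p)"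
      using zelevinsky_above[OF v, of p] zlam_less_iff[of p n r "v p"] old vr[of p] by auto
    then show ?thesis using old ext_old[of p v] old_row[of p] old_col[OF vr] by simp
  next
    case (new j t)
    then show ?thesis using ext_new[OF new(1-3)] new_row[of t j] new_col[of j t] by simp
  next
    case (last t)
    then show ?thesis using ext_last[of P v] last_col[of t] by simp
  qed
  show ?thesis
    unfolding zelevinsky_iff
  proof (intro conjI ballI impI)
    show "ext v permutes {1..d'}" by (rule ext_permutes[OF pv])
    show "zlam n r' P < ext v P" if "P \<in> {1..d'}" for P
      using zlam_less_iff[of P n r' "ext v P"] above[of P] er[of P] that by auto
    fix P P' assume PP': "P \<in> {1..d'}" "P' \<in> {1..d'}" "P < P'"
    then have b: "1 \<le> P" "P \<le> d'" "1 \<le> P'" "P' \<le> d'" by auto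
    {
      assume row: "rowblk r' P = rowblk r' P'"
      from b(1,2) show "ext v P < ext v P'"
      proof (cases P rule: position_cases)
        case (old p)
        from b(3,4) show ?thesis
        proof (cases P' rule: position_cases)
          case (old p')
          note p = \<open>p \<in> {1..d}\<close> \<open>P = \<psi> p\<close> and p' = old
          have "p < p'" using PP'(3) p p' strict_mono_on_less[OF psi_mono] by blast
          then have "v p < v p'" using zelevinsky_rowD[OF v, of p p'] p p' row old_row by auto
          then have "\<phi> (v p) < \<phi> (v p')" using vr[of p] vr[of p'] p p' strict_mono_onD[OF phi_mono] by auto
          then show ?thesis using p p' by (simp add: ext_old)
        next
          case (new j t)
          have "rowblk r p = j" using row old_row[of p] old new_row[of t j] new by simp
          then have False using old_row_local[of p] old new PP'(3) by auto
          then show ?thesis ..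
        next
          case (last t)
          then show ?thesis using ext_old[of p v] old old_le[OF vr[of p]] ext_last[of P' v] by auto
        qed
      next
        case (new j t)
        from b(3,4) show ?thesis
        proof (cases P' rule: position_cases)
          case (old p')
          have j: "rowblk r p' = j" using row old_row[of p'] old new_row[of t j] new by simp
          have "colblk n r (v p') \<le> Suc j"
            using above[OF b(3,4)] old old_row[of p'] old_col[OF vr[of p']] ext_old[of p' v] j by simp
          \<comment> \<open>The old value lies in a block column further to the right, or behind the
            new columns of block column j + 1.\<close>
          then consider "colblk n r (v p') < Suc j" | "colblk n r (v p') = Suc j" by linarith
          then show ?thesis
          proof cases
            case 1
            have "colblk n r' (ext v P) = Suc j"
              using new_col[OF new(1-3)] ext_new[OF new(1-3), of v] new(4) by simp
            moreover have "colblk n r' (ext v P') = colblk n r (v p')"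
              using old_col[OF vr[OF old(1)]] ext_old[OF old(1), of v] old(2) by simp
            ultimately show ?thesis using 1 er[OF b(1,2)] er[OF b(3,4)] by - (rule col_less, simp_all)
          next
            case 2
            then show ?thesis
              using old_col_local[OF vr[of p']] old new ext_new[of j t v] ext_old[of p' v] by auto
          qed
        next
          case (new j' t')
          have "j = j'" using row new_row[of t j] new_row[of t' j'] new \<open>P = _\<close> \<open>1 \<le> t\<close> \<open>t \<le> m\<close> by simp
          then show ?thesis using new \<open>P = row_offset r' j + t\<close> \<open>1 \<le> t\<close> \<open>t \<le> m\<close> PP'(3) by (simp add: ext_new)
        next
          case (last t')
          then show ?thesis using row new new_row[of t j] last_row[of t'] by simp
        qed
      next
        case (last t)
        then show ?thesis using PP'(3) by (simp add: ext_last)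
      qed
    next
      assume col: "colblk n r' (ext v P) = colblk n r' (ext v P')"
      from b(1,2) show "ext v P < ext v P'"
      proof (cases P rule: position_cases)
        case (old p)
        from b(3,4) show ?thesis
        proof (cases P' rule: position_cases)
          case (old p')
          note p = \<open>p \<in> {1..d}\<close> \<open>P = \<psi> p\<close> and p' = old
          have "p < p'" using PP'(3) p p' strict_mono_on_less[OF psi_mono] by blast
          then have "v p < v p'" using zelevinsky_colD[OF v, of p p'] p p' col old_col vr ext_old by auto
          then have "\<phi> (v p) < \<phi> (v p')" using vr[of p] vr[of p'] p p' strict_mono_onD[OF phi_mono] by auto
          then show ?thesis using p p' by (simp add: ext_old)
        next
          case (new j t)
          \<comment> \<open>An old point of block column j + 1 that lies above the new point would
            be in block row j, but there the new rows come first.\<close>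
          have "colblk n r (v p) = Suc j"
            using col old_col[OF vr[of p]] ext_old[of p v] old new_col[of j t] new ext_new[of j t v] by simp
          then have "j \<le> rowblk r p"
            using above[OF b(1,2)] old old_row[of p] old_col[OF vr[of p]] ext_old[of p v] by simp
          moreover have "rowblk r p \<le> j"
            using rowblk_mono[of P P' n r'] b PP'(3) old old_row[of p] new new_row[of t j] by simp
          ultimately have "rowblk r p = j" by simp
          then have False using old_row_local[of p] old new PP'(3) by auto
          then show ?thesis ..
        next
          case (last t)
          then show ?thesis using ext_old[of p v] old old_le[OF vr[of p]] ext_last[of P' v] by auto
        qed
      next
        case (new j t)
        from b(3,4) show ?thesis
        proof (cases P' rule: position_cases)
          case (old p')
          have "colblk n r (v p') = Suc j"
            using col old_col[OF vr[of p']] ext_old[of p' v] old new_col[of j t] new ext_new[of j t v] by simp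
          then show ?thesis
            using old_col_local[OF vr[of p']] old new ext_new[of j t v] ext_old[of p' v] by auto
        next
          case (new j' t')
          have "j = j'"
            using col new_col[of j t] new_col[of j' t'] new \<open>P = _\<close> \<open>1 \<le> t\<close> \<open>t \<le> m\<close> \<open>j < n\<close> by (simp add: ext_new)
          then show ?thesis using new \<open>P = row_offset r' j + t\<close> \<open>1 \<le> t\<close> \<open>t \<le> m\<close> PP'(3) by (simp add: ext_new)
        next
          case (last t')
          then show ?thesis using col new new_col[of j t] last_col[of t'] ext_new[of j t v] ext_last[of P' v] by simp
        qed
      next
        case (last t)
        then show ?thesis using PP'(3) by (simp add: ext_last)
      qed
    }
  qed
qed

lemma zel_rank_ext:
  assumes v: "zelevinsky n r v" and ij: "i \<le> j" "j \<le> n"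
  shows "zel_rank n r' (ext v) i j = m + zel_rank n r v i j"
proof -
  note pv = zelevinsky_permutes[OF v]
  have i: "i \<le> n" using ij by simp
  have vr: "1 \<le> v p \<and> v p \<le> d" if "p \<in> {1..d}" for p using permutes_in_image[OF pv, of p] that by auto
  have rowcond: "row_offset r' j < \<psi> p \<longleftrightarrow> row_offset r j < p" if "p \<in> {1..d}" for p
  proof -
    have b: "p \<in> block_row r (rowblk r p)" "rowblk r p \<le> n" using rowblk_props[of p n r] that by auto
    note b' = psi_block(2)[OF b]
    have "row_offset s j < x \<longleftrightarrow> j \<le> k" if "x \<in> block_row s k" for s x k
      using row_offset_mono[of j k s] row_offset_mono[of "Suc k" j s] that by (cases "j \<le> k") (auto simp: block_row_Suc)
    then show ?thesis using b(1) b' by blast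
  qed
  have colcond: "col_offset n r' i < \<phi> q \<longleftrightarrow> col_offset n r i < q" if "1 \<le> q \<and> q \<le> d" for q
  proof -
    have b: "q \<in> block_col n r (colblk n r q)" "colblk n r q \<le> n" using colblk_props[of q n r] that by auto
    note b' = phi_block(2)[OF b]
    have "col_offset n s i < x \<longleftrightarrow> k \<le> i" if x: "x \<in> block_col n s k" and k: "k \<le> n" for s x k
    proof (cases "k \<le> i")
      case True
      then show ?thesis using col_offset_antimono[of k i n s] x by (auto simp: block_col_def)
    next
      case False
      then have "x \<le> col_offset n s (k - 1)" using x col_offset_Suc[of "k - 1" n s] k by (auto simp: block_col_def)
      also have "\<dots> \<le> col_offset n s i" by (rule col_offset_antimono) (use False in simp)
      finally show ?thesis using False by simp
    qed
    then show ?thesis using b(1) b' b(2) by blast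
  qed
  let ?A = "{a \<in> {row_offset r j<..d}. col_offset n r i < v a}"
  let ?L = "(\<lambda>t. d' - m + t) ` {1..m}"
  have "{a \<in> {row_offset r' j<..d'}. col_offset n r' i < ext v a} = \<psi> ` ?A \<union> ?L"
  proof (intro set_eqI iffI)
    fix P assume P: "P \<in> {a \<in> {row_offset r' j<..d'}. col_offset n r' i < ext v a}"
    then have "1 \<le> P" "P \<le> d'" by auto
    then show "P \<in> \<psi> ` ?A \<union> ?L"
    proof (cases P rule: position_cases)
      case (old p)
      then show ?thesis using P rowcond[of p] colcond[OF vr[of p]] ext_old[of p v] by auto
    next
      case (new q t)
      \<comment> \<open>A counted new point would have q >= j >= i, while it lies in block column q
        + 1, to the left of the counted columns.\<close>
      have "j \<le> q"
      proof (rule ccontr)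
        assume "\<not> j \<le> q"
        then have "row_offset r' (Suc q) \<le> row_offset r' j" by (intro row_offset_mono) simp
        then show False using P new by (simp add: row_offset_Suc r'_def)
      qed
      then have "col_offset n r' q \<le> col_offset n r' i" using ij by (intro col_offset_antimono) simp
      moreover have "col_offset n r' (Suc q) + t \<le> col_offset n r' q"
        using col_offset_Suc[of q n r'] new by (simp add: r'_def)
      ultimately have False using P new ext_new[of q t v] by simp
      then show ?thesis ..
    next
      case (last t)
      then show ?thesis by auto
    qed
  next
    fix P assume "P \<in> \<psi> ` ?A \<union> ?L"
    then show "P \<in> {a \<in> {row_offset r' j<..d'}. col_offset n r' i < ext v a}"
    proof
      assume "P \<in> \<psi> ` ?A"
      then obtain p where p: "P = \<psi> p" "row_offset r j < p" "p \<le> d" "col_offset n r i < v p" by auto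
      then have pd: "p \<in> {1..d}" by auto
      have "\<psi> p \<le> d'" using psi_block(5)[of p "rowblk r p"] rowblk_props[of p n r] pd by auto
      then show ?thesis using p rowcond[OF pd] colcond[OF vr[OF pd]] ext_old[OF pd, of v] by auto
    next
      assume "P \<in> ?L"
      then obtain t where t: "1 \<le> t" "t \<le> m" "P = d' - m + t" by (auto simp del: image_add_atLeastAtMost)
      have "row_offset r' j \<le> row_offset r' n" using ij by (intro row_offset_mono) simp
      then have 1: "row_offset r' j \<le> d' - m" using row_offset_total[of r' n] by (simp add: row_offset_Suc r'_def)
      have "col_offset n r' i \<le> col_offset n r' 0" by (rule col_offset_antimono) simp
      then have 2: "col_offset n r' i \<le> d' - m" using col_offset_add[of 0 n r'] by (simp add: row_offset_def r'_def)
      show ?thesis using t 1 2 ext_last[of P v] d'_ge by auto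
    qed
  qed
  moreover have "card (\<psi> ` ?A \<union> ?L) = card (\<psi> ` ?A) + card ?L"
  proof (rule card_Un_disjoint)
    show "\<psi> ` ?A \<inter> ?L = {}"
    proof (rule ccontr)
      assume "\<psi> ` ?A \<inter> ?L \<noteq> {}"
      then obtain p where p: "p \<in> ?A" "\<psi> p \<in> ?L" by blast
      then have "d' - m < \<psi> p" by auto
      have "\<psi> p \<le> d' - m" using psi_block(5)[of p "rowblk r p"] rowblk_props[of p n r] p(1) by auto
      then show False using \<open>d' - m < \<psi> p\<close> by simp
    qed
  qed auto
  moreover have "card (\<psi> ` ?A) = card ?A"
    by (rule card_image, rule inj_on_subset[OF strict_mono_on_imp_inj_on[OF psi_mono]]) auto
  moreover have "card ?L = m" by (subst card_image) (auto simp: inj_on_def)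
  ultimately show ?thesis
    using zel_rank_card[OF ext_permutes[OF pv] i ij(2)] zel_rank_card[OF pv i ij(2)] by simp
qed

lemma zel_perm_ext:
  assumes "zelevinsky n r v" "has_rank_array n r v R"
  shows "zel_perm n r' (\<lambda>i j. m + R i j) = ext v"
  by (rule zel_perm_eqI[OF ext_zelevinsky[OF assms(1)]])
    (use assms zel_rank_ext[OF assms(1)] in \<open>auto simp: has_rank_array_def\<close>)

subsection \<open>Extensions and words\<close>

definition newb :: "nat \<Rightarrow> nat list" where
  "newb i = [Suc (col_offset n r' i)..<Suc (col_offset n r' i + m)]"

definition lastb :: "nat list" where "lastb = [Suc (d' - m)..<Suc d']"

lemma length_newb: "length (newb i) = m" "length lastb = m"
  using d'_ge by (auto simp: newb_def lastb_def simp del: upt_Suc)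

lemma colb_0: "colb n r' 0 = map \<phi> (colb n r 0) @ lastb"
proof -
  have d: "col_offset n r' 0 + r 0 = d' - m" using col_offset_add[of 0 n r'] by (simp add: row_offset_def r'_def)
  have "colb n r' 0 = [Suc (col_offset n r' 0)..<Suc (col_offset n r' 0 + r 0)] @ lastb"
    using upt_add_eq_append[of "Suc (col_offset n r' 0)" "Suc (col_offset n r' 0 + r 0)" m] d'_ge
    unfolding colb_def lastb_def d[symmetric] r'_def[of 0] using d by (simp add: add.assoc add.commute del: upt_Suc)
  moreover have "[Suc (col_offset n r' 0)..<Suc (col_offset n r' 0 + r 0)] = map \<phi> (colb n r 0)"
    by (rule nth_equalityI)
      (auto simp: colb_def phi_block(1)[of _ 0] block_col_def simp del: upt_Suc)
  ultimately show ?thesis by simp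
qed

lemma colb_Suc:
  assumes "Suc i \<le> n"
  shows "colb n r' (Suc i) = newb (Suc i) @ map \<phi> (colb n r (Suc i))"
proof -
  let ?c = "col_offset n r' (Suc i)"
  have "colb n r' (Suc i) = newb (Suc i) @ [Suc (?c + m)..<Suc (?c + m + r (Suc i))]"
    using upt_add_eq_append[of "Suc ?c" "Suc (?c + m)" "r (Suc i)"]
    by (simp add: colb_def newb_def r'_def add.assoc del: upt_Suc)
  moreover have "[Suc (?c + m)..<Suc (?c + m + r (Suc i))] = map \<phi> (colb n r (Suc i))"
    by (rule nth_equalityI)
      (use assms in \<open>auto simp: colb_def phi_block(1)[of _ "Suc i"] block_col_def simp del: upt_Suc\<close>)
  ultimately show ?thesis by simp
qed

text \<open>At every stage the m new columns stay in front and the last m values stay at the end.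
  Between them the old run takes place, relabelled by the monotone \<open>\<phi>\<close>: letters
  count from the end, so their shift by m skips the last m values and never reaches the new
  columns.\<close>

lemma trun_ext:
  assumes g: "words_ok n r g" and j: "j \<le> n"
  shows "trun (colb n r') r' (\<lambda>j. map ((+) m) (g j)) j =
    (map (\<lambda>q. newb (Suc q) @ map \<phi> (fst (trun (colb n r) r g j) ! q)) [0..<j],
     map \<phi> (snd (trun (colb n r) r g j)) @ lastb)"
  using j
proof (induction j)
  case 0
  then show ?case by (simp add: colb_0)
next
  case (Suc j)
  obtain outs R where t: "trun (colb n r) r g j = (outs, R)" by fastforce
  have jn: "j \<le> n" "j < n" using Suc.prems by auto
  have R: "length R = r j" "map length outs = map r [0..<j]" "set R \<subseteq> (\<Union>i\<le>j. set (colb n r i))"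
    using trun_invariants[OF g jn(1), of "colb n r"] t by auto
  have lo: "length outs = j" using arg_cong[OF R(2), of length] by simp
  define M where "M = fops (colb n r (Suc j) @ R) (g j)"
  have letters: "1 \<le> i \<and> i < r j + r (Suc j)" if "i \<in> set (g j)" for i
    using g jn that by (auto simp: words_ok_def)
  have lenM: "length M = r (Suc j) + r j" by (simp add: M_def fops_def R)
  let ?B = "colb n r (Suc j) @ R"
  have Bd: "set ?B \<subseteq> {1..d}"
  proof
    fix x assume "x \<in> set ?B"
    then have "x \<in> (\<Union>i\<le>Suc j. set (colb n r i))" using R(3) by (auto simp: atMost_Suc)
    then obtain i where "i \<le> Suc j" "x \<in> block_col n r i" by (auto simp: set_colb)
    then show "x \<in> {1..d}" using block_col_bounds[of i n x r] Suc.prems by auto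
  qed
  have "fops (newb (Suc j) @ map \<phi> ?B @ lastb) (map ((+) m) (g j)) = newb (Suc j) @ map \<phi> M @ lastb"
  proof -
    let ?w = "map (\<lambda>i. length ?B - i) (rev (g j))"
    have w: "map (\<lambda>i. length (newb (Suc j) @ map \<phi> ?B @ lastb) - i) (rev (map ((+) m) (g j))) =
        map ((+) (length (newb (Suc j)))) ?w"
      using letters by (fastforce simp: length_newb R rev_map)
    have wl: "1 \<le> i \<and> i < length ?B" if "i \<in> set ?w" for i using that letters by (fastforce simp: R)
    have "lops (newb (Suc j) @ map \<phi> ?B @ lastb) (map ((+) (length (newb (Suc j)))) ?w) =
        newb (Suc j) @ lops (map \<phi> ?B) ?w @ lastb"
      by (rule lops_window) (use wl in auto)
    also have "lops (map \<phi> ?B) ?w = map \<phi> (lops ?B ?w)"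
      by (rule lops_map[OF phi_mono Bd]) (use wl in auto)
    finally show ?thesis unfolding fops_def[of "newb (Suc j) @ map \<phi> ?B @ lastb"] w by (simp add: M_def fops_def)
  qed
  then have M': "fops (colb n r' (Suc j) @ map \<phi> R @ lastb) (map ((+) m) (g j)) = newb (Suc j) @ map \<phi> M @ lastb"
    using colb_Suc[of j] Suc.prems by simp
  have tk: "take (r' j) (newb (Suc j) @ map \<phi> M @ lastb) = newb (Suc j) @ map \<phi> (take (r j) M)"
    "drop (r' j) (newb (Suc j) @ map \<phi> M @ lastb) = map \<phi> (drop (r j) M) @ lastb"
    using lenM by (auto simp: r'_def length_newb take_map drop_map)
  have "trun (colb n r') r' (\<lambda>j. map ((+) m) (g j)) (Suc j) =
      (map (\<lambda>q. newb (Suc q) @ map \<phi> (outs ! q)) [0..<j] @ [newb (Suc j) @ map \<phi> (take (r j) M)],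
       map \<phi> (drop (r j) M) @ lastb)"
  proof -
    have "trun (colb n r') r' (\<lambda>j. map ((+) m) (g j)) j =
        (map (\<lambda>q. newb (Suc q) @ map \<phi> (outs ! q)) [0..<j], map \<phi> R @ lastb)"
      using Suc.IH jn t by simp
    then show ?thesis by (simp only: trun.simps Let_def prod.case M' tk)
  qed
  also have "map (\<lambda>q. newb (Suc q) @ map \<phi> (outs ! q)) [0..<j] @ [newb (Suc j) @ map \<phi> (take (r j) M)] =
      map (\<lambda>q. newb (Suc q) @ map \<phi> ((outs @ [take (r j) M]) ! q)) [0..<Suc j]"
    using lo by (auto simp: nth_append)
  finally show ?case by (simp add: t Let_def M_def)
qed

lemma map_ext_rowl:
  "j < n \<Longrightarrow> map (ext v) (rowl r' j) = newb (Suc j) @ map \<phi> (map v (rowl r j))"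
  "map (ext v) (rowl r' n) = map \<phi> (map v (rowl r n)) @ lastb"
proof -
  assume j: "j < n"
  let ?c = "row_offset r' j"
  have "rowl r' j = [Suc ?c..<Suc (?c + m)] @ [Suc (?c + m)..<Suc (?c + m + r j)]"
    using upt_add_eq_append[of "Suc ?c" "Suc (?c + m)" "r j"]
    by (simp add: rowl_def r'_def add.assoc del: upt_Suc)
  moreover have "map (ext v) [Suc ?c..<Suc (?c + m)] = newb (Suc j)"
  proof (rule nth_equalityI)
    fix i assume "i < length (map (ext v) [Suc ?c..<Suc (?c + m)])"
    then show "map (ext v) [Suc ?c..<Suc (?c + m)] ! i = newb (Suc j) ! i"
      using ext_new[OF j, of "Suc i" v] by (simp add: newb_def del: upt_Suc)
  qed (simp add: newb_def del: upt_Suc)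
  moreover have "[Suc (?c + m)..<Suc (?c + m + r j)] = map \<psi> (rowl r j)"
    by (rule nth_equalityI)
      (use j in \<open>auto simp: rowl_def psi_block(1)[of _ j] block_row_def simp del: upt_Suc\<close>)
  moreover have "map (ext v) (map \<psi> (rowl r j)) = map \<phi> (map v (rowl r j))"
    using block_row_bounds[of j n _ r] j by (auto simp: set_rowl ext_old)
  ultimately show "map (ext v) (rowl r' j) = newb (Suc j) @ map \<phi> (map v (rowl r j))" by simp
next
  let ?c = "row_offset r' n"
  have d: "?c + r n = d' - m" using row_offset_total[of r' n] by (simp add: row_offset_Suc r'_def)
  have "rowl r' n = [Suc ?c..<Suc (?c + r n)] @ [Suc (?c + r n)..<Suc (?c + r n + m)]"
    using upt_add_eq_append[of "Suc ?c" "Suc (?c + r n)" m]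
    by (simp add: rowl_def r'_def add.assoc add.commute[of m] del: upt_Suc)
  also have "[Suc (?c + r n)..<Suc (?c + r n + m)] = lastb"
    unfolding d lastb_def using d'_ge by simp
  finally have 1: "rowl r' n = [Suc ?c..<Suc (?c + r n)] @ lastb" .
  have "[Suc ?c..<Suc (?c + r n)] = map \<psi> (rowl r n)"
    by (rule nth_equalityI) (auto simp: rowl_def psi_block(1)[of _ n] block_row_def simp del: upt_Suc)
  moreover have "map (ext v) (map \<psi> (rowl r n)) = map \<phi> (map v (rowl r n))"
    using block_row_bounds[of n n _ r] by (auto simp: set_rowl ext_old)
  moreover have "map (ext v) lastb = lastb"
    by (rule map_idI) (auto simp: lastb_def ext_last simp del: upt_Suc)
  ultimately show "map (ext v) (rowl r' n) = map \<phi> (map v (rowl r n)) @ lastb" using 1 by simp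
qed

lemma words_ok_shift: "words_ok n r g \<Longrightarrow> words_ok n r' (\<lambda>j. map ((+) m) (g j))"
  unfolding words_ok_def r'_def by fastforce

lemma demazure_ext:
  assumes g: "words_ok n r g"
  shows "word_demazure (total_word n r' (\<lambda>j. map ((+) m) (g j)) n) = ext (word_demazure (total_word n r g n))"
proof -
  let ?v = "word_demazure (total_word n r g n)"
  let ?g = "\<lambda>j. map ((+) m) (g j)"
  let ?v' = "word_demazure (total_word n r' ?g n)"
  note g' = words_ok_shift[OF g]
  note pv = total_word_permutes[OF g] and pv' = total_word_permutes[OF g']
  have rows: "fst (trun (colb n r) r g n) = map (\<lambda>j. map ?v (rowl r j)) [0..<n]"
    "snd (trun (colb n r) r g n) = map ?v (rowl r n)"
    using trun_rows[OF refl g] by auto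
  have "map ?v' [1..<Suc d'] = concat (map (\<lambda>q. newb (Suc q) @ map \<phi> (map ?v (rowl r q))) [0..<n]) @
      map \<phi> (map ?v (rowl r n)) @ lastb"
  proof -
    have ns: "map (\<lambda>q. newb (Suc q) @ map \<phi> (map (\<lambda>j. map ?v (rowl r j)) [0..<n] ! q)) [0..<n] =
        map (\<lambda>q. newb (Suc q) @ map \<phi> (map ?v (rowl r q))) [0..<n]" by (rule map_cong) auto
    show ?thesis unfolding total_word_final[OF g'] trun_ext[OF g order_refl] rows by (simp only: fst_conv snd_conv ns)
  qed
  also have "\<dots> = concat (map (\<lambda>q. map (ext ?v) (rowl r' q)) [0..<Suc n])"
  proof -
    have mp: "map (\<lambda>q. map (ext ?v) (rowl r' q)) [0..<n] = map (\<lambda>q. newb (Suc q) @ map \<phi> (map ?v (rowl r q))) [0..<n]"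
      by (rule map_cong[OF refl], rule map_ext_rowl) simp
    have up: "[0..<Suc n] = [0..<n] @ [n]" by simp
    show ?thesis
      by (simp only: up map_append concat_append mp list.map concat.simps map_ext_rowl(2) append_Nil2)
  qed
  also have "\<dots> = map (ext ?v) [1..<Suc d']"
    unfolding row_offset_total[symmetric] concat_rowl[symmetric] by (simp only: map_concat map_map comp_def)
  finally have e: "map ?v' [1..<Suc d'] = map (ext ?v) [1..<Suc d']" .
  show ?thesis
  proof
    fix P show "?v' P = ext ?v P"
    proof (cases "P \<in> {1..d'}")
      case True
      then have "P \<in> set [1..<Suc d']" by auto
      then show ?thesis using map_eq_conv[THEN iffD1, OF e] by blast
    next
      case False
      show ?thesis unfolding permutes_not_in[OF pv' False] permutes_not_in[OF ext_permutes[OF pv] False] ..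
    qed
  qed
qed

subsection \<open>Parity of the length\<close>

lemma sign_perm_length: "permutation u \<Longrightarrow> demazure_perm u \<Longrightarrow> (- 1) ^ perm_length u = (of_int (sign u) :: 'a::ring_1)"
proof -
  have "(- 1) ^ perm_length (word_demazure w) = (of_int (sign (word_demazure w)) :: 'a::ring_1)" for w
  proof (induction w rule: rev_induct)
    case Nil
    have "perm_length id = 0"
    proof -
      have "{(p, q). p < q \<and> id q < (id p :: nat)} = {}" by auto
      then show ?thesis by (simp only: perm_length_def card.empty)
    qed
    then show ?case by (simp only: word_demazure_rops foldl.simps sign_id) simp
  next
    case (snoc i w)
    let ?u = "word_demazure w"
    show ?case
    proof (cases "?u i < ?u (Suc i)")
      case True
      then have e: "word_demazure (w @ [i]) = ?u \<circ> adj i" by (simp add: demazure_snoc rop_def)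
      have "sign (?u \<circ> adj i) = - sign ?u"
        using sign_compose[of ?u "adj i"] by (simp add: adj_def sign_swap_id permutation_swap_id)
      then show ?thesis
        unfolding e perm_length_ascent[OF permutation_demazure True] by (simp only: power_Suc snoc of_int_minus) simp
    next
      case False
      then show ?thesis using snoc by (simp add: demazure_snoc rop_def)
    qed
  qed
  then show "permutation u \<Longrightarrow> demazure_perm u \<Longrightarrow> (- 1) ^ perm_length u = (of_int (sign u) :: 'a::ring_1)"
    unfolding demazure_perm_def by metis
qed

lemma ext_adj:
  assumes u: "u permutes {1..d}" and i: "1 \<le> i" "i < d"
  shows "ext (u \<circ> adj i) = ext u \<circ> Transposition.transpose (\<psi> i) (\<psi> (Suc i))"
proof
  fix P
  have id: "i \<in> {1..d}" "Suc i \<in> {1..d}" using i by auto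
  show "ext (u \<circ> adj i) P = (ext u \<circ> Transposition.transpose (\<psi> i) (\<psi> (Suc i))) P"
  proof (cases "\<exists>p\<in>{1..d}. P = \<psi> p")
    case True
    then obtain p where p: "p \<in> {1..d}" "P = \<psi> p" by blast
    have "Transposition.transpose (\<psi> i) (\<psi> (Suc i)) (\<psi> p) = \<psi> (adj i p)"
      using psi_inj[OF p(1) id(1)] psi_inj[OF p(1) id(2)]
      by (auto simp: adj_apply transpose_apply_other)
    moreover have "adj i p \<in> {1..d}" using p id by (auto simp: adj_apply)
    ultimately show ?thesis using p ext_old[OF p(1), of "u \<circ> adj i"] ext_old[of "adj i p" u] by simp
  next
    case False
    then have "P \<noteq> \<psi> i" "P \<noteq> \<psi> (Suc i)" using id by auto
    then show ?thesis using False by (simp add: transpose_apply_other ext_def)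
  qed
qed

text \<open>An adjacent exchange of old rows extends to a single transposition, so both signs change
  together. The unknown factor \<open>sign (ext id)\<close> cancels in
  \<open>ext_length_parity\<close>.\<close>

lemma sign_ext:
  assumes u: "u permutes {1..d}"
  shows "sign (ext u) = sign (ext id) * sign u"
proof -
  obtain w where w: "word_demazure w = u" "\<And>i. i \<in> set w \<Longrightarrow> 1 \<le> i \<and> i < d"
    using every_permutation_demazure[OF u] by blast
  have "sign (ext (word_demazure w)) = sign (ext id) * sign (word_demazure w)"
    using w(2)
  proof (induction w rule: rev_induct)
    case Nil
    then show ?case by (simp only: word_demazure_rops foldl.simps sign_id mult_1_right)
  next
    case (snoc i w)
    let ?u = "word_demazure w"
    have pu: "?u permutes {1..d}" by (rule demazure_permutes) (use snoc.prems in auto)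
    have IH: "sign (ext ?u) = sign (ext id) * sign ?u" by (rule snoc.IH) (use snoc.prems in auto)
    have i: "1 \<le> i" "i < d" using snoc.prems[of i] by auto
    show ?case
    proof (cases "?u i < ?u (Suc i)")
      case True
      then have e: "word_demazure (w @ [i]) = ?u \<circ> adj i" by (simp add: demazure_snoc rop_def)
      have 1: "sign (?u \<circ> adj i) = - sign ?u"
        using sign_compose[of ?u "adj i"] by (simp add: adj_def sign_swap_id permutation_swap_id)
      have "permutation (ext ?u)" using ext_permutes[OF pu] by (auto intro: permutation_permutes[THEN iffD2])
      moreover have "\<psi> i \<noteq> \<psi> (Suc i)" using psi_inj[of i "Suc i"] i by auto
      ultimately have "sign (ext (?u \<circ> adj i)) = - sign (ext ?u)"
        unfolding ext_adj[OF pu i] by (simp add: sign_compose permutation_swap_id sign_swap_id)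
      then show ?thesis unfolding e by (simp only: 1 IH mult_minus_right)
    next
      case False
      then have e: "word_demazure (w @ [i]) = ?u" by (simp add: demazure_snoc rop_def)
      show ?thesis unfolding e by (rule IH)
    qed
  qed
  then show ?thesis by (simp add: w)
qed

lemma ext_length_parity:
  assumes "u permutes {1..d}" "v permutes {1..d}"
  shows "(- 1) ^ (perm_length (ext u) + perm_length (ext v)) = ((- 1) ^ (perm_length u + perm_length v) :: 'a::ring_1)"
proof -
  have s: "(- 1) ^ perm_length u = (of_int (sign u) :: 'a)" if "u permutes {1..k}" for u and k :: nat
    using sign_perm_length[OF _ demazure_perm_permutes[OF that]] that by (auto intro: permutation_permutes[THEN iffD2])
  have "(of_int (sign (ext u)) * of_int (sign (ext v)) :: 'a) = of_int (sign (ext id) * sign (ext id) * (sign u * sign v))"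
    by (simp add: sign_ext[OF assms(1)] sign_ext[OF assms(2)] flip: of_int_mult) (simp add: mult_ac)
  then show ?thesis
    by (simp add: power_add s[OF assms(1)] s[OF assms(2)] s[OF ext_permutes[OF assms(1)]] s[OF ext_permutes[OF assms(2)]])
qed

end

section \<open>Assembled pipe dreams\<close>

lemma longest_longest [simp]: "longest D (longest D x) = x"
  by (auto simp: longest_def)

text \<open>Conjugation with the longest element reflects both positions and values. Ascents remain
  ascents, and the letter i turns into D - i.\<close>

lemma demazure_flip:
  assumes "\<And>i. i \<in> set w \<Longrightarrow> 1 \<le> i \<and> i < D"
  shows "word_demazure (map (\<lambda>i. D - i) w) x = longest D (word_demazure w (longest D x))"
  using assms
proof (induction w arbitrary: x rule: rev_induct)
  case Nil
  then show ?case by (simp add: word_demazure_rops)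
next
  case (snoc i w)
  let ?u = "word_demazure w"
  have i: "1 \<le> i" "i < D" using snoc.prems[of i] by auto
  have pu: "?u permutes {1..D}" by (rule demazure_permutes) (use snoc.prems in auto)
  have ui: "1 \<le> ?u i \<and> ?u i \<le> D" "1 \<le> ?u (Suc i) \<and> ?u (Suc i) \<le> D"
    using permutes_in_image[OF pu, of i] permutes_in_image[OF pu, of "Suc i"] i by auto
  have IH: "word_demazure (map (\<lambda>i. D - i) w) y = longest D (?u (longest D y))" for y
    by (rule snoc.IH) (use snoc.prems in auto)
  have l: "longest D (D - i) = Suc i" "longest D (Suc (D - i)) = i" using i by (auto simp: longest_def)
  have lu: "longest D (?u i) = Suc D - ?u i" "longest D (?u (Suc i)) = Suc D - ?u (Suc i)"
    using ui by (auto simp: longest_def)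
  have e: "word_demazure (map (\<lambda>i. D - i) (w @ [i])) = rop (word_demazure (map (\<lambda>i. D - i) w)) (D - i)"
    by (simp add: demazure_snoc)
  consider "x = D - i" | "x = Suc (D - i)" | "x \<noteq> D - i" "x \<noteq> Suc (D - i)" by blast
  then show ?case
  proof cases
    case 1
    have "max (Suc D - ?u (Suc i)) (Suc D - ?u i) = longest D (min (?u i) (?u (Suc i)))"
      using ui by (auto simp: longest_def min_def max_def)
    then show ?thesis unfolding e by (simp add: 1 rop_apply IH l lu demazure_snoc)
  next
    case 2
    have "min (Suc D - ?u (Suc i)) (Suc D - ?u i) = longest D (max (?u i) (?u (Suc i)))"
      using ui by (auto simp: longest_def min_def max_def)
    then show ?thesis unfolding e by (simp add: 2 rop_apply IH l lu demazure_snoc)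
  next
    case 3
    then have "longest D x \<noteq> Suc i" "longest D x \<noteq> i" using l by (metis longest_longest)+
    then show ?thesis unfolding e using 3 by (simp add: rop_apply IH demazure_snoc)
  qed
qed

text \<open>Reversing a word inverts its product and reflecting its letters conjugates it, so the
  stage depends on \<open>w\<close> only through the product of \<open>w\<close>.\<close>

lemma stage_word_cong:
  assumes j: "j < n" and "word_demazure w = word_demazure w'"
    and "\<And>i. i \<in> set w \<Longrightarrow> 1 \<le> i \<and> i < r j + r (Suc j)" "\<And>i. i \<in> set w' \<Longrightarrow> 1 \<le> i \<and> i < r j + r (Suc j)"
  shows "word_demazure (stage_word n r w j) = word_demazure (stage_word n r w' j)"
  unfolding stage_word_def
proof (rule demazure_cong[OF _ refl])
  have d: "r j + r (Suc j) \<le> total_size n r" using offsets_total[OF j, of r] by simp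
  have rv: "word_demazure (rev w) = word_demazure (rev w')" using assms(2) by (simp add: demazure_rev)
  have "word_demazure (map (\<lambda>i. total_size n r - i) (rev w)) x =
      word_demazure (map (\<lambda>i. total_size n r - i) (rev w')) x" for x
    by (subst (1 2) demazure_flip) (use assms(3,4) d rv in fastforce)+
  then show "word_demazure (map (\<lambda>i. total_size n r - i) (rev w)) =
      word_demazure (map (\<lambda>i. total_size n r - i) (rev w'))" by blast
qed

lemma total_word_cong:
  assumes "words_ok n r g" "words_ok n r g'" "\<And>j. j < n \<Longrightarrow> word_demazure (g j) = word_demazure (g' j)"
  shows "word_demazure (total_word n r g n) = word_demazure (total_word n r g' n)"
  unfolding total_word_def
  by (rule demazure_concat_cong)
    (use assms in \<open>auto intro!: stage_word_cong simp: words_ok_def\<close>)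

section \<open>Words of rotated blocks\<close>

lemma rev_upt_flip: "rev [1..<Suc k] = map (\<lambda>p. Suc k - p) [1..<Suc k]"
  by (rule nth_equalityI) (auto simp: rev_nth simp del: upt_Suc)

lemma rev_boxes: "rev (boxes k l) = map (\<lambda>(p, q). (Suc k - p, Suc l - q)) (boxes k l)"
proof -
  have "rev (boxes k l) = concat (map (\<lambda>p. map (\<lambda>q. (p, q)) [1..<Suc l]) (rev [1..<Suc k]))"
    by (simp add: boxes_def rev_concat rev_map comp_def del: upt_Suc)
  also have "\<dots> = concat (map (\<lambda>p. map (\<lambda>q. (Suc k - p, q)) [1..<Suc l]) [1..<Suc k])"
    unfolding rev_upt_flip by (simp only: map_map comp_def)
  also have "\<dots> = concat (map (\<lambda>p. map (\<lambda>q. (Suc k - p, Suc l - q)) (rev [1..<Suc l])) [1..<Suc k])"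
  proof -
    have "[1..<Suc l] = map (\<lambda>q. Suc l - q) (rev [1..<Suc l])"
      using arg_cong[OF rev_upt_flip[of l], of rev] by (simp only: rev_rev_ident rev_map)
    then have "map (\<lambda>q. (Suc k - p, q)) [1..<Suc l] = map (\<lambda>q. (Suc k - p, Suc l - q)) (rev [1..<Suc l])" for p
      by (metis (no_types, lifting) list.map_comp map_cong comp_apply)
    then show ?thesis by simp
  qed
  also have "\<dots> = map (\<lambda>(p, q). (Suc k - p, Suc l - q)) (boxes k l)"
    by (simp add: boxes_def map_concat comp_def del: upt_Suc)
  finally show ?thesis .
qed

lemma rotate_pd_iff:
  assumes "P \<subseteq> {1..k} \<times> {1..l}" "p \<in> {1..k}" "q \<in> {1..l}"
  shows "(Suc k - p, Suc l - q) \<in> rotate_pd k l P \<longleftrightarrow> (p, q) \<in> P"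
proof
  assume "(Suc k - p, Suc l - q) \<in> rotate_pd k l P"
  then obtain i j where ij: "(i, j) \<in> P" "Suc k - p = Suc k - i" "Suc l - q = Suc l - j" by (auto simp: rotate_pd_def)
  moreover from this have "i \<in> {1..k}" "j \<in> {1..l}" using assms(1) by auto
  ultimately have "i = p" "j = q" using assms by auto
  then show "(p, q) \<in> P" using ij by simp
qed (auto simp: rotate_pd_def)

lemma rotate_pd_subset: "P \<subseteq> {1..k} \<times> {1..l} \<Longrightarrow> rotate_pd k l P \<subseteq> {1..k} \<times> {1..l}"
  unfolding rotate_pd_def by (fastforce dest: subsetD)

lemma rotate_pd_involutive: "P \<subseteq> {1..k} \<times> {1..l} \<Longrightarrow> rotate_pd k l (rotate_pd k l P) = P"
proof -
  assume P: "P \<subseteq> {1..k} \<times> {1..l}"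
  have "x \<in> rotate_pd k l (rotate_pd k l P) \<longleftrightarrow> x \<in> P" for x
  proof (cases "x \<in> {1..k} \<times> {1..l}")
    case True
    obtain p q where x: "x = (Suc k - p, Suc l - q)" "p \<in> {1..k}" "q \<in> {1..l}"
    proof
      show "x = (Suc k - (Suc k - fst x), Suc l - (Suc l - snd x))" "Suc k - fst x \<in> {1..k}" "Suc l - snd x \<in> {1..l}"
        using True by (auto simp: mem_Times_iff intro!: prod_eqI)
    qed
    have "x \<in> rotate_pd k l (rotate_pd k l P) \<longleftrightarrow> (p, q) \<in> rotate_pd k l P"
      unfolding x by (rule rotate_pd_iff[OF rotate_pd_subset[OF P] x(2,3)])
    also have "(p, q) = (Suc k - (Suc k - p), Suc l - (Suc l - q))" using x by auto
    also have "\<dots> \<in> rotate_pd k l P \<longleftrightarrow> (Suc k - p, Suc l - q) \<in> P" by (rule rotate_pd_iff[OF P]) (use x in auto)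
    finally show ?thesis unfolding x .
  next
    case False
    then show ?thesis using P rotate_pd_subset[OF rotate_pd_subset[OF P]] by blast
  qed
  then show ?thesis by blast
qed

text \<open>A rotation by 180 degrees reverses the reading order and reflects the letters. Undoing
  both recovers the block itself, with its letters shifted by e to its place in the large
  grid.\<close>

lemma hword_rotated:
  assumes P: "P \<subseteq> {1..k} \<times> {1..l}" and D: "D = e + (k + l)"
  shows "hword (map (\<lambda>i. D - i) (rev (pipe_word k l (rotate_pd k l P)))) =
    grid k l (\<lambda>p q. if (p, q) \<in> P then hgen (e + p + q - 1) else 1)"
proof -
  let ?\<rho> = "\<lambda>(p, q). (Suc k - p, Suc l - q)"
  have f: "filter (\<lambda>x. ?\<rho> x \<in> rotate_pd k l P) (boxes k l) = filter (\<lambda>x. x \<in> P) (boxes k l)"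
    by (rule filter_cong[OF refl]) (use rotate_pd_iff[OF P] in \<open>auto simp: set_boxes\<close>)
  have "rev (pipe_word k l (rotate_pd k l P)) =
      map (\<lambda>(p, q). p + q - 1) (map ?\<rho> (filter (\<lambda>x. ?\<rho> x \<in> rotate_pd k l P) (boxes k l)))"
    by (simp add: pipe_word_boxes rev_map rev_filter rev_boxes filter_map comp_def case_prod_unfold)
  then have "map (\<lambda>i. D - i) (rev (pipe_word k l (rotate_pd k l P))) =
      map (\<lambda>(p, q). e + p + q - 1) (filter (\<lambda>x. x \<in> P) (boxes k l))"
    by (auto simp: f D set_boxes)
  then show ?thesis
    unfolding grid_def by (simp only: hword_filter) (rule arg_cong[where f = prod_list], rule map_cong, auto)
qed

lemma hword_rect_word: "hword (rect_word a k c) = grid k c (\<lambda>p q. hgen (a + p + q - 1))"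
proof (induction k)
  case (Suc k)
  have "map (\<lambda>q. a + Suc k + q - 1) (rev [1..<Suc c]) = rev [a + Suc k..<a + Suc k + c]"
    by (rule nth_equalityI) (auto simp: rev_nth simp del: upt_Suc)
  note 1 = this
  have "prod_list (map (\<lambda>q. hgen (a + Suc k + q - 1)) (rev [1..<Suc c])) =
      prod_list (map hgen (map (\<lambda>q. a + Suc k + q - 1) (rev [1..<Suc c])))"
    by (simp only: map_map comp_def)
  also have "\<dots> = hword (rev [a + Suc k..<a + Suc k + c])" unfolding 1 hword_prod_list ..
  finally have "prod_list (map (\<lambda>q. hgen (a + Suc k + q - 1)) (rev [1..<Suc c])) = hword (rev [a + Suc k..<a + Suc k + c])" .
  moreover have "rect_word a (Suc k) c = rect_word a k c @ rev [a + Suc k..<a + Suc k + c]"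
    by (simp add: rect_word_def)
  ultimately show ?case by (simp only: grid_Suc Suc hword_append(2))
qed (simp add: rect_word_def hword_Nil(2))

section \<open>The product of an assembled pipe dream\<close>

definition subgrids :: "nat \<Rightarrow> (nat \<Rightarrow> nat) \<Rightarrow> (nat \<Rightarrow> (nat \<times> nat) set) \<Rightarrow> bool" where
  "subgrids n r P \<longleftrightarrow> (\<forall>j\<in>{1..n}. P j \<subseteq> {1..r (j - 1)} \<times> {1..r j})"

lemma subgridsD: "subgrids n r P \<Longrightarrow> j < n \<Longrightarrow> P (Suc j) \<subseteq> {1..r j} \<times> {1..r (Suc j)}"
  unfolding subgrids_def by (drule bspec[of _ _ "Suc j"]) auto

lemma assembled_pd_young:
  "assembled_pd n r P = young (total_size n r) (zlam n r) \<union>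
     (\<Union>j<n. (\<lambda>(p, q). (row_offset r j + p, col_offset n r (Suc j) + q)) ` P (Suc j))"
proof -
  have "{1..n} = Suc ` {..<n}" by (auto simp: image_iff Suc_le_eq gr0_conv_Suc)
  then show ?thesis unfolding assembled_pd_def zero_blocks by simp
qed

lemma assembled_row:
  assumes P: "subgrids n r P" and j: "j < n" and p: "p \<in> {1..r j}" and q: "1 \<le> q"
  shows "(row_offset r j + p, q) \<in> assembled_pd n r P \<longleftrightarrow>
    q \<le> col_offset n r (Suc j) \<or> (col_offset n r (Suc j) < q \<and> (p, q - col_offset n r (Suc j)) \<in> P (Suc j))"
proof -
  let ?a = "row_offset r j + p" and ?c = "col_offset n r (Suc j)"
  have b: "?a \<in> block_row r j" using p by (auto simp: block_row_def)
  have rb: "rowblk r ?a = j" by (rule rowblk_eqI[OF b])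
  have "(?a, q) \<in> young (total_size n r) (zlam n r) \<longleftrightarrow> q \<le> ?c"
    using block_row_bounds[OF _ b, of n] j q by (auto simp: young_def zlam_def rb)
  moreover have "(?a, q) \<in> (\<Union>j<n. (\<lambda>(p, q). (row_offset r j + p, col_offset n r (Suc j) + q)) ` P (Suc j)) \<longleftrightarrow>
      ?c < q \<and> (p, q - ?c) \<in> P (Suc j)"
  proof
    assume "(?a, q) \<in> (\<Union>j<n. (\<lambda>(p, q). (row_offset r j + p, col_offset n r (Suc j) + q)) ` P (Suc j))"
    then obtain j' p' q' where *: "j' < n" "(p', q') \<in> P (Suc j')" "?a = row_offset r j' + p'"
      "q = col_offset n r (Suc j') + q'" by auto
    have pq: "p' \<in> {1..r j'}" "q' \<in> {1..r (Suc j')}" using subgridsD[OF P *(1)] *(2) by auto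
    have "?a \<in> block_row r j'" using * pq by (auto simp: block_row_def)
    then have "j' = j" using rowblk_eqI rb by metis
    then show "?c < q \<and> (p, q - ?c) \<in> P (Suc j)" using * pq by auto
  next
    assume "?c < q \<and> (p, q - ?c) \<in> P (Suc j)"
    then show "(?a, q) \<in> (\<Union>j<n. (\<lambda>(p, q). (row_offset r j + p, col_offset n r (Suc j) + q)) ` P (Suc j))"
      by (intro UN_I[of j] image_eqI[of _ _ "(p, q - ?c)"]) (use j in auto)
  qed
  ultimately show ?thesis unfolding assembled_pd_young Un_iff by simp
qed

lemma assembled_last_row:
  assumes P: "subgrids n r P" and p: "p \<in> {1..r n}"
  shows "(row_offset r n + p, q) \<notin> assembled_pd n r P"
proof
  let ?a = "row_offset r n + p"
  have b: "?a \<in> block_row r n" using p by (auto simp: block_row_def)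
  assume "(?a, q) \<in> assembled_pd n r P"
  then consider "(?a, q) \<in> young (total_size n r) (zlam n r)" |
      j p' q' where "j < n" "(p', q') \<in> P (Suc j)" "?a = row_offset r j + p'"
    unfolding assembled_pd_young by auto
  then show False
  proof cases
    case 1
    then show ?thesis by (auto simp: young_def zlam_def rowblk_eqI[OF b] col_offset_top)
  next
    case 2
    then have "p' \<in> {1..r j}" using subgridsD[OF P 2(1)] by auto
    then have "?a \<in> block_row r j" using 2 by (auto simp: block_row_def)
    then show ?thesis using rowblk_eqI b 2(1) by (metis less_irrefl)
  qed
qed

definition rotated_word :: "(nat \<Rightarrow> nat) \<Rightarrow> (nat \<Rightarrow> (nat \<times> nat) set) \<Rightarrow> nat \<Rightarrow> nat list" where
  "rotated_word r P j = pipe_word (r j) (r (Suc j)) (rotate_pd (r j) (r (Suc j)) (P (Suc j)))"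

lemma words_ok_rotated: "words_ok n r (rotated_word r P)"
  by (auto simp: words_ok_def rotated_word_def set_pipe_word)

text \<open>The columns of a block row split into the compulsory rectangle, the superantidiagonal
  block and an empty part; read from the right they give the stage word. The last block row is
  empty.\<close>

lemma demazure_assembled:
  assumes P: "subgrids n r P"
  shows "pipe_demazure (total_size n r) (total_size n r) (assembled_pd n r P) =
    word_demazure (total_word n r (rotated_word r P) n)"
proof -
  let ?d = "total_size n r"
  let ?E = "\<lambda>p q. if (p, q) \<in> assembled_pd n r P then hgen (p + q - 1) else 1"
  have comm: "?E p q * ?E p' q' = ?E p' q' * ?E p q" if "1 \<le> p" "1 \<le> q" "p < p'" "q < q'" for p q p' q' :: nat
    using that by (auto intro: hgen_commute)
  have main: "grid (row_offset r j) ?d ?E = hword (total_word n r (rotated_word r P) j)" if "j \<le> n" for j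
    using that
  proof (induction j)
    case 0
    then show ?case by (simp add: row_offset_def total_word_def hword_Nil(2))
  next
    case (Suc j)
    then have j: "j < n" by simp
    let ?F = "\<lambda>(p::nat) (q::nat). ?E (row_offset r j + p) q"
    define c where "c = col_offset n r (Suc j)"
    define x where "x = ?d - (c + r (Suc j))"
    have d: "?d = row_offset r j + c + (r j + r (Suc j))" using offsets_total[OF j, of r] by (simp add: c_def)
    have d2: "?d = c + (r (Suc j) + x)" using d by (simp add: x_def)
    have F: "?F p q = (if q \<le> c then hgen (row_offset r j + p + q - 1)
        else if (p, q - c) \<in> P (Suc j) then hgen (row_offset r j + p + q - 1) else 1)"
      if "p \<in> {1..r j}" "1 \<le> q" for p q
      using assembled_row[OF P j that] by (auto simp: c_def)
    have "grid (r j) ?d ?F = grid (r j) (r (Suc j) + x) (\<lambda>p q. ?F p (c + q)) * grid (r j) c ?F"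
      unfolding d2 by (rule grid_add_cols) (rule comm, auto)
    also have "grid (r j) (r (Suc j) + x) (\<lambda>p q. ?F p (c + q)) =
        grid (r j) x (\<lambda>p q. ?F p (c + (r (Suc j) + q))) * grid (r j) (r (Suc j)) (\<lambda>p q. ?F p (c + q))"
      by (rule grid_add_cols) (rule comm, auto)
    also have "grid (r j) x (\<lambda>p q. ?F p (c + (r (Suc j) + q))) = 1"
    proof (rule grid_one)
      fix p q assume *: "1 \<le> p" "p \<le> r j" "1 \<le> q" "q \<le> x"
      have "(p, r (Suc j) + q) \<notin> P (Suc j)" using subgridsD[OF P j] * by auto
      then show "?F p (c + (r (Suc j) + q)) = 1" using F[of p "c + (r (Suc j) + q)"] * by auto
    qed
    also have "grid (r j) c ?F = hword (rect_word (row_offset r j) (r j) c)"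
      unfolding hword_rect_word by (rule grid_cong) (use F in auto)
    also have "grid (r j) (r (Suc j)) (\<lambda>p q. ?F p (c + q)) = hword (map (\<lambda>i. ?d - i) (rev (rotated_word r P j)))"
      unfolding rotated_word_def hword_rotated[OF subgridsD[OF P j] d]
    proof (rule grid_cong)
      fix p q :: nat assume *: "1 \<le> p" "p \<le> r j" "1 \<le> q"
      have "row_offset r j + p + (c + q) - 1 = row_offset r j + c + p + q - 1" using * by simp
      then show "?F p (c + q) = (if (p, q) \<in> P (Suc j) then hgen (row_offset r j + c + p + q - 1) else 1)"
        using F[of p "c + q"] * by auto
    qed
    finally have "grid (r j) ?d ?F = hword (stage_word n r (rotated_word r P j) j)"
      by (simp add: stage_word_def hword_append(2) c_def)
    then show ?case
      using Suc.IH j by (simp only: row_offset_Suc grid_add_rows total_word_Suc hword_append(2) less_imp_le)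
  qed
  have "hword (pipe_word ?d ?d (assembled_pd n r P)) = grid (row_offset r n + r n) ?d ?E"
    by (simp add: hword_pipe_word row_offset_Suc[symmetric] row_offset_total)
  also have "\<dots> = grid (row_offset r n) ?d ?E * grid (r n) ?d (\<lambda>p q. ?E (row_offset r n + p) q)"
    by (rule grid_add_rows)
  also have "grid (r n) ?d (\<lambda>p q. ?E (row_offset r n + p) q) = 1"
    by (rule grid_one) (use assembled_last_row[OF P] in auto)
  finally show ?thesis
    unfolding pipe_demazure_def hword_eq_iff[symmetric] by (simp add: main)
qed

lemma zel_hom_total_word: "zel_hom n r = word_demazure (total_word n r (\<lambda>_. []) n)"
proof -
  interpret dominant "total_size n r" "zlam n r" by (rule zlam_dominant)
  have "assembled_pd n r (\<lambda>_. {}) = young (total_size n r) (zlam n r)" by (simp add: assembled_pd_young)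
  moreover have "rotated_word r (\<lambda>_. {}) = (\<lambda>_. [])"
    by (rule ext) (simp add: rotated_word_def rotate_pd_def pipe_word_def del: upt_Suc)
  moreover have "subgrids n r (\<lambda>_. {})" by (simp add: subgrids_def)
  ultimately show ?thesis
    using demazure_assembled[of n r "\<lambda>_. {}"] by (simp add: zel_hom_eq dom_perm_def)
qed

lemma (in block_shift) zel_hom_ext: "zel_hom n r' = ext (zel_hom n r)"
proof -
  have "words_ok n r (\<lambda>_. [])" by (simp add: words_ok_def)
  from demazure_ext[OF this] show ?thesis by (simp add: zel_hom_total_word)
qed

subsection \<open>Existence of pipe dreams\<close>

text \<open>The pipe dream is the left-justified diagram of the Lehmer code.\<close>

lemma every_permutation_pipe_dream:
  assumes u: "u permutes {1..N}"
  shows "\<exists>Q. Q \<subseteq> {1..N} \<times> {1..N} \<and> pipe_demazure N N Q = u"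
proof -
  define c where "c p = card {p'. p < p' \<and> u p' < u p}" for p
  define A where "A n = word_demazure (pipe_word n N (young N c))" for n
  have sub: "{p'. p < p' \<and> u p' < u p} \<subseteq> {p<..N}" if "1 \<le> p" "p \<le> N" for p
  proof
    fix p' assume *: "p' \<in> {p'. p < p' \<and> u p' < u p}"
    have "p' \<le> N"
    proof (rule ccontr)
      assume "\<not> p' \<le> N"
      then have "u p' = p'" by (intro permutes_not_in[OF u]) simp
      moreover have "u p \<le> N" using permutes_in_image[OF u, of p] that by auto
      ultimately show False using * \<open>\<not> p' \<le> N\<close> by auto
    qed
    then show "p' \<in> {p<..N}" using * by auto
  qed
  have c: "p + c p \<le> N" if "1 \<le> p" "p \<le> N" for p
    using card_mono[OF _ sub[OF that]] that unfolding c_def by simp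
  have cN: "c p \<le> N" if "1 \<le> p" "p \<le> N" for p using c[OF that] by simp
  note rows = young_rows[of _ N c N, OF _ cN, folded A_def]
  have perm: "A n permutes {1..N}" if "n \<le> N" for n
    unfolding A_def by (rule demazure_permutes) (use c that in \<open>fastforce simp: set_pipe_word young_def\<close>)
  have "\<forall>p\<in>{1..n}. A n p = u p" if "n \<le> N" for n
    using that
  proof (induction n)
    case (Suc n)
    then have n: "n \<le> N" "n < N" by auto
    note pa = perm[OF n(1)]
    have IH: "A n p = u p" if "p \<le> n" for p
      using Suc.IH n that permutes_not_in[OF pa, of 0] permutes_not_in[OF u, of 0] by (cases "p = 0") auto
    have inc: "n < x \<Longrightarrow> x < y \<Longrightarrow> A n x < A n y" for x y using rows[OF n(1)] by blast
    obtain x where x: "A n x = u (Suc n)" using permutes_surj[OF pa] by (metis surjD)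
    have nx: "n < x"
    proof (rule ccontr)
      assume "\<not> n < x"
      then have "u x = u (Suc n)" using IH[of x] x by simp
      then have "x = Suc n" by (rule injD[OF permutes_inj[OF u]])
      then show False using \<open>\<not> n < x\<close> by simp
    qed
    \<comment> \<open>Behind position n the entries increase, so those before u (n + 1) are the
      later and smaller values which the Lehmer code counts.\<close>
    have "bij_betw (inv u \<circ> A n) {n<..<x} {p'. Suc n < p' \<and> u p' < u (Suc n)}"
    proof (rule bij_betwI[where g = "inv (A n) \<circ> u"])
      have inj: "A n a = A n b \<Longrightarrow> a = b" "u a = u b \<Longrightarrow> a = b" for a b
        using injD[OF permutes_inj[OF pa]] injD[OF permutes_inj[OF u]] by blast+
      show "inv u \<circ> A n \<in> {n<..<x} \<rightarrow> {p'. Suc n < p' \<and> u p' < u (Suc n)}"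
      proof
        fix y assume y: "y \<in> {n<..<x}"
        define p where "p = inv u (A n y)"
        have p: "u p = A n y" by (simp add: p_def permutes_inverses[OF u])
        have less: "u p < u (Suc n)" using inc[of y x] y x p by simp
        have "\<not> p \<le> n"
        proof
          assume "p \<le> n"
          then have "A n p = A n y" using IH p by simp
          then have "p = y" by (rule inj)
          then show False using \<open>p \<le> n\<close> y by simp
        qed
        then have "Suc n < p" using less by (cases "p = Suc n") auto
        then show "(inv u \<circ> A n) y \<in> {p'. Suc n < p' \<and> u p' < u (Suc n)}" using less by (simp add: p_def)
      qed
      show "inv (A n) \<circ> u \<in> {p'. Suc n < p' \<and> u p' < u (Suc n)} \<rightarrow> {n<..<x}"
      proof
        fix p assume p: "p \<in> {p'. Suc n < p' \<and> u p' < u (Suc n)}"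
        define y where "y = inv (A n) (u p)"
        have y: "A n y = u p" by (simp add: y_def permutes_inverses[OF pa])
        have "\<not> y \<le> n"
        proof
          assume "y \<le> n"
          then have "u y = u p" using IH y by simp
          then have "y = p" by (rule inj)
          then show False using \<open>y \<le> n\<close> p by simp
        qed
        moreover have "y < x"
        proof (rule ccontr)
          assume "\<not> y < x"
          then have "A n x \<le> A n y" using inc[of x y] nx by (cases "x = y") auto
          then show False using p x y by simp
        qed
        ultimately show "(inv (A n) \<circ> u) p \<in> {n<..<x}" by (simp add: y_def)
      qed
    qed (simp_all add: permutes_inverses[OF u] permutes_inverses[OF pa])
    then have "c (Suc n) = x - Suc n" by (simp add: c_def bij_betw_same_card[symmetric])
    then have "x = Suc n + c (Suc n)" using nx by simp
    then show ?case using rows[OF n(1)] n x IH by (auto simp: le_Suc_eq)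
  qed simp
  then have "A N p = u p" for p
    using permutes_not_in[OF perm[OF order_refl], of p] permutes_not_in[OF u, of p] by (cases "p \<in> {1..N}") auto
  then have "A N = u" by blast
  moreover have "young N c \<subseteq> {1..N} \<times> {1..N}" using cN by (fastforce simp: young_def)
  ultimately show ?thesis by (auto simp: A_def pipe_demazure_def)
qed

lemma nice_pipe_dream_exists:
  assumes u: "nice k l u"
  shows "\<exists>Q. Q \<subseteq> {1..k} \<times> {1..l} \<and> pipe_demazure k l Q = u"
proof -
  obtain Q where Q: "Q \<subseteq> {1..k + l} \<times> {1..k + l}" "pipe_demazure (k + l) (k + l) Q = u"
    using every_permutation_pipe_dream[OF nice_permutes[OF u]] by blast
  have "Q \<subseteq> {1..k} \<times> {1..l}" by (rule nice_pipe_dream_subset[OF u Q])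
  then show ?thesis using Q pipe_word_restrict[of Q k l "k + l" "k + l"] by (auto simp: pipe_demazure_def)
qed

section \<open>The factors of a Zelevinsky permutation\<close>

lemma total_word_low:
  assumes g: "words_ok n r g" and j: "j \<le> n" and x: "1 \<le> x" "x \<le> col_offset n r j"
  shows "word_demazure (total_word n r g j) (row_offset r j + x) = x"
proof -
  let ?u = "word_demazure (total_word n r g j)" and ?d = "total_size n r"
  let ?o = "fst (trun (colb n r) r g j)" and ?R = "snd (trun (colb n r) r g j)"
  have "map length ?o = map r [0..<j]" using trun_invariants[OF g j, of "colb n r"] by auto
  then have len: "length (concat ?o) = row_offset r j"
    by (simp add: length_concat row_offset_def interv_sum_list_conv_sum_set_nat atLeast0LessThan)
  have lst: "map ?u [1..<Suc ?d] = concat ?o @ [1..<Suc (col_offset n r j)] @ ?R"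
    using olist_demazure[of "total_word n r g j" ?d] total_word_letters[OF g j] total_word_state[OF g j] by simp
  have d: "row_offset r j + x \<le> ?d"
    using x col_offset_row_offset[OF j, of r] row_offset_Suc[of r j] by simp
  have "?u (row_offset r j + x) = map ?u [1..<Suc ?d] ! (row_offset r j + (x - 1))"
    using x d by (simp del: upt_Suc)
  also have "\<dots> = [1..<Suc (col_offset n r j)] ! (x - 1)"
  proof -
    have "x - 1 < col_offset n r j" using x by arith
    then show ?thesis unfolding lst len[symmetric] nth_append_length_plus by (simp add: nth_append del: upt_Suc)
  qed
  also have "\<dots> = x" using x by (simp del: upt_Suc)
  finally show ?thesis .
qed

lemma trun_nth:
  "length (fst (trun cb s g n)) = n \<and>
    (\<forall>j<n. fst (trun cb s g n) ! j = take (s j) (fops (cb (Suc j) @ snd (trun cb s g j)) (g j)))"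
proof (induction n)
  case (Suc n)
  obtain outs R where t: "trun cb s g n = (outs, R)" by fastforce
  then show ?case using Suc by (auto simp: Let_def nth_append less_Suc_eq)
qed simp

lemma fops_Cons: "fops L (i # w) = lop (fops L w) (length L - i)"
  by (simp add: fops_def)

lemma lop_not_ascent: "1 \<le> i \<Longrightarrow> i < length L \<Longrightarrow> \<not> lop L i ! (i - 1) < lop L i ! i"
  by (auto simp: lop_def nth_list_update)

lemma permutes_descent_less:
  fixes u :: "nat \<Rightarrow> nat"
  assumes "u permutes {1..N}" "u (Suc i) < u i" shows "i < N"
proof (rule ccontr)
  assume "\<not> i < N"
  then have "u (Suc i) = Suc i" by (intro permutes_not_in[OF assms(1)]) simp
  moreover have "u i \<le> i"
  proof (cases "i \<in> {1..N}")
    case True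
    then have "u i \<le> N" using permutes_in_image[OF assms(1), of i] by auto
    then show ?thesis using \<open>\<not> i < N\<close> by simp
  qed (simp add: permutes_not_in[OF assms(1)])
  ultimately show False using assms(2) by simp
qed

lemma words_ok_update:
  "words_ok n r g \<Longrightarrow> (\<And>i. i \<in> set w \<Longrightarrow> 1 \<le> i \<and> i < r j + r (Suc j)) \<Longrightarrow> words_ok n r (g(j := w))"
  by (auto simp: words_ok_def)

lemma total_word_split:
  assumes "j < n"
  shows "\<exists>rest. total_word n r g n = total_word n r g j @ stage_word n r (g j) j @ rest"
proof -
  have "[0..<n] = [0..<j] @ j # [Suc j..<n]"
    using assms upt_add_eq_append[of 0 j "n - j"] by (simp add: upt_conv_Cons)
  then show ?thesis by (simp add: total_word_def)
qed

text \<open>A wrong descent of a factor could be repeated at the corresponding end of its word. Repeated at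
  the beginning of the stage, it would invert two values from the same block column; repeated at the
  end of the stage, it would leave a descent inside of a block row.\<close>

lemma zelevinsky_factor_nice:
  assumes g: "words_ok n r g" and v: "word_demazure (total_word n r g n) = v" "zelevinsky n r v" and j: "j < n"
  shows "nice (r j) (r (Suc j)) (word_demazure (g j))"
proof -
  let ?u = "word_demazure (g j)" and ?k = "r j" and ?l = "r (Suc j)" and ?d = "total_size n r"
  let ?N = "?k + ?l"
  have letters: "1 \<le> i \<and> i < ?N" if "i \<in> set (g j)" for i using g j that by (auto simp: words_ok_def)
  have pu: "?u permutes {1..?N}" by (rule demazure_permutes) (use letters in auto)
  then have S: "?u \<in> S_inf" unfolding S_inf_def by blast
  note d = offsets_total[OF j, of r]
  have subst: "word_demazure (total_word n r (g(j := w)) n) = v" "words_ok n r (g(j := w))"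
    if "word_demazure w = ?u" "\<And>i. i \<in> set w \<Longrightarrow> 1 \<le> i \<and> i < ?N" for w
  proof -
    show ok: "words_ok n r (g(j := w))" by (rule words_ok_update[OF g that(2)])
    show "word_demazure (total_word n r (g(j := w)) n) = v"
      unfolding v(1)[symmetric] by (rule total_word_cong[OF ok g]) (use that in auto)
  qed
  have "?u i < ?u (Suc i)" if i: "?k < i" for i
  proof (rule ccontr)
    assume "\<not> ?u i < ?u (Suc i)"
    moreover have "?u i \<noteq> ?u (Suc i)"
      using permutes_inj[OF pu, THEN injD, of i "Suc i"] by auto
    ultimately have desc: "?u (Suc i) < ?u i" by simp
    have iN: "i < ?N" by (rule permutes_descent_less[OF pu desc])
    let ?g = "g(j := g j @ [i])"
    have "1 \<le> i' \<and> i' < ?N" if "i' \<in> set (g j @ [i])" for i' using that letters i iN by auto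
    then have ok: "words_ok n r ?g" and v': "word_demazure (total_word n r ?g n) = v"
      using subst[OF demazure_right_descent[OF desc]] by blast+
    obtain rest where rest: "total_word n r ?g n = total_word n r ?g j @ stage_word n r (?g j) j @ rest"
      using total_word_split[OF j] by blast
    \<comment> \<open>The stage reverses the word, so the appended letter is read first. At that
      time positions d - i and d - i + 1 hold two consecutive values of block column j + 1, which
      are then inverted for good.\<close>
    have "stage_word n r (?g j) j = (?d - i) # stage_word n r (g j) j" by (simp add: stage_word_def)
    then have w: "total_word n r ?g n = (total_word n r ?g j @ [?d - i]) @ (stage_word n r (g j) j @ rest)"
      using rest by simp
    define x where "x = col_offset n r (Suc j) + (?N - i)"
    have x: "1 \<le> x" "Suc x \<le> col_offset n r j" "?d - i = row_offset r j + x"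
      using i iN d col_offset_Suc[OF j, of r] by (auto simp: x_def)
    let ?U = "word_demazure (total_word n r ?g j)"
    have "?U (?d - i) = x" "?U (Suc (?d - i)) = Suc x"
      using total_word_low[OF ok, of j x] total_word_low[OF ok, of j "Suc x"] x j by auto
    then have "word_demazure (total_word n r ?g j @ [?d - i]) (?d - i) = Suc x"
      "word_demazure (total_word n r ?g j @ [?d - i]) (Suc (?d - i)) = x"
      unfolding demazure_snoc rop_apply by auto
    then obtain s t where st: "s < t" "v s = Suc x" "v t = x"
      using rops_inverted[of "?d - i" "Suc (?d - i)" "word_demazure (total_word n r ?g j @ [?d - i])"
          "stage_word n r (g j) j @ rest"] v'
      unfolding w demazure_append[of "total_word n r ?g j @ [?d - i]"] by auto
    have "x \<in> block_col n r (Suc j)" "Suc x \<in> block_col n r (Suc j)"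
      using i iN by (auto simp: block_col_def x_def)
    then have c: "colblk n r (v s) = colblk n r (v t)" "x \<in> {1..?d}" "Suc x \<in> {1..?d}"
      using colblk_eqI[of "Suc j" n _ r] block_col_bounds[of "Suc j" n _ r] j st by auto
    have "s \<in> {1..?d}" "t \<in> {1..?d}"
      using permutes_in_image[OF zelevinsky_permutes[OF v(2)], of s] c(3) st
        permutes_in_image[OF zelevinsky_permutes[OF v(2)], of t] c(2) by auto
    then have "v s < v t" using zelevinsky_colD[OF v(2) _ st(1) _ c(1)] by auto
    then show False using st by simp
  qed
  moreover have "inv ?u i < inv ?u (Suc i)" if i: "?l < i" for i
  proof (rule ccontr)
    have pi: "inv ?u permutes {1..?N}" by (rule permutes_inv[OF pu])
    assume "\<not> inv ?u i < inv ?u (Suc i)"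
    moreover have "inv ?u i \<noteq> inv ?u (Suc i)"
      using permutes_inj[OF pi, THEN injD, of i "Suc i"] by auto
    ultimately have desc: "inv ?u (Suc i) < inv ?u i" by simp
    have iN: "i < ?N" by (rule permutes_descent_less[OF pi desc])
    let ?g = "g(j := i # g j)"
    have "1 \<le> i' \<and> i' < ?N" if "i' \<in> set (i # g j)" for i' using that letters i iN by auto
    then have ok: "words_ok n r ?g" and v': "word_demazure (total_word n r ?g n) = v"
      using subst[OF demazure_left_descent[OF desc]] by blast+
    let ?R = "snd (trun (colb n r) r ?g j)"
    have lR: "length ?R = ?k" using trun_invariants[OF ok, of j "colb n r"] j by auto
    define B where "B = colb n r (Suc j) @ ?R"
    have lB: "length B = ?N" by (simp add: B_def lR)
    \<comment> \<open>The prepended letter acts last, at this position of the current list. By i > r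
      (j + 1) it lies within the first r j entries, which become block row j.\<close>
    let ?a = "?N - i"
    have a: "1 \<le> ?a" "?a < ?k" using i iN by auto
    have "map v (rowl r j) = take ?k (lop (fops B (g j)) ?a)"
      using trun_rows(1)[OF v' ok] trun_nth[of "colb n r" r ?g n] j
      by (simp add: B_def[symmetric] fops_Cons lB)
    moreover have "length (fops B (g j)) = ?N" by (simp add: fops_def lB)
    ultimately have "map v (rowl r j) ! (?a - 1) = lop (fops B (g j)) ?a ! (?a - 1)"
      "map v (rowl r j) ! ?a = lop (fops B (g j)) ?a ! ?a" using a by auto
    moreover have "\<not> lop (fops B (g j)) ?a ! (?a - 1) < lop (fops B (g j)) ?a ! ?a"
      by (rule lop_not_ascent) (use a \<open>length (fops B (g j)) = ?N\<close> in auto)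
    moreover have "map v (rowl r j) ! (?a - 1) = v (row_offset r j + ?a)"
      "map v (rowl r j) ! ?a = v (Suc (row_offset r j + ?a))"
    proof -
      have nth: "map v (rowl r j) ! t = v (Suc (row_offset r j + t))" if "t < ?k" for t
        using that by (simp add: rowl_def del: upt_Suc)
      have "Suc (row_offset r j + (?a - 1)) = row_offset r j + ?a" "?a - 1 < ?k" using a by arith+
      then show "map v (rowl r j) ! (?a - 1) = v (row_offset r j + ?a)" using nth[of "?a - 1"] by (simp only:)
      show "map v (rowl r j) ! ?a = v (Suc (row_offset r j + ?a))" by (rule nth[OF a(2)])
    qed
    moreover have "v (row_offset r j + ?a) < v (Suc (row_offset r j + ?a))"
    proof (rule zelevinsky_rowD[OF v(2)])
      have "row_offset r j + ?a \<in> block_row r j" "Suc (row_offset r j + ?a) \<in> block_row r j"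
        using a by (auto simp: block_row_def)
      then show "rowblk r (row_offset r j + ?a) = rowblk r (Suc (row_offset r j + ?a))"
        "Suc (row_offset r j + ?a) \<le> ?d"
        using rowblk_eqI block_row_bounds(2)[of j n _ r] j by auto
    qed (use a in auto)
    ultimately show False by simp
  qed
  ultimately show ?thesis using S unfolding nice_def by blast
qed

text \<open>The pipe dreams of the definition may be replaced by arbitrary words with the same
  products, since the total product depends on the factors only and every completion has a pipe
  dream.\<close>

lemma lacings_iff:
  assumes v: "zelevinsky n r v" "has_rank_array n r v R"
  shows "ws \<in> lacings n r R \<longleftrightarrow> ws \<in> lacing_diagrams n r \<and>
    (\<exists>g. words_ok n r g \<and> (\<forall>j<n. word_demazure (g j) = completion (r j) (r (Suc j)) (ws ! j)) \<and>
      word_demazure (total_word n r g n) = v)"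
proof (cases "ws \<in> lacing_diagrams n r")
  case True
  have zp: "zel_perm n r R = v" by (rule zel_perm_eqI[OF v])
  have pp: "ws ! j \<in> partial_perms (r j) (r (Suc j))" if "j < n" for j
  proof -
    have "\<forall>j\<in>{1..n}. ws ! (j - 1) \<in> partial_perms (r (j - 1)) (r j)"
      using True by (simp add: lacing_diagrams_def)
    from bspec[OF this, of "Suc j"] show ?thesis using that by simp
  qed
  have "lacing_demazure_eq n r ws R \<longleftrightarrow>
      (\<exists>g. words_ok n r g \<and> (\<forall>j<n. word_demazure (g j) = completion (r j) (r (Suc j)) (ws ! j)) \<and>
        word_demazure (total_word n r g n) = v)"
  proof
    assume "lacing_demazure_eq n r ws R"
    then obtain P where P: "\<forall>j\<in>{1..n}. P j \<subseteq> {1..r (j - 1)} \<times> {1..r j} \<and>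
        rotate_pd (r (j - 1)) (r j) (P j) \<in> pipe_dreams (r (j - 1)) (r j) (ws ! (j - 1))"
      "pipe_demazure (total_size n r) (total_size n r) (assembled_pd n r P) = v"
      unfolding lacing_demazure_eq_def zp by blast
    have s: "subgrids n r P" using P(1) by (simp add: subgrids_def)
    have "word_demazure (rotated_word r P j) = completion (r j) (r (Suc j)) (ws ! j)" if "j < n" for j
      using bspec[OF P(1), of "Suc j"] that by (simp add: pipe_dreams_def rotated_word_def pipe_demazure_def)
    then show "\<exists>g. words_ok n r g \<and> (\<forall>j<n. word_demazure (g j) = completion (r j) (r (Suc j)) (ws ! j)) \<and>
        word_demazure (total_word n r g n) = v"
      using words_ok_rotated demazure_assembled[OF s] P(2) by (intro exI[of _ "rotated_word r P"]) simp
  next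
    assume "\<exists>g. words_ok n r g \<and> (\<forall>j<n. word_demazure (g j) = completion (r j) (r (Suc j)) (ws ! j)) \<and>
        word_demazure (total_word n r g n) = v"
    then obtain g where g: "words_ok n r g" "\<And>j. j < n \<Longrightarrow> word_demazure (g j) = completion (r j) (r (Suc j)) (ws ! j)"
        "word_demazure (total_word n r g n) = v" by blast
    have "\<forall>j. \<exists>Q. j < n \<longrightarrow> Q \<subseteq> {1..r j} \<times> {1..r (Suc j)} \<and>
        pipe_demazure (r j) (r (Suc j)) Q = completion (r j) (r (Suc j)) (ws ! j)"
      using nice_pipe_dream_exists[OF completion_props(2)[OF pp]] by blast
    then obtain Q where Q: "\<And>j. j < n \<Longrightarrow> Q j \<subseteq> {1..r j} \<times> {1..r (Suc j)}"
        "\<And>j. j < n \<Longrightarrow> pipe_demazure (r j) (r (Suc j)) (Q j) = completion (r j) (r (Suc j)) (ws ! j)"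
      by metis
    define P where "P j = rotate_pd (r (j - 1)) (r j) (Q (j - 1))" for j
    have s: "subgrids n r P"
      unfolding subgrids_def P_def
    proof
      fix j assume "j \<in> {1..n}"
      then have "j - 1 < n" "Suc (j - 1) = j" by auto
      then show "rotate_pd (r (j - 1)) (r j) (Q (j - 1)) \<subseteq> {1..r (j - 1)} \<times> {1..r j}"
        using rotate_pd_subset[OF Q(1)[of "j - 1"]] by simp
    qed
    have w: "rotated_word r P j = pipe_word (r j) (r (Suc j)) (Q j)" if "j < n" for j
      by (simp add: rotated_word_def P_def rotate_pd_involutive[OF Q(1)[OF that]])
    have "word_demazure (total_word n r (rotated_word r P) n) = v"
      unfolding g(3)[symmetric]
      by (rule total_word_cong[OF words_ok_rotated g(1)]) (use w g(2) Q(2) in \<open>auto simp: pipe_demazure_def\<close>)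
    then have "pipe_demazure (total_size n r) (total_size n r) (assembled_pd n r P) = v"
      by (simp add: demazure_assembled[OF s])
    moreover have "P j \<subseteq> {1..r (j - 1)} \<times> {1..r j} \<and>
        rotate_pd (r (j - 1)) (r j) (P j) \<in> pipe_dreams (r (j - 1)) (r j) (ws ! (j - 1))"
      if "j \<in> {1..n}" for j
    proof -
      define i where "i = j - 1"
      have i: "j = Suc i" "i < n" using that by (auto simp: i_def)
      show ?thesis
        using rotate_pd_subset[OF Q(1)[OF i(2)]] rotate_pd_involutive[OF Q(1)[OF i(2)]] Q[OF i(2)]
        by (simp add: i P_def pipe_dreams_def)
    qed
    ultimately show "lacing_demazure_eq n r ws R" unfolding lacing_demazure_eq_def zp by blast
  qed
  then show ?thesis using True by (simp add: lacings_def)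
qed (simp add: lacings_def)

context block_shift
begin

text \<open>Forwards: as the last m points are fixed, all letters are below d' - m; those of the
  factors are reflected, so they exceed m, and \<open>small\<close> bounds them from above. Hence
  the factors are shifts of words for \<open>r\<close>, \<open>ext\<close> can be cancelled, and
  \<open>zelevinsky_factor_nice\<close> makes them completions. Backwards,
  \<open>demazure_ext\<close> applies.\<close>

lemma assembled_ext_iff:
  assumes v: "zelevinsky n r v" "has_rank_array n r v R" and P: "subgrids n r' P"
    and small: "\<And>j p q. j < n \<Longrightarrow> (p, q) \<in> rotate_pd (r' j) (r' (Suc j)) (P (Suc j)) \<Longrightarrow> p \<le> r j \<or> q \<le> r (Suc j)"
  shows "pipe_demazure d' d' (assembled_pd n r' P) = ext v \<longleftrightarrow>
    (\<exists>ws\<in>lacings n r R. \<forall>j<n. pipe_demazure (r' j) (r' (Suc j)) (rotate_pd (r' j) (r' (Suc j)) (P (Suc j))) =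
      shift_perm m (completion (r j) (r (Suc j)) (ws ! j)))"
proof -
  define g' where "g' = rotated_word r' P"
  have g': "words_ok n r' g'" unfolding g'_def by (rule words_ok_rotated)
  have dg': "word_demazure (g' j) = pipe_demazure (r' j) (r' (Suc j)) (rotate_pd (r' j) (r' (Suc j)) (P (Suc j)))" for j
    by (simp add: g'_def rotated_word_def pipe_demazure_def)
  have shifted: "word_demazure (map ((+) m) (g j)) = shift_perm m (word_demazure (g j))"
    if "words_ok n r g" "j < n" for g j
    by (rule demazure_shift) (use words_okD[OF that, of 0] in auto)
  show ?thesis
    unfolding demazure_assembled[OF P] dg'[symmetric] g'_def[symmetric]
  proof
    assume e: "word_demazure (total_word n r' g' n) = ext v"
    have "ext v permutes {1..d' - m}"
    proof (rule permutes_subset[OF ext_permutes[OF zelevinsky_permutes[OF v(1)]], THEN permutes_superset])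
      show "{1..d'} \<subseteq> {1..d'}" by simp
      show "\<And>x. x \<in> {1..d'} - {1..d' - m} \<Longrightarrow> ext v x = x" by (auto intro: ext_last)
    qed
    then have range: "i < d' - m" if "i \<in> set (total_word n r' g' n)" for i
      using demazure_letter_range[of "total_word n r' g' n" 1 "d' - m" i] e that by simp
    have letters: "m < i \<and> i < m + (r j + r (Suc j))" if j: "j < n" and i: "i \<in> set (g' j)" for j i
    proof
      have "d' - i \<in> set (stage_word n r' (g' j) j)" using i by (simp add: stage_word_def)
      then have "d' - i \<in> set (total_word n r' g' n)" using j by (auto simp: total_word_def)
      then show "m < i" using range by fastforce
      \<comment> \<open>By \<open>small\<close> one coordinate is within its old bound, and the
        other one exceeds its old bound by at most m.\<close>
      obtain p q where pq: "(p, q) \<in> rotate_pd (r' j) (r' (Suc j)) (P (Suc j))" "p \<in> {1..r' j}" "q \<in> {1..r' (Suc j)}"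
          "i = p + q - 1"
        using i unfolding g'_def rotated_word_def set_pipe_word by auto
      then show "i < m + (r j + r (Suc j))" using small[OF j pq(1)] by (auto simp: r'_def)
    qed
    define g where "g j = map (\<lambda>i. i - m) (g' j)" for j
    have g: "words_ok n r g" unfolding words_ok_def g_def using letters by fastforce
    have gm: "map ((+) m) (g j) = g' j" if "j < n" for j
      unfolding g_def map_map by (rule map_idI) (use letters[OF that] in fastforce)
    have "total_word n r' (\<lambda>j. map ((+) m) (g j)) n = total_word n r' g' n"
      unfolding total_word_def by (rule arg_cong[where f = concat], rule map_cong) (use gm in auto)
    then have "ext (word_demazure (total_word n r g n)) = ext v" using demazure_ext[OF g] e by simp
    then have gv: "word_demazure (total_word n r g n) = v"
      by (rule ext_inject[OF total_word_permutes[OF g] zelevinsky_permutes[OF v(1)]])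
    define w where "w j = {(p, word_demazure (g j) p) | p. p \<in> {1..r j} \<and> word_demazure (g j) p \<in> {1..r (Suc j)}}" for j
    have w: "w j \<in> partial_perms (r j) (r (Suc j))" "completion (r j) (r (Suc j)) (w j) = word_demazure (g j)"
      if "j < n" for j
      using nice_completion[OF zelevinsky_factor_nice[OF g gv v(1) that]] by (simp_all add: w_def)
    define ws where "ws = map w [0..<n]"
    have ws: "ws ! j = w j" if "j < n" for j using that by (simp add: ws_def)
    have "ws \<in> lacing_diagrams n r"
      unfolding lacing_diagrams_def
    proof (intro CollectI conjI ballI)
      fix j assume "j \<in> {1..n}"
      then show "ws ! (j - 1) \<in> partial_perms (r (j - 1)) (r j)" using w(1)[of "j - 1"] ws[of "j - 1"] by auto
    qed (simp add: ws_def)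
    then have "ws \<in> lacings n r R" unfolding lacings_iff[OF v] using g gv w(2) ws by auto
    moreover have "word_demazure (g' j) = shift_perm m (completion (r j) (r (Suc j)) (ws ! j))" if "j < n" for j
      using shifted[OF g that] gm[OF that] w(2)[OF that] ws[OF that] by simp
    ultimately show "\<exists>ws\<in>lacings n r R. \<forall>j<n. word_demazure (g' j) = shift_perm m (completion (r j) (r (Suc j)) (ws ! j))"
      by blast
  next
    assume "\<exists>ws\<in>lacings n r R. \<forall>j<n. word_demazure (g' j) = shift_perm m (completion (r j) (r (Suc j)) (ws ! j))"
    then obtain ws where ws: "ws \<in> lacings n r R"
        "\<And>j. j < n \<Longrightarrow> word_demazure (g' j) = shift_perm m (completion (r j) (r (Suc j)) (ws ! j))" by blast
    obtain g where g: "words_ok n r g" "\<And>j. j < n \<Longrightarrow> word_demazure (g j) = completion (r j) (r (Suc j)) (ws ! j)"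
        "word_demazure (total_word n r g n) = v"
      using ws(1) unfolding lacings_iff[OF v] by blast
    have "word_demazure (total_word n r' g' n) = word_demazure (total_word n r' (\<lambda>j. map ((+) m) (g j)) n)"
      by (rule total_word_cong[OF g' words_ok_shift[OF g(1)]]) (use ws(2) g(2) shifted[OF g(1)] in simp)
    then show "word_demazure (total_word n r' g' n) = ext v" by (simp add: demazure_ext[OF g(1)] g(3))
  qed
qed

end

section \<open>Reversing the letters inside of the blocks\<close>

text \<open>The reflection of each block row: p and its image add up to the sum of the first and the
  last row of the block.\<close>

definition flip_row :: "(nat \<Rightarrow> nat) \<Rightarrow> nat \<Rightarrow> nat" where
  "flip_row r p = 2 * row_offset r (rowblk r p) + r (rowblk r p) + 1 - p"

definition flip_col :: "nat \<Rightarrow> (nat \<Rightarrow> nat) \<Rightarrow> nat \<Rightarrow> nat" where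
  "flip_col n r q = 2 * col_offset n r (colblk n r q) + r (colblk n r q) + 1 - q"

lemma reversal_permutes:
  fixes c k :: nat
  shows "(\<lambda>p. if c < p \<and> p \<le> c + k then 2 * c + k + 1 - p else p) permutes {c<..c + k}"
proof (rule bij_imp_permutes)
  show "bij_betw (\<lambda>p. if c < p \<and> p \<le> c + k then 2 * c + k + 1 - p else p) {c<..c + k} {c<..c + k}"
    by (rule bij_betw_byWitness[where f' = "\<lambda>p. 2 * c + k + 1 - p"]) auto
qed auto

text \<open>The blocks are reversed one at a time, each by the symmetry within its block row; the
  blocks below i are those already done.\<close>

lemma kp_flip_rows:
  assumes v: "zelevinsky n r v" and a: "\<And>p. a p dvd 1"
  shows "kp (young (total_size n r) (zlam n r)) (\<lambda>p. a (flip_row r p)) b (total_size n r) v =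
    kp (young (total_size n r) (zlam n r)) a b (total_size n r) v"
proof -
  let ?d = "total_size n r"
  let ?K = "\<lambda>a. kp (young ?d (zlam n r)) a b ?d v"
  have "?K (\<lambda>p. if rowblk r p < i then a (flip_row r p) else a p) = ?K a" if "i \<le> Suc n" for i
    using that
  proof (induction i)
    case (Suc i)
    let ?c = "row_offset r i"
    let ?s = "\<lambda>p. if p \<in> {?c<..?c + r i} then 2 * ?c + r i + 1 - p else p"
    let ?a = "\<lambda>p. if rowblk r p < i then a (flip_row r p) else a p"
    have "?K (\<lambda>p. if rowblk r p < Suc i then a (flip_row r p) else a p) = ?K (?a \<circ> ?s)"
    proof (rule kp_cong[OF _ refl])
      fix p assume p: "1 \<le> p" "p \<le> ?d"
      show "(if rowblk r p < Suc i then a (flip_row r p) else a p) = (?a \<circ> ?s) p"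
      proof (cases "p \<in> {?c<..?c + r i}")
        case True
        have rp: "rowblk r p = i" by (rule rowblk_eqI) (use True in \<open>simp add: block_row_def\<close>)
        have "?s p \<in> block_row r i" using True by (auto simp: block_row_def)
        then have "rowblk r (?s p) = i" by (rule rowblk_eqI)
        then show ?thesis using True rp by (simp add: flip_row_def)
      next
        case False
        then have "rowblk r p \<noteq> i" using rowblk_props[OF p] by (auto simp: block_row_def)
        then show ?thesis using False by (simp only: comp_def if_False less_Suc_eq) auto
      qed
    qed
    also have "\<dots> = ?K ?a"
      by (rule kp_row_block_symmetric[OF v, of i])
        (use Suc.prems a in \<open>auto simp: block_row_def intro: reversal_permutes\<close>)
    finally show ?case using Suc by simp
  qed simp
  from this[of "Suc n"] have "?K a = ?K (\<lambda>p. if rowblk r p < Suc n then a (flip_row r p) else a p)" by simp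
  also have "\<dots> = ?K (\<lambda>p. a (flip_row r p))"
    by (rule kp_cong) (use rowblk_props(2)[of _ n r] in \<open>auto simp: less_Suc_eq_le\<close>)
  finally show ?thesis ..
qed

lemma kp_flip_cols:
  assumes v: "zelevinsky n r v" and b: "\<And>q. b q dvd 1"
  shows "kp (young (total_size n r) (zlam n r)) a (\<lambda>q. b (flip_col n r q)) (total_size n r) v =
    kp (young (total_size n r) (zlam n r)) a b (total_size n r) v"
proof -
  let ?d = "total_size n r"
  let ?K = "\<lambda>b. kp (young ?d (zlam n r)) a b ?d v"
  have "?K (\<lambda>q. if colblk n r q < i then b (flip_col n r q) else b q) = ?K b" if "i \<le> Suc n" for i
    using that
  proof (induction i)
    case (Suc i)
    let ?c = "col_offset n r i"
    let ?s = "\<lambda>q. if q \<in> {?c<..?c + r i} then 2 * ?c + r i + 1 - q else q"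
    let ?b = "\<lambda>q. if colblk n r q < i then b (flip_col n r q) else b q"
    have i: "i \<le> n" using Suc.prems by simp
    have "?K (\<lambda>q. if colblk n r q < Suc i then b (flip_col n r q) else b q) = ?K (?b \<circ> ?s)"
    proof (rule kp_cong[OF refl])
      fix q assume q: "1 \<le> q" "q \<le> ?d"
      show "(if colblk n r q < Suc i then b (flip_col n r q) else b q) = (?b \<circ> ?s) q"
      proof (cases "q \<in> {?c<..?c + r i}")
        case True
        have rq: "colblk n r q = i" by (rule colblk_eqI[OF i]) (use True in \<open>simp add: block_col_def\<close>)
        have "?s q \<in> block_col n r i" using True by (auto simp: block_col_def)
        then have "colblk n r (?s q) = i" by (rule colblk_eqI[OF i])
        then show ?thesis using True rq by (simp add: flip_col_def)
      next
        case False
        then have "colblk n r q \<noteq> i" using colblk_props[OF q] by (auto simp: block_col_def)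
        then show ?thesis using False by (simp only: comp_def if_False less_Suc_eq) auto
      qed
    qed
    also have "\<dots> = ?K ?b"
      by (rule kp_col_block_symmetric[OF v, of i])
        (use Suc.prems b in \<open>auto simp: block_col_def intro: reversal_permutes\<close>)
    finally show ?case using Suc by simp
  qed simp
  from this[of "Suc n"] have "?K b = ?K (\<lambda>q. if colblk n r q < Suc n then b (flip_col n r q) else b q)" by simp
  also have "\<dots> = ?K (\<lambda>q. b (flip_col n r q))"
    by (rule kp_cong) (use colblk_props(2)[of _ n r] in \<open>auto simp: less_Suc_eq_le\<close>)
  finally show ?thesis ..
qed

section \<open>Pipe dreams of Zelevinsky permutations\<close>

lemma assembled_part:
  assumes P: "subgrids n r P" and j: "j < n"
  shows "P (Suc j) = {(p, q). (p, q) \<in> {1..r j} \<times> {1..r (Suc j)} \<and>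
    (row_offset r j + p, col_offset n r (Suc j) + q) \<in> assembled_pd n r P}"
  using subgridsD[OF P j] assembled_row[OF P j] by fastforce

lemma superantidiagonal_not_young:
  assumes j: "j < n" and p: "p \<in> {1..r j}" and q: "q \<in> {1..r (Suc j)}"
  shows "(row_offset r j + p, col_offset n r (Suc j) + q) \<notin> young (total_size n r) (zlam n r)"
proof -
  have "rowblk r (row_offset r j + p) = j" by (rule rowblk_eqI) (use p in \<open>auto simp: block_row_def\<close>)
  then show ?thesis using q by (auto simp: young_def zlam_def)
qed

lemma assembled_weight:
  fixes f :: "nat \<times> nat \<Rightarrow> 'a::comm_ring_1"
  assumes P: "subgrids n r P"
  shows "(\<Prod>x\<in>{1..total_size n r} \<times> {1..total_size n r}. if x \<in> assembled_pd n r P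
      then if x \<in> young (total_size n r) (zlam n r) then 1 else f x
      else if x \<in> young (total_size n r) (zlam n r) then 0 else 1) =
    (\<Prod>j<n. \<Prod>(p, q)\<in>P (Suc j). f (row_offset r j + p, col_offset n r (Suc j) + q))"
proof -
  let ?d = "total_size n r"
  let ?Y = "young ?d (zlam n r)"
  let ?e = "\<lambda>j (p, q). (row_offset r j + p, col_offset n r (Suc j) + q)"
  define D where "D = (\<Union>j<n. ?e j ` P (Suc j))"
  have as: "assembled_pd n r P = ?Y \<union> D" by (simp add: assembled_pd_young D_def)
  have mem: "p \<in> {1..r j}" "q \<in> {1..r (Suc j)}" if "j < n" "(p, q) \<in> P (Suc j)" for j p q
    using subgridsD[OF P that(1)] that(2) by auto
  have disj: "?Y \<inter> D = {}"
  proof -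
    have "x \<notin> ?Y" if xD: "x \<in> D" for x
    proof -
      obtain j p q where x: "j < n" "(p, q) \<in> P (Suc j)" "x = (row_offset r j + p, col_offset n r (Suc j) + q)"
        using xD by (auto simp: D_def)
      show ?thesis unfolding x(3) by (rule superantidiagonal_not_young[OF x(1) mem[OF x(1,2)]])
    qed
    then show ?thesis by blast
  qed
  have sub: "D \<subseteq> {1..?d} \<times> {1..?d}"
  proof
    fix x assume "x \<in> D"
    then obtain j p q where x: "j < n" "(p, q) \<in> P (Suc j)" "x = (row_offset r j + p, col_offset n r (Suc j) + q)"
      by (auto simp: D_def)
    have "row_offset r j + p \<in> block_row r j" "col_offset n r (Suc j) + q \<in> block_col n r (Suc j)"
      using mem[OF x(1,2)] by (auto simp: block_row_def block_col_def)
    then show "x \<in> {1..?d} \<times> {1..?d}"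
      using block_row_bounds[of j n _ r] block_col_bounds[of "Suc j" n _ r] x by auto
  qed
  have "(\<Prod>x\<in>{1..?d} \<times> {1..?d}. if x \<in> assembled_pd n r P then if x \<in> ?Y then 1 else f x
      else if x \<in> ?Y then 0 else 1) = (\<Prod>x\<in>{1..?d} \<times> {1..?d}. if x \<in> D then f x else 1)"
    by (rule prod.cong) (use disj in \<open>auto simp: as\<close>)
  also have "\<dots> = prod f D" using sub by (simp add: prod.If_cases Int_absorb1)
  also have "\<dots> = (\<Prod>j<n. prod f (?e j ` P (Suc j)))"
    unfolding D_def
  proof (rule prod.UNION_disjoint)
    show "\<forall>j\<in>{..<n}. finite (?e j ` P (Suc j))"
      using subgridsD[OF P] by (meson finite_SigmaI finite_atLeastAtMost finite_imageI finite_subset lessThan_iff)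
    show "\<forall>i\<in>{..<n}. \<forall>j\<in>{..<n}. i \<noteq> j \<longrightarrow> ?e i ` P (Suc i) \<inter> ?e j ` P (Suc j) = {}"
    proof (intro ballI impI)
      fix i j assume ij: "i \<in> {..<n}" "j \<in> {..<n}" "i \<noteq> j"
      have row: "rowblk r (fst x) = j" if jx: "j < n" "x \<in> ?e j ` P (Suc j)" for j x
      proof -
        obtain p q where "(p, q) \<in> P (Suc j)" "x = (row_offset r j + p, col_offset n r (Suc j) + q)"
          using jx(2) by auto
        moreover from this have "p \<in> {1..r j}" using mem(1)[OF jx(1)] by blast
        ultimately show ?thesis by (intro rowblk_eqI) (auto simp: block_row_def)
      qed
      show "?e i ` P (Suc i) \<inter> ?e j ` P (Suc j) = {}"
      proof (rule ccontr)
        assume "?e i ` P (Suc i) \<inter> ?e j ` P (Suc j) \<noteq> {}"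
        then obtain x where "x \<in> ?e i ` P (Suc i)" "x \<in> ?e j ` P (Suc j)" by blast
        then show False using row[of i x] row[of j x] ij by simp
      qed
    qed
  qed simp
  also have "\<dots> = (\<Prod>j<n. \<Prod>(p, q)\<in>P (Suc j). f (row_offset r j + p, col_offset n r (Suc j) + q))"
  proof (rule prod.cong[OF refl])
    fix j
    have "inj_on (?e j) (P (Suc j))" by (auto simp: inj_on_def)
    then show "prod f (?e j ` P (Suc j)) = (\<Prod>(p, q)\<in>P (Suc j). f (row_offset r j + p, col_offset n r (Suc j) + q))"
      by (simp add: prod.reindex case_prod_unfold comp_def)
  qed
  finally show ?thesis .
qed

lemma assembledI:
  assumes P: "young (total_size n r) (zlam n r) \<subseteq> P" "P \<subseteq> {1..total_size n r} \<times> {1..total_size n r}"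
    and anti: "\<And>p q. (p, q) \<in> P \<Longrightarrow> (p, q) \<notin> young (total_size n r) (zlam n r) \<Longrightarrow> colblk n r q = Suc (rowblk r p)"
    and Q: "\<And>j. j < n \<Longrightarrow> Q (Suc j) = {(p, q). (p, q) \<in> {1..r j} \<times> {1..r (Suc j)} \<and>
      (row_offset r j + p, col_offset n r (Suc j) + q) \<in> P}"
  shows "assembled_pd n r Q = P"
proof (intro set_eqI iffI)
  fix x assume "x \<in> assembled_pd n r Q"
  then show "x \<in> P" unfolding assembled_pd_young using P(1) Q by auto
next
  fix x assume x: "x \<in> P"
  obtain p q where pq: "x = (p, q)" by (cases x)
  show "x \<in> assembled_pd n r Q"
  proof (cases "x \<in> young (total_size n r) (zlam n r)")
    case False
    define j where "j = rowblk r p"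
    have b: "1 \<le> p" "p \<le> total_size n r" "1 \<le> q" "q \<le> total_size n r" using P(2) x pq by auto
    have c: "colblk n r q = Suc j" using anti x False pq by (simp add: j_def)
    have j: "j < n" using colblk_props(2)[OF b(3,4)] c by simp
    define p' q' where "p' = p - row_offset r j" and "q' = q - col_offset n r (Suc j)"
    have "p \<in> block_row r j" "q \<in> block_col n r (Suc j)"
      using rowblk_props(1)[OF b(1,2)] colblk_props(1)[OF b(3,4)] by (simp_all add: c j_def)
    then have "p = row_offset r j + p'" "q = col_offset n r (Suc j) + q'" "p' \<in> {1..r j}" "q' \<in> {1..r (Suc j)}"
      by (auto simp: p'_def q'_def block_row_def block_col_def)
    then have "(p', q') \<in> Q (Suc j)" "x = (row_offset r j + p', col_offset n r (Suc j) + q')"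
      using Q[OF j] x pq by auto
    then show ?thesis unfolding assembled_pd_young using j by force
  qed (simp add: assembled_pd_young)
qed

section \<open>The stable limit\<close>

definition xx :: "(nat \<Rightarrow> nat) \<Rightarrow> nat \<Rightarrow> nat \<Rightarrow> qletter laurent" where
  "xx r j t = lval (nth_letter (xalph r j) t)"

definition yy :: "(nat \<Rightarrow> nat) \<Rightarrow> nat \<Rightarrow> nat \<Rightarrow> qletter laurent" where
  "yy r j t = ilval (nth_letter (yalph r j) t)"

lemma xx_truncate: "1 \<le> t \<Longrightarrow> xx r j t = lval (truncate_letter r (X j t))"
  by (auto simp: xx_def nth_letter_def xalph_def simp del: upt_Suc)

lemma yy_truncate: "1 \<le> t \<Longrightarrow> yy r j t = ilval (truncate_letter r (Y j t))"
  by (auto simp: yy_def nth_letter_def yalph_def simp del: upt_Suc)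

lemma xx_yy_one: "r j < t \<Longrightarrow> xx r j t = 1" "r j < t \<Longrightarrow> yy r j t = 1"
  by (auto simp: xx_truncate yy_truncate lval_def ilval_def)

lemma prod_rotate_pd:
  assumes Q: "Q \<subseteq> {1..k} \<times> {1..l}"
    and h: "\<And>p q. p \<in> {1..k} \<Longrightarrow> q \<in> {1..l} \<Longrightarrow> h' (Suc k - p) (Suc l - q) = h p q"
  shows "(\<Prod>(p, q)\<in>rotate_pd k l Q. h' p q) = (\<Prod>(p, q)\<in>Q. h p q)"
proof (rule prod.reindex_bij_witness[of _ "\<lambda>(p, q). (Suc k - p, Suc l - q)" "\<lambda>(p, q). (Suc k - p, Suc l - q)"])
  have mem: "p \<in> {1..k}" "q \<in> {1..l}" if "(p, q) \<in> Q" for p q using Q that by auto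
  fix x assume "x \<in> rotate_pd k l Q"
  then obtain p q where x: "(p, q) \<in> Q" "x = (Suc k - p, Suc l - q)" by (auto simp: rotate_pd_def)
  have e: "Suc k - (Suc k - p) = p" "Suc l - (Suc l - q) = q" using mem[OF x(1)] by auto
  show "(case case x of (p, q) \<Rightarrow> (Suc k - p, Suc l - q) of (p, q) \<Rightarrow> (Suc k - p, Suc l - q)) = x"
    "(case x of (p, q) \<Rightarrow> (Suc k - p, Suc l - q)) \<in> Q"
    "(case case x of (p, q) \<Rightarrow> (Suc k - p, Suc l - q) of (p, q) \<Rightarrow> h p q) = (case x of (p, q) \<Rightarrow> h' p q)"
    using x(1) h[OF mem[OF x(1)]] by (simp_all add: x(2) e)
next
  have mem: "p \<in> {1..k}" "q \<in> {1..l}" if "(p, q) \<in> Q" for p q using Q that by auto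
  fix x assume x: "x \<in> Q"
  obtain p q where pq: "x = (p, q)" by (cases x)
  have "(p, q) \<in> Q" using x pq by simp
  from mem[OF this] have e: "Suc k - (Suc k - p) = p" "Suc l - (Suc l - q) = q" by auto
  show "(case case x of (p, q) \<Rightarrow> (Suc k - p, Suc l - q) of (p, q) \<Rightarrow> (Suc k - p, Suc l - q)) = x"
    "(case x of (p, q) \<Rightarrow> (Suc k - p, Suc l - q)) \<in> rotate_pd k l Q"
    using x e by (auto simp: pq rotate_pd_def)
qed

lemma shift_perm_inject:
  assumes "u \<in> S_inf" "v \<in> S_inf" "shift_perm m u = shift_perm m v"
  shows "u = v"
proof
  fix x
  show "u x = v x"
  proof (cases "x = 0")
    case True
    then show ?thesis using assms by (simp add: S_inf_0)
  next
    case False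
    then show ?thesis using fun_cong[OF assms(3), of "m + x"] by (simp add: shift_perm_def)
  qed
qed

lemma finite_partial_perms: "finite (partial_perms k l)"
  by (rule finite_subset[of _ "Pow ({1..k} \<times> {1..l})"]) (auto simp: partial_perms_def)

lemma lacing_diagramsD: "ws \<in> lacing_diagrams n r \<Longrightarrow> j < n \<Longrightarrow> ws ! j \<in> partial_perms (r j) (r (Suc j))"
  unfolding lacing_diagrams_def by (drule CollectD, drule conjunct2, drule bspec[of _ _ "Suc j"]) auto

lemma finite_lacings: "finite (lacings n r R)"
proof (rule finite_subset)
  show "lacings n r R \<subseteq> {xs. set xs \<subseteq> (\<Union>j<n. partial_perms (r j) (r (Suc j))) \<and> length xs = n}"
  proof
    fix ws assume "ws \<in> lacings n r R"
    then have ws: "ws \<in> lacing_diagrams n r" by (simp add: lacings_def)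
    then have "length ws = n" by (simp add: lacing_diagrams_def)
    then show "ws \<in> {xs. set xs \<subseteq> (\<Union>j<n. partial_perms (r j) (r (Suc j))) \<and> length xs = n}"
      using lacing_diagramsD[OF ws] by (auto simp: set_conv_nth)
  qed
qed (simp add: finite_lists_length_eq finite_partial_perms)

lemma sign_pow_diff: "sign_pow (int a - (int b - int c)) = ((- 1) ^ (b + c) * (- 1) ^ a :: 'a::ring_1)"
proof -
  have "even (nat \<bar>int a - (int b - int c)\<bar>) \<longleftrightarrow> even (b + c + a)" by (auto simp: even_nat_iff)
  then show ?thesis unfolding sign_pow_def power_add[symmetric] by (simp only: minus_one_power_iff)
qed

context block_shift
begin

definition \<alpha> :: "nat \<Rightarrow> qletter laurent" where "\<alpha> p = lval (truncate_letter r (xpar r' p))"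
definition \<beta> :: "nat \<Rightarrow> qletter laurent" where "\<beta> q = ilval (truncate_letter r (ypar n r' q))"

lemma shifted_quiver_K_kp:
  assumes v: "zelevinsky n r v" "has_rank_array n r v R"
  shows "shifted_quiver_K n r R m = (- 1) ^ (perm_length v + perm_length (zel_hom n r)) *
    kp (young d' (zlam n r')) \<alpha> \<beta> d' (ext v)"
proof -
  have zp: "zel_perm n r' (\<lambda>i j. m + R i j) = ext v" by (rule zel_perm_ext[OF v])
  have hom: "zel_hom n r permutes {1..d}"
    unfolding zel_hom_total_word by (rule total_word_permutes) (simp add: words_ok_def)
  have "double_quiver_K n r' (\<lambda>i j. m + R i j) = (- 1) ^ (perm_length (ext v) + perm_length (ext (zel_hom n r))) *
      kp (young d' (zlam n r')) (\<lambda>p. letter (xpar r' p)) (\<lambda>q. inv_letter (ypar n r' q)) d' (ext v)"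
    using double_quiver_K_eq[of n r' "\<lambda>i j. m + R i j"] ext_zelevinsky[OF v(1)] by (simp add: zp zel_hom_ext)
  moreover have "(\<lambda>j. m + r j) = r'" by (simp add: fun_eq_iff r'_def)
  ultimately show ?thesis
    by (simp add: shifted_quiver_K_def ext_length_parity[OF zelevinsky_permutes[OF v(1)] hom] subst_laurent_mult
        subst_laurent_power subst_laurent_uminus subst_kp subst_letter \<alpha>_def[abs_def] \<beta>_def[abs_def])
qed

lemma alpha_flip:
  assumes "s \<in> {1..r' j}"
  shows "\<alpha> (flip_row r' (row_offset r' j + s)) = xx r j (Suc (r' j) - s)"
proof -
  define u where "u = Suc (r' j) - s"
  let ?p = "row_offset r' j + s" and ?p' = "row_offset r' j + u"
  have u: "1 \<le> u" "u \<le> r' j" "Suc (r' j) - s = u" "2 * row_offset r' j + r' j + 1 - ?p = ?p'"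
    using assms by (auto simp: u_def)
  have "rowblk r' ?p = j" "rowblk r' ?p' = j"
    by (rule rowblk_eqI, use assms u in \<open>simp add: block_row_def\<close>)+
  moreover from this have "flip_row r' ?p = ?p'" by (simp only: flip_row_def u(4))
  ultimately show ?thesis using u(1-3) by (simp add: \<alpha>_def xpar_def xx_truncate)
qed

lemma beta_flip:
  assumes "i \<le> n" "t \<in> {1..r' i}"
  shows "\<beta> (flip_col n r' (col_offset n r' i + t)) = yy r i (Suc (r' i) - t)"
proof -
  define u where "u = Suc (r' i) - t"
  let ?q = "col_offset n r' i + t" and ?q' = "col_offset n r' i + u"
  have u: "1 \<le> u" "u \<le> r' i" "Suc (r' i) - t = u" "2 * col_offset n r' i + r' i + 1 - ?q = ?q'"
    using assms by (auto simp: u_def)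
  have "colblk n r' ?q = i" "colblk n r' ?q' = i"
    by (rule colblk_eqI[OF assms(1)], use assms u in \<open>simp add: block_col_def\<close>)+
  moreover from this have "flip_col n r' ?q = ?q'" by (simp only: flip_col_def u(4))
  ultimately show ?thesis using u(1-3) by (simp add: \<beta>_def ypar_def yy_truncate)
qed

definition box :: "nat \<Rightarrow> (nat \<times> nat) set" where "box j = {1..r' j} \<times> {1..r' (Suc j)}"

text \<open>Families are indexed here by the block row j < n, whereas \<open>assembled_pd\<close>
  numbers the same block j + 1.\<close>

definition unrotate :: "(nat \<Rightarrow> (nat \<times> nat) set) \<Rightarrow> nat \<Rightarrow> (nat \<times> nat) set" where
  "unrotate Q j = rotate_pd (r' (j - 1)) (r' j) (Q (j - 1))"

definition weight :: "nat \<Rightarrow> (nat \<times> nat) set \<Rightarrow> qletter laurent" where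
  "weight j S = (\<Prod>(p, q)\<in>S. xx r j p * yy r (Suc j) q - 1)"

lemma unrotate_subgrids:
  assumes "Q \<in> PiE {..<n} (\<lambda>j. Pow (box j))"
  shows "subgrids n r' (unrotate Q)"
  unfolding subgrids_def unrotate_def
proof
  fix j assume "j \<in> {1..n}"
  then have "j - 1 < n" "Suc (j - 1) = j" by auto
  then show "rotate_pd (r' (j - 1)) (r' j) (Q (j - 1)) \<subseteq> {1..r' (j - 1)} \<times> {1..r' j}"
    using PiE_mem[OF assms, of "j - 1"] by (intro rotate_pd_subset) (auto simp: box_def)
qed

lemma rotate_unrotate:
  assumes "Q \<in> PiE {..<n} (\<lambda>j. Pow (box j))" "j < n"
  shows "rotate_pd (r' j) (r' (Suc j)) (unrotate Q (Suc j)) = Q j"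
  using rotate_pd_involutive[of "Q j" "r' j" "r' (Suc j)"] PiE_mem[OF assms(1), of j] assms(2)
  by (simp add: unrotate_def box_def)

text \<open>Far from the northwest corner of a block only letters equal to 1 are left, and the crosses near
  that corner would move one of the last \<open>m\<close> points, which the permutation fixes.\<close>

lemma weight_one_below:
  assumes m: "d \<le> m" and ij: "i \<le> j" "j \<le> n" and s: "s \<in> {1..r' j}" and t: "t \<in> {1..r' i}"
    and less: "row_offset r' j + s + (col_offset n r' i + t) - 1 < d' - m"
  shows "xx r j (Suc (r' j) - s) = 1" "yy r i (Suc (r' i) - t) = 1"
proof -
  have le: "r j' \<le> m" if "j' \<le> n" for j'
    using m row_offset_le_total[of "Suc j'" n r] that by (simp add: row_offset_Suc)
  have "col_offset n r' i + row_offset r' (Suc i) = d'" using col_offset_row_offset[of i n r'] ij by simp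
  moreover have "row_offset r' (Suc i) \<le> row_offset r' (Suc j)" by (rule row_offset_mono) (use ij in simp)
  \<comment> \<open>The two offsets add up to at least d' - m - r j, so s + t <= r j, and r j <= d
    <= m. Both coordinates are thus among the first m of their blocks, where the reversed letters
    are 1.\<close>
  ultimately have st: "s + t \<le> r j" using less s t by (simp add: row_offset_Suc r'_def)
  show "xx r j (Suc (r' j) - s) = 1" using st le[OF ij(2)] s t by (intro xx_yy_one) (auto simp: r'_def)
  show "yy r i (Suc (r' i) - t) = 1" using st le[OF ij(2)] s t by (intro xx_yy_one) (auto simp: r'_def)
qed

text \<open>A pipe dream of nonzero weight contains the compulsory crosses and, by
  \<open>weight_one_below\<close>, has no cross southeast of the superantidiagonal. So it is
  assembled from rotated blocks, which it determines, and reversed letters on a rotated block are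
  letters in the usual order.\<close>

lemma kp_assembled:
  assumes m: "d \<le> m" and v: "zelevinsky n r v"
  shows "kp (young d' (zlam n r')) \<alpha> \<beta> d' (ext v) =
    (\<Sum>Q\<in>PiE {..<n} (\<lambda>j. Pow (box j)). if pipe_demazure d' d' (assembled_pd n r' (unrotate Q)) = ext v
      then \<Prod>j<n. weight j (Q j) else 0)"
proof -
  let ?U = "young d' (zlam n r')" and ?F = "PiE {..<n} (\<lambda>j. Pow (box j))"
  let ?a = "\<lambda>p. \<alpha> (flip_row r' p)" and ?b = "\<lambda>q. \<beta> (flip_col n r' q)"
  let ?\<Phi> = "\<lambda>Q. assembled_pd n r' (unrotate Q)"
  define W where "W P = (\<Prod>x\<in>{1..d'} \<times> {1..d'}. if x \<in> P then if x \<in> ?U then 1 else ?a (fst x) * ?b (snd x) - 1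
      else if x \<in> ?U then 0 else 1)" for P
  define S where "S = {P. P \<subseteq> {1..d'} \<times> {1..d'} \<and> pipe_demazure d' d' P = ext v}"
  define T where "T = {Q \<in> ?F. pipe_demazure d' d' (?\<Phi> Q) = ext v}"
  interpret dm: dominant d' "zlam n r'" by (rule zlam_dominant)
  note v' = ext_zelevinsky[OF v]
  have finF: "finite ?F" by (intro finite_PiE) (auto simp: box_def)
  have grid: "?\<Phi> Q \<subseteq> {1..d'} \<times> {1..d'}" if "Q \<in> ?F" for Q
  proof
    fix x assume "x \<in> ?\<Phi> Q"
    then consider "x \<in> ?U" | j p q where "j < n" "(p, q) \<in> unrotate Q (Suc j)"
        "x = (row_offset r' j + p, col_offset n r' (Suc j) + q)"
      unfolding assembled_pd_young by auto
    then show "x \<in> {1..d'} \<times> {1..d'}"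
    proof cases
      case 1
      then show ?thesis using dm.young_subset by blast
    next
      case 2
      have pq: "p \<in> {1..r' j}" "q \<in> {1..r' (Suc j)}"
        using subgridsD[OF unrotate_subgrids[OF that] 2(1)] 2(2) by auto
      then have "row_offset r' j + p \<in> block_row r' j" "col_offset n r' (Suc j) + q \<in> block_col n r' (Suc j)"
        by (auto simp: block_row_def block_col_def)
      then show ?thesis using block_row_bounds[of j n _ r'] block_col_bounds[of "Suc j" n _ r'] 2 by auto
    qed
  qed
  have inj: "inj_on ?\<Phi> T"
  proof (rule inj_onI)
    fix Q Q' assume Q: "Q \<in> T" "Q' \<in> T" and e: "?\<Phi> Q = ?\<Phi> Q'"
    have F: "Q \<in> ?F" "Q' \<in> ?F" using Q by (auto simp: T_def)
    show "Q = Q'"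
    proof (rule PiE_ext[OF F])
      fix j assume "j \<in> {..<n}"
      then have j: "j < n" by simp
      have "unrotate Q (Suc j) = unrotate Q' (Suc j)"
        using assembled_part[OF unrotate_subgrids[OF F(1)] j] assembled_part[OF unrotate_subgrids[OF F(2)] j] e by simp
      then show "Q j = Q' j" using rotate_unrotate[OF F(1) j] rotate_unrotate[OF F(2) j] by simp
    qed
  qed
  have WQ: "W (?\<Phi> Q) = (\<Prod>j<n. weight j (Q j))" if Q: "Q \<in> ?F" for Q
  proof -
    have "W (?\<Phi> Q) = (\<Prod>j<n. \<Prod>(p, q)\<in>unrotate Q (Suc j).
        ?a (row_offset r' j + p) * ?b (col_offset n r' (Suc j) + q) - 1)"
      unfolding W_def by (subst assembled_weight[OF unrotate_subgrids[OF Q]]) simp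
    also have "\<dots> = (\<Prod>j<n. weight j (Q j))"
    proof (rule prod.cong[OF refl])
      fix j assume "j \<in> {..<n}"
      then have j: "j < n" by simp
      have e: "Suc (r' j) - (Suc (r' j) - p) = p" "Suc (r' i) - (Suc (r' i) - q) = q"
        if "p \<in> {1..r' j}" "q \<in> {1..r' i}" for p q i using that by auto
      show "(\<Prod>(p, q)\<in>unrotate Q (Suc j). ?a (row_offset r' j + p) * ?b (col_offset n r' (Suc j) + q) - 1) =
          weight j (Q j)"
        unfolding unrotate_def weight_def diff_Suc_1
      proof (rule prod_rotate_pd)
        show "Q j \<subseteq> {1..r' j} \<times> {1..r' (Suc j)}" using PiE_mem[OF Q, of j] j by (simp add: box_def)
        fix p q assume pq: "p \<in> {1..r' j}" "q \<in> {1..r' (Suc j)}"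
        then have "Suc (r' j) - p \<in> {1..r' j}" "Suc (r' (Suc j)) - q \<in> {1..r' (Suc j)}" by auto
        then show "?a (row_offset r' j + (Suc (r' j) - p)) * ?b (col_offset n r' (Suc j) + (Suc (r' (Suc j)) - q)) - 1 =
            xx r j p * yy r (Suc j) q - 1"
          using alpha_flip[of "Suc (r' j) - p" j] beta_flip[of "Suc j" "Suc (r' (Suc j)) - q"] j e[OF pq] by simp
      qed
    qed
    finally show ?thesis .
  qed
  have zero: "W P = 0" if P: "P \<in> S" "P \<notin> ?\<Phi> ` T" for P
  proof (rule ccontr)
    assume "W P \<noteq> 0"
    moreover have fin: "finite ({1..d'} \<times> {1..d'})" by simp
    ultimately have nz: "(if x \<in> P then if x \<in> ?U then 1 else ?a (fst x) * ?b (snd x) - 1 else if x \<in> ?U then 0 else 1) \<noteq> 0"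
      if "x \<in> {1..d'} \<times> {1..d'}" for x
      using that unfolding W_def prod_zero_iff[OF fin] by blast
    have Pg: "P \<subseteq> {1..d'} \<times> {1..d'}" and Pv: "pipe_demazure d' d' P = ext v" using P(1) by (auto simp: S_def)
    have U: "?U \<subseteq> P"
    proof
      fix x assume x: "x \<in> ?U"
      then have "x \<in> {1..d'} \<times> {1..d'}" by (rule subsetD[OF dm.young_subset])
      from nz[OF this] show "x \<in> P" using x by (simp split: if_splits)
    qed
    have anti: "colblk n r' q = Suc (rowblk r' p)" if pq: "(p, q) \<in> P" "(p, q) \<notin> ?U" for p q
    proof (rule ccontr)
      assume ne: "colblk n r' q \<noteq> Suc (rowblk r' p)"
      have b: "1 \<le> p" "p \<le> d'" "1 \<le> q" "q \<le> d'" using Pg pq by auto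
      define j i s t where "j = rowblk r' p" and "i = colblk n r' q" and "s = p - row_offset r' j"
        and "t = q - col_offset n r' i"
      have ij: "i \<le> j" using young_zlam_iff[OF b] pq(2) ne by (simp add: i_def j_def)
      have jn: "j \<le> n" using rowblk_props(2)[OF b(1,2)] by (simp add: j_def)
      have "p \<in> block_row r' j" "q \<in> block_col n r' i"
        using rowblk_props(1)[OF b(1,2)] colblk_props(1)[OF b(3,4)] by (simp_all add: i_def j_def)
      then have e: "p = row_offset r' j + s" "q = col_offset n r' i + t" "s \<in> {1..r' j}" "t \<in> {1..r' i}"
        by (auto simp: s_def t_def block_row_def block_col_def)
      have "ext v permutes {1..d' - m}"
      proof (rule permutes_superset[OF ext_permutes[OF zelevinsky_permutes[OF v]]])
        show "\<And>x. x \<in> {1..d'} - {1..d' - m} \<Longrightarrow> ext v x = x" by (auto intro: ext_last)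
      qed
      then have "p + q - 1 < d' - m"
        using pipe_demazure_letter[of d' d' P 1 "d' - m" p q] Pv Pg pq(1) by simp
      then have "row_offset r' j + s + (col_offset n r' i + t) - 1 < d' - m" by (simp add: e)
      note one = weight_one_below[OF m ij jn e(3,4) this]
      have "?a p * ?b q - 1 = 0"
        using alpha_flip[OF e(3)] beta_flip[OF _ e(4)] ij jn one unfolding e(1,2) by simp
      then show False using nz[of "(p, q)"] pq b by simp
    qed
    \<comment> \<open>The blocks are cut out of P and rotated; \<open>restrict\<close> puts the
      family into the extensional product.\<close>
    define Q where "Q = restrict (\<lambda>j. rotate_pd (r' j) (r' (Suc j)) {(p, q). (p, q) \<in> {1..r' j} \<times> {1..r' (Suc j)} \<and>
      (row_offset r' j + p, col_offset n r' (Suc j) + q) \<in> P}) {..<n}"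
    have QF: "Q \<in> ?F"
      unfolding Q_def box_def by (intro restrict_PiE_iff[THEN iffD2] ballI PowI rotate_pd_subset) auto
    have "?\<Phi> Q = P"
    proof (rule assembledI[OF U Pg anti])
      fix j assume "j < n"
      then show "unrotate Q (Suc j) = {(p, q). (p, q) \<in> {1..r' j} \<times> {1..r' (Suc j)} \<and>
          (row_offset r' j + p, col_offset n r' (Suc j) + q) \<in> P}"
        unfolding unrotate_def Q_def by (simp, intro rotate_pd_involutive) auto
    qed
    then show False using P QF Pv by (auto simp: T_def)
  qed
  have "kp ?U \<alpha> \<beta> d' (ext v) = kp ?U ?a ?b d' (ext v)"
    using kp_flip_rows[OF v', of \<alpha> \<beta>] kp_flip_cols[OF v', of \<beta> ?a] by (simp add: \<alpha>_def \<beta>_def lval_dvd_1)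
  also have "\<dots> = sum W S" by (simp add: kp_def pd_sum_def W_def S_def cong: if_cong)
  also have "\<dots> = sum W (?\<Phi> ` T)"
    by (rule sum.mono_neutral_right) (use grid zero in \<open>auto simp: S_def T_def intro: finite_subset[of _ "Pow ({1..d'} \<times> {1..d'})"]\<close>)
  also have "\<dots> = (\<Sum>Q\<in>T. \<Prod>j<n. weight j (Q j))"
    unfolding sum.reindex[OF inj] comp_def by (rule sum.cong[OF refl], rule WQ) (simp add: T_def)
  also have "\<dots> = (\<Sum>Q\<in>?F. if pipe_demazure d' d' (?\<Phi> Q) = ext v then \<Prod>j<n. weight j (Q j) else 0)"
    unfolding T_def by (rule sum.inter_filter[OF finF])
  finally show ?thesis .
qed

end

context block_shift
begin

definition fits :: "(nat \<times> nat) set list \<Rightarrow> nat \<Rightarrow> (nat \<times> nat) set \<Rightarrow> bool" where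
  "fits ws j S \<longleftrightarrow> pipe_demazure (r' j) (r' (Suc j)) S = shift_perm m (completion (r j) (r (Suc j)) (ws ! j))"

text \<open>A shifted completion determines its partial permutation, so no family of blocks is
  counted for two lacing diagrams.\<close>

lemma fits_unique:
  assumes ws: "ws \<in> lacings n r R" "ws' \<in> lacings n r R" and Q: "\<And>j. j < n \<Longrightarrow> fits ws j (Q j)" "\<And>j. j < n \<Longrightarrow> fits ws' j (Q j)"
  shows "ws = ws'"
proof (rule nth_equalityI)
  have l: "ws \<in> lacing_diagrams n r" "ws' \<in> lacing_diagrams n r" using ws by (auto simp: lacings_def)
  then show "length ws = length ws'" by (simp add: lacing_diagrams_def)
  fix j assume "j < length ws"
  then have j: "j < n" using l(1) by (simp add: lacing_diagrams_def)
  note w = lacing_diagramsD[OF l(1) j] lacing_diagramsD[OF l(2) j]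
  have S: "completion (r j) (r (Suc j)) (ws ! j) \<in> S_inf" "completion (r j) (r (Suc j)) (ws' ! j) \<in> S_inf"
    using completion_props(1)[OF w(1)] completion_props(1)[OF w(2)] by (auto simp: completions_def)
  have "completion (r j) (r (Suc j)) (ws ! j) = completion (r j) (r (Suc j)) (ws' ! j)"
    by (rule shift_perm_inject[OF S, of m]) (use Q[OF j] in \<open>simp add: fits_def\<close>)
  then show "ws ! j = ws' ! j" by (rule completion_inject[OF w])
qed

text \<open>For families of nonzero weight \<open>assembled_ext_iff\<close> turns the condition on
  the product into the existence of a lacing diagram, which is unique. Then the two sums can be
  exchanged.\<close>

lemma sum_weights:
  assumes m: "d \<le> m" and v: "zelevinsky n r v" "has_rank_array n r v R"
  shows "kp (young d' (zlam n r')) \<alpha> \<beta> d' (ext v) =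
    (\<Sum>ws\<in>lacings n r R. \<Prod>j<n. rect_sum (r' j) (r' (Suc j)) (xx r j) (yy r (Suc j))
      (shift_perm m (completion (r j) (r (Suc j)) (ws ! j))))"
proof -
  let ?F = "PiE {..<n} (\<lambda>j. Pow (box j))" and ?w = "\<lambda>Q. \<Prod>j<n. weight j (Q j)"
  have finF: "finite ?F" by (intro finite_PiE) (auto simp: box_def)
  have key: "(if pipe_demazure d' d' (assembled_pd n r' (unrotate Q)) = ext v then ?w Q else 0) =
      (\<Sum>ws\<in>lacings n r R. if \<forall>j<n. fits ws j (Q j) then ?w Q else 0)" if Q: "Q \<in> ?F" for Q
  proof (cases "?w Q = 0")
    case False
    \<comment> \<open>A cross that lies beyond both alphabets weighs 0, so nonzero weight provides
      the bound required by \<open>assembled_ext_iff\<close>.\<close>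
    have small: "p \<le> r j \<or> q \<le> r (Suc j)"
      if j: "j < n" and pq: "(p, q) \<in> rotate_pd (r' j) (r' (Suc j)) (unrotate Q (Suc j))" for j p q
    proof (rule ccontr)
      assume "\<not> (p \<le> r j \<or> q \<le> r (Suc j))"
      then have one: "xx r j p * yy r (Suc j) q - 1 = 0" by (simp add: xx_yy_one)
      have "(p, q) \<in> Q j" using pq rotate_unrotate[OF Q j] by simp
      moreover have "Q j \<subseteq> {1..r' j} \<times> {1..r' (Suc j)}" using PiE_mem[OF Q, of j] j by (simp add: box_def)
      then have "finite (Q j)" by (rule finite_subset) simp
      ultimately have "weight j (Q j) = 0"
        unfolding weight_def using one by (intro prod_zero bexI[of _ "(p, q)"]) auto
      then show False using False j by auto
    qed
    have iff: "pipe_demazure d' d' (assembled_pd n r' (unrotate Q)) = ext v \<longleftrightarrow>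
        (\<exists>ws\<in>lacings n r R. \<forall>j<n. fits ws j (Q j))"
      unfolding fits_def
      using assembled_ext_iff[OF v unrotate_subgrids[OF Q] small] rotate_unrotate[OF Q] by simp
    show ?thesis
    proof (cases "\<exists>ws\<in>lacings n r R. \<forall>j<n. fits ws j (Q j)")
      case True
      then obtain ws0 where ws0: "ws0 \<in> lacings n r R" "\<forall>j<n. fits ws0 j (Q j)" by blast
      have "(\<Sum>ws\<in>lacings n r R. if \<forall>j<n. fits ws j (Q j) then ?w Q else 0) =
          (\<Sum>ws\<in>lacings n r R. if ws = ws0 then ?w Q else 0)"
        using ws0 fits_unique[OF _ ws0(1)] by (intro sum.cong if_cong) auto
      also have "\<dots> = ?w Q" using ws0(1) by (simp add: finite_lacings)
      finally show ?thesis using iff True by simp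
    next
      case none: False
      then have "(\<Sum>ws\<in>lacings n r R. if \<forall>j<n. fits ws j (Q j) then ?w Q else 0) = 0"
        by (intro sum.neutral) auto
      then show ?thesis using iff none by simp
    qed
  next
    case True
    show ?thesis by (simp only: True if_cancel sum.neutral_const)
  qed
  have "kp (young d' (zlam n r')) \<alpha> \<beta> d' (ext v) =
      (\<Sum>Q\<in>?F. \<Sum>ws\<in>lacings n r R. if \<forall>j<n. fits ws j (Q j) then ?w Q else 0)"
    unfolding kp_assembled[OF m v(1)] by (rule sum.cong[OF refl key])
  also have "\<dots> = (\<Sum>ws\<in>lacings n r R. \<Sum>Q\<in>?F. if \<forall>j<n. fits ws j (Q j) then ?w Q else 0)"
    by (rule sum.swap)
  also have "\<dots> = (\<Sum>ws\<in>lacings n r R. \<Prod>j<n. rect_sum (r' j) (r' (Suc j)) (xx r j) (yy r (Suc j))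
      (shift_perm m (completion (r j) (r (Suc j)) (ws ! j))))"
  proof (rule sum.cong[OF refl])
    fix ws
    let ?B = "\<lambda>j. {S. S \<subseteq> {1..r' j} \<times> {1..r' (Suc j)} \<and> fits ws j S}"
    \<comment> \<open>For a fixed lacing diagram the conditions on the blocks are independent, so
      the sum over families factors.\<close>
    have "{Q \<in> ?F. \<forall>j<n. fits ws j (Q j)} = PiE {..<n} ?B" by (intro set_eqI) (simp add: PiE_iff box_def, blast)
    then have "(\<Sum>Q\<in>?F. if \<forall>j<n. fits ws j (Q j) then ?w Q else 0) = sum ?w (PiE {..<n} ?B)"
      by (simp add: sum.inter_filter[OF finF, symmetric])
    also have "\<dots> = (\<Prod>j<n. \<Sum>S\<in>?B j. weight j S)"
      by (rule prod_sum_PiE[symmetric]) auto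
    also have "\<dots> = (\<Prod>j<n. rect_sum (r' j) (r' (Suc j)) (xx r j) (yy r (Suc j))
      (shift_perm m (completion (r j) (r (Suc j)) (ws ! j))))"
      by (simp add: rect_sum_def fits_def weight_def)
    finally show "(\<Sum>Q\<in>?F. if \<forall>j<n. fits ws j (Q j) then ?w Q else 0) =
      (\<Prod>j<n. rect_sum (r' j) (r' (Suc j)) (xx r j) (yy r (Suc j))
        (shift_perm m (completion (r j) (r (Suc j)) (ws ! j))))" .
  qed
  finally show ?thesis .
qed

lemma lacing_grothendieck_rect_sum:
  assumes m: "d \<le> m" and ws: "ws \<in> lacing_diagrams n r"
  shows "(\<Prod>j<n. rect_sum (r' j) (r' (Suc j)) (xx r j) (yy r (Suc j))
      (shift_perm m (completion (r j) (r (Suc j)) (ws ! j)))) =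
    (- 1) ^ lacing_length n r ws * lacing_grothendieck n r ws"
proof -
  let ?v = "\<lambda>j. completion (r j) (r (Suc j)) (ws ! j)"
  let ?G = "\<lambda>j. at_alphabets (stable_grothendieck (r j) (r (Suc j)) (ws ! j)) (xalph r j) (yalph r (Suc j))"
  have "rect_sum (r' j) (r' (Suc j)) (xx r j) (yy r (Suc j)) (shift_perm m (?v j)) = (- 1) ^ perm_length (?v j) * ?G j"
    if j: "j < n" for j
  proof -
    \<comment> \<open>Two neighbouring block sizes add up to at most d, so m lies in the stable
      range of every factor.\<close>
    have "r j + r (Suc j) \<le> m" using m offsets_total[OF j, of r] by simp
    then have "?G j = (- 1) ^ perm_length (?v j) *
        rect_sum (r' j) (r' (Suc j)) (xx r j) (yy r (Suc j)) (shift_perm m (?v j))"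
      using stable_grothendieck_at[OF lacing_diagramsD[OF ws j], of "xalph r j" "yalph r (Suc j)" m]
      by (simp add: xalph_def yalph_def xx_def[abs_def] yy_def[abs_def] r'_def del: upt_Suc)
    then show ?thesis by (simp add: mult.assoc[symmetric] power_add[symmetric])
  qed
  then have "(\<Prod>j<n. rect_sum (r' j) (r' (Suc j)) (xx r j) (yy r (Suc j)) (shift_perm m (?v j))) =
      (\<Prod>j<n. (- 1) ^ perm_length (?v j) * ?G j)" by (intro prod.cong) auto
  also have "\<dots> = (- 1) ^ (\<Sum>j<n. perm_length (?v j)) * (\<Prod>j<n. ?G j)"
    by (simp add: prod.distrib power_sum)
  finally show ?thesis
    by (simp add: lacing_length_def lacing_grothendieck_def sum.atLeast1_atMost_eq prod.atLeast1_atMost_eq)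
qed

lemma shifted_quiver_K_eq:
  assumes m: "d \<le> m" and v: "zelevinsky n r v" "has_rank_array n r v R"
  shows "shifted_quiver_K n r R m = (\<Sum>ws\<in>lacings n r R.
    sign_pow (int (lacing_length n r ws) - quiver_codim n r R) * lacing_grothendieck n r ws)"
proof -
  have zp: "zel_perm n r R = v" by (rule zel_perm_eqI[OF v])
  show ?thesis
    unfolding shifted_quiver_K_kp[OF v] sum_weights[OF m v] sum_distrib_left quiver_codim_def zp sign_pow_diff
    by (rule sum.cong[OF refl])
      (simp add: lacing_grothendieck_rect_sum[OF m] lacings_def mult.assoc)
qed

end

subsection \<open>Symmetry\<close>

lemma transport_permutation:
  assumes \<pi>: "\<pi> permutes A" and f: "bij_betw f A B"
  obtains s where "s permutes B" "\<And>w. w \<in> A \<Longrightarrow> s (f w) = f (\<pi> w)" "\<And>x. x \<notin> B \<Longrightarrow> s x = x"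
proof
  let ?s = "\<lambda>x. if x \<in> B then f (\<pi> (inv_into A f x)) else x"
  show "?s permutes B" by (rule permutes_bij_inv_into[OF assms])
  show "?s (f w) = f (\<pi> w)" if "w \<in> A" for w
    using that bij_betw_imp_inj_on[OF f] bij_betwE[OF f] by simp
qed simp

lemma subst_lval:
  "subst_laurent (Some \<circ> \<pi>) (lval x) = lval (map_option \<pi> x)"
  "subst_laurent (Some \<circ> \<pi>) (ilval x) = ilval (map_option \<pi> x)"
  by (cases x; simp add: lval_def ilval_def subst_letter)+

context block_shift
begin

text \<open>A permutation of the r j letters is transported to the first r j rows, or columns, of
  the enlarged block j; the remaining ones carry the letter 1 and stay fixed. The block symmetry of
  \<open>kp\<close> then applies.\<close>

lemma kp_symmetric:
  assumes v: "zelevinsky n r v" and j: "j \<le> n"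
  shows "symmetric_in (set (xalph r j)) (kp (young d' (zlam n r')) \<alpha> \<beta> d' (ext v))"
    "symmetric_in (set (yalph r j)) (kp (young d' (zlam n r')) \<alpha> \<beta> d' (ext v))"
proof -
  note v' = ext_zelevinsky[OF v]
  let ?K = "\<lambda>a b. kp (young d' (zlam n r')) a b d' (ext v)"
  show "symmetric_in (set (xalph r j)) (?K \<alpha> \<beta>)"
    unfolding symmetric_in_def
  proof (intro allI impI)
    fix \<pi> assume \<pi>: "\<pi> permutes set (xalph r j)"
    let ?c = "row_offset r' j"
    let ?f = "case_qletter (\<lambda>_ t. ?c + t) (\<lambda>_ t. ?c + t)"
    have A: "set (xalph r j) = X j ` {1..r j}" by (simp add: xalph_def atLeastLessThanSuc_atLeastAtMost del: upt_Suc)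
    have "bij_betw ?f (set (xalph r j)) {?c<..?c + r j}"
      by (rule bij_betw_byWitness[where f' = "\<lambda>p. X j (p - ?c)"]) (auto simp: A intro!: image_eqI[of _ "X j"])
    then obtain s where s: "s permutes {?c<..?c + r j}" "\<And>w. w \<in> set (xalph r j) \<Longrightarrow> s (?f w) = ?f (\<pi> w)"
        "\<And>p. p \<notin> {?c<..?c + r j} \<Longrightarrow> s p = p"
      using transport_permutation[OF \<pi>] by metis
    have sb: "s permutes block_row r' j"
      by (rule permutes_subset[OF s(1)]) (auto simp: block_row_def r'_def)
    have xs: "map_option \<pi> (truncate_letter r (xpar r' p)) = truncate_letter r (xpar r' (s p))"
      if p: "1 \<le> p" "p \<le> d'" for p
    proof (cases "p \<in> {?c<..?c + r j}")
      case True
      define t where "t = p - ?c"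
      have t: "p = ?c + t" "t \<in> {1..r j}" using True by (auto simp: t_def)
      have w: "X j t \<in> set (xalph r j)" using t by (simp add: A)
      have "\<pi> (X j t) \<in> set (xalph r j)" using permutes_in_image[OF \<pi>, of "X j t"] w by simp
      then obtain t' where t': "\<pi> (X j t) = X j t'" "t' \<in> {1..r j}" by (auto simp: A)
      have sp: "s p = ?c + t'" using s(2)[OF w] t t' by simp
      have par: "xpar r' (?c + u) = X j u" if "u \<in> {1..r j}" for u
      proof -
        have "rowblk r' (?c + u) = j"
          by (rule rowblk_eqI) (use that in \<open>auto simp: block_row_def r'_def\<close>)
        then show ?thesis by (simp add: xpar_def)
      qed
      show ?thesis unfolding sp par[OF t'(2)] using t t' by (simp add: par)
    next
      case False
      define i t where "i = rowblk r' p" and "t = p - row_offset r' i"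
      have par: "xpar r' p = X i t" by (simp add: xpar_def i_def t_def)
      have "p = row_offset r' i + t" "1 \<le> t"
        using rowblk_props(1)[OF p] by (auto simp: i_def t_def block_row_def)
      then have "X i t \<notin> set (xalph r j)" if "t \<le> r i" using that False by (auto simp: A)
      then show ?thesis using s(3)[OF False] permutes_not_in[OF \<pi>, of "X i t"] by (auto simp: par)
    qed
    have ys: "map_option \<pi> (truncate_letter r (ypar n r' q)) = truncate_letter r (ypar n r' q)" for q
      using permutes_not_in[OF \<pi>] by (auto simp: ypar_def A)
    have "subst_laurent (Some \<circ> \<pi>) (?K \<alpha> \<beta>) = ?K (\<alpha> \<circ> s) \<beta>"
      unfolding subst_kp by (rule kp_cong) (auto simp: \<alpha>_def \<beta>_def subst_lval xs ys)
    also have "\<dots> = ?K \<alpha> \<beta>"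
      by (rule kp_row_block_symmetric[OF v' j sb]) (simp add: \<alpha>_def lval_dvd_1)
    finally show "subst_laurent (Some \<circ> \<pi>) (?K \<alpha> \<beta>) = ?K \<alpha> \<beta>" .
  qed
  show "symmetric_in (set (yalph r j)) (?K \<alpha> \<beta>)"
    unfolding symmetric_in_def
  proof (intro allI impI)
    fix \<pi> assume \<pi>: "\<pi> permutes set (yalph r j)"
    let ?c = "col_offset n r' j"
    let ?f = "case_qletter (\<lambda>_ t. ?c + t) (\<lambda>_ t. ?c + t)"
    have A: "set (yalph r j) = Y j ` {1..r j}" by (simp add: yalph_def atLeastLessThanSuc_atLeastAtMost del: upt_Suc)
    have "bij_betw ?f (set (yalph r j)) {?c<..?c + r j}"
      by (rule bij_betw_byWitness[where f' = "\<lambda>q. Y j (q - ?c)"]) (auto simp: A intro!: image_eqI[of _ "Y j"])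
    then obtain s where s: "s permutes {?c<..?c + r j}" "\<And>w. w \<in> set (yalph r j) \<Longrightarrow> s (?f w) = ?f (\<pi> w)"
        "\<And>q. q \<notin> {?c<..?c + r j} \<Longrightarrow> s q = q"
      using transport_permutation[OF \<pi>] by metis
    have sb: "s permutes block_col n r' j"
      by (rule permutes_subset[OF s(1)]) (auto simp: block_col_def r'_def)
    have ys: "map_option \<pi> (truncate_letter r (ypar n r' q)) = truncate_letter r (ypar n r' (s q))"
      if q: "1 \<le> q" "q \<le> d'" for q
    proof (cases "q \<in> {?c<..?c + r j}")
      case True
      define t where "t = q - ?c"
      have t: "q = ?c + t" "t \<in> {1..r j}" using True by (auto simp: t_def)
      have w: "Y j t \<in> set (yalph r j)" using t by (simp add: A)
      have "\<pi> (Y j t) \<in> set (yalph r j)" using permutes_in_image[OF \<pi>, of "Y j t"] w by simp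
      then obtain t' where t': "\<pi> (Y j t) = Y j t'" "t' \<in> {1..r j}" by (auto simp: A)
      have sq: "s q = ?c + t'" using s(2)[OF w] t t' by simp
      have par: "ypar n r' (?c + u) = Y j u" if "u \<in> {1..r j}" for u
      proof -
        have "colblk n r' (?c + u) = j"
          by (rule colblk_eqI[OF j]) (use that in \<open>auto simp: block_col_def r'_def\<close>)
        then show ?thesis by (simp add: ypar_def)
      qed
      show ?thesis unfolding sq par[OF t'(2)] using t t' by (simp add: par)
    next
      case False
      define i t where "i = colblk n r' q" and "t = q - col_offset n r' i"
      have par: "ypar n r' q = Y i t" by (simp add: ypar_def i_def t_def)
      have "q = col_offset n r' i + t" "1 \<le> t"
        using colblk_props(1)[OF q] by (auto simp: i_def t_def block_col_def)
      then have "Y i t \<notin> set (yalph r j)" if "t \<le> r i" using that False by (auto simp: A)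
      then show ?thesis using s(3)[OF False] permutes_not_in[OF \<pi>, of "Y i t"] by (auto simp: par)
    qed
    have xs: "map_option \<pi> (truncate_letter r (xpar r' p)) = truncate_letter r (xpar r' p)" for p
      using permutes_not_in[OF \<pi>] by (auto simp: xpar_def A)
    have "subst_laurent (Some \<circ> \<pi>) (?K \<alpha> \<beta>) = ?K \<alpha> (\<beta> \<circ> s)"
      unfolding subst_kp by (rule kp_cong) (auto simp: \<alpha>_def \<beta>_def subst_lval xs ys)
    also have "\<dots> = ?K \<alpha> \<beta>"
      by (rule kp_col_block_symmetric[OF v' j sb]) (simp add: \<beta>_def lval_dvd_1)
    finally show "subst_laurent (Some \<circ> \<pi>) (?K \<alpha> \<beta>) = ?K \<alpha> \<beta>" .
  qed
qed

lemma shifted_quiver_K_symmetric: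
  assumes v: "zelevinsky n r v" "has_rank_array n r v R" and j: "j \<le> n"
  shows "symmetric_in (set (xalph r j)) (shifted_quiver_K n r R m)"
    "symmetric_in (set (yalph r j)) (shifted_quiver_K n r R m)"
  using kp_symmetric[OF v(1) j] unfolding shifted_quiver_K_kp[OF v] symmetric_in_def
  by (simp_all add: subst_laurent_mult subst_laurent_power subst_laurent_uminus)

end

section \<open>The component formula\<close>

theorem theorem5p1:
  fixes n :: nat and r :: "nat \<Rightarrow> nat" and R :: "nat \<Rightarrow> nat \<Rightarrow> nat"
  assumes "is_zel_rank_array n r R"
  shows "(\<exists>L. stabilizes_to (shifted_quiver_K n r R) L) \<and>
         stable_quiver_K n r R =
           (\<Sum>ws\<in>lacings n r R.
              sign_pow (int (lacing_length n r ws) - quiver_codim n r R) *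
              lacing_grothendieck n r ws) \<and>
         (\<forall>j\<le>n. symmetric_in (set (xalph r j)) (stable_quiver_K n r R) \<and>
                symmetric_in (set (yalph r j)) (stable_quiver_K n r R))"
proof -
  obtain v where v: "zelevinsky n r v" "has_rank_array n r v R"
    using assms unfolding is_zel_rank_array_def by blast
  let ?L = "\<Sum>ws\<in>lacings n r R.
    sign_pow (int (lacing_length n r ws) - quiver_codim n r R) * lacing_grothendieck n r ws"
  have eq: "shifted_quiver_K n r R m = ?L" if "total_size n r \<le> m" for m
    by (rule block_shift.shifted_quiver_K_eq[OF that v])
  then have s: "stabilizes_to (shifted_quiver_K n r R) ?L"
    unfolding stabilizes_to_def by (rule eventually_sequentiallyI)
  then have L: "stable_quiver_K n r R = ?L"
    unfolding stable_quiver_K_def by (rule stable_limit_eqI)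
  have "symmetric_in (set (xalph r j)) (stable_quiver_K n r R) \<and>
      symmetric_in (set (yalph r j)) (stable_quiver_K n r R)" if "j \<le> n" for j
    \<comment> \<open>The limit equals the polynomial for m = d, whose symmetry is already
      known.\<close>
    unfolding L eq[OF order_refl, symmetric]
    using block_shift.shifted_quiver_K_symmetric[OF v that] by blast
  with s L show ?thesis by blast
qed

end
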